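(* Let $\mathfrak g$ be a basic classical Lie superalgebra over $K$ from the list in the context, let $\chi\in\mathfrak g_{\bar 0}^*$ be nilpotent, and let $\mathfrak m\subseteq\mathfrak g$ be the associated subalgebra described in the context. Then every $U_\chi(\mathfrak g)$-module is free as a $U_\chi(\mathfrak m)$-module.
   Context: $K$ is an algebraically closed field of characteristic $p>2$. All spaces, subalgebras, ideals, modules and submodules are $\mathbb Z_2$-graded. A restricted Lie superalgebra is a Lie superalgebra $\mathfrak g$ whose even part is a restricted Lie algebra with $p$-th power map $x\mapsto x^{[p]}$ and such that $[x^{[p]},y]=(\mathrm{ad}\,x)^p(y)$ for $x\in\mathfrak g_{\bar 0},y\in\mathfrak g$. For $\chi\in\mathfrak g_{\bar 0}^*$ (extended by $\chi(\mathfrak g_{\bar 1})=0$), $U_\chi(\mathfrak g)=U(\mathfrak g)/\langle x^p-x^{[p]}-\chi(x)^p : x\in\mathfrak g_{\bar 0}\rangle$. For a restricted subalgebra $\mathfrak a$, $U_\chi(\mathfrak a)$ is taken with respect to $\chi|_{\mathfrak a}$. "Basic classical Lie superalgebra" means one of (ordinary Lie algebras excluded): $\mathfrak{gl}(m|n)$ ($p>2$); $\mathfrak{sl}(m|n)$ ($p>2$, $p\nmid m-n$); the ortho-symplectic $B(m,n)=\mathfrak{osp}(2m+1|2n)$, $C(n)=\mathfrak{osp}(2|2n)$, $D(m,n)=\mathfrak{osp}(2m|2n)$ ($p>2$); $D(2,1;\alpha)$, $\alpha\in K\setminus\{0,-1\}$ ($p>3$); $F(4)$ ($p>15$); $G(3)$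 ($p>15$). Here $D(2,1;\alpha)$ is the $17$-dimensional simple Lie superalgebra with even part $\mathfrak{sl}(2)^{\oplus 3}$ and odd part $V\otimes V\otimes V$ ($V$ natural), with odd bracket (in one standard normalization) $[v_1\otimes v_2\otimes v_3,w_1\otimes w_2\otimes w_3]=\sum_i\sigma_i\prod_{j\ne i}\psi(v_j,w_j)P_i(v_i,w_i)$, $\psi$ the symplectic form on $V$, $P_i(x,y)z=\psi(y,z)x-\psi(z,x)y$ in the $i$-th $\mathfrak{sl}(2)$, $(\sigma_1,\sigma_2,\sigma_3)=(1,\alpha,-1-\alpha)$; $F(4)$ is the $40$-dimensional simple one with even part $B_3\oplus A_1$ and odd part (8-dimensional spin)$\otimes$(natural); $G(3)$ is the $31$-dimensional simple one with even part $G_2\oplus A_1$ and odd part (7-dimensional simple)$\otimes$(natural). Each carries a fixed nondegenerate invariant even supersymmetric form $(\cdot,\cdot)$, giving $\mathfrak g_{\bar 0}\cong\mathfrak g_{\bar 0}^*$, and a natural restricted structure ($\mathfrak g_{\bar 0}$ is the Lie algebra of a reductive group). $\chi\in\mathfrak g_{\bar 0}^*$ is nilpotent if it corresponds to a nilpotent $X\in\mathfrak g_{\bar 0}$, so $\chi=(X,\cdot)$. The grading. (a) For $\mathfrak g=\mathfrak{gl}(V),\mathfrak{sl}(V)$ choose homogeneous $w_1,\dots,w_r\in V_{\bar 0}\cup V_{\bar 1}$ and integers $\lambda_i\ge1$ such that the $X^jw_i$ ($0\le j<\lambda_i$) form a basis of $V$ and $X^{\lambda_i}w_i=0$; let $V(k)$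 be the span of those $X^jw_i$ with $2j+1-\lambda_i=k$ and $\mathfrak g(k)=\{f\in\mathfrak g: f(V(l))\subseteq V(l+k)\ \forall l\}$. (b) For $\mathfrak g=\mathfrak{osp}(V)$ with form $\phi$, do the same with the $w_i$ chosen (as is possible) so that moreover $\phi(V(k),V(l))=0$ unless $k+l=0$. (c) For exceptional $\mathfrak g$, take an $\mathfrak{sl}(2)$-triple $\{X,H,Y\}$ in $\mathfrak g_{\bar 0}$ such that $KH$ lifts to a one-dimensional torus $\gamma:K^\times\to G_{\bar 0}$ ($G_{\bar 0}$ the simply connected group of $\mathfrak g_{\bar 0}$) for which $\mathfrak g(k)=\{z:\mathrm{Ad}(\gamma(t))z=t^kz\ \forall t\in K^\times\}$ defines a grading with the following properties. In all cases the grading is compatible with the $\mathbb Z_2$-grading and satisfies: $X\in\mathfrak g(2)$; $(\mathfrak g(k),\mathfrak g(l))=0$ if $k+l\ne0$; $\mathfrak g_X=\bigoplus_k\mathfrak g_X\cap\mathfrak g(k)$, with $\mathfrak g_X\cap\mathfrak g(s)=0$ for $s<0$; $\underline{\dim}\,\mathfrak g_X=\underline{\dim}\,\mathfrak g(0)+\underline{\dim}\,\mathfrak g(1)$, where $\mathfrak g_X$ is the centralizer of $X$ and $\underline{\dim}$ is the pair (even dimension $|$ odd dimension). The subalgebra $\mathfrak m$. On $\mathfrak g(-1)$ put $\langle x,y\rangle=(X,[x,y])=\chi([x,y])$; it is even, nondegenerate, symplectic on $\mathfrak g(-1)_{\bar 0}$ and symmetric on $\mathfrak g(-1)_{\bar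 1}$. Let $\mathfrak g(-1)'_{\bar 0}\subset\mathfrak g(-1)_{\bar 0}$ be a maximal isotropic subspace. Let $r=\dim\mathfrak g(-1)_{\bar 1}$ and choose a basis $v_1,\dots,v_r$ of $\mathfrak g(-1)_{\bar 1}$ with $\langle v_i,v_j\rangle=\delta_{i+j,r+1}$; let $\mathfrak g(-1)'_{\bar 1}$ be the span of $v_1,\dots,v_{r/2}$ if $r$ is even and of $v_1,\dots,v_{(r-1)/2}$ if $r$ is odd. Put $\mathfrak g(-1)'=\mathfrak g(-1)'_{\bar 0}\oplus\mathfrak g(-1)'_{\bar 1}$ and $\mathfrak m=\bigoplus_{k\ge2}\mathfrak g(-k)\oplus\mathfrak g(-1)'$. *)

theory Defs
  imports
    "HOL-Analysis.Determinants"
    "HOL-Algebra.QuotRing"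
    "HOL-Algebra.Module"
    "HOL-Library.Poly_Mapping"
    "HOL-Library.Function_Algebras"
    "HOL-Computational_Algebra.Polynomial"
begin

section \<open>Graded vector spaces\<close>

text \<open>
  Parities are booleans: \<open>False\<close> is even, \<open>True\<close> is odd and \<open>a \<noteq> b\<close> is the sum of \<open>a\<close> and \<open>b\<close>.
  A graded space is given by its two components, which are subspaces of an ambient
  vector space with scalar multiplication \<open>s\<close>.
\<close>

definition ksign :: "bool \<Rightarrow> bool \<Rightarrow> 'k::ring_1" where
  "ksign a b = (if a \<and> b then - 1 else 1)"

definition total :: "(bool \<Rightarrow> 'v::ab_group_add set) \<Rightarrow> 'v set" where
  "total V = {x + y | x y. x \<in> V False \<and> y \<in> V True}"

definition graded_space :: "('k::field \<Rightarrow> 'v::ab_group_add \<Rightarrow> 'v) \<Rightarrow> (bool \<Rightarrow> 'v set) \<Rightarrow> bool" where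
  "graded_space s V \<longleftrightarrow> vector_space s \<and> (\<forall>a. module.subspace s (V a)) \<and> V False \<inter> V True = {0}"

definition fin_dim :: "('k::field \<Rightarrow> 'v::ab_group_add \<Rightarrow> 'v) \<Rightarrow> 'v set \<Rightarrow> bool" where
  "fin_dim s W \<longleftrightarrow> (\<exists>B. finite B \<and> module.span s B = W)"

definition direct_sum :: "'g::ab_group_add set \<Rightarrow> ('i \<Rightarrow> 'g set) \<Rightarrow> bool" where
  "direct_sum W S \<longleftrightarrow> (\<forall>k. S k \<subseteq> W) \<and>
     (\<forall>z\<in>W. \<exists>!c. (\<forall>k. c k \<in> S k) \<and> finite {k. c k \<noteq> 0} \<and> z = (\<Sum>k | c k \<noteq> 0. c k))"

section \<open>Restricted Lie superalgebras\<close>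

record ('k, 'g) lsuper =
  scl :: "'k \<Rightarrow> 'g \<Rightarrow> 'g"
  part :: "bool \<Rightarrow> 'g set"
  brk :: "'g \<Rightarrow> 'g \<Rightarrow> 'g"
  ppow :: "'g \<Rightarrow> 'g"

abbreviation space_of :: "('k, 'g::ab_group_add) lsuper \<Rightarrow> 'g set" where
  "space_of G \<equiv> total (part G)"

text \<open>The condition \<open>[y, [y, y]] = 0\<close> for odd \<open>y\<close> follows from the Jacobi identity unless \<open>p = 3\<close>.\<close>

definition lie_superalgebra :: "('k::field, 'g::ab_group_add) lsuper \<Rightarrow> bool" where
  "lie_superalgebra G \<longleftrightarrow>
     graded_space (scl G) (part G) \<and>
     (\<forall>x\<in>space_of G. \<forall>y\<in>space_of G. \<forall>z\<in>space_of G. \<forall>c.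
        brk G (x + y) z = brk G x z + brk G y z \<and>
        brk G x (y + z) = brk G x y + brk G x z \<and>
        brk G (scl G c x) y = scl G c (brk G x y) \<and>
        brk G x (scl G c y) = scl G c (brk G x y)) \<and>
     (\<forall>a b. \<forall>x\<in>part G a. \<forall>y\<in>part G b.
        brk G x y \<in> part G (a \<noteq> b) \<and>
        brk G x y = - scl G (ksign a b) (brk G y x) \<and>
        (\<forall>z\<in>space_of G.
           brk G x (brk G y z) = brk G (brk G x y) z + scl G (ksign a b) (brk G y (brk G x z)))) \<and>
     (\<forall>y\<in>part G True. brk G y (brk G y y) = 0)"

text \<open>
  In the last clause \<open>s i\<close> is the usual \<open>s\<^sub>i(x, y)\<close>: \<open>i s\<^sub>i(x, y)\<close> is the coefficient of
  \<open>c\<^sup>i\<^sup>-\<^sup>1\<close> in \<open>ad(c x + y)\<^sup>p\<^sup>-\<^sup>1(x)\<close>. It is determined by these values because \<open>K\<close> is infinite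
  in all applications.
\<close>

definition restricted_lie_superalgebra :: "('k::field, 'g::ab_group_add) lsuper \<Rightarrow> bool" where
  "restricted_lie_superalgebra G \<longleftrightarrow>
     lie_superalgebra G \<and>
     (\<forall>x\<in>part G False. ppow G x \<in> part G False \<and>
        (\<forall>y\<in>space_of G. brk G (ppow G x) y = (brk G x ^^ CHAR('k)) y) \<and>
        (\<forall>c. ppow G (scl G c x) = scl G (c ^ CHAR('k)) (ppow G x))) \<and>
     (\<forall>x\<in>part G False. \<forall>y\<in>part G False. \<exists>s.
        (\<forall>i\<in>{1..<CHAR('k)}. s i \<in> part G False) \<and>
        (\<forall>c. (brk G (scl G c x + y) ^^ (CHAR('k) - 1)) x =
             (\<Sum>i = 1..<CHAR('k). scl G (of_nat i * c ^ (i - 1)) (s i))) \<and>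
        ppow G (x + y) = ppow G x + ppow G y + (\<Sum>i = 1..<CHAR('k). s i))"

definition invariant_form :: "('k::field, 'g::ab_group_add) lsuper \<Rightarrow> ('g \<Rightarrow> 'g \<Rightarrow> 'k) \<Rightarrow> bool" where
  "invariant_form G B \<longleftrightarrow>
     (\<forall>x\<in>space_of G. \<forall>y\<in>space_of G. \<forall>z\<in>space_of G. \<forall>c.
        B (x + y) z = B x z + B y z \<and> B x (y + z) = B x y + B x z \<and>
        B (scl G c x) y = c * B x y \<and> B x (scl G c y) = c * B x y \<and>
        B (brk G x y) z = B x (brk G y z)) \<and>
     (\<forall>a b. \<forall>x\<in>part G a. \<forall>y\<in>part G b. B x y = ksign a b * B y x \<and> (a \<noteq> b \<longrightarrow> B x y = 0)) \<and>
     (\<forall>x\<in>space_of G. (\<forall>y\<in>space_of G. B x y = 0) \<longrightarrow> x = 0)"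

definition simple_lsuper :: "('k::field, 'g::ab_group_add) lsuper \<Rightarrow> bool" where
  "simple_lsuper G \<longleftrightarrow>
     (\<exists>x\<in>space_of G. \<exists>y\<in>space_of G. brk G x y \<noteq> 0) \<and>
     (\<forall>I. (\<forall>a. I a \<subseteq> part G a \<and> module.subspace (scl G) (I a)) \<and>
          (\<forall>x\<in>space_of G. \<forall>y\<in>total I. brk G x y \<in> total I)
        \<longrightarrow> total I = {0} \<or> total I = space_of G)"

section \<open>The classical series\<close>

text \<open>
  Endomorphisms of \<open>V\<close> are represented by functions that vanish outside \<open>V\<close>;
  this class is closed under composition and pointwise linear combinations.
\<close>

definition gl_part :: "('k::field \<Rightarrow> 'v::ab_group_add \<Rightarrow> 'v) \<Rightarrow> (bool \<Rightarrow> 'v set) \<Rightarrow> bool \<Rightarrow> ('v \<Rightarrow> 'v) set" where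
  "gl_part s V a = {f.
     (\<forall>x\<in>total V. \<forall>y\<in>total V. f (x + y) = f x + f y) \<and>
     (\<forall>c. \<forall>x\<in>total V. f (s c x) = s c (f x)) \<and>
     (\<forall>x. x \<notin> total V \<longrightarrow> f x = 0) \<and>
     (\<forall>b. \<forall>x\<in>V b. f x \<in> V (a \<noteq> b))}"

definition trace_on :: "('k::field \<Rightarrow> 'v::ab_group_add \<Rightarrow> 'v) \<Rightarrow> 'v set \<Rightarrow> ('v \<Rightarrow> 'v) \<Rightarrow> 'k" where
  "trace_on s W f =
     (let B = (SOME B. \<not> module.dependent s B \<and> module.span s B = W)
      in \<Sum>b\<in>B. module.representation s B (f b) b)"

text \<open>Odd endomorphisms have supertrace \<open>0\<close>.\<close>

definition sl_part :: "('k::field \<Rightarrow> 'v::ab_group_add \<Rightarrow> 'v) \<Rightarrow> (bool \<Rightarrow> 'v set) \<Rightarrow> bool \<Rightarrow> ('v \<Rightarrow> 'v) set" where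
  "sl_part s V a = {f \<in> gl_part s V a. \<not> a \<longrightarrow> trace_on s (V False) f - trace_on s (V True) f = 0}"

definition osp_form :: "('k::field \<Rightarrow> 'v::ab_group_add \<Rightarrow> 'v) \<Rightarrow> (bool \<Rightarrow> 'v set) \<Rightarrow> ('v \<Rightarrow> 'v \<Rightarrow> 'k) \<Rightarrow> bool" where
  "osp_form s V \<phi> \<longleftrightarrow>
     (\<forall>x\<in>total V. \<forall>y\<in>total V. \<forall>z\<in>total V. \<forall>c.
        \<phi> (x + y) z = \<phi> x z + \<phi> y z \<and> \<phi> x (y + z) = \<phi> x y + \<phi> x z \<and>
        \<phi> (s c x) y = c * \<phi> x y \<and> \<phi> x (s c y) = c * \<phi> x y) \<and>
     (\<forall>a b. \<forall>x\<in>V a. \<forall>y\<in>V b. \<phi> x y = ksign a b * \<phi> y x \<and> (a \<noteq> b \<longrightarrow> \<phi> x y = 0)) \<and>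
     (\<forall>x\<in>total V. (\<forall>y\<in>total V. \<phi> x y = 0) \<longrightarrow> x = 0)"

definition osp_part ::
  "('k::field \<Rightarrow> 'v::ab_group_add \<Rightarrow> 'v) \<Rightarrow> (bool \<Rightarrow> 'v set) \<Rightarrow> ('v \<Rightarrow> 'v \<Rightarrow> 'k) \<Rightarrow> bool \<Rightarrow> ('v \<Rightarrow> 'v) set" where
  "osp_part s V \<phi> a = {f \<in> gl_part s V a.
     \<forall>b. \<forall>x\<in>V b. \<forall>y\<in>total V. \<phi> (f x) y = - ksign a b * \<phi> x (f y)}"

text \<open>
  \<open>\<Phi>\<close> is an isomorphism of restricted Lie superalgebras from \<open>G\<close> onto the superalgebra of
  endomorphisms with components \<open>L a\<close>, whose bracket is the supercommutator and whose
  \<open>p\<close>-map is the \<open>p\<close>-th power.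
\<close>

definition linear_realization ::
  "('k::field, 'g::ab_group_add) lsuper \<Rightarrow> ('k \<Rightarrow> 'v::ab_group_add \<Rightarrow> 'v) \<Rightarrow> (bool \<Rightarrow> ('v \<Rightarrow> 'v) set) \<Rightarrow>
   ('g \<Rightarrow> 'v \<Rightarrow> 'v) \<Rightarrow> bool" where
  "linear_realization G s L \<Phi> \<longleftrightarrow>
     bij_betw \<Phi> (space_of G) (total L) \<and>
     (\<forall>a. \<Phi> ` part G a = L a) \<and>
     (\<forall>x\<in>space_of G. \<forall>y\<in>space_of G. \<Phi> (x + y) = \<Phi> x + \<Phi> y) \<and>
     (\<forall>x\<in>space_of G. \<forall>c. \<Phi> (scl G c x) = (\<lambda>v. s c (\<Phi> x v))) \<and>
     (\<forall>a b. \<forall>x\<in>part G a. \<forall>y\<in>part G b.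
        \<Phi> (brk G x y) = (\<lambda>v. \<Phi> x (\<Phi> y v) - s (ksign a b) (\<Phi> y (\<Phi> x v)))) \<and>
     (\<forall>x\<in>part G False. \<Phi> (ppow G x) = \<Phi> x ^^ CHAR('k))"

text \<open>Up to isomorphism, every finite-dimensional space is a subspace of the space of sequences.\<close>

definition seq_scale :: "'k::field \<Rightarrow> (nat \<Rightarrow> 'k) \<Rightarrow> nat \<Rightarrow> 'k" where
  "seq_scale c v = (\<lambda>i. c * v i)"

definition natural_space :: "(bool \<Rightarrow> (nat \<Rightarrow> 'k::field) set) \<Rightarrow> bool" where
  "natural_space V \<longleftrightarrow> graded_space seq_scale V \<and> (\<forall>a. fin_dim seq_scale (V a) \<and> V a \<noteq> {0})"

definition gl_realization ::
  "('k::field, 'g::ab_group_add) lsuper \<Rightarrow> (bool \<Rightarrow> (nat \<Rightarrow> 'k) set) \<Rightarrow> ('g \<Rightarrow> (nat \<Rightarrow> 'k) \<Rightarrow> nat \<Rightarrow> 'k) \<Rightarrow> bool" where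
  "gl_realization G V \<Phi> \<longleftrightarrow>
     natural_space V \<and> linear_realization G seq_scale (gl_part seq_scale V) \<Phi>"

definition sl_realization ::
  "('k::field, 'g::ab_group_add) lsuper \<Rightarrow> (bool \<Rightarrow> (nat \<Rightarrow> 'k) set) \<Rightarrow> ('g \<Rightarrow> (nat \<Rightarrow> 'k) \<Rightarrow> nat \<Rightarrow> 'k) \<Rightarrow> bool" where
  "sl_realization G V \<Phi> \<longleftrightarrow>
     natural_space V \<and>
     \<not> int CHAR('k) dvd int (vector_space.dim seq_scale (V False)) - int (vector_space.dim seq_scale (V True)) \<and>
     linear_realization G seq_scale (sl_part seq_scale V) \<Phi>"

definition osp_realization ::
  "('k::field, 'g::ab_group_add) lsuper \<Rightarrow> (bool \<Rightarrow> (nat \<Rightarrow> 'k) set) \<Rightarrow> ((nat \<Rightarrow> 'k) \<Rightarrow> (nat \<Rightarrow> 'k) \<Rightarrow> 'k) \<Rightarrow>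
   ('g \<Rightarrow> (nat \<Rightarrow> 'k) \<Rightarrow> nat \<Rightarrow> 'k) \<Rightarrow> bool" where
  "osp_realization G V \<phi> \<Phi> \<longleftrightarrow>
     natural_space V \<and> osp_form seq_scale V \<phi> \<and>
     linear_realization G seq_scale (osp_part seq_scale V \<phi>) \<Phi>"

section \<open>The exceptional superalgebras\<close>

definition mat_scale :: "'k::field \<Rightarrow> 'k^'m^'n \<Rightarrow> 'k^'m^'n" where
  "mat_scale c A = (\<chi> i j. c * A $ i $ j)"

definition mat_comm :: "'k::field^'n^'n \<Rightarrow> 'k^'n^'n \<Rightarrow> 'k^'n^'n" where
  "mat_comm A B = A ** B - B ** A"

definition conj_by :: "'k::field^'n^'n \<Rightarrow> 'k^'n^'n \<Rightarrow> 'k^'n^'n" where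
  "conj_by g A = g ** A ** matrix_inv g"

definition sl2 :: "('k::field^2^2) set" where
  "sl2 = {A. trace A = 0}"

definition SL2 :: "('k::field^2^2) set" where
  "SL2 = {A. det A = 1}"

subsection \<open>The family depending on a parameter\<close>

definition psi :: "'k::field^2 \<Rightarrow> 'k^2 \<Rightarrow> 'k" where
  "psi v w = v $ 1 * w $ 2 - v $ 2 * w $ 1"

definition Pmat :: "'k::field^2 \<Rightarrow> 'k^2 \<Rightarrow> 'k^2^2" where
  "Pmat x y = matrix (\<lambda>z. psi y z *s x - psi z x *s y)"

definition bpsi :: "2 \<Rightarrow> 2 \<Rightarrow> 'k::field" where
  "bpsi i j = psi (axis i 1) (axis j 1)"

definition bP :: "2 \<Rightarrow> 2 \<Rightarrow> 'k::field^2^2" where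
  "bP i j = Pmat (axis i 1) (axis j 1)"

type_synonym 'k d21 = "(('k^2^2) \<times> ('k^2^2) \<times> ('k^2^2)) \<times> ('k^2^2^2)"

definition d21_scale :: "'k::field \<Rightarrow> 'k d21 \<Rightarrow> 'k d21" where
  "d21_scale c = (\<lambda>((A, B, C), T).
     ((mat_scale c A, mat_scale c B, mat_scale c C), \<chi> i j k. c * T $ i $ j $ k))"

definition d21_act :: "('k::field^2^2) \<times> ('k^2^2) \<times> ('k^2^2) \<Rightarrow> 'k^2^2^2 \<Rightarrow> 'k^2^2^2" where
  "d21_act = (\<lambda>(A, B, C) T. \<chi> i j k.
     (\<Sum>a\<in>UNIV. A $ i $ a * T $ a $ j $ k) +
     (\<Sum>b\<in>UNIV. B $ j $ b * T $ i $ b $ k) +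
     (\<Sum>c\<in>UNIV. C $ k $ c * T $ i $ j $ c))"

text \<open>The bilinear extension of the given bracket of pure tensors, with \<open>(\<sigma>\<^sub>1, \<sigma>\<^sub>2, \<sigma>\<^sub>3) = (1, \<alpha>, -1-\<alpha>)\<close>.\<close>

definition d21_odd :: "'k::field \<Rightarrow> 'k^2^2^2 \<Rightarrow> 'k^2^2^2 \<Rightarrow> ('k^2^2) \<times> ('k^2^2) \<times> ('k^2^2)" where
  "d21_odd \<alpha> S T =
     ((\<Sum>i\<in>UNIV. \<Sum>j\<in>UNIV. \<Sum>k\<in>UNIV. \<Sum>l\<in>UNIV. \<Sum>m\<in>UNIV. \<Sum>n\<in>UNIV.
         mat_scale (S $ i $ j $ k * T $ l $ m $ n * bpsi j m * bpsi k n) (bP i l)),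
      (\<Sum>i\<in>UNIV. \<Sum>j\<in>UNIV. \<Sum>k\<in>UNIV. \<Sum>l\<in>UNIV. \<Sum>m\<in>UNIV. \<Sum>n\<in>UNIV.
         mat_scale (\<alpha> * (S $ i $ j $ k * T $ l $ m $ n * bpsi i l * bpsi k n)) (bP j m)),
      (\<Sum>i\<in>UNIV. \<Sum>j\<in>UNIV. \<Sum>k\<in>UNIV. \<Sum>l\<in>UNIV. \<Sum>m\<in>UNIV. \<Sum>n\<in>UNIV.
         mat_scale ((- 1 - \<alpha>) * (S $ i $ j $ k * T $ l $ m $ n * bpsi i l * bpsi j m)) (bP k n)))"

definition d21_brk :: "'k::field \<Rightarrow> 'k d21 \<Rightarrow> 'k d21 \<Rightarrow> 'k d21" where
  "d21_brk \<alpha> = (\<lambda>((A, B, C), S) ((A', B', C'), T).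
     ((mat_comm A A', mat_comm B B', mat_comm C C') + d21_odd \<alpha> S T,
      d21_act (A, B, C) T - d21_act (A', B', C') S))"

definition d21_Ad :: "('k::field^2^2) \<times> ('k^2^2) \<times> ('k^2^2) \<Rightarrow> 'k d21 \<Rightarrow> 'k d21" where
  "d21_Ad = (\<lambda>(g, h, q) ((A, B, C), T).
     ((conj_by g A, conj_by h B, conj_by q C),
      \<chi> i j k. \<Sum>a\<in>UNIV. \<Sum>b\<in>UNIV. \<Sum>c\<in>UNIV. g $ i $ a * h $ j $ b * q $ k $ c * T $ a $ b $ c))"

definition d21_realization :: "('k::field, 'g::ab_group_add) lsuper \<Rightarrow> 'k \<Rightarrow> ('g \<Rightarrow> 'k d21) \<Rightarrow> bool" where
  "d21_realization G \<alpha> \<theta> \<longleftrightarrow>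
     CHAR('k) > 3 \<and> \<alpha> \<noteq> 0 \<and> \<alpha> \<noteq> - 1 \<and>
     inj_on \<theta> (space_of G) \<and>
     \<theta> ` part G False = (sl2 \<times> sl2 \<times> sl2) \<times> {0} \<and> \<theta> ` part G True = {0} \<times> UNIV \<and>
     (\<forall>x\<in>space_of G. \<forall>y\<in>space_of G. \<forall>c.
        \<theta> (x + y) = \<theta> x + \<theta> y \<and> \<theta> (scl G c x) = d21_scale c (\<theta> x) \<and>
        \<theta> (brk G x y) = d21_brk \<alpha> (\<theta> x) (\<theta> y))"

subsection \<open>The superalgebras of dimension 40 and 31\<close>

text \<open>
  Both have even part \<open>L \<oplus> sl(2)\<close> with \<open>L\<close> a Lie algebra of \<open>n \<times> n\<close> matrices, and odd part
  \<open>K\<^sup>n \<otimes> K\<^sup>2\<close>, written as the space of \<open>n \<times> 2\<close> matrices.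
\<close>

type_synonym ('k, 'n) tmod = "(('k^'n^'n) \<times> ('k^2^2)) \<times> ('k^2^'n)"

definition tmod_scale :: "'k::field \<Rightarrow> ('k, 'n::finite) tmod \<Rightarrow> ('k, 'n) tmod" where
  "tmod_scale c = (\<lambda>((A, B), T). ((mat_scale c A, mat_scale c B), mat_scale c T))"

definition tmod_ad :: "('k::field^'n^'n) \<times> ('k^2^2) \<Rightarrow> ('k, 'n::finite) tmod \<Rightarrow> ('k, 'n) tmod" where
  "tmod_ad = (\<lambda>(A, B) ((A', B'), T). ((mat_comm A A', mat_comm B B'), A ** T + T ** transpose B))"

definition tmod_Ad :: "('k::field^'n^'n) \<times> ('k^2^2) \<Rightarrow> ('k, 'n::finite) tmod \<Rightarrow> ('k, 'n) tmod" where
  "tmod_Ad = (\<lambda>(g, h) ((A, B), T). ((conj_by g A, conj_by h B), g ** T ** transpose h))"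

definition tmod_realization ::
  "('k::field, 'g::ab_group_add) lsuper \<Rightarrow> ('k^'n::finite^'n) set \<Rightarrow> ('g \<Rightarrow> ('k, 'n) tmod) \<Rightarrow> bool" where
  "tmod_realization G L \<theta> \<longleftrightarrow>
     CHAR('k) > 15 \<and> simple_lsuper G \<and>
     inj_on \<theta> (space_of G) \<and>
     \<theta> ` part G False = (L \<times> sl2) \<times> {0} \<and> \<theta> ` part G True = {0} \<times> UNIV \<and>
     (\<forall>x\<in>space_of G. \<forall>y\<in>space_of G. \<forall>c.
        \<theta> (x + y) = \<theta> x + \<theta> y \<and> \<theta> (scl G c x) = tmod_scale c (\<theta> x)) \<and>
     (\<forall>x\<in>part G False. \<forall>y\<in>space_of G. \<theta> (brk G x y) = tmod_ad (fst (\<theta> x)) (\<theta> y))"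

text \<open>
  \<open>gam\<close> makes \<open>K\<^sup>8\<close> a module over the Clifford algebra of the seven-dimensional quadratic space.
  There are two such modules, which differ by the sign of \<open>gam\<close> and define the same
  spin representation of \<open>Spin(7)\<close> and of its Lie algebra, which has type \<open>B\<^sub>3\<close>.
\<close>

definition clifford7 :: "(7 \<Rightarrow> 'k::field^8^8) \<Rightarrow> bool" where
  "clifford7 gam \<longleftrightarrow> (\<forall>i j. gam i ** gam j + gam j ** gam i = (if i = j then mat 2 else 0))"

definition cliff :: "(7 \<Rightarrow> 'k::field^8^8) \<Rightarrow> 'k^7 \<Rightarrow> 'k^8^8" where
  "cliff gam u = (\<Sum>i\<in>UNIV. mat_scale (u $ i) (gam i))"

definition spin7 :: "(7 \<Rightarrow> 'k::field^8^8) \<Rightarrow> ('k^8^8) set" where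
  "spin7 gam = module.span mat_scale {gam i ** gam j | i j. i \<noteq> j}"

inductive_set Spin7 :: "(7 \<Rightarrow> 'k::field^8^8) \<Rightarrow> ('k^8^8) set" for gam where
  one: "mat 1 \<in> Spin7 gam"
| mult: "\<lbrakk>g \<in> Spin7 gam; (\<Sum>i\<in>UNIV. u $ i * u $ i) = 1; (\<Sum>i\<in>UNIV. v $ i * v $ i) = 1\<rbrakk>
         \<Longrightarrow> g ** cliff gam u ** cliff gam v \<in> Spin7 gam"

text \<open>
  The product of imaginary octonions, with \<open>e\<^sub>i e\<^sub>i\<^sub>+\<^sub>1 = e\<^sub>i\<^sub>+\<^sub>3\<close> (indices modulo 7). Its derivations and
  automorphisms are those of the octonions, and \<open>K\<^sup>7\<close> is the seven-dimensional simple module.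
\<close>

definition cross7 :: "'k::field^7 \<Rightarrow> 'k^7 \<Rightarrow> 'k^7" where
  "cross7 x y = (\<chi> k.
     (x $ (k - 3) * y $ (k - 2) - x $ (k - 2) * y $ (k - 3)) +
     (x $ (k + 1) * y $ (k + 3) - x $ (k + 3) * y $ (k + 1)) +
     (x $ (k + 2) * y $ (k - 1) - x $ (k - 1) * y $ (k + 2)))"

definition g2_alg :: "('k::field^7^7) set" where
  "g2_alg = {D. \<forall>x y. D *v cross7 x y = cross7 (D *v x) y + cross7 x (D *v y)}"

definition G2_grp :: "('k::field^7^7) set" where
  "G2_grp = {g. invertible g \<and> (\<forall>x y. g *v cross7 x y = cross7 (g *v x) (g *v y))}"

definition f4_realization ::
  "('k::field, 'g::ab_group_add) lsuper \<Rightarrow> (7 \<Rightarrow> 'k^8^8) \<Rightarrow> ('g \<Rightarrow> ('k, 8) tmod) \<Rightarrow> bool" where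
  "f4_realization G gam \<theta> \<longleftrightarrow> clifford7 gam \<and> tmod_realization G (spin7 gam) \<theta>"

definition g3_realization :: "('k::field, 'g::ab_group_add) lsuper \<Rightarrow> ('g \<Rightarrow> ('k, 7) tmod) \<Rightarrow> bool" where
  "g3_realization G \<theta> \<longleftrightarrow> tmod_realization G g2_alg \<theta>"

definition basic_classical :: "('k::field, 'g::ab_group_add) lsuper \<Rightarrow> bool" where
  "basic_classical G \<longleftrightarrow>
     restricted_lie_superalgebra G \<and>
     ((\<exists>V \<Phi>. gl_realization G V \<Phi>) \<or> (\<exists>V \<Phi>. sl_realization G V \<Phi>) \<or>
      (\<exists>V \<phi> \<Phi>. osp_realization G V \<phi> \<Phi>) \<or>
      (\<exists>\<alpha> \<theta>. d21_realization G \<alpha> \<theta>) \<or> (\<exists>gam \<theta>. f4_realization G gam \<theta>) \<or>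
      (\<exists>\<theta>. g3_realization G \<theta>))"

section \<open>The grading attached to a nilpotent element\<close>

definition nilpotent_elt :: "('k::field, 'g::ab_group_add) lsuper \<Rightarrow> 'g \<Rightarrow> bool" where
  "nilpotent_elt G X \<longleftrightarrow> X \<in> part G False \<and> (\<exists>n. (ppow G ^^ n) X = 0)"

definition jordan_basis ::
  "('k::field \<Rightarrow> 'v::ab_group_add \<Rightarrow> 'v) \<Rightarrow> (bool \<Rightarrow> 'v set) \<Rightarrow> ('v \<Rightarrow> 'v) \<Rightarrow> nat \<Rightarrow> (nat \<Rightarrow> 'v) \<Rightarrow> (nat \<Rightarrow> nat) \<Rightarrow> bool" where
  "jordan_basis s V f r w lam \<longleftrightarrow>
     (\<forall>i<r. w i \<in> V False \<union> V True \<and> lam i \<ge> 1 \<and> (f ^^ lam i) (w i) = 0) \<and>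
     (let J = {(i, j). i < r \<and> j < lam i}; e = (\<lambda>(i, j). (f ^^ j) (w i)) in
        inj_on e J \<and> \<not> module.dependent s (e ` J) \<and> module.span s (e ` J) = total V)"

definition jordan_piece ::
  "('k::field \<Rightarrow> 'v::ab_group_add \<Rightarrow> 'v) \<Rightarrow> ('v \<Rightarrow> 'v) \<Rightarrow> nat \<Rightarrow> (nat \<Rightarrow> 'v) \<Rightarrow> (nat \<Rightarrow> nat) \<Rightarrow> int \<Rightarrow> 'v set" where
  "jordan_piece s f r w lam k =
     module.span s {(f ^^ j) (w i) | i j. i < r \<and> j < lam i \<and> 2 * int j + 1 - int (lam i) = k}"

definition shift_grading ::
  "('k, 'g::ab_group_add) lsuper \<Rightarrow> ('g \<Rightarrow> 'v \<Rightarrow> 'v) \<Rightarrow> (int \<Rightarrow> 'v set) \<Rightarrow> int \<Rightarrow> 'g set" where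
  "shift_grading G \<Phi> Vk k = {z \<in> space_of G. \<forall>l. \<Phi> z ` Vk l \<subseteq> Vk (l + k)}"

definition gl_sl_grading :: "('k::field, 'g::ab_group_add) lsuper \<Rightarrow> 'g \<Rightarrow> (int \<Rightarrow> 'g set) \<Rightarrow> bool" where
  "gl_sl_grading G X gr \<longleftrightarrow> (\<exists>V \<Phi> r w lam.
     (gl_realization G V \<Phi> \<or> sl_realization G V \<Phi>) \<and>
     jordan_basis seq_scale V (\<Phi> X) r w lam \<and>
     gr = shift_grading G \<Phi> (jordan_piece seq_scale (\<Phi> X) r w lam))"

definition osp_grading :: "('k::field, 'g::ab_group_add) lsuper \<Rightarrow> 'g \<Rightarrow> (int \<Rightarrow> 'g set) \<Rightarrow> bool" where
  "osp_grading G X gr \<longleftrightarrow> (\<exists>V \<phi> \<Phi> r w lam.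
     osp_realization G V \<phi> \<Phi> \<and>
     jordan_basis seq_scale V (\<Phi> X) r w lam \<and>
     (\<forall>k l. k + l \<noteq> 0 \<longrightarrow>
        (\<forall>x\<in>jordan_piece seq_scale (\<Phi> X) r w lam k.
         \<forall>y\<in>jordan_piece seq_scale (\<Phi> X) r w lam l. \<phi> x y = 0)) \<and>
     gr = shift_grading G \<Phi> (jordan_piece seq_scale (\<Phi> X) r w lam))"

text \<open>
  One-parameter subgroups: morphisms of algebraic groups from \<open>K\<^sup>\<times>\<close> into a closed matrix group
  are the group homomorphisms whose entries are Laurent polynomials. The differential is taken at \<open>1\<close>.
\<close>

definition laurent_coeffs :: "('k::field \<Rightarrow> 'k) \<Rightarrow> (int \<Rightarrow> 'k) \<Rightarrow> bool" where
  "laurent_coeffs f c \<longleftrightarrow>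
     finite {n. c n \<noteq> 0} \<and> (\<forall>t. t \<noteq> 0 \<longrightarrow> f t = (\<Sum>n | c n \<noteq> 0. c n * t powi n))"

definition laurent_deriv1 :: "('k::field \<Rightarrow> 'k) \<Rightarrow> 'k" where
  "laurent_deriv1 f = (let c = (SOME c. laurent_coeffs f c) in \<Sum>n | c n \<noteq> 0. of_int n * c n)"

definition cochar :: "('k::field^'n^'n) set \<Rightarrow> ('k \<Rightarrow> 'k^'n^'n) \<Rightarrow> bool" where
  "cochar Q \<gamma> \<longleftrightarrow>
     (\<forall>t. t \<noteq> 0 \<longrightarrow> \<gamma> t \<in> Q) \<and> (\<forall>t u. t \<noteq> 0 \<longrightarrow> u \<noteq> 0 \<longrightarrow> \<gamma> (t * u) = \<gamma> t ** \<gamma> u) \<and>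
     (\<forall>i j. \<exists>c. laurent_coeffs (\<lambda>t. \<gamma> t $ i $ j) c)"

definition differential :: "('k::field \<Rightarrow> 'k^'n^'n) \<Rightarrow> 'k^'n^'n" where
  "differential \<gamma> = (\<chi> i j. laurent_deriv1 (\<lambda>t. \<gamma> t $ i $ j))"

definition sl2_triple :: "('k::field, 'g::ab_group_add) lsuper \<Rightarrow> 'g \<Rightarrow> 'g \<Rightarrow> 'g \<Rightarrow> bool" where
  "sl2_triple G X H Y \<longleftrightarrow>
     X \<in> part G False \<and> H \<in> part G False \<and> Y \<in> part G False \<and>
     brk G H X = scl G 2 X \<and> brk G H Y = scl G (- 2) Y \<and> brk G X Y = H"

definition centralizer :: "('k, 'g::ab_group_add) lsuper \<Rightarrow> 'g \<Rightarrow> 'g set" where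
  "centralizer G X = {z \<in> space_of G. brk G X z = 0}"

definition good_grading ::
  "('k::field, 'g::ab_group_add) lsuper \<Rightarrow> ('g \<Rightarrow> 'g \<Rightarrow> 'k) \<Rightarrow> 'g \<Rightarrow> (int \<Rightarrow> 'g set) \<Rightarrow> bool" where
  "good_grading G B X gr \<longleftrightarrow>
     direct_sum (space_of G) gr \<and>
     (\<forall>k l. \<forall>x\<in>gr k. \<forall>y\<in>gr l. brk G x y \<in> gr (k + l)) \<and>
     (\<forall>k. gr k = total (\<lambda>a. gr k \<inter> part G a)) \<and>
     X \<in> gr 2 \<and>
     (\<forall>k l. k + l \<noteq> 0 \<longrightarrow> (\<forall>x\<in>gr k. \<forall>y\<in>gr l. B x y = 0)) \<and>
     direct_sum (centralizer G X) (\<lambda>k. centralizer G X \<inter> gr k) \<and>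
     (\<forall>k<0. centralizer G X \<inter> gr k = {0}) \<and>
     (\<forall>a. vector_space.dim (scl G) (centralizer G X \<inter> part G a) =
          vector_space.dim (scl G) (gr 0 \<inter> part G a) + vector_space.dim (scl G) (gr 1 \<inter> part G a))"

text \<open>
  The clause with \<open>c\<close> says that \<open>K H\<close> is the Lie algebra of the image of the one-parameter
  subgroup; for \<open>X = 0\<close> (so \<open>H = 0\<close>) the subgroup is trivial. The simply connected
  groups are \<open>SL(2)\<^sup>3\<close>, \<open>Spin(7) \<times> SL(2)\<close> and \<open>G\<^sub>2 \<times> SL(2)\<close>.
\<close>

definition d21_grading ::
  "('k::field, 'g::ab_group_add) lsuper \<Rightarrow> ('g \<Rightarrow> 'g \<Rightarrow> 'k) \<Rightarrow> 'g \<Rightarrow> (int \<Rightarrow> 'g set) \<Rightarrow> bool" where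
  "d21_grading G B X gr \<longleftrightarrow> (\<exists>\<alpha> \<theta> H Y c \<gamma>\<^sub>1 \<gamma>\<^sub>2 \<gamma>\<^sub>3.
     d21_realization G \<alpha> \<theta> \<and> sl2_triple G X H Y \<and>
     cochar SL2 \<gamma>\<^sub>1 \<and> cochar SL2 \<gamma>\<^sub>2 \<and> cochar SL2 \<gamma>\<^sub>3 \<and> c \<noteq> 0 \<and>
     fst (\<theta> H) = (mat_scale c (differential \<gamma>\<^sub>1), mat_scale c (differential \<gamma>\<^sub>2), mat_scale c (differential \<gamma>\<^sub>3)) \<and>
     gr = (\<lambda>k. {z \<in> space_of G. \<forall>t. t \<noteq> 0 \<longrightarrow>
                  d21_Ad (\<gamma>\<^sub>1 t, \<gamma>\<^sub>2 t, \<gamma>\<^sub>3 t) (\<theta> z) = d21_scale (t powi k) (\<theta> z)}) \<and>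
     good_grading G B X gr)"

definition tmod_grading ::
  "('k::field, 'g::ab_group_add) lsuper \<Rightarrow> ('g \<Rightarrow> 'g \<Rightarrow> 'k) \<Rightarrow> 'g \<Rightarrow> (int \<Rightarrow> 'g set) \<Rightarrow>
   ('k^'n::finite^'n) set \<Rightarrow> ('g \<Rightarrow> ('k, 'n) tmod) \<Rightarrow> bool" where
  "tmod_grading G B X gr Q \<theta> \<longleftrightarrow> (\<exists>H Y c \<gamma>\<^sub>1 \<gamma>\<^sub>2.
     sl2_triple G X H Y \<and>
     cochar Q \<gamma>\<^sub>1 \<and> cochar SL2 \<gamma>\<^sub>2 \<and> c \<noteq> 0 \<and>
     fst (\<theta> H) = (mat_scale c (differential \<gamma>\<^sub>1), mat_scale c (differential \<gamma>\<^sub>2)) \<and>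
     gr = (\<lambda>k. {z \<in> space_of G. \<forall>t. t \<noteq> 0 \<longrightarrow>
                  tmod_Ad (\<gamma>\<^sub>1 t, \<gamma>\<^sub>2 t) (\<theta> z) = tmod_scale (t powi k) (\<theta> z)}) \<and>
     good_grading G B X gr)"

definition associated_grading ::
  "('k::field, 'g::ab_group_add) lsuper \<Rightarrow> ('g \<Rightarrow> 'g \<Rightarrow> 'k) \<Rightarrow> 'g \<Rightarrow> (int \<Rightarrow> 'g set) \<Rightarrow> bool" where
  "associated_grading G B X gr \<longleftrightarrow>
     gl_sl_grading G X gr \<or> osp_grading G X gr \<or> d21_grading G B X gr \<or>
     (\<exists>gam \<theta>. f4_realization G gam \<theta> \<and> tmod_grading G B X gr (Spin7 gam) \<theta>) \<or>
     (\<exists>\<theta>. g3_realization G \<theta> \<and> tmod_grading G B X gr G2_grp \<theta>)"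

section \<open>The subalgebra of the negative part\<close>

definition isotropic :: "('k::field, 'g) lsuper \<Rightarrow> ('g \<Rightarrow> 'k) \<Rightarrow> 'g set \<Rightarrow> bool" where
  "isotropic G chi E \<longleftrightarrow> (\<forall>x\<in>E. \<forall>y\<in>E. chi (brk G x y) = 0)"

definition maximal_isotropic :: "('k::field, 'g::ab_group_add) lsuper \<Rightarrow> ('g \<Rightarrow> 'k) \<Rightarrow> 'g set \<Rightarrow> 'g set \<Rightarrow> bool" where
  "maximal_isotropic G chi W E \<longleftrightarrow>
     module.subspace (scl G) E \<and> E \<subseteq> W \<and> isotropic G chi E \<and>
     (\<forall>F. module.subspace (scl G) F \<and> F \<subseteq> W \<and> isotropic G chi F \<and> E \<subseteq> F \<longrightarrow> F = E)"

text \<open>For \<open>r\<close> even or odd, \<open>r div 2\<close> is \<open>r/2\<close> or \<open>(r-1)/2\<close> respectively.\<close>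

definition associated_subalgebra ::
  "('k::field, 'g::ab_group_add) lsuper \<Rightarrow> ('g \<Rightarrow> 'k) \<Rightarrow> (int \<Rightarrow> 'g set) \<Rightarrow> 'g set \<Rightarrow> bool" where
  "associated_subalgebra G chi gr m \<longleftrightarrow> (\<exists>E (v :: nat \<Rightarrow> 'g) r.
     maximal_isotropic G chi (gr (- 1) \<inter> part G False) E \<and>
     r = vector_space.dim (scl G) (gr (- 1) \<inter> part G True) \<and>
     inj_on v {1..r} \<and> \<not> module.dependent (scl G) (v ` {1..r}) \<and>
     module.span (scl G) (v ` {1..r}) = gr (- 1) \<inter> part G True \<and>
     (\<forall>i\<in>{1..r}. \<forall>j\<in>{1..r}. chi (brk G (v i) (v j)) = (if i + j = r + 1 then 1 else 0)) \<and>
     m = module.span (scl G) ((\<Union>k\<in>{2..}. gr (- k)) \<union> E \<union> v ` {1..r div 2}))"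

section \<open>Reduced enveloping algebras\<close>

text \<open>
  The free algebra on a set of letters is the monoid algebra of the monoid of words.
  The (reduced) enveloping algebra of \<open>A\<close> is its quotient; the linear relations first turn
  it into the tensor algebra of \<open>A\<close>, and imposing all relations at once amounts to the iterated quotient.
\<close>

instantiation list :: (type) monoid_add
begin
definition zero_list :: "'a list" where "zero_list = []"
definition plus_list :: "'a list \<Rightarrow> 'a list \<Rightarrow> 'a list" where "plus_list = (@)"
instance by standard (simp_all add: zero_list_def plus_list_def)
end

definition free_alg :: "'g set \<Rightarrow> ('g list \<Rightarrow>\<^sub>0 'k::field) ring" where
  "free_alg A = \<lparr>carrier = {f. \<forall>w\<in>Poly_Mapping.keys f. set w \<subseteq> A}, mult = (*), one = 1, zero = 0, add = (+)\<rparr>"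

definition letter :: "'g \<Rightarrow> 'g list \<Rightarrow>\<^sub>0 'k::field" where
  "letter x = Poly_Mapping.single [x] 1"

definition scalar :: "'k \<Rightarrow> 'g list \<Rightarrow>\<^sub>0 'k::field" where
  "scalar c = Poly_Mapping.single [] c"

definition tensor_relations :: "('k::field, 'g::ab_group_add) lsuper \<Rightarrow> 'g set \<Rightarrow> ('g list \<Rightarrow>\<^sub>0 'k) set" where
  "tensor_relations G A =
     {letter (x + y) - letter x - letter y | x y. x \<in> A \<and> y \<in> A} \<union>
     {letter (scl G c x) - scalar c * letter x | c x. x \<in> A}"

definition enveloping_relations :: "('k::field, 'g::ab_group_add) lsuper \<Rightarrow> 'g set \<Rightarrow> ('g list \<Rightarrow>\<^sub>0 'k) set" where
  "enveloping_relations G A =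
     {letter x * letter y - scalar (ksign a b) * letter y * letter x - letter (brk G x y)
      | a b x y. x \<in> A \<inter> part G a \<and> y \<in> A \<inter> part G b}"

definition reduced_relations ::
  "('k::field, 'g::ab_group_add) lsuper \<Rightarrow> ('g \<Rightarrow> 'k) \<Rightarrow> 'g set \<Rightarrow> ('g list \<Rightarrow>\<^sub>0 'k) set" where
  "reduced_relations G chi A =
     {letter x ^ CHAR('k) - letter (ppow G x) - scalar (chi x ^ CHAR('k)) | x. x \<in> A \<inter> part G False}"

definition red_ideal :: "('k::field, 'g::ab_group_add) lsuper \<Rightarrow> ('g \<Rightarrow> 'k) \<Rightarrow> 'g set \<Rightarrow> ('g list \<Rightarrow>\<^sub>0 'k) set" where
  "red_ideal G chi A =
     genideal (free_alg A) (tensor_relations G A \<union> enveloping_relations G A \<union> reduced_relations G chi A)"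

definition red_env :: "('k::field, 'g::ab_group_add) lsuper \<Rightarrow> ('g \<Rightarrow> 'k) \<Rightarrow> 'g set \<Rightarrow> ('g list \<Rightarrow>\<^sub>0 'k) set ring" where
  "red_env G chi A = free_alg A Quot red_ideal G chi A"

fun hom_word :: "('k, 'g) lsuper \<Rightarrow> bool \<Rightarrow> 'g list \<Rightarrow> bool" where
  "hom_word G a [] \<longleftrightarrow> \<not> a"
| "hom_word G a (x # w) \<longleftrightarrow> (\<exists>b. x \<in> part G b \<and> hom_word G (a \<noteq> b) w)"

definition red_env_part ::
  "('k::field, 'g::ab_group_add) lsuper \<Rightarrow> ('g \<Rightarrow> 'k) \<Rightarrow> 'g set \<Rightarrow> bool \<Rightarrow> ('g list \<Rightarrow>\<^sub>0 'k) set set" where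
  "red_env_part G chi A a =
     {red_ideal G chi A +>\<^bsub>free_alg A\<^esub> f | f. f \<in> carrier (free_alg A) \<and> (\<forall>w\<in>Poly_Mapping.keys f. hom_word G a w)}"

section \<open>Modules\<close>

text \<open>The locale of modules in the library is restricted to commutative rings; only its record is used.\<close>

definition left_module :: "'r ring \<Rightarrow> ('r, 'm) module \<Rightarrow> bool" where
  "left_module R M \<longleftrightarrow> ring R \<and> abelian_group M \<and>
     (\<forall>a\<in>carrier R. \<forall>b\<in>carrier R. \<forall>x\<in>carrier M. \<forall>y\<in>carrier M.
        a \<odot>\<^bsub>M\<^esub> x \<in> carrier M \<and>
        (a \<oplus>\<^bsub>R\<^esub> b) \<odot>\<^bsub>M\<^esub> x = a \<odot>\<^bsub>M\<^esub> x \<oplus>\<^bsub>M\<^esub> b \<odot>\<^bsub>M\<^esub> x \<and>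
        a \<odot>\<^bsub>M\<^esub> (x \<oplus>\<^bsub>M\<^esub> y) = a \<odot>\<^bsub>M\<^esub> x \<oplus>\<^bsub>M\<^esub> a \<odot>\<^bsub>M\<^esub> y \<and>
        (a \<otimes>\<^bsub>R\<^esub> b) \<odot>\<^bsub>M\<^esub> x = a \<odot>\<^bsub>M\<^esub> (b \<odot>\<^bsub>M\<^esub> x) \<and>
        \<one>\<^bsub>R\<^esub> \<odot>\<^bsub>M\<^esub> x = x)"

definition graded_module :: "'r ring \<Rightarrow> (bool \<Rightarrow> 'r set) \<Rightarrow> ('r, 'm) module \<Rightarrow> (bool \<Rightarrow> 'm set) \<Rightarrow> bool" where
  "graded_module R Rp M Mp \<longleftrightarrow> left_module R M \<and>
     (\<forall>a. subgroup (Mp a) (add_monoid M)) \<and>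
     Mp False \<inter> Mp True = {\<zero>\<^bsub>M\<^esub>} \<and>
     carrier M = {x \<oplus>\<^bsub>M\<^esub> y | x y. x \<in> Mp False \<and> y \<in> Mp True} \<and>
     (\<forall>a b. \<forall>u\<in>Rp a. \<forall>x\<in>Mp b. u \<odot>\<^bsub>M\<^esub> x \<in> Mp (a \<noteq> b))"

text \<open>Free in the category of graded modules: there is a basis of homogeneous elements.\<close>

definition graded_free :: "'r ring \<Rightarrow> ('r, 'm) module \<Rightarrow> (bool \<Rightarrow> 'm set) \<Rightarrow> bool" where
  "graded_free R M Mp \<longleftrightarrow> (\<exists>B. B \<subseteq> Mp False \<union> Mp True \<and>
     (\<forall>x\<in>carrier M. \<exists>!c. (\<forall>b. c b \<in> carrier R) \<and> {b. c b \<noteq> \<zero>\<^bsub>R\<^esub>} \<subseteq> B \<and> finite {b. c b \<noteq> \<zero>\<^bsub>R\<^esub>} \<and>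
        x = finsum M (\<lambda>b. c b \<odot>\<^bsub>M\<^esub> b) {b. c b \<noteq> \<zero>\<^bsub>R\<^esub>}))"

text \<open>
  Restriction of a module over \<open>red_env G chi (space_of G)\<close> along the canonical map from
  \<open>red_env G chi A\<close>, which sends the coset \<open>u\<close> to the larger coset \<open>u + red_ideal G chi (space_of G)\<close>.
\<close>

definition restrict_module ::
  "('k::field, 'g::ab_group_add) lsuper \<Rightarrow> ('g \<Rightarrow> 'k) \<Rightarrow> (('g list \<Rightarrow>\<^sub>0 'k) set, 'm) module \<Rightarrow>
   (('g list \<Rightarrow>\<^sub>0 'k) set, 'm) module" where
  "restrict_module G chi M =
     M\<lparr>smult := (\<lambda>u x. (u <+>\<^bsub>free_alg (space_of G)\<^esub> red_ideal G chi (space_of G)) \<odot>\<^bsub>M\<^esub> x)\<rparr>"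

end

theory Submission
  imports Defs
begin

text \<open>
  Let \<open>x\<^sub>1, \<dots>, x\<^sub>n\<close> be a homogeneous basis of \<open>m\<close>, with \<open>x\<^sub>i\<close> of degree \<open>-k\<^sub>i\<close>. Since \<open>ad X\<close> is injective in
  negative degrees, there are \<open>y\<^sub>i\<close> of degree \<open>k\<^sub>i - 2\<close> with \<open>chi [x\<^sub>i, y\<^sub>j] = \<delta>\<^sub>i\<^sub>j\<close>. The elements \<open>x\<^sub>i - chi(x\<^sub>i)\<close> of
  \<open>U\<^sub>\<chi>(m)\<close> straighten with corrections of larger weight, so the monomials dividing a top monomial \<open>P\<close>
  span \<open>U\<^sub>\<chi>(m)\<close>, and the elements act nilpotently. Let \<open>W\<close> be the space of vectors of the module that they kill. On the filtration generated
  by \<open>W\<close> under degrees \<open>\<ge> -1\<close> they act as lowering operators, and a commutator computation shows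
  \<open>P y\<^sup>t\<^sup>o\<^sup>p w = c w\<close> with \<open>c \<noteq> 0\<close> for \<open>w \<in> W\<close>. Multiplying by complementary monomials then shows that the vectors
  \<open>y\<^sup>t\<^sup>o\<^sup>p w\<close>, for \<open>w\<close> in a basis of \<open>W\<close>, freely generate the module; the Poincare-Birkhoff-Witt theorem is not needed.

  What remains is that \<open>chi\<close> vanishes outside degree \<open>-2\<close> and that \<open>ad X\<close> is injective in negative degrees.
  For the linear superalgebras the first follows from the invariance of the form under the diagonal tori and
  under \<open>ad X\<close>, the second from the Jordan basis.
\<close>

section \<open>Straightening\<close>

text \<open>The filtration is Kazhdan's: an element of degree \<open>j\<close> counts as
  \<open>j + 2\<close>. Then \<open>y_i\<close> raises by exactly what \<open>x_i\<close> lowers,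
  and brackets of degree at most -2 act by \<open>chi\<close> up to lower terms, so on leading parts
  the \<open>x_i\<close> and \<open>y_i\<close> behave like Weyl and Clifford generators. Hence the
  constant \<open>c\<close>: up to sign it is a product of factorials \<open>(p - 1)!\<close>. The
  identity is exact because the computation ends at index 0, below which the filtration is zero.
  Ordered by weight, the products of complementary monomials form a triangular matrix with nonzero
  diagonal; this yields spanning, and also uniqueness of coefficients, since the monomials span the
  coefficient algebra. The obstacle in the case analysis is the characteristic: weights of the
  grading torus are known only modulo \<open>p\<close>, so it cannot separate degrees congruent to
  -2, and \<open>sl(2)\<close>-theory fails for small \<open>p\<close>. Compatibility of the
  \<open>p\<close>-map with degrees is read off a faithful representation in which it is a genuine
  \<open>p\<close>-th power. For the exceptional superalgebras the required properties of
  \<open>chi\<close> and \<open>ad X\<close> are part of \<open>good_grading\<close>.\<close>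

lemma wt_mset: "sum_list (map (f::_\<Rightarrow>nat) xs) = sum_mset (image_mset f (mset xs))"
  by (simp flip: sum_mset_sum_list)

lemma sum_mset_image_mono:
  fixes f :: "'a \<Rightarrow> nat"
  assumes "A \<subseteq># B"
  shows "sum_mset (image_mset f A) \<le> sum_mset (image_mset f B)"
  by (metis assms image_mset_union le_add1 subset_mset.add_diff_inverse sum_mset.union)

lemma sum_mset_image_strict_mono:
  fixes f :: "'a \<Rightarrow> nat"
  assumes "A \<subseteq># B" "A \<noteq> B" "\<And>x. x \<in># B \<Longrightarrow> f x > 0"
  shows "sum_mset (image_mset f A) < sum_mset (image_mset f B)"
proof -
  obtain C where C: "B = A + C" using assms(1) by (metis subset_mset.add_diff_inverse)
  with assms(2) obtain x where "x \<in># C" by (metis add.right_neutral multiset_nonemptyE)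
  then obtain D where "C = add_mset x D" by (metis insert_DiffM)
  then show ?thesis using C assms(3)[of x] by simp
qed

text \<open>The model is the free algebra before division: \<open>I\<close> is the ideal of
  relations, seen as a subspace stable under the generators \<open>e i\<close>. Every correction in
  \<open>swap\<close> and \<open>pow\<close> is a combination of single letters, so rewriting never
  lengthens a word and strictly raises its weight. \<open>count Top i\<close> is the largest
  exponent allowed for \<open>e i\<close>.\<close>

locale straightening =
  fixes \<sigma> :: "'k::field \<Rightarrow> 'u::ring_1" and I :: "'u set" and n :: nat and e :: "nat \<Rightarrow> 'u"
    and kap :: "nat \<Rightarrow> nat" and sg :: "nat \<Rightarrow> nat \<Rightarrow> 'k" and Top :: "nat multiset"
  assumes \<sigma>_add: "\<sigma> (a + b) = \<sigma> a + \<sigma> b" and \<sigma>_mult: "\<sigma> (a * b) = \<sigma> a * \<sigma> b"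
    and \<sigma>_1: "\<sigma> 1 = 1" and \<sigma>_comm: "\<sigma> a * u = u * \<sigma> a"
    and I_sub: "module.subspace (\<lambda>a u. \<sigma> a * u) I"
    and I_left: "i < n \<Longrightarrow> f \<in> I \<Longrightarrow> e i * f \<in> I" and I_right: "i < n \<Longrightarrow> f \<in> I \<Longrightarrow> f * e i \<in> I"
    and kap_pos: "i < n \<Longrightarrow> kap i > 0" and set_Top: "set_mset Top = {..<n}"
    and sg: "sg i j = 1 \<or> sg i j = - 1"
    and swap: "i < n \<Longrightarrow> j < n \<Longrightarrow> e i * e j - \<sigma> (sg i j) * (e j * e i)
        \<in> module.span (\<lambda>a u. \<sigma> a * u) (I \<union> e ` {l. l < n \<and> kap i + kap j < kap l})"
    and pow: "i < n \<Longrightarrow> e i ^ Suc (count Top i)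
        \<in> module.span (\<lambda>a u. \<sigma> a * u) (I \<union> e ` {l. l < n \<and> Suc (count Top i) * kap i < kap l})"
begin

abbreviation sc :: "'k \<Rightarrow> 'u \<Rightarrow> 'u" where "sc a u \<equiv> \<sigma> a * u"

sublocale V: vector_space sc
  by unfold_locales (simp_all add: \<sigma>_add \<sigma>_mult \<sigma>_1 algebra_simps)

definition P :: "nat list \<Rightarrow> 'u" where "P is = prod_list (map e is)"
definition wt :: "nat list \<Rightarrow> nat" where "wt is = sum_list (map kap is)"
definition wtm :: "nat multiset \<Rightarrow> nat" where "wtm A = sum_mset (image_mset kap A)"

text \<open>The length bound makes rewriting terminate: it bounds the weight from above, while each
  correction raises the weight.\<close>

definition T :: "nat \<Rightarrow> nat \<Rightarrow> 'u set" where
  "T d L = V.span (I \<union> P ` {is. set is \<subseteq> {..<n} \<and> d \<le> wt is \<and> length is \<le> L})"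

lemma P_simps [simp]: "P [] = 1" "P (i # is) = e i * P is" "P (is @ js) = P is * P js"
  by (simp_all add: P_def)

lemma wt_simps [simp]: "wt [] = 0" "wt (i # is) = kap i + wt is" "wt (is @ js) = wt is + wt js"
  by (simp_all add: wt_def)

lemma P_replicate: "P (replicate k i) = e i ^ k"
  by (induction k) auto

lemma wt_replicate: "wt (replicate k i) = k * kap i"
  by (induction k) auto

lemma wt_eq_wtm: "wt is = wtm (mset is)"
  by (simp add: wt_def wtm_def wt_mset)

lemma T_mono: "d' \<le> d \<Longrightarrow> L \<le> L' \<Longrightarrow> T d L \<subseteq> T d' L'"
  unfolding T_def by (rule V.span_mono) auto

lemma sc_left: "x * sc a u = sc a (x * u)"
  by (metis \<sigma>_comm mult.assoc)

lemma T_left: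
  assumes "i < n" "f \<in> T d L"
  shows "e i * f \<in> T (d + kap i) (Suc L)"
  using assms(2) unfolding T_def
proof (induction rule: V.span_induct_alt)
  case base then show ?case by (simp add: V.span_zero)
next
  case (step c x y)
  have "e i * x \<in> I \<union> P ` {is. set is \<subseteq> {..<n} \<and> d + kap i \<le> wt is \<and> length is \<le> Suc L}"
  proof (cases "x \<in> I")
    case True then show ?thesis using I_left assms(1) by auto
  next
    case False
    then obtain "is" where "x = P is" "set is \<subseteq> {..<n}" "d \<le> wt is" "length is \<le> L" using step by auto
    then show ?thesis using assms(1) by (intro UnI2 image_eqI[of _ _ "i # is"]) auto
  qed
  then show ?case using step by (simp add: distrib_left sc_left V.span_add V.span_scale V.span_base)
qed

lemma T_right:
  assumes "i < n" "f \<in> T d L"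
  shows "f * e i \<in> T (d + kap i) (Suc L)"
  using assms(2) unfolding T_def
proof (induction rule: V.span_induct_alt)
  case base then show ?case by (simp add: V.span_zero)
next
  case (step c x y)
  have "x * e i \<in> I \<union> P ` {is. set is \<subseteq> {..<n} \<and> d + kap i \<le> wt is \<and> length is \<le> Suc L}"
  proof (cases "x \<in> I")
    case True then show ?thesis using I_right assms(1) by auto
  next
    case False
    then obtain "is" where "x = P is" "set is \<subseteq> {..<n}" "d \<le> wt is" "length is \<le> L" using step by auto
    then show ?thesis using assms(1) by (intro UnI2 image_eqI[of _ _ "is @ [i]"]) auto
  qed
  then show ?case using step by (simp add: distrib_right mult.assoc V.span_add V.span_scale V.span_base)
qed

lemma T_right_word:
  "set u \<subseteq> {..<n} \<Longrightarrow> f \<in> T d L \<Longrightarrow> f * P u \<in> T (d + wt u) (L + length u)"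
proof (induction u arbitrary: f d L)
  case (Cons i u)
  then have "f * e i * P u \<in> T (d + kap i + wt u) (Suc L + length u)" by (intro Cons.IH T_right) auto
  then show ?case by (simp add: mult.assoc ac_simps)
qed simp

lemma span_letters:
  assumes "f \<in> V.span (I \<union> e ` {l. l < n \<and> d < kap l})"
  shows "f \<in> T (Suc d) (Suc 0)"
proof -
  have "e ` {l. l < n \<and> d < kap l} \<subseteq> P ` {is. set is \<subseteq> {..<n} \<and> Suc d \<le> wt is \<and> length is \<le> Suc 0}"
  proof safe
    fix l assume "l < n" "d < kap l"
    then show "e l \<in> P ` {is. set is \<subseteq> {..<n} \<and> Suc d \<le> wt is \<and> length is \<le> Suc 0}"
      by (intro image_eqI[of _ _ "[l]"]) auto
  qed
  then have "V.span (I \<union> e ` {l. l < n \<and> d < kap l}) \<subseteq> T (Suc d) (Suc 0)"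
    unfolding T_def by (intro V.span_mono) blast
  then show ?thesis using assms by blast
qed

lemma T_sub: "V.subspace (T d L)" unfolding T_def by simp

lemma sign_mult: "\<epsilon> \<in> {1, - 1} \<Longrightarrow> V.subspace S \<Longrightarrow> f \<in> S \<Longrightarrow> \<epsilon> * f \<in> S"
  using V.subspace_neg by auto

lemma sg_cases: "sc (sg i j) u = u \<or> sc (sg i j) u = - u"
  using sg[of i j] \<sigma>_1 \<sigma>_add[of 1 "- 1"] \<sigma>_add[of 0 0]
  by (metis add_cancel_right_right add.right_inverse eq_neg_iff_add_eq_0 mult_1 mult_minus_left add.commute)

text \<open>Exchanging \<open>i\<close> with a smaller \<open>j\<close> costs a sign and, modulo
  \<open>I\<close>, single letters heavier than the two together. The correction is therefore
  heavier than the word and one letter shorter.\<close>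

lemma insort_straighten:
  assumes "i < n" "set js \<subseteq> {..<n}"
  shows "\<exists>\<epsilon>\<in>{1, - 1}. P (i # js) - \<epsilon> * P (insort i js) \<in> T (Suc (kap i + wt js)) (Suc (length js))"
  using assms
proof (induction js)
  case Nil then show ?case by (simp add: V.subspace_0[OF T_sub])
next
  case (Cons j js)
  show ?case
  proof (cases "i \<le> j")
    case True then show ?thesis by (intro bexI[of _ 1]) (simp_all add: V.subspace_0[OF T_sub])
  next
    case False
    have "set js \<subseteq> {..<n}" using Cons.prems by auto
    from Cons.IH[OF Cons.prems(1) this] obtain \<epsilon> where \<epsilon>: "\<epsilon> \<in> {1, - 1}"
      "P (i # js) - \<epsilon> * P (insort i js) \<in> T (Suc (kap i + wt js)) (Suc (length js))" by blast
    have ej: "\<epsilon> = 1 \<or> \<epsilon> = -1" using \<epsilon>(1) by auto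
    have "e j * (P (i # js) - \<epsilon> * P (insort i js)) \<in> T (Suc (kap i + wt js) + kap j) (Suc (Suc (length js)))"
      using Cons.prems \<epsilon>(2) by (intro T_left) auto
    then have 1: "e j * (P (i # js) - \<epsilon> * P (insort i js)) \<in> T (Suc (kap i + wt (j # js))) (Suc (length (j # js)))"
      by (simp add: ac_simps)
    have "(e i * e j - sc (sg i j) (e j * e i)) * P js \<in> T (Suc (kap i + kap j) + wt js) (Suc 0 + length js)"
      using Cons.prems by (intro T_right_word span_letters swap) auto
    then have 2: "(e i * e j - sc (sg i j) (e j * e i)) * P js \<in> T (Suc (kap i + wt (j # js))) (Suc (length (j # js)))"
      using T_mono[of "Suc (kap i + wt (j # js))" "Suc (kap i + kap j) + wt js" "Suc 0 + length js" "Suc (length (j # js))"] by auto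
    \<comment> \<open>The scalar sign \<open>sg i j\<close> is turned into a ring element, so that
      it can be multiplied with \<open>\<epsilon>\<close>.\<close>
    obtain \<delta> :: 'u where \<delta>: "\<delta> = 1 \<or> \<delta> = -1" "sc (sg i j) (e j * e i) = \<delta> * (e j * e i)"
      using sg_cases[of i j "e j * e i"] by (metis mult_1 mult_minus_left)
    have "\<delta> * (e j * (P (i # js) - \<epsilon> * P (insort i js))) \<in> T (Suc (kap i + wt (j # js))) (Suc (length (j # js)))"
      using \<delta>(1) 1 V.subspace_neg[OF T_sub] by auto
    then have "\<delta> * (e j * (P (i # js) - \<epsilon> * P (insort i js))) + (e i * e j - sc (sg i j) (e j * e i)) * P js
       \<in> T (Suc (kap i + wt (j # js))) (Suc (length (j # js)))"
      using 2 V.subspace_add[OF T_sub] by blast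
    also have "\<delta> * (e j * (P (i # js) - \<epsilon> * P (insort i js))) + (e i * e j - sc (sg i j) (e j * e i)) * P js
       = P (i # j # js) - (\<delta> * \<epsilon>) * P (insort i (j # js))"
      using False \<delta> ej unfolding \<delta>(2) by (auto simp: algebra_simps)
    finally show ?thesis using \<delta>(1) \<epsilon>(1) by (intro bexI[of _ "\<delta> * \<epsilon>"]) auto
  qed
qed

lemma sort_straighten:
  assumes "set is \<subseteq> {..<n}"
  shows "\<exists>\<epsilon>\<in>{1, - 1}. P is - \<epsilon> * P (sort is) \<in> T (Suc (wt is)) (length is)"
  using assms
proof (induction "is")
  case Nil then show ?case by (simp add: V.subspace_0[OF T_sub])
next
  case (Cons i "is")
  then have "set is \<subseteq> {..<n}" by auto
  from Cons.IH[OF this] obtain \<epsilon> where \<epsilon>: "\<epsilon> \<in> {1, - 1}" "P is - \<epsilon> * P (sort is) \<in> T (Suc (wt is)) (length is)" by blast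
  have ej: "\<epsilon> = 1 \<or> \<epsilon> = -1" using \<epsilon>(1) by auto
  obtain \<delta> where \<delta>: "\<delta> \<in> {1, - 1}"
    "P (i # sort is) - \<delta> * P (insort i (sort is)) \<in> T (Suc (kap i + wt (sort is))) (Suc (length (sort is)))"
    using insort_straighten[of i "sort is"] Cons.prems by (metis insert_subset lessThan_iff list.simps(15) set_sort)
  have w: "wt (sort is) = wt is" by (simp add: wt_eq_wtm)
  have 1: "e i * (P is - \<epsilon> * P (sort is)) \<in> T (Suc (kap i + wt is)) (Suc (length is))"
    using T_left[OF _ \<epsilon>(2), of i] Cons.prems by (simp add: ac_simps)
  have 2: "\<epsilon> * (P (i # sort is) - \<delta> * P (insort i (sort is))) \<in> T (Suc (kap i + wt is)) (Suc (length is))"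
    using \<delta>(2) \<epsilon>(1) unfolding w length_sort by (intro sign_mult[OF _ T_sub])
  have "e i * (P is - \<epsilon> * P (sort is)) + \<epsilon> * (P (i # sort is) - \<delta> * P (insort i (sort is)))
      \<in> T (Suc (kap i + wt is)) (Suc (length is))"
    using 1 2 V.subspace_add[OF T_sub] by blast
  also have "e i * (P is - \<epsilon> * P (sort is)) + \<epsilon> * (P (i # sort is) - \<delta> * P (insort i (sort is)))
    = P (i # is) - (\<epsilon> * \<delta>) * P (sort (i # is))"
    using ej by (auto simp: algebra_simps)
  finally show ?case using \<delta>(1) \<epsilon>(1) by (intro bexI[of _ "\<epsilon> * \<delta>"]) auto
qed

text \<open>Both words are compared with their common sorted form.\<close>

lemma permute_straighten:
  assumes "set is \<subseteq> {..<n}" "mset is = mset js"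
  shows "\<exists>\<epsilon>\<in>{1, - 1}. P is - \<epsilon> * P js \<in> T (Suc (wt is)) (length is)"
proof -
  obtain \<epsilon> where \<epsilon>: "\<epsilon> \<in> {1, - 1}" "P is - \<epsilon> * P (sort is) \<in> T (Suc (wt is)) (length is)"
    using sort_straighten assms by blast
  obtain \<delta> where \<delta>: "\<delta> \<in> {1, - 1}" "P js - \<delta> * P (sort js) \<in> T (Suc (wt js)) (length js)"
    using sort_straighten[of js] assms by (metis set_mset_mset)
  have eq: "sort js = sort is" "wt js = wt is" "length js = length is"
    using assms(2) by (metis properties_for_sort sorted_sort mset_sort, simp add: wt_eq_wtm, metis size_mset)
  have "(\<epsilon> * \<delta>) * (P js - \<delta> * P (sort js)) \<in> T (Suc (wt is)) (length is)"
    using \<delta> \<epsilon>(1) unfolding eq by (intro sign_mult[OF _ T_sub]) auto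
  then have "(P is - \<epsilon> * P (sort is)) - (\<epsilon> * \<delta>) * (P js - \<delta> * P (sort js)) \<in> T (Suc (wt is)) (length is)"
    using \<epsilon>(2) V.subspace_diff[OF T_sub] by blast
  also have "(P is - \<epsilon> * P (sort is)) - (\<epsilon> * \<delta>) * (P js - \<delta> * P (sort js)) = P is - (\<epsilon> * \<delta>) * P js"
    using \<delta>(1) \<epsilon>(1) unfolding eq by (auto simp: algebra_simps)
  finally show ?thesis using \<delta>(1) \<epsilon>(1) by (intro bexI[of _ "\<epsilon> * \<delta>"]) auto
qed

text \<open>A word that does not divide \<open>Top\<close> repeats some letter too often. Up to sign
  and heavier terms the copies can be moved to the front, where \<open>pow\<close> replaces the
  power by heavier single letters.\<close>

lemma overflow_straighten:
  assumes "set is \<subseteq> {..<n}" "\<not> mset is \<subseteq># Top"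
  shows "P is \<in> T (Suc (wt is)) (length is)"
proof -
  obtain i where i: "count (mset is) i > count Top i"
    using assms(2) by (meson mset_subset_eqI not_less)
  then have "i \<in> set is" by (metis count_eq_zero_iff gr_implies_not0 set_mset_mset)
  then have "i < n" using assms(1) by auto
  define v where "v = sorted_list_of_multiset (mset is - replicate_mset (Suc (count Top i)) i)"
  have "replicate_mset (Suc (count Top i)) i \<subseteq># mset is" 
    using i by (metis Suc_leI count_le_replicate_mset_subset_eq)
  then have m: "mset is = mset (replicate (Suc (count Top i)) i @ v)"
    unfolding v_def by (simp only: mset_append mset_replicate mset_sorted_list_of_multiset subset_mset.add_diff_inverse)
  then have sv: "set v \<subseteq> {..<n}" and len: "length is = Suc (count Top i) + length v"
    using assms(1) mset_eq_setD[OF m] mset_eq_length[OF m] by auto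
  have wt: "wt is = Suc (count Top i) * kap i + wt v"
    unfolding wt_eq_wtm[of "is"] m unfolding wt_eq_wtm[symmetric] by (simp only: wt_simps wt_replicate)
  have "e i ^ Suc (count Top i) * P v \<in> T (Suc (Suc (count Top i) * kap i) + wt v) (Suc 0 + length v)"
    using \<open>i < n\<close> sv by (intro T_right_word span_letters pow)
  also have "\<dots> \<subseteq> T (Suc (wt is)) (length is)" unfolding wt len by (rule T_mono) auto
  also have "e i ^ Suc (count Top i) * P v = P (replicate (Suc (count Top i)) i @ v)"
    by (simp only: P_simps P_replicate)
  finally have 1: "P (replicate (Suc (count Top i)) i @ v) \<in> T (Suc (wt is)) (length is)" .
  obtain \<epsilon> where "\<epsilon> \<in> {1, - 1}" "P is - \<epsilon> * P (replicate (Suc (count Top i)) i @ v) \<in> T (Suc (wt is)) (length is)"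
    using permute_straighten[OF assms(1) m] by blast
  moreover from this 1 have "\<epsilon> * P (replicate (Suc (count Top i)) i @ v) \<in> T (Suc (wt is)) (length is)"
    using V.subspace_neg[OF T_sub] by (elim insertE) (simp_all del: P_simps replicate_Suc)
  ultimately have "(P is - \<epsilon> * P (replicate (Suc (count Top i)) i @ v)) + \<epsilon> * P (replicate (Suc (count Top i)) i @ v) \<in> T (Suc (wt is)) (length is)"
    by (intro V.subspace_add[OF T_sub])
  then show ?thesis by simp
qed

definition good :: "nat \<Rightarrow> 'u set" where
  "good d = V.span (I \<union> {P (sorted_list_of_multiset A) | A. A \<subseteq># Top \<and> d \<le> wtm A})"

lemma good_mono: "d' \<le> d \<Longrightarrow> good d \<subseteq> good d'"
  unfolding good_def by (rule V.span_mono) auto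

lemma good_sub: "V.subspace (good d)" unfolding good_def by simp

text \<open>Induction on the distance of the weight from \<open>L * K\<close>, an upper bound for
  the weight of all words of length at most \<open>L\<close>. Each rewriting leaves only strictly
  heavier words of no greater length.\<close>

lemma word_good:
  assumes "set is \<subseteq> {..<n}"
  shows "P is \<in> good (wt is)"
proof -
  define K where "K = Max (insert 0 (kap ` {..<n}))"
  have K: "wt js \<le> length js * K" if "set js \<subseteq> {..<n}" for js
    using that
  proof (induction js)
    case (Cons j js)
    then have "kap j \<le> K" unfolding K_def by (intro Max_ge) auto
    then show ?case using Cons by auto
  qed auto
  define L where "L = length is"
  have "set js \<subseteq> {..<n} \<Longrightarrow> length js \<le> L \<Longrightarrow> P js \<in> good (wt js)" for js
  proof (induction "L * K - wt js" arbitrary: js rule: less_induct)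
    case less
    \<comment> \<open>By the induction hypothesis every error term produced by rewriting
      \<open>js\<close> is already in normal form.\<close>
    have TG: "T (Suc (wt js)) (length js) \<subseteq> good (wt js)"
      unfolding T_def
    proof (rule V.span_minimal[OF _ good_sub], safe)
      fix f assume "f \<in> I" then show "f \<in> good (wt js)" unfolding good_def by (auto intro: V.span_base)
    next
      fix ks assume ks: "set ks \<subseteq> {..<n}" "Suc (wt js) \<le> wt ks" "length ks \<le> length js"
      have "wt ks \<le> L * K" using K[OF ks(1)] ks(3) less.prems(2) by (meson le_trans mult_le_mono1)
      then have "P ks \<in> good (wt ks)" using ks less.prems by (intro less.hyps) auto
      then show "P ks \<in> good (wt js)" using good_mono[of "wt js" "wt ks"] ks(2) by auto
    qed
    show ?case
    proof (cases "mset js \<subseteq># Top")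
      case False
      then show ?thesis using TG overflow_straighten less.prems by blast
    next
      case True
      have "P (sorted_list_of_multiset (mset js)) \<in> good (wt js)"
        unfolding good_def using True by (intro V.span_base UnI2 CollectI exI[of _ "mset js"]) (simp only: wt_eq_wtm order_refl simp_thms)
      moreover obtain \<epsilon> where "\<epsilon> \<in> {1, - 1}" "P js - \<epsilon> * P (sorted_list_of_multiset (mset js)) \<in> T (Suc (wt js)) (length js)"
        using permute_straighten[OF less.prems(1), of "sorted_list_of_multiset (mset js)"] by (metis mset_sorted_list_of_multiset)
      ultimately have "(P js - \<epsilon> * P (sorted_list_of_multiset (mset js))) + \<epsilon> * P (sorted_list_of_multiset (mset js)) \<in> good (wt js)"
        using TG by (intro V.subspace_add[OF good_sub] sign_mult[OF _ good_sub]) auto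
      then show ?thesis by simp
    qed
  qed
  then show ?thesis using assms by (simp add: L_def)
qed

lemma T_good: "T d L \<subseteq> good d"
  unfolding T_def
proof (rule V.span_minimal[OF _ good_sub], safe)
  fix f assume "f \<in> I" then show "f \<in> good d" unfolding good_def by (auto intro: V.span_base)
next
  fix ks assume "set ks \<subseteq> {..<n}" "d \<le> wt ks"
  then show "P ks \<in> good d" using word_good good_mono by blast
qed

text \<open>A divisor of \<open>Top\<close> weighs at most as much as \<open>Top\<close>. This is
  the source of nilpotency: long products of generators fall into \<open>I\<close>.\<close>

lemma good_overweight:
  assumes "d > wtm Top"
  shows "good d = I"
proof -
  have "{P (sorted_list_of_multiset A) | A. A \<subseteq># Top \<and> d \<le> wtm A} = {}"
    using assms sum_mset_image_mono[of _ Top kap] unfolding wtm_def by force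
  then have "good d = V.span I" unfolding good_def by (simp only: Un_empty_right)
  then show ?thesis using I_sub by (simp only: V.span_eq_iff)
qed

lemma overweight_word: "set is \<subseteq> {..<n} \<Longrightarrow> wt is > wtm Top \<Longrightarrow> P is \<in> I"
  using word_good good_overweight by blast

text \<open>All letters have positive weight, so a proper divisor of \<open>Top\<close> is lighter
  than \<open>Top\<close>. The word therefore overflows and is pushed beyond the top weight.\<close>

lemma top_word_other:
  assumes "set is \<subseteq> {..<n}" "wt is = wtm Top" "mset is \<noteq> Top"
  shows "P is \<in> I"
proof -
  have "\<not> mset is \<subseteq># Top"
    using sum_mset_image_strict_mono[of "mset is" Top kap] assms kap_pos set_Top
    unfolding wt_eq_wtm wtm_def by fastforce
  then have "P is \<in> T (Suc (wtm Top)) (length is)" using overflow_straighten assms by metis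
  then show ?thesis using T_good good_overweight[of "Suc (wtm Top)"] by blast
qed

text \<open>At the top weight every error falls into \<open>I\<close>, so reordering costs a sign
  and nothing else.\<close>

lemma top_word:
  assumes "mset is = Top"
  shows "\<exists>\<epsilon>\<in>{1, - 1}. P is - \<epsilon> * P (sorted_list_of_multiset Top) \<in> I"
proof -
  have "set is \<subseteq> {..<n}" using assms set_Top by (metis order_refl set_mset_mset)
  then obtain \<epsilon> where "\<epsilon> \<in> {1, - 1}" "P is - \<epsilon> * P (sorted_list_of_multiset Top) \<in> T (Suc (wt is)) (length is)"
    using permute_straighten[of "is" "sorted_list_of_multiset Top"] assms by (metis mset_sorted_list_of_multiset)
  then show ?thesis using T_good[of "Suc (wt is)"] good_overweight[of "Suc (wtm Top)"] assms
    by (metis lessI subsetD wt_eq_wtm)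
qed

end

section \<open>Whittaker vectors\<close>

text \<open>\<open>x\<close> and \<open>y\<close> are dual for the pairing given by
  \<open>chi\<close> and the bracket, and the indices are sorted by depth \<open>kk\<close>; this
  order makes the commutator computation triangular. The module is a subspace \<open>V0\<close> of
  an ambient space, because a module on a record carrier is later embedded into such a
  space.\<close>

locale whittaker = V: vector_space sv
  for sv :: "'k::field \<Rightarrow> 'v::ab_group_add \<Rightarrow> 'v" +
  fixes part :: "bool \<Rightarrow> 'g set" and br :: "'g \<Rightarrow> 'g \<Rightarrow> 'g" and gr :: "int \<Rightarrow> 'g set" and chi :: "'g \<Rightarrow> 'k"
    and V0 :: "'v set" and \<rho> :: "'g \<Rightarrow> 'v \<Rightarrow> 'v"
    and n :: nat and x y :: "nat \<Rightarrow> 'g" and kk :: "nat \<Rightarrow> nat" and pp :: "nat \<Rightarrow> bool" and p :: nat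
  assumes p: "p = CHAR('k)" and V0: "V.subspace V0"
    and br_gr: "z \<in> gr l \<Longrightarrow> z' \<in> gr l' \<Longrightarrow> br z z' \<in> gr (l + l')"
    and br_part: "z \<in> part a \<Longrightarrow> z' \<in> part b \<Longrightarrow> br z z' \<in> part (a \<noteq> b)"
    and chi_odd: "z \<in> part True \<Longrightarrow> chi z = 0"
    and chi_gr: "z \<in> gr l \<Longrightarrow> l \<noteq> -2 \<Longrightarrow> chi z = 0"
    and \<rho>_V0: "z \<in> part a \<Longrightarrow> v \<in> V0 \<Longrightarrow> \<rho> z v \<in> V0"
    and \<rho>_add: "z \<in> part a \<Longrightarrow> v \<in> V0 \<Longrightarrow> v' \<in> V0 \<Longrightarrow> \<rho> z (v + v') = \<rho> z v + \<rho> z v'"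
    and \<rho>_scale: "z \<in> part a \<Longrightarrow> v \<in> V0 \<Longrightarrow> \<rho> z (sv c v) = sv c (\<rho> z v)"
    and \<rho>_br: "z \<in> part a \<Longrightarrow> z' \<in> part b \<Longrightarrow> v \<in> V0 \<Longrightarrow>
        \<rho> z (\<rho> z' v) = sv (ksign a b) (\<rho> z' (\<rho> z v)) + \<rho> (br z z') v"
    and x: "i < n \<Longrightarrow> x i \<in> gr (- int (kk i))" "i < n \<Longrightarrow> x i \<in> part (pp i)" "i < n \<Longrightarrow> kk i > 0"
    and y: "i < n \<Longrightarrow> y i \<in> gr (int (kk i) - 2)" "i < n \<Longrightarrow> y i \<in> part (pp i)"
    and dual: "i < n \<Longrightarrow> j < n \<Longrightarrow> chi (br (x i) (y j)) = (if i = j then 1 else 0)"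
    and kk_mono: "i \<le> j \<Longrightarrow> j < n \<Longrightarrow> kk i \<le> kk j"
begin

definition bar :: "'g \<Rightarrow> 'v \<Rightarrow> 'v" where "bar z v = \<rho> z v - sv (chi z) v"

definition neg :: "int \<Rightarrow> 'g \<Rightarrow> bool" where
  "neg k z \<longleftrightarrow> z \<in> gr (- k) \<and> (\<exists>a. z \<in> part a) \<and> (k \<ge> 2 \<or> k = 1 \<and> z \<in> x ` {..<n})"

definition W :: "'v set" where "W = {w \<in> V0. \<forall>k z. neg k z \<longrightarrow> bar z w = 0}"

text \<open>The Kazhdan filtration generated by \<open>W\<close>. With degrees at least -1 each
  application raises the index by at least one, which is why all negative steps vanish.\<close>

inductive Fp :: "int \<Rightarrow> 'v \<Rightarrow> bool" where
  zero: "Fp d 0"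
| W: "w \<in> W \<Longrightarrow> 0 \<le> d \<Longrightarrow> Fp d w"
| add: "Fp d u \<Longrightarrow> Fp d u' \<Longrightarrow> Fp d (u + u')"
| scale: "Fp d u \<Longrightarrow> Fp d (sv c u)"
| act: "z \<in> gr j \<Longrightarrow> z \<in> part a \<Longrightarrow> -1 \<le> j \<Longrightarrow> Fp d' u \<Longrightarrow> d' + j + 2 \<le> d \<Longrightarrow> Fp d (\<rho> z u)"

definition F :: "int \<Rightarrow> 'v set" where "F d = {u. Fp d u}"

lemma Fp_iff: "Fp d u \<longleftrightarrow> u \<in> F d" by (simp add: F_def)

lemmas F_zero = Fp.zero[unfolded Fp_iff]
lemmas F_W = Fp.W[unfolded Fp_iff]
lemmas F_add = Fp.add[unfolded Fp_iff]
lemmas F_scale = Fp.scale[unfolded Fp_iff]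
lemmas F_act = Fp.act[unfolded Fp_iff]
lemmas F_induct = Fp.induct[unfolded Fp_iff, consumes 1, case_names zero W add scale act]

lemma V0_simps: "0 \<in> V0" "v \<in> V0 \<Longrightarrow> v' \<in> V0 \<Longrightarrow> v + v' \<in> V0" "v \<in> V0 \<Longrightarrow> sv c v \<in> V0"
  "v \<in> V0 \<Longrightarrow> v' \<in> V0 \<Longrightarrow> v - v' \<in> V0"
  using V0 by (auto intro: V.subspace_0 V.subspace_add V.subspace_scale V.subspace_diff)

lemma \<rho>_0: "z \<in> part a \<Longrightarrow> \<rho> z 0 = 0"
  using \<rho>_scale[of z a 0 0] V0_simps by simp

lemma \<rho>_diff: "z \<in> part a \<Longrightarrow> v \<in> V0 \<Longrightarrow> v' \<in> V0 \<Longrightarrow> \<rho> z (v - v') = \<rho> z v - \<rho> z v'"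
  using \<rho>_add[of z a v "sv (-1) v'"] \<rho>_scale[of z a v' "-1"] V0_simps(3)[of v' "-1"] by simp

lemma F_V0: "u \<in> F d \<Longrightarrow> u \<in> V0"
  by (induction rule: F_induct) (simp_all add: V0_simps W_def \<rho>_V0)

lemma F_mono: "u \<in> F d \<Longrightarrow> d \<le> d' \<Longrightarrow> u \<in> F d'"
proof (induction arbitrary: d' rule: F_induct)
  case (act z j a d1 u d)
  then show ?case by (intro F_act[of z j a u d1]) auto
qed (simp_all add: F_zero F_W F_add F_scale)

lemma F_neg: "u \<in> F d \<Longrightarrow> d < 0 \<Longrightarrow> u = 0"
  by (induction rule: F_induct) (auto simp: \<rho>_0)

lemma bar_add: "z \<in> part a \<Longrightarrow> v \<in> V0 \<Longrightarrow> v' \<in> V0 \<Longrightarrow> bar z (v + v') = bar z v + bar z v'"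
  by (simp add: bar_def \<rho>_add V.scale_right_distrib)

lemma bar_scale: "z \<in> part a \<Longrightarrow> v \<in> V0 \<Longrightarrow> bar z (sv c v) = sv c (bar z v)"
  by (simp add: bar_def \<rho>_scale V.scale_right_diff_distrib V.scale_left_commute)

lemma bar_0: "z \<in> part a \<Longrightarrow> bar z 0 = 0"
  by (simp add: bar_def \<rho>_0)

lemma W_sub: "V.subspace W"
proof (rule V.subspaceI)
  show "0 \<in> W" unfolding W_def neg_def using bar_0 V0_simps(1) by blast
next
  fix u v assume uv: "u \<in> W" "v \<in> W"
  have "bar z (u + v) = 0" if "neg k z" for k z
  proof -
    obtain a where "z \<in> part a" using \<open>neg k z\<close> unfolding neg_def by auto
    then show ?thesis using uv that bar_add[of z a u v] unfolding W_def by auto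
  qed
  then show "u + v \<in> W" using uv V0_simps(2) unfolding W_def by blast
next
  fix c v assume v: "v \<in> W"
  have "bar z (sv c v) = 0" if "neg k z" for k z
  proof -
    obtain a where "z \<in> part a" using \<open>neg k z\<close> unfolding neg_def by auto
    then show ?thesis using v that bar_scale[of z a v c] unfolding W_def by auto
  qed
  then show "sv c v \<in> W" using v V0_simps(3) unfolding W_def by blast
qed

lemma bar_V0: "z \<in> part a \<Longrightarrow> v \<in> V0 \<Longrightarrow> bar z v \<in> V0"
  by (auto simp add: bar_def intro: V0_simps \<rho>_V0)

text \<open>Subtracting \<open>chi z\<close> does not disturb the commutation rule: when the sign is
  -1 both elements are odd and \<open>chi z\<close> vanishes, otherwise the scalar cancels on both
  sides.\<close>

lemma bar_\<rho>:
  assumes "z \<in> part a" "z' \<in> part b" "v \<in> V0"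
  shows "bar z (\<rho> z' v) = sv (ksign a b) (\<rho> z' (bar z v)) + \<rho> (br z z') v"
proof (cases "a \<and> b")
  case True
  then have "chi z = 0" using chi_odd assms by simp
  then show ?thesis using \<rho>_br[OF assms] by (simp add: bar_def)
next
  case False
  then have "ksign a b = (1::'k)" by (auto simp: ksign_def)
  moreover have "\<rho> z' (bar z v) = \<rho> z' (\<rho> z v) - sv (chi z) (\<rho> z' v)"
    unfolding bar_def using assms by (simp add: \<rho>_diff[OF assms(2)] \<rho>_scale[OF assms(2)] \<rho>_V0 V0_simps)
  ultimately show ?thesis using \<rho>_br[OF assms] by (simp add: bar_def)
qed

text \<open>The commutator with an acting \<open>z'\<close> has degree \<open>j - k\<close>. At -1
  or above it is again a raising operator of the right index; below, it is a lowering operator, and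
  the induction hypothesis applies to \<open>u\<close> itself.\<close>

lemma bar_F: "u \<in> F d \<Longrightarrow> neg k z \<Longrightarrow> bar z u \<in> F (d - k)"
proof (induction arbitrary: k z rule: F_induct)
  case (zero d)
  then show ?case unfolding neg_def using bar_0 F_zero by metis
next
  case (W w d)
  then show ?case unfolding W_def using F_zero by auto
next
  case (add d u u')
  then obtain a where "z \<in> part a" unfolding neg_def by auto
  then show ?case using add F_V0 bar_add[of z a u u'] by (simp add: F_add)
next
  case (scale d u c)
  then obtain a where "z \<in> part a" unfolding neg_def by auto
  then show ?case using scale F_V0 bar_scale[of z a u] by (simp add: F_scale)
next
  case (act z' j b d' u d)
  from act.prems obtain a where z: "z \<in> part a" "z \<in> gr (- k)" "k \<ge> 1" unfolding neg_def by auto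
  have u: "u \<in> V0" using act F_V0 by auto
  have 1: "\<rho> z' (bar z u) \<in> F (d - k)"
    using act.hyps act.IH[OF act.prems] by (intro F_act[of z' j b _ "d' - k"]) auto
  have t: "br z z' \<in> gr (j - k)" "br z z' \<in> part (a \<noteq> b)"
    using br_gr[OF z(2) act.hyps(1)] br_part[OF z(1) act.hyps(2)] by auto
  have 2: "\<rho> (br z z') u \<in> F (d - k)"
  proof (cases "j - k \<ge> -1")
    case True
    show ?thesis using act.hyps by (intro F_act[OF t True, of u d']) auto
  next
    case False
    then have "neg (k - j) (br z z')" using t unfolding neg_def by auto
    then have "bar (br z z') u \<in> F (d' - (k - j))" by (rule act.IH)
    then have b: "bar (br z z') u \<in> F (d - k)" by (rule F_mono) (use act.hyps in simp)
    \<comment> \<open>The scalar survives only in degree -2, that is for \<open>j = k - 2\<close>;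
      then \<open>d' + k \<le> d\<close> keeps \<open>u\<close> within the bound.\<close>
    have "sv (chi (br z z')) u \<in> F (d - k)"
    proof (cases "chi (br z z') = 0")
      case True then show ?thesis using F_zero by simp
    next
      case False
      then have "j - k = -2" using chi_gr[OF t(1)] by auto
      then have "u \<in> F (d - k)" using F_mono[OF act.hyps(4)] act.hyps(5) by simp
      then show ?thesis by (rule F_scale)
    qed
    with b have "bar (br z z') u + sv (chi (br z z')) u \<in> F (d - k)" by (rule F_add)
    then show ?thesis by (simp add: bar_def)
  qed
  show ?case unfolding bar_\<rho>[OF z(1) act.hyps(2) u] using 1 2 by (intro F_add F_scale)
qed

lemma neg_x: "i < n \<Longrightarrow> neg (int (kk i)) (x i)"
  unfolding neg_def using x(1)[of i] x(2)[of i] x(3)[of i]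
  by (intro conjI exI[of _ "pp i"]; cases "kk i = 1"; simp)

lemma y_F: "u \<in> F d \<Longrightarrow> i < n \<Longrightarrow> \<rho> (y i) u \<in> F (d + int (kk i))"
  using x(3)[of i] y(1,2)[of i] by (intro F_act[where j = "int (kk i) - 2" and a = "pp i" and d' = d]) simp_all

text \<open>With \<open>kk j \<le> kk i\<close> the bracket has degree at most -2, so apart from its
  value under \<open>chi\<close>, a Kronecker delta, it is a lowering operator. The subtracted 1 is
  the gain over the bound expected from the degrees alone.\<close>

lemma xy_lower:
  assumes "i < n" "j < n" "kk j \<le> kk i" "u \<in> F d"
  shows "\<rho> (br (x i) (y j)) u - sv (if i = j then 1 else 0) u \<in> F (d + int (kk j) - int (kk i) - 1)"
proof -
  have "br (x i) (y j) \<in> gr (- int (kk i) + (int (kk j) - 2))" "br (x i) (y j) \<in> part (pp i \<noteq> pp j)"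
    by (rule br_gr[OF x(1)[OF assms(1)] y(1)[OF assms(2)]], rule br_part[OF x(2)[OF assms(1)] y(2)[OF assms(2)]])
  then have "neg (int (kk i) - int (kk j) + 2) (br (x i) (y j))"
    unfolding neg_def using assms(3) by (auto simp: algebra_simps)
  then have "bar (br (x i) (y j)) u \<in> F (d - (int (kk i) - int (kk j) + 2))" by (rule bar_F[OF assms(4)])
  then have "bar (br (x i) (y j)) u \<in> F (d + int (kk j) - int (kk i) - 1)" by (rule F_mono) simp
  then show ?thesis by (simp add: bar_def dual[OF assms(1,2)])
qed

definition top :: "nat \<Rightarrow> nat" where "top i = (if pp i then 1 else p - 1)"

fun Y :: "nat \<Rightarrow> 'v \<Rightarrow> 'v" where
  "Y 0 w = w"
| "Y (Suc i) w = (\<rho> (y i) ^^ top i) (Y i w)"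

text \<open>\<open>X\<close> applies the generator of the last index first, so that it meets the
  dual generator that \<open>Y\<close> applied last.\<close>

fun X :: "nat \<Rightarrow> 'v \<Rightarrow> 'v" where
  "X 0 v = v"
| "X (Suc i) v = X i ((bar (x i) ^^ top i) v)"

text \<open>The filtration index reached by \<open>Y i w\<close>, and equally the amount by which
  the matching powers of the \<open>x j\<close> lower it.\<close>

fun D :: "nat \<Rightarrow> int" where
  "D 0 = 0"
| "D (Suc i) = D i + int (top i) * int (kk i)"

lemma y_pow_F: "u \<in> F d \<Longrightarrow> i < n \<Longrightarrow> (\<rho> (y i) ^^ a) u \<in> F (d + int a * int (kk i))"
proof (induction a)
  case (Suc a)
  have "d + int a * int (kk i) + int (kk i) = d + int (Suc a) * int (kk i)" by (simp add: distrib_right)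
  then show ?case using y_F[OF Suc.IH[OF Suc.prems] Suc.prems(2)] by (simp only: funpow.simps o_apply)
qed simp

lemma Y_F: "w \<in> W \<Longrightarrow> i \<le> n \<Longrightarrow> Y i w \<in> F (D i)"
proof (induction i)
  case (Suc i)
  then show ?case using y_pow_F[of "Y i w" "D i" i "top i"] by simp
qed (simp add: F_W)

lemma x_pow_F: "u \<in> F d \<Longrightarrow> i < n \<Longrightarrow> (bar (x i) ^^ a) u \<in> F (d - int a * int (kk i))"
proof (induction a)
  case (Suc a)
  have "d - int a * int (kk i) - int (kk i) = d - int (Suc a) * int (kk i)" by (simp add: distrib_right)
  then show ?case using bar_F[OF Suc.IH[OF Suc.prems] neg_x[OF Suc.prems(2)]] by (simp only: funpow.simps o_apply)
qed simp

text \<open>The hypothesis on \<open>bar (x i) u\<close> says that \<open>x i\<close> lowers by one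
  more than its degree forces, so it acts as zero on the leading part of \<open>u\<close>. This
  survives the action of a dual generator of another index that is no deeper.\<close>

lemma x_lower_step:
  assumes "i < n" "j < n" "kk j \<le> kk i" "i \<noteq> j" "u \<in> F d" "bar (x i) u \<in> F (d - int (kk i) - 1)"
  shows "bar (x i) (\<rho> (y j) u) \<in> F (d + int (kk j) - int (kk i) - 1)"
proof -
  have "\<rho> (y j) (bar (x i) u) \<in> F (d + int (kk j) - int (kk i) - 1)"
    by (rule F_mono[OF y_F[OF assms(6,2)]]) simp
  moreover have "\<rho> (br (x i) (y j)) u \<in> F (d + int (kk j) - int (kk i) - 1)"
    using xy_lower[OF assms(1,2,3,5)] assms(4) by simp
  ultimately show ?thesis
    unfolding bar_\<rho>[OF x(2)[OF assms(1)] y(2)[OF assms(2)] F_V0[OF assms(5)]] by (rule F_add[OF F_scale])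
qed

lemma x_lower_pow:
  assumes "i < n" "j < n" "kk j \<le> kk i" "i \<noteq> j" "u \<in> F d" "bar (x i) u \<in> F (d - int (kk i) - 1)"
  shows "bar (x i) ((\<rho> (y j) ^^ a) u) \<in> F (d + int a * int (kk j) - int (kk i) - 1)"
proof (induction a)
  case (Suc a)
  have "d + int a * int (kk j) + int (kk j) = d + int (Suc a) * int (kk j)" by (simp add: distrib_right)
  then show ?case using x_lower_step[OF assms(1-4) y_pow_F[OF assms(5,2)] Suc.IH] by (simp only: funpow.simps o_apply)
qed (use assms in simp)

text \<open>Starts from \<open>bar (x l) w = 0\<close> and passes the dual generators of smaller
  index one after another; sorting by depth provides the inequality that each passage
  requires.\<close>

lemma x_lower_Y:
  assumes "w \<in> W" "i \<le> l" "l < n"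
  shows "bar (x l) (Y i w) \<in> F (D i - int (kk l) - 1)"
  using assms(2)
proof (induction i)
  case 0
  have "bar (x l) w = 0" using assms(1) neg_x[OF assms(3)] unfolding W_def by blast
  then show ?case by (simp add: F_zero)
next
  case (Suc i)
  then show ?case using x_lower_pow[of l i "Y i w" "D i" "top i"] assms kk_mono[of i l] Y_F by simp
qed

lemma x_y_pow:
  assumes "i < n" "u \<in> F d" "bar (x i) u \<in> F (d - int (kk i) - 1)" "a = 0 \<or> \<not> pp i"
  shows "bar (x i) ((\<rho> (y i) ^^ Suc a) u) - sv (of_nat (Suc a)) ((\<rho> (y i) ^^ a) u) \<in> F (d + int a * int (kk i) - 1)"
  using assms(4)
proof (induction a)
  case 0
  have "\<rho> (y i) (bar (x i) u) \<in> F (d - 1)"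
    by (rule F_mono[OF y_F[OF assms(3,1)]]) simp
  moreover have "\<rho> (br (x i) (y i)) u - u \<in> F (d - 1)"
    using xy_lower[OF assms(1,1) order_refl assms(2)] by simp
  ultimately have "sv (ksign (pp i) (pp i)) (\<rho> (y i) (bar (x i) u)) + (\<rho> (br (x i) (y i)) u - u) \<in> F (d - 1)"
    by (rule F_add[OF F_scale])
  moreover have "bar (x i) (\<rho> (y i) u) - u = sv (ksign (pp i) (pp i)) (\<rho> (y i) (bar (x i) u)) + (\<rho> (br (x i) (y i)) u - u)"
    unfolding bar_\<rho>[OF x(2)[OF assms(1)] y(2)[OF assms(1)] F_V0[OF assms(2)]] by (rule add_diff_eq[symmetric])
  ultimately have "bar (x i) (\<rho> (y i) u) - u \<in> F (d - 1)" by (simp only:)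
  then show ?case by simp
next
  case (Suc a)
  then have np: "\<not> pp i" by simp
  define v where "v = (\<rho> (y i) ^^ a) u"
  define v' where "v' = \<rho> (y i) v"
  define r where "r = bar (x i) v' - sv (of_nat (Suc a)) v"
  have v: "v \<in> F (d + int a * int (kk i))" unfolding v_def by (rule y_pow_F[OF assms(2,1)])
  have v': "v' \<in> F (d + int (Suc a) * int (kk i))" 
    unfolding v'_def using y_F[OF v assms(1)] by (simp add: algebra_simps)
  have r: "r \<in> F (d + int a * int (kk i) - 1)" using Suc.IH np unfolding v_def r_def v'_def by simp
  have yp: "y i \<in> part (pp i)" using y assms(1) by auto
  have 1: "\<rho> (y i) r \<in> F (d + int (Suc a) * int (kk i) - 1)"
    using y_F[OF r assms(1)] by (simp add: algebra_simps)
  have 2: "\<rho> (br (x i) (y i)) v' - v' \<in> F (d + int (Suc a) * int (kk i) - 1)"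
    using xy_lower[OF assms(1,1) order_refl v'] by simp
  have "\<rho> (y i) (bar (x i) v') = \<rho> (y i) (r + sv (of_nat (Suc a)) v)" by (simp add: r_def)
  also have "\<dots> = \<rho> (y i) r + sv (of_nat (Suc a)) v'"
    using \<rho>_add[OF yp F_V0[OF r]] \<rho>_scale[OF yp F_V0[OF v]] F_V0[OF v] V0_simps by (simp add: v'_def)
  finally have 3: "\<rho> (y i) (bar (x i) v') = \<rho> (y i) r + sv (of_nat (Suc a)) v'" .
  have "of_nat (Suc (Suc a)) = of_nat (Suc a) + (1::'k)" by simp
  then have 4: "sv (of_nat (Suc (Suc a))) v' = sv (of_nat (Suc a)) v' + v'"
    by (simp only: V.scale_left_distrib V.scale_one)
  have "bar (x i) (\<rho> (y i) v') - sv (of_nat (Suc (Suc a))) v' = \<rho> (y i) r + (\<rho> (br (x i) (y i)) v' - v')"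
    unfolding bar_\<rho>[OF x(2)[OF assms(1)] y(2)[OF assms(1)] F_V0[OF v']] 3 4
    using np by (simp add: ksign_def)
  also have "\<dots> \<in> F (d + int (Suc a) * int (kk i) - 1)" using 1 2 by (rule F_add)
  finally show ?case unfolding v'_def v_def by simp
qed

text \<open>Iterating the Weyl relation yields the factorial; the remaining powers of
  \<open>x i\<close> carry each error term down to index \<open>d - 1\<close>.\<close>

lemma x_pow_y_pow:
  assumes "i < n" "u \<in> F d" "bar (x i) u \<in> F (d - int (kk i) - 1)" "a \<le> 1 \<or> \<not> pp i"
  shows "(bar (x i) ^^ a) ((\<rho> (y i) ^^ a) u) - sv (of_nat (fact a)) u \<in> F (d - 1)"
  using assms(4)
proof (induction a)
  case 0 then show ?case by (simp add: F_zero)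
next
  case (Suc a)
  have xp: "x i \<in> part (pp i)" using x assms by auto
  have lin: "(bar (x i) ^^ b) (v + v') = (bar (x i) ^^ b) v + (bar (x i) ^^ b) v' \<and>
       (bar (x i) ^^ b) (sv c v) = sv c ((bar (x i) ^^ b) v) \<and> (bar (x i) ^^ b) v \<in> V0 \<and> (bar (x i) ^^ b) v' \<in> V0" 
    if "v \<in> V0" "v' \<in> V0" for b v v' c
    using that by (induction b) (auto simp: bar_add[OF xp] bar_scale[OF xp] bar_V0[OF xp])
  define v where "v = (\<rho> (y i) ^^ a) u"
  define r where "r = bar (x i) ((\<rho> (y i) ^^ Suc a) u) - sv (of_nat (Suc a)) v"
  have v: "v \<in> V0" unfolding v_def using F_V0 y_pow_F assms by blast
  have r: "r \<in> F (d + int a * int (kk i) - 1)"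
    unfolding r_def v_def using Suc.prems by (intro x_y_pow assms) auto
  have "(bar (x i) ^^ Suc a) ((\<rho> (y i) ^^ Suc a) u) = (bar (x i) ^^ a) (r + sv (of_nat (Suc a)) v)"
    by (simp add: r_def funpow_Suc_right del: funpow.simps)
  also have "\<dots> = (bar (x i) ^^ a) r + sv (of_nat (Suc a)) ((bar (x i) ^^ a) v)"
    using lin F_V0[OF r] v V0_simps by metis
  finally have "(bar (x i) ^^ Suc a) ((\<rho> (y i) ^^ Suc a) u) - sv (of_nat (fact (Suc a))) u
     = (bar (x i) ^^ a) r + sv (of_nat (Suc a)) ((bar (x i) ^^ a) v - sv (of_nat (fact a)) u)"
    by (simp add: V.scale_right_diff_distrib distrib_right)
  moreover have "(bar (x i) ^^ a) v - sv (of_nat (fact a)) u \<in> F (d - 1)" using Suc unfolding v_def by auto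
  moreover have "(bar (x i) ^^ a) r \<in> F (d - 1)" using x_pow_F[OF r assms(1), of a] by simp
  ultimately show ?case by (simp add: F_add F_scale)
qed

definition cX :: "nat \<Rightarrow> 'k" where "cX i = (\<Prod>j<i. of_nat (fact (top j)))"

lemma X_lin: "v \<in> V0 \<Longrightarrow> i \<le> n \<Longrightarrow> X i (sv c v) = sv c (X i v)"
proof (induction i arbitrary: v)
  case (Suc i)
  then have xp: "x i \<in> part (pp i)" using x by auto
  have "(bar (x i) ^^ b) (sv c v) = sv c ((bar (x i) ^^ b) v) \<and> (bar (x i) ^^ b) v \<in> V0" for b
    using Suc.prems by (induction b) (auto simp: bar_add[OF xp] bar_scale[OF xp] bar_V0[OF xp])
  then show ?case using Suc by simp
qed simp

text \<open>An error \<open>f\<close> below the leading index is carried along. At the end it lies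
  in index -1, hence is zero, so the final identity is exact and not merely one of leading
  parts.\<close>

lemma X_Y_aux:
  assumes "w \<in> W" "\<And>i. i < n \<Longrightarrow> of_nat (fact (top i)) \<noteq> (0::'k)"
  shows "i \<le> n \<Longrightarrow> f \<in> F (D i - 1) \<Longrightarrow> X i (Y i w + f) = sv (cX i) w"
proof (induction i arbitrary: f)
  case 0 then show ?case using F_neg by (auto simp: cX_def)
next
  case (Suc i)
  then have i: "i < n" by simp
  have xp: "x i \<in> part (pp i)" using x i by auto
  have lin: "(bar (x i) ^^ b) (v + v') = (bar (x i) ^^ b) v + (bar (x i) ^^ b) v' \<and>
       (bar (x i) ^^ b) v \<in> V0 \<and> (bar (x i) ^^ b) v' \<in> V0" 
    if "v \<in> V0" "v' \<in> V0" for b v v'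
    using that by (induction b) (auto simp: bar_add[OF xp] bar_scale[OF xp] bar_V0[OF xp])
  define t where "t = top i"
  define c where "c = (of_nat (fact t) :: 'k)"
  have c: "c \<noteq> 0" using assms(2)[OF i] unfolding c_def t_def .
  have "t \<le> 1 \<or> \<not> pp i" unfolding t_def top_def by auto
  then have 1: "(bar (x i) ^^ t) ((\<rho> (y i) ^^ t) (Y i w)) - sv c (Y i w) \<in> F (D i - 1)"
    unfolding c_def using i assms Y_F x_lower_Y by (intro x_pow_y_pow) auto
  have 2: "(bar (x i) ^^ t) f \<in> F (D i - 1)"
    using x_pow_F[OF Suc.prems(2) i, of t] by (simp add: t_def)
  \<comment> \<open>All errors of this step, divided by the factorial so that the scalar can be
    taken out in front.\<close>
  define g where "g = sv (inverse c) (((bar (x i) ^^ t) ((\<rho> (y i) ^^ t) (Y i w)) - sv c (Y i w)) + (bar (x i) ^^ t) f)"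
  have g: "g \<in> F (D i - 1)" unfolding g_def using 1 2 by (intro F_scale F_add)
  have "(bar (x i) ^^ t) (Y (Suc i) w + f) = (bar (x i) ^^ t) ((\<rho> (y i) ^^ t) (Y i w)) + (bar (x i) ^^ t) f"
    using lin[of "Y (Suc i) w" f t] F_V0[OF Suc.prems(2)] F_V0[OF Y_F[OF assms(1) Suc.prems(1)]] by (simp add: t_def)
  also have "\<dots> = sv c (Y i w + g)" using c by (simp add: g_def V.scale_right_distrib)
  finally have "X (Suc i) (Y (Suc i) w + f) = X i (sv c (Y i w + g))" by (simp add: t_def)
  also have "\<dots> = sv c (X i (Y i w + g))"
    using X_lin i F_V0[OF g] F_V0[OF Y_F[OF assms(1), of i]] V0_simps by auto
  also have "\<dots> = sv (cX (Suc i)) w" using Suc.IH[OF _ g] i by (simp add: cX_def c_def t_def mult.commute)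
  finally show ?case .
qed

text \<open>The exponents are at most \<open>p - 1\<close>, and the prime \<open>p\<close> does not
  divide \<open>(p - 1)!\<close>.\<close>

lemma X_Y:
  assumes "w \<in> W" "CHAR('k) > 0"
  shows "X n (Y n w) = sv (cX n) w" "cX n \<noteq> 0"
proof -
  have f: "of_nat (fact (top i)) \<noteq> (0::'k)" for i
  proof -
    have pr: "prime CHAR('k)" using assms(2) by (rule prime_CHAR_semidom)
    have "\<not> CHAR('k) dvd fact (top i)"
      using prime_gt_1_nat[OF pr] p unfolding prime_dvd_fact_iff[OF pr] top_def by auto
    then show ?thesis using of_nat_eq_0_iff_char_dvd by blast
  qed
  show "X n (Y n w) = sv (cX n) w" using X_Y_aux[OF assms(1) f, of n 0] F_zero by simp
  show "cX n \<noteq> 0" unfolding cX_def using f by simp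
qed

end

lemma finite_submultisets: "finite {N. N \<subseteq># M}"
proof (induction M)
  case (add x M)
  have "{N. N \<subseteq># add_mset x M} \<subseteq> {N. N \<subseteq># M} \<union> add_mset x ` {N. N \<subseteq># M}"
  proof safe
    fix N assume N: "N \<subseteq># add_mset x M" "N \<notin> add_mset x ` {N. N \<subseteq># M}"
    then have "x \<notin># N" by (metis image_eqI insert_DiffM mem_Collect_eq insert_subset_eq_iff add_mset_remove_trivial)
    then have "count N x = 0" by (simp add: not_in_iff)
    then show "N \<subseteq># M" using N(1) unfolding subseteq_mset_def by (metis count_add_mset le0)
  qed
  then show ?case using add by (meson finite_UnI finite_imageI finite_subset)
qed simp

text \<open>\<open>C\<close> is a subring of the ambient ring on which \<open>A\<close> is an
  action; in the application it is the free algebra on \<open>m\<close>, whose ring type contains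
  words in all other letters too. Through \<open>neg_span\<close> the finitely many
  \<open>x i\<close> detect Whittaker vectors.\<close>

locale whittaker_module =
  S: straightening \<sigma> I n e kap sg Top + whittaker sv part br gr chi V0 \<rho> n x y kk pp p
  for \<sigma> :: "'k::field \<Rightarrow> 'u::ring_1" and I :: "'u set" and n :: nat and e :: "nat \<Rightarrow> 'u"
    and kap :: "nat \<Rightarrow> nat" and sg :: "nat \<Rightarrow> nat \<Rightarrow> 'k" and Top :: "nat multiset"
    and sv :: "'k \<Rightarrow> 'v::ab_group_add \<Rightarrow> 'v"
    and part :: "bool \<Rightarrow> 'g set" and br :: "'g \<Rightarrow> 'g \<Rightarrow> 'g" and gr :: "int \<Rightarrow> 'g set" and chi :: "'g \<Rightarrow> 'k"
    and V0 :: "'v set" and \<rho> :: "'g \<Rightarrow> 'v \<Rightarrow> 'v"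
    and x y :: "nat \<Rightarrow> 'g" and kk :: "nat \<Rightarrow> nat" and pp :: "nat \<Rightarrow> bool" and p :: nat +
  fixes C :: "'u set" and A :: "'u \<Rightarrow> 'v \<Rightarrow> 'v"
  assumes C: "I \<subseteq> C" "i < n \<Longrightarrow> e i \<in> C" "\<sigma> c \<in> C" "f \<in> C \<Longrightarrow> g \<in> C \<Longrightarrow> f + g \<in> C"
      "f \<in> C \<Longrightarrow> g \<in> C \<Longrightarrow> f * g \<in> C"
    and A_V0: "f \<in> C \<Longrightarrow> v \<in> V0 \<Longrightarrow> A f v \<in> V0"
    and A_add: "f \<in> C \<Longrightarrow> g \<in> C \<Longrightarrow> v \<in> V0 \<Longrightarrow> A (f + g) v = A f v + A g v"
    and A_mult: "f \<in> C \<Longrightarrow> g \<in> C \<Longrightarrow> v \<in> V0 \<Longrightarrow> A (f * g) v = A f (A g v)"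
    and A_add_right: "f \<in> C \<Longrightarrow> v \<in> V0 \<Longrightarrow> v' \<in> V0 \<Longrightarrow> A f (v + v') = A f v + A f v'"
    and A_\<sigma>: "v \<in> V0 \<Longrightarrow> A (\<sigma> c) v = sv c v"
    and A_I: "f \<in> I \<Longrightarrow> v \<in> V0 \<Longrightarrow> A f v = 0"
    and A_e: "i < n \<Longrightarrow> v \<in> V0 \<Longrightarrow> A (e i) v = bar (x i) v"
    and neg_span: "z \<in> gr (- k) \<Longrightarrow> z \<in> part a \<Longrightarrow> k \<ge> 2 \<Longrightarrow> w \<in> V0 \<Longrightarrow>
        (\<And>i. i < n \<Longrightarrow> bar (x i) w = 0) \<Longrightarrow> bar z w = 0"
    and count_Top: "i < n \<Longrightarrow> count Top i = top i"
    and char: "CHAR('k) > 0"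
begin

lemma W_iff: "w \<in> W \<longleftrightarrow> w \<in> V0 \<and> (\<forall>i<n. bar (x i) w = 0)"
proof
  assume "w \<in> W"
  then show "w \<in> V0 \<and> (\<forall>i<n. bar (x i) w = 0)" using neg_x unfolding W_def by blast
next
  assume w: "w \<in> V0 \<and> (\<forall>i<n. bar (x i) w = 0)"
  have "bar z w = 0" if "neg k z" for k z
    using that neg_span[of z k _ w] w unfolding neg_def by auto
  then show "w \<in> W" using w unfolding W_def by blast
qed

lemma A_sv: "f \<in> C \<Longrightarrow> v \<in> V0 \<Longrightarrow> A f (sv c v) = sv c (A f v)"
  using A_mult[of f "\<sigma> c" v] A_mult[of "\<sigma> c" f v] S.\<sigma>_comm[of c f] A_\<sigma> C A_V0 by metis

lemma A_1: "v \<in> V0 \<Longrightarrow> A 1 v = v"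
  using A_\<sigma>[of v 1] S.\<sigma>_1 by simp

lemma A_0_right: "f \<in> C \<Longrightarrow> A f 0 = 0"
  using A_sv[of f 0 0] V0_simps by simp

lemma A_sum_right: "f \<in> C \<Longrightarrow> (\<And>j. j \<in> J \<Longrightarrow> u j \<in> V0) \<Longrightarrow> A f (sum u J) = (\<Sum>j\<in>J. A f (u j))"
  by (induction J rule: infinite_finite_induct)
    (auto simp: A_0_right A_add_right V.subspace_sum[OF V0])

lemma P_C: "set is \<subseteq> {..<n} \<Longrightarrow> S.P is \<in> C"
  by (induction "is") (use C(3)[of 1] in \<open>auto simp: C S.\<sigma>_1\<close>)

abbreviation Pm :: "nat multiset \<Rightarrow> 'u" where "Pm M \<equiv> S.P (sorted_list_of_multiset M)"

lemma sub_Top: "M \<subseteq># Top \<Longrightarrow> set (sorted_list_of_multiset M) \<subseteq> {..<n}"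
  using S.set_Top by (metis set_sorted_list_of_multiset set_mset_mono)

lemma Pm_C: "M \<subseteq># Top \<Longrightarrow> Pm M \<in> C"
  using sub_Top P_C by blast

lemma A_P_append:
  assumes "set is \<subseteq> {..<n}" "set js \<subseteq> {..<n}" "v \<in> V0"
  shows "A (S.P is) (A (S.P js) v) = A (S.P (is @ js)) v"
  using assms P_C A_mult by simp

definition X_word :: "nat \<Rightarrow> nat list" where
  "X_word i = concat (map (\<lambda>j. replicate (top j) j) [0..<i])"

lemma A_X_word: "i \<le> n \<Longrightarrow> v \<in> V0 \<Longrightarrow> A (S.P (X_word i)) v = X i v"
proof (induction i arbitrary: v)
  case 0 then show ?case by (simp add: X_word_def A_1)
next
  case (Suc i)
  have pow: "A (S.P (replicate t i)) v = (bar (x i) ^^ t) v \<and> (bar (x i) ^^ t) v \<in> V0" for t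
  proof (induction t)
    case (Suc t)
    have "S.P (replicate t i) \<in> C" by (rule P_C) (use \<open>Suc i \<le> n\<close> in auto)
    then have "A (e i * S.P (replicate t i)) v = A (e i) (A (S.P (replicate t i)) v)"
      by (intro A_mult C) (use Suc.prems \<open>Suc i \<le> n\<close> \<open>v \<in> V0\<close> in auto)
    then show ?case using Suc \<open>Suc i \<le> n\<close> \<open>v \<in> V0\<close> by (simp add: A_e bar_V0[OF x(2)])
  qed (use Suc.prems in \<open>simp add: A_1\<close>)
  have "set (X_word i) \<subseteq> {..<n}" "set (replicate (top i) i) \<subseteq> {..<n}"
    using Suc.prems unfolding X_word_def by auto
  then have "A (S.P (X_word (Suc i))) v = A (S.P (X_word i)) (A (S.P (replicate (top i) i)) v)"
    using Suc.prems by (subst A_P_append) (auto simp: X_word_def)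
  then show ?case using Suc pow by simp
qed

lemma mset_X_word: "mset (X_word n) = Top"
proof (rule multiset_eqI)
  fix j
  have "count (mset (X_word i)) j = (if j < i then top j else 0)" for i
    by (induction i) (auto simp: X_word_def)
  moreover have "j \<ge> n \<Longrightarrow> count Top j = 0" using S.set_Top by (metis count_eq_zero_iff lessThan_iff not_less)
  ultimately show "count (mset (X_word n)) j = count Top j" using count_Top by simp
qed

lemma Y_V0: "w \<in> W \<Longrightarrow> Y n w \<in> V0"
  using Y_F F_V0 by blast

text \<open>Every ordering of the top monomial agrees with \<open>X_word n\<close> up to sign modulo
  \<open>I\<close>, and for that word the scalar is known from \<open>X_Y\<close>. It is the same
  for all \<open>w\<close>.\<close>

lemma A_Top:
  assumes "mset is = Top"
  shows "\<exists>c. c \<noteq> 0 \<and> (\<forall>w\<in>W. A (S.P is) (Y n w) = sv c w)"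
proof -
  have s: "set is \<subseteq> {..<n}" using assms S.set_Top by (metis order_refl set_mset_mset)
  have sX: "set (X_word n) \<subseteq> {..<n}" using mset_X_word S.set_Top by (metis order_refl set_mset_mset)
  have set0: "M \<in> C" if "M \<in> I" for M using C that by auto
  have word: "\<exists>\<delta>\<in>{1, - 1}. \<forall>v\<in>V0. A (S.P js) v = sv \<delta> (A (Pm Top) v)" if mj: "mset js = Top" for js
  proof -
    have js: "set js \<subseteq> {..<n}" using that S.set_Top by (metis order_refl set_mset_mset)
    obtain \<epsilon> where \<epsilon>: "\<epsilon> \<in> {1, - 1}" "S.P js - \<epsilon> * Pm Top \<in> I" using S.top_word[OF mj] by (elim bexE)
    obtain \<delta> where \<delta>: "\<delta> \<in> {1, -1}" "\<epsilon> = \<sigma> \<delta>"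
    proof -
      have "\<sigma> (- 1) * 1 = - (\<sigma> 1 * 1)" by (rule S.V.scale_minus_left)
      then have m1: "\<sigma> (- 1) = - 1" unfolding mult_1_right S.\<sigma>_1 .
      consider "\<epsilon> = 1" | "\<epsilon> = - 1" using \<epsilon>(1) by blast
      then show thesis
      proof cases
        case 1 show thesis by (rule that[of 1]) (simp_all only: 1 S.\<sigma>_1 insertI1)
      next
        case 2 show thesis by (rule that[of "-1"]) (simp_all only: 2 m1 insertI1 insertI2)
      qed
    qed
    have "A (S.P js) v = sv \<delta> (A (Pm Top) v)" if v: "v \<in> V0" for v
    proof -
      have PT: "Pm Top \<in> C" using Pm_C by blast
      have "A (S.P js) v = A ((S.P js - \<epsilon> * Pm Top) + \<epsilon> * Pm Top) v" by simp
      also have "\<dots> = A (S.P js - \<epsilon> * Pm Top) v + A (\<epsilon> * Pm Top) v"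
        unfolding \<delta>(2) by (rule A_add) (use \<epsilon>(2) \<delta>(2) set0 v PT C in auto)
      also have "\<dots> = sv \<delta> (A (Pm Top) v)"
        unfolding \<delta>(2) using A_I[OF \<epsilon>(2)[unfolded \<delta>(2)] v] v PT C by (simp add: A_mult A_\<sigma> A_V0)
      finally show ?thesis .
    qed
    then show ?thesis using \<delta>(1) by blast
  qed
  obtain \<delta>1 where 1: "\<delta>1 \<in> {1, -1}" "\<forall>v\<in>V0. A (S.P is) v = sv \<delta>1 (A (Pm Top) v)" using word assms by blast
  obtain \<delta>2 where 2: "\<delta>2 \<in> {1, -1}" "\<forall>v\<in>V0. A (S.P (X_word n)) v = sv \<delta>2 (A (Pm Top) v)"
    using word mset_X_word by blast
  have "A (S.P is) (Y n w) = sv (\<delta>1 * \<delta>2 * cX n) w" if w: "w \<in> W" for w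
  proof -
    have "A (Pm Top) (Y n w) = sv \<delta>2 (A (S.P (X_word n)) (Y n w))"
      using 2 Y_V0[OF w] by auto
    then show ?thesis using 1 Y_V0[OF w] A_X_word[of n "Y n w"] X_Y[OF w char] by auto
  qed
  then show ?thesis using 1(1) 2(1) X_Y(2)[OF V.subspace_0[OF W_sub] char]
    by (intro exI[of _ "\<delta>1 * \<delta>2 * cX n"]) auto
qed

text \<open>The word has the letters of \<open>M'\<close> and of the complement of \<open>M\<close>:
  it weighs at least as much as \<open>Top\<close> without being a rearrangement of it, and such
  words lie in \<open>I\<close>. With the next lemma, the matrix with rows \<open>Top - M\<close>
  and columns \<open>M'\<close>, ordered by weight, is triangular with nonzero diagonal.\<close>

lemma A_complement:
  assumes "M \<subseteq># Top" "M' \<subseteq># Top" "S.wtm M \<le> S.wtm M'" "w \<in> W"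
  shows "M \<noteq> M' \<Longrightarrow> A (Pm (Top - M)) (A (Pm M') (Y n w)) = 0"
    and "M \<noteq> M' \<Longrightarrow> A (Pm M') (A (Pm (Top - M)) (Y n w)) = 0"
proof -
  have "\<And>M1 M2. S.wtm (M1 + M2) = S.wtm M1 + S.wtm M2" by (simp add: S.wtm_def)
  then have t: "S.wtm Top = S.wtm (Top - M) + S.wtm M" using assms(1) by (metis subset_mset.diff_add)
  have dT: "Top - M \<subseteq># Top" by simp
  have kill: "A (S.P is) (Y n w) = 0" if "mset is = M' + (Top - M)" "M \<noteq> M'" for "is"
  proof -
    have s: "set is \<subseteq> {..<n}"
      using that(1) assms(2) S.set_Top
      by (metis dT set_mset_mono set_mset_mset set_mset_union sup.boundedI)
    have w: "S.wt is \<ge> S.wtm Top" unfolding S.wt_eq_wtm that(1) using t assms(3) by (simp add: S.wtm_def)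
    have "mset is \<noteq> Top" using that assms(1) 
      by (metis add.commute add_right_cancel subset_mset.diff_add union_commute)
    then have "S.P is \<in> I" using S.overweight_word[OF s] S.top_word_other[OF s] w by fastforce
    then show ?thesis using A_I Y_V0[OF assms(4)] by blast
  qed
  show "M \<noteq> M' \<Longrightarrow> A (Pm (Top - M)) (A (Pm M') (Y n w)) = 0"
    using kill[of "sorted_list_of_multiset (Top - M) @ sorted_list_of_multiset M'"]
    by (subst A_P_append) (auto simp only: sub_Top dT assms Y_V0 mset_append mset_sorted_list_of_multiset union_commute)
  show "M \<noteq> M' \<Longrightarrow> A (Pm M') (A (Pm (Top - M)) (Y n w)) = 0"
    using kill[of "sorted_list_of_multiset M' @ sorted_list_of_multiset (Top - M)"]
    by (subst A_P_append) (auto simp only: sub_Top dT assms Y_V0 mset_append mset_sorted_list_of_multiset)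
qed

lemma A_complement_same:
  assumes "M \<subseteq># Top"
  shows "\<exists>c. c \<noteq> 0 \<and> (\<forall>w\<in>W. A (Pm (Top - M)) (A (Pm M) (Y n w)) = sv c w)"
    and "\<exists>c. c \<noteq> 0 \<and> (\<forall>w\<in>W. A (Pm M) (A (Pm (Top - M)) (Y n w)) = sv c w)"
proof -
  have dT: "Top - M \<subseteq># Top" by simp
  have *: "(Top - M) + M = Top" "M + (Top - M) = Top" using assms by auto
  have "mset (sorted_list_of_multiset (Top - M) @ sorted_list_of_multiset M) = Top" using * by simp
  from A_Top[OF this] show "\<exists>c. c \<noteq> 0 \<and> (\<forall>w\<in>W. A (Pm (Top - M)) (A (Pm M) (Y n w)) = sv c w)"
    using A_P_append[OF sub_Top[OF dT] sub_Top[OF assms] Y_V0] by simp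
  have "mset (sorted_list_of_multiset M @ sorted_list_of_multiset (Top - M)) = Top" using * by simp
  from A_Top[OF this] show "\<exists>c. c \<noteq> 0 \<and> (\<forall>w\<in>W. A (Pm M) (A (Pm (Top - M)) (Y n w)) = sv c w)"
    using A_P_append[OF sub_Top[OF assms] sub_Top[OF dT] Y_V0] by simp
qed

definition TT :: "nat multiset set" where "TT = {M. M \<subseteq># Top}"

lemma finite_TT: "finite TT"
  unfolding TT_def by (rule finite_submultisets)

text \<open>Among the nonzero coefficients take one of least weight; the complementary monomial
  kills all other terms and returns a nonzero multiple of this coefficient.\<close>

lemma free_independent:
  assumes "\<And>M. M \<in> TT \<Longrightarrow> w M \<in> W" "(\<Sum>M\<in>TT. A (Pm M) (Y n (w M))) = 0" "M \<in> TT"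
  shows "w M = 0"
proof (rule ccontr)
  assume nz: "w M \<noteq> 0"
  define Z where "Z = {M\<in>TT. w M \<noteq> 0}"
  have "Z \<noteq> {}" "finite Z" unfolding Z_def using nz assms(3) finite_TT by auto
  then obtain M0 where M0: "M0 \<in> Z" "\<And>M. M \<in> Z \<Longrightarrow> S.wtm M0 \<le> S.wtm M"
    using ex_min_if_finite[of "S.wtm ` Z"] by (metis (no_types, lifting) arg_min_if_finite(1) arg_min_least)
  have M0T: "M0 \<in> TT" "w M0 \<noteq> 0" using M0 Z_def by auto
  have Y0: "Y n 0 = 0"
  proof -
    have "i \<le> n \<Longrightarrow> Y i 0 = 0" for i
    proof (induction i)
      case (Suc i)
      have "(\<rho> (y i) ^^ t) 0 = 0" for t using y(2)[of i] Suc.prems by (induction t) (auto simp: \<rho>_0)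
      then show ?case using Suc by simp
    qed simp
    then show ?thesis by simp
  qed
  obtain c where c: "c \<noteq> 0" "\<forall>w\<in>W. A (Pm (Top - M0)) (A (Pm M0) (Y n w)) = sv c w"
    using A_complement_same(1)[of M0] M0T unfolding TT_def by auto
  have C1: "Pm (Top - M0) \<in> C" by (rule Pm_C) simp
  have "0 = A (Pm (Top - M0)) (\<Sum>M\<in>TT. A (Pm M) (Y n (w M)))" using assms(2) A_0_right[OF C1] by simp
  also have "\<dots> = (\<Sum>M\<in>TT. A (Pm (Top - M0)) (A (Pm M) (Y n (w M))))"
    using assms(1) Y_V0 Pm_C by (intro A_sum_right C1 A_V0) (auto simp: TT_def)
  also have "\<dots> = (\<Sum>M\<in>TT. if M = M0 then sv c (w M0) else 0)"
  proof (rule sum.cong[OF refl])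
    fix M assume M: "M \<in> TT"
    show "A (Pm (Top - M0)) (A (Pm M) (Y n (w M))) = (if M = M0 then sv c (w M0) else 0)"
    proof (cases "M = M0")
      case True then show ?thesis using c assms(1) M0T by auto
    next
      case False
      show ?thesis
      proof (cases "w M = 0")
        case True
        then show ?thesis using False M Y0 A_0_right[OF C1] A_0_right[OF Pm_C] by (auto simp: TT_def)
      next
        case nz: False
        then have "S.wtm M0 \<le> S.wtm M" using M M0 Z_def by auto
        then show ?thesis using False A_complement(1)[of M0 M "w M"] M M0T assms(1) unfolding TT_def by auto
      qed
    qed
  qed
  also have "\<dots> = sv c (w M0)" using finite_TT M0T by simp
  finally show False using c M0T by simp
qed

lemma Y_lin: 
  assumes "v \<in> V0" "v' \<in> V0"
  shows "i \<le> n \<Longrightarrow> Y i (v + v') = Y i v + Y i v' \<and> Y i (sv c v) = sv c (Y i v) \<and> Y i v \<in> V0 \<and> Y i v' \<in> V0"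
proof (induction i)
  case 0 then show ?case using assms by simp
next
  case (Suc i)
  then have yp: "y i \<in> part (pp i)" using y by simp
  have "(\<rho> (y i) ^^ t) (u + u') = (\<rho> (y i) ^^ t) u + (\<rho> (y i) ^^ t) u' \<and>
     (\<rho> (y i) ^^ t) (sv c u) = sv c ((\<rho> (y i) ^^ t) u) \<and> (\<rho> (y i) ^^ t) u \<in> V0 \<and> (\<rho> (y i) ^^ t) u' \<in> V0"
    if "u \<in> V0" "u' \<in> V0" for u u' t
    using that by (induction t) (auto simp: \<rho>_add[OF yp] \<rho>_scale[OF yp] \<rho>_V0[OF yp])
  from this[of "Y i v" "Y i v'" "top i"] show ?case using Suc by simp
qed

text \<open>Induction on a bound \<open>d\<close> such that all monomials of weight at least
  \<open>d\<close> kill \<open>v\<close>. When this is known for \<open>Suc d\<close>, the monomials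
  of weight exactly \<open>d\<close> send \<open>v\<close> into \<open>W\<close>, and a correction
  by complementary monomials makes them kill \<open>v\<close> too.\<close>

lemma free_spanning:
  assumes "v \<in> V0"
  shows "\<exists>w. (\<forall>M\<in>TT. w M \<in> W) \<and> v = (\<Sum>M\<in>TT. A (Pm M) (Y n (w M)))"
proof -
  define FF where "FF = {v. \<exists>w. (\<forall>M\<in>TT. w M \<in> W) \<and> v = (\<Sum>M\<in>TT. A (Pm M) (Y n (w M)))}"
  have WV0: "w \<in> W \<Longrightarrow> w \<in> V0" for w unfolding W_def by auto
  have FF_add: "u + v \<in> FF" if "u \<in> FF" "v \<in> FF" for u v
  proof -
    obtain w w' where w: "\<forall>M\<in>TT. w M \<in> W" "u = (\<Sum>M\<in>TT. A (Pm M) (Y n (w M)))"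
      and w': "\<forall>M\<in>TT. w' M \<in> W" "v = (\<Sum>M\<in>TT. A (Pm M) (Y n (w' M)))" using \<open>u \<in> FF\<close> \<open>v \<in> FF\<close> FF_def by auto
    have "A (Pm M) (Y n (w M + w' M)) = A (Pm M) (Y n (w M)) + A (Pm M) (Y n (w' M))" if "M \<in> TT" for M
      using Y_lin[of "w M" "w' M" n] w(1) w'(1) WV0 that A_add_right[OF Pm_C, of M] by (auto simp: TT_def)
    then have "u + v = (\<Sum>M\<in>TT. A (Pm M) (Y n (w M + w' M)))" unfolding w(2) w'(2) by (simp add: sum.distrib)
    moreover have "\<forall>M\<in>TT. w M + w' M \<in> W" using w w' V.subspace_add[OF W_sub] by auto
    ultimately show ?thesis unfolding FF_def by (intro CollectI exI[of _ "\<lambda>M. w M + w' M"]) simp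
  qed
  have Y0: "Y n 0 = 0" using Y_lin[of 0 0 n 0] V0_simps by simp
  have FF_0: "0 \<in> FF" unfolding FF_def
    using Y0 A_0_right[OF Pm_C] V.subspace_0[OF W_sub] by (intro CollectI exI[of _ "\<lambda>M. 0"]) (auto simp: TT_def)
  have FF_single: "A (Pm M) (Y n w) \<in> FF" if "M \<in> TT" "w \<in> W" for M w
  proof -
    have "(\<Sum>M'\<in>TT. A (Pm M') (Y n (if M' = M then w else 0))) = (\<Sum>M'\<in>TT. if M' = M then A (Pm M) (Y n w) else 0)"
      using Y0 A_0_right[OF Pm_C] by (intro sum.cong) (auto simp: TT_def)
    also have "\<dots> = A (Pm M) (Y n w)" using finite_TT that by simp
    finally show ?thesis unfolding FF_def using that V.subspace_0[OF W_sub]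
      by (intro CollectI exI[of _ "\<lambda>M'. if M' = M then w else 0"]) auto
  qed
  have "v \<in> V0 \<Longrightarrow> (\<forall>M\<in>TT. d \<le> S.wtm M \<longrightarrow> A (Pm M) v = 0) \<Longrightarrow> v \<in> FF" for d v
  proof (induction d arbitrary: v)
    case 0
    \<comment> \<open>For \<open>d = 0\<close> the empty monomial, which is 1, kills
      \<open>v\<close>.\<close>
    have "A (Pm {#}) v = 0" by (rule 0(2)[rule_format]) (simp_all add: TT_def)
    then show ?case using A_1 0 FF_0 by simp
  next
    case (Suc d)
    have kill: "A f v = 0" if "f \<in> S.good (Suc d)" for f
    proof -
      have "f \<in> C \<and> A f v = 0" using that unfolding S.good_def
      proof (induction rule: S.V.span_induct_alt)
        case base
        have "\<sigma> 0 * 1 \<in> C" using C(3)[of 0] by simp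
        then show ?case using A_\<sigma>[OF Suc.prems(1), of 0] S.V.scale_zero_left[of 1] by simp
      next
        case (step c f g)
        have "f \<in> C \<and> A f v = 0"
          using step(1) Suc.prems A_I C(1) Pm_C unfolding TT_def by auto
        then show ?case using step Suc.prems C by (simp add: A_add A_mult A_\<sigma> V0_simps)
      qed
      then show ?thesis by simp
    qed
    define R where "R = {M\<in>TT. S.wtm M = d}"
    have fR: "finite R" unfolding R_def using finite_TT by simp
    \<comment> \<open>One more generator in front of a monomial of weight \<open>d\<close> gives a
      word of larger weight, whose normal form kills \<open>v\<close>.\<close>
    have w: "A (Pm M) v \<in> W" if "M \<in> R" for M
      unfolding W_iff
    proof (intro conjI allI impI)
      have MT: "M \<subseteq># Top" "S.wtm M = d" using that R_def TT_def by auto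
      show "A (Pm M) v \<in> V0" using A_V0 Pm_C MT Suc.prems by auto
      fix i assume i: "i < n"
      have "set (i # sorted_list_of_multiset M) \<subseteq> {..<n}" using sub_Top[OF MT(1)] i by auto
      then have "S.P (i # sorted_list_of_multiset M) \<in> S.good (S.wt (i # sorted_list_of_multiset M))"
        by (rule S.word_good)
      also have "S.wt (i # sorted_list_of_multiset M) = kap i + d" using MT by (simp add: S.wt_eq_wtm S.wtm_def)
      also have "S.good (kap i + d) \<subseteq> S.good (Suc d)" using S.kap_pos[OF i] by (intro S.good_mono) auto
      finally have "A (e i * Pm M) v = 0" using kill by simp
      then show "bar (x i) (A (Pm M) v) = 0"
        using A_mult[of "e i" "Pm M" v] A_e i C(2) Pm_C MT Suc.prems A_V0 by auto
    qed
    have "\<forall>M\<in>TT. \<exists>c. c \<noteq> 0 \<and> (\<forall>w\<in>W. A (Pm M) (A (Pm (Top - M)) (Y n w)) = sv c w)"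
      using A_complement_same(2) unfolding TT_def by auto
    then obtain c where c: "\<And>M. M \<in> TT \<Longrightarrow> c M \<noteq> 0"
      "\<And>M w. M \<in> TT \<Longrightarrow> w \<in> W \<Longrightarrow> A (Pm M) (A (Pm (Top - M)) (Y n w)) = sv (c M) w"
      by metis
    \<comment> \<open>The sign and the inverse are chosen so that adding the correction cancels
      \<open>A (Pm M) v\<close>.\<close>
    define w' where "w' M = sv (- inverse (c M)) (A (Pm M) v)" for M
    have w': "w' M \<in> W" if "M \<in> R" for M unfolding w'_def by (rule V.subspace_scale[OF W_sub w[OF that]])
    define f where "f M = A (Pm (Top - M)) (Y n (w' M))" for M
    have fV0: "f M \<in> V0" if "M \<in> R" for M
      unfolding f_def using w'[OF that] Y_V0 Pm_C[of "Top - M"] A_V0 by simp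
    have fFF: "sum f R' \<in> FF" if "R' \<subseteq> R" for R'
      using finite_subset[OF that fR] that
    proof (induction R' rule: finite_induct)
      case (insert M R')
      then show ?case using FF_add FF_single[of "Top - M" "w' M"] w' by (auto simp: f_def TT_def)
    qed (simp add: FF_0)
    have sV0: "sum f R \<in> V0" using fV0 V.subspace_sum[OF V0] by auto
    define v' where "v' = v + sum f R"
    have "v' \<in> FF"
    proof (rule Suc.IH)
      show "v' \<in> V0" unfolding v'_def using Suc.prems sV0 V0_simps by auto
      show "\<forall>M\<in>TT. d \<le> S.wtm M \<longrightarrow> A (Pm M) v' = 0"
      proof (intro ballI impI)
        fix M assume M: "M \<in> TT" "d \<le> S.wtm M"
        have PC: "Pm M \<in> C" using M Pm_C unfolding TT_def by auto
        have "A (Pm M) v' = A (Pm M) v + (\<Sum>M'\<in>R. A (Pm M) (f M'))"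
          unfolding v'_def using A_add_right[OF PC Suc.prems(1) sV0] A_sum_right[OF PC fV0] by simp
        also have "(\<Sum>M'\<in>R. A (Pm M) (f M')) = (\<Sum>M'\<in>R. if M' = M then - A (Pm M) v else 0)"
        proof (rule sum.cong[OF refl])
          fix M' assume M': "M' \<in> R"
          show "A (Pm M) (f M') = (if M' = M then - A (Pm M) v else 0)"
          proof (cases "M' = M")
            case True
            then have "A (Pm M) (f M') = sv (c M) (w' M)" unfolding f_def using c M w' M' by auto
            also have "\<dots> = - A (Pm M) v" unfolding w'_def using c(1)[OF M(1)] by simp
            finally show ?thesis using True by simp
          next
            case False
            have "S.wtm M' \<le> S.wtm M" using M M' R_def by auto
            then show ?thesis unfolding f_def using False A_complement(2)[of M' M "w' M'"] M M' w' 
              by (auto simp: R_def TT_def)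
          qed
        qed
        also have "\<dots> = (if M \<in> R then - A (Pm M) v else 0)" using fR by simp
        also have "A (Pm M) v + \<dots> = 0"
          using M Suc.prems(2) by (cases "M \<in> R") (auto simp: R_def)
        finally show "A (Pm M) v' = 0" .
      qed
    qed
    moreover have "sv (-1) u \<in> FF" if "u \<in> FF" for u
    proof -
      obtain w where w: "\<forall>M\<in>TT. w M \<in> W" "u = (\<Sum>M\<in>TT. A (Pm M) (Y n (w M)))" using \<open>u \<in> FF\<close> FF_def by auto
      have "A (Pm M) (Y n (sv (-1) (w M))) = sv (-1) (A (Pm M) (Y n (w M)))" if "M \<in> TT" for M
        using Y_lin[of "w M" "w M" n "-1"] w(1) WV0 that A_sv[OF Pm_C, of M "Y n (w M)" "-1"] by (auto simp: TT_def)
      then have "sv (-1) u = (\<Sum>M\<in>TT. A (Pm M) (Y n (sv (-1) (w M))))" unfolding w(2)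
        by (subst V.scale_sum_right) simp
      then show ?thesis unfolding FF_def using w(1) V.subspace_neg[OF W_sub]
        by (intro CollectI exI[of _ "\<lambda>M. sv (-1) (w M)"]) auto
    qed
    then have "v' + sv (-1) (sum f R) \<in> FF" using FF_add fFF[OF order_refl] \<open>v' \<in> FF\<close> by blast
    then show ?case by (simp add: v'_def)
  qed
  \<comment> \<open>The induction is entered beyond the weight of \<open>Top\<close>, where its
    hypothesis is vacuous.\<close>
  moreover have "\<forall>M\<in>TT. Suc (S.wtm Top) \<le> S.wtm M \<longrightarrow> A (Pm M) v = 0"
    unfolding TT_def S.wtm_def using sum_mset_image_mono[of _ Top kap] by fastforce
  ultimately show ?thesis using assms unfolding FF_def by blast
qed

end

section \<open>Modules given by records\<close>

text \<open>The formal combinations of the elements are divided by all linear relations, by means of a complement of the relations.\<close>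

lemma record_space_embedding:
  fixes M :: "('r, 'm) module" and sm :: "'k::field \<Rightarrow> 'm \<Rightarrow> 'm"
  assumes M: "abelian_group M"
    and sm_closed: "\<And>c x. x \<in> carrier M \<Longrightarrow> sm c x \<in> carrier M"
    and sm_add: "\<And>c x y. x \<in> carrier M \<Longrightarrow> y \<in> carrier M \<Longrightarrow> sm c (x \<oplus>\<^bsub>M\<^esub> y) = sm c x \<oplus>\<^bsub>M\<^esub> sm c y"
    and sm_add_left: "\<And>c d x. x \<in> carrier M \<Longrightarrow> sm (c + d) x = sm c x \<oplus>\<^bsub>M\<^esub> sm d x"
    and sm_mult: "\<And>c d x. x \<in> carrier M \<Longrightarrow> sm (c * d) x = sm c (sm d x)"
    and sm_1: "\<And>x. x \<in> carrier M \<Longrightarrow> sm 1 x = x"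
  obtains \<iota> :: "'m \<Rightarrow> ('m \<Rightarrow> 'k)" where "inj_on \<iota> (carrier M)"
    "\<And>x y. x \<in> carrier M \<Longrightarrow> y \<in> carrier M \<Longrightarrow> \<iota> (x \<oplus>\<^bsub>M\<^esub> y) = \<iota> x + \<iota> y"
    "\<And>c x. x \<in> carrier M \<Longrightarrow> \<iota> (sm c x) = (\<lambda>t. c * \<iota> x t)"
proof -
  interpret M: abelian_group M by (rule M)
  define sT :: "'k \<Rightarrow> ('m \<Rightarrow> 'k) \<Rightarrow> ('m \<Rightarrow> 'k)" where "sT c f = (\<lambda>t. c * f t)" for c f
  interpret T: vector_space sT
    by unfold_locales (auto simp: sT_def plus_fun_def fun_eq_iff algebra_simps)
  define \<delta> :: "'m \<Rightarrow> ('m \<Rightarrow> 'k)" where "\<delta> x = (\<lambda>t. if t = x then 1 else 0)" for x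
  define rel where "rel = {\<delta> (x \<oplus>\<^bsub>M\<^esub> y) - \<delta> x - \<delta> y | x y. x \<in> carrier M \<and> y \<in> carrier M}
     \<union> {\<delta> (sm c x) - sT c (\<delta> x) | c x. x \<in> carrier M}"
  define N where "N = T.span rel"
  have sm_0: "sm 0 x = \<zero>\<^bsub>M\<^esub>" if "x \<in> carrier M" for x
    using sm_add_left[OF that, of 0 0] sm_closed[OF that] that by simp
  have sm_0r: "sm c \<zero>\<^bsub>M\<^esub> = \<zero>\<^bsub>M\<^esub>" for c
    using sm_add[of "\<zero>\<^bsub>M\<^esub>" "\<zero>\<^bsub>M\<^esub>" c] sm_closed[of "\<zero>\<^bsub>M\<^esub>"] by simp
  \<comment> \<open>Evaluation in \<open>M\<close> is defined on formal combinations with finite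
    support and kills all relations. Hence distinct elements of \<open>M\<close> stay distinct
    modulo the relations.\<close>
  define FS where "FS = {f :: 'm \<Rightarrow> 'k. finite {x. f x \<noteq> 0} \<and> {x. f x \<noteq> 0} \<subseteq> carrier M}"
  define ev where "ev f = finsum M (\<lambda>x. sm (f x) x) {x. f x \<noteq> 0}" for f
  have ev_sup: "ev f = finsum M (\<lambda>x. sm (f x) x) S" if "finite S" "{x. f x \<noteq> 0} \<subseteq> S" "S \<subseteq> carrier M" for f S
    unfolding ev_def using that sm_0 sm_closed by (intro M.add.finprod_mono_neutral_cong_left) auto
  have FS_add: "f + g \<in> FS" if "f \<in> FS" "g \<in> FS" for f g
  proof -
    have "{x. (f + g) x \<noteq> 0} \<subseteq> {x. f x \<noteq> 0} \<union> {x. g x \<noteq> 0}" by auto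
    then show ?thesis using that unfolding FS_def by (auto intro: finite_subset)
  qed
  have FS_scale: "sT c f \<in> FS" if "f \<in> FS" for c f
  proof -
    have "{x. sT c f x \<noteq> 0} \<subseteq> {x. f x \<noteq> 0}" by (auto simp: sT_def)
    then show ?thesis using that unfolding FS_def by (auto intro: finite_subset)
  qed
  have ev_closed: "ev f \<in> carrier M" if "f \<in> FS" for f
    unfolding ev_def using that sm_closed by (intro M.finsum_closed) (auto simp: FS_def)
  have ev_add: "ev (f + g) = ev f \<oplus>\<^bsub>M\<^esub> ev g" if "f \<in> FS" "g \<in> FS" for f g
  proof -
    define S where "S = {x. f x \<noteq> 0} \<union> {x. g x \<noteq> 0}"
    have S: "finite S" "S \<subseteq> carrier M" using that unfolding S_def FS_def by auto
    have "ev (f + g) = finsum M (\<lambda>x. sm ((f + g) x) x) S" using S by (intro ev_sup) (auto simp: S_def)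
    also have "\<dots> = finsum M (\<lambda>x. sm (f x) x \<oplus>\<^bsub>M\<^esub> sm (g x) x) S"
      using S sm_closed by (intro M.finsum_cong') (auto simp: sm_add_left)
    also have "\<dots> = finsum M (\<lambda>x. sm (f x) x) S \<oplus>\<^bsub>M\<^esub> finsum M (\<lambda>x. sm (g x) x) S"
      using S sm_closed by (intro M.finsum_addf) auto
    also have "\<dots> = ev f \<oplus>\<^bsub>M\<^esub> ev g" using S ev_sup[of S f] ev_sup[of S g] by (auto simp: S_def)
    finally show ?thesis .
  qed
  have ev_scale: "ev (sT c f) = sm c (ev f)" if "f \<in> FS" for c f
  proof -
    define S where "S = {x. f x \<noteq> 0}"
    have S: "finite S" "S \<subseteq> carrier M" using that unfolding S_def FS_def by auto
    have "ev (sT c f) = finsum M (\<lambda>x. sm (sT c f x) x) S" using S by (intro ev_sup) (auto simp: S_def sT_def)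
    also have "\<dots> = finsum M (\<lambda>x. sm c (sm (f x) x)) S"
      using S sm_closed by (intro M.finsum_cong') (auto simp: sm_mult[symmetric] sT_def)
    also have "\<dots> = sm c (finsum M (\<lambda>x. sm (f x) x) S)"
      using S
    proof (induction S rule: finite_induct)
      case (insert x S)
      have "finsum M (\<lambda>x. sm (f x) x) S \<in> carrier M"
        using insert.prems sm_closed by (intro M.finsum_closed) auto
      then show ?case using insert sm_closed
        by (subst M.finsum_insert; (subst M.finsum_insert)?) (auto simp: sm_add)
    qed (simp add: sm_0r)
    finally show ?thesis by (simp add: ev_def S_def)
  qed
  have \<delta>_FS: "\<delta> x \<in> FS" if "x \<in> carrier M" for x
    using that by (auto simp: \<delta>_def FS_def)
  have ev_\<delta>: "ev (\<delta> x) = x" if "x \<in> carrier M" for x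
    using ev_sup[of "{x}" "\<delta> x"] that sm_closed sm_1 by (auto simp: \<delta>_def)
  have diff_eq: "f - g = f + sT (-1) g" for f g by (auto simp: sT_def fun_eq_iff)
  have sm_m1: "x \<oplus>\<^bsub>M\<^esub> sm (-1) x = \<zero>\<^bsub>M\<^esub>" if "x \<in> carrier M" for x
    using sm_add_left[OF that, of 1 "-1"] sm_0[OF that] sm_1[OF that] by simp
  have ev_diff: "ev (f - g) = ev f \<oplus>\<^bsub>M\<^esub> sm (-1) (ev g)" "f - g \<in> FS" if "f \<in> FS" "g \<in> FS" for f g
    unfolding diff_eq using ev_add[OF that(1) FS_scale[OF that(2)]] ev_scale[OF that(2)] FS_add[OF that(1) FS_scale[OF that(2)]]
    by (simp_all only:)
  have N: "f \<in> FS \<and> ev f = \<zero>\<^bsub>M\<^esub>" if "f \<in> N" for f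
    using that unfolding N_def
  proof (induction rule: T.span_induct_alt)
    case base
    have "0 \<in> FS" unfolding FS_def by simp
    moreover have "ev 0 = \<zero>\<^bsub>M\<^esub>" unfolding ev_def by simp
    ultimately show ?case ..
  next
    case (step c f g)
    have "f \<in> FS \<and> ev f = \<zero>\<^bsub>M\<^esub>"
      using step(1) unfolding rel_def
    proof (elim UnE CollectE exE conjE)
      fix x y assume f: "f = \<delta> (x \<oplus>\<^bsub>M\<^esub> y) - \<delta> x - \<delta> y" and xy: "x \<in> carrier M" "y \<in> carrier M"
      have "ev f = (x \<oplus>\<^bsub>M\<^esub> y \<oplus>\<^bsub>M\<^esub> sm (-1) x) \<oplus>\<^bsub>M\<^esub> sm (-1) y"
        unfolding f using xy by (simp add: ev_diff \<delta>_FS ev_\<delta>)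
      also have "\<dots> = (x \<oplus>\<^bsub>M\<^esub> sm (-1) x) \<oplus>\<^bsub>M\<^esub> (y \<oplus>\<^bsub>M\<^esub> sm (-1) y)"
        using xy sm_closed by (simp add: M.a_ac)
      also have "\<dots> = \<zero>\<^bsub>M\<^esub>" using xy by (simp add: sm_m1)
      finally show ?thesis using xy unfolding f by (simp add: ev_diff \<delta>_FS)
    next
      fix c x assume f: "f = \<delta> (sm c x) - sT c (\<delta> x)" and x: "x \<in> carrier M"
      have "ev f = sm c x \<oplus>\<^bsub>M\<^esub> sm (-1) (sm c x)"
        unfolding f using x sm_closed by (simp add: ev_diff \<delta>_FS ev_\<delta> FS_scale ev_scale)
      also have "\<dots> = \<zero>\<^bsub>M\<^esub>" using x sm_closed by (simp add: sm_m1)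
      finally show ?thesis using x sm_closed unfolding f by (simp add: ev_diff \<delta>_FS FS_scale)
    qed
    then show ?case using step(2) ev_add[OF FS_scale, of f g c] ev_scale[of f c] FS_add[OF FS_scale, of f g c] sm_0r[of c]
      by (metis M.l_zero M.zero_closed)
  qed
  obtain BN where BN: "BN \<subseteq> N" "T.independent BN" "N \<subseteq> T.span BN"
    using T.maximal_independent_subset by metis
  interpret TT: vector_space_pair sT sT ..
  \<comment> \<open>A basis of \<open>N\<close>, extended to the whole function space, gives a
    projection along \<open>N\<close>. Its image takes the place of the quotient, so the type of
    functions is kept.\<close>
  define BT where "BT = T.extend_basis BN"
  have BT: "BN \<subseteq> BT" "T.independent BT" "T.span BT = UNIV"
    unfolding BT_def using BN(2) by (auto simp: T.extend_basis_superset T.independent_extend_basis T.span_extend_basis)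
  obtain \<pi> where \<pi>: "Vector_Spaces.linear sT sT \<pi>" "\<And>b. b \<in> BT \<Longrightarrow> \<pi> b = (if b \<in> BN then 0 else b)"
    using TT.linear_independent_extend[OF BT(2), of "\<lambda>b. if b \<in> BN then 0 else b"] by metis
  interpret \<pi>: Vector_Spaces.linear sT sT \<pi> by (rule \<pi>(1))
  have NBN: "N = T.span BN" using BN T.span_minimal[OF BN(1)] unfolding N_def by auto
  have \<pi>N: "\<pi> f = 0" if "f \<in> N" for f
    using that unfolding NBN
  proof (induction rule: T.span_induct_alt)
    case (step c x y)
    then have "\<pi> x = 0" using \<pi>(2)[of x] BT(1) by auto
    then show ?case using step by (simp only: \<pi>.add \<pi>.scale T.scale_zero_right add_0_left)
  qed (rule \<pi>.zero)
  have "f - \<pi> f \<in> N" for f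
  proof -
    have "f \<in> T.span BT" using BT by simp
    then show ?thesis
    proof (induction rule: T.span_induct_alt)
      case base then show ?case unfolding N_def \<pi>.zero diff_0_right by (rule T.span_zero)
    next
      case (step c x y)
      have "x - \<pi> x \<in> N" using \<pi>(2)[OF step(1)] BN(1) unfolding N_def by (auto simp: T.span_zero)
      then have "sT c (x - \<pi> x) + (y - \<pi> y) \<in> N" using step(2) unfolding N_def by (intro T.span_add T.span_scale)
      also have "sT c (x - \<pi> x) + (y - \<pi> y) = (sT c x + y) - \<pi> (sT c x + y)"
        by (simp only: \<pi>.add \<pi>.scale T.scale_right_diff_distrib add_diff_add)
      finally show ?case .
    qed
  qed
  then have \<pi>0: "f \<in> N" if "\<pi> f = 0" for f using that by (metis diff_zero)
  show thesis
  proof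
    show "inj_on (\<lambda>x. \<pi> (\<delta> x)) (carrier M)"
    proof
      fix x y assume xy: "x \<in> carrier M" "y \<in> carrier M" "\<pi> (\<delta> x) = \<pi> (\<delta> y)"
      then have "\<delta> x - \<delta> y \<in> N" by (intro \<pi>0) (simp add: \<pi>.diff)
      then have "x \<oplus>\<^bsub>M\<^esub> sm (-1) y = \<zero>\<^bsub>M\<^esub>" using N xy by (fastforce simp: ev_diff \<delta>_FS ev_\<delta>)
      moreover have "y \<oplus>\<^bsub>M\<^esub> sm (-1) y = \<zero>\<^bsub>M\<^esub>" using xy by (simp add: sm_m1)
      ultimately show "x = y" using xy sm_closed by (metis M.add.right_cancel)
    qed
    fix x y assume xy: "x \<in> carrier M" "y \<in> carrier M"
    then have "\<delta> (x \<oplus>\<^bsub>M\<^esub> y) - \<delta> x - \<delta> y \<in> N" unfolding N_def rel_def by (intro T.span_base) blast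
    from \<pi>N[OF this] have "\<pi> (\<delta> (x \<oplus>\<^bsub>M\<^esub> y)) - \<pi> (\<delta> x) - \<pi> (\<delta> y) = 0" by (simp only: \<pi>.diff)
    then show "\<pi> (\<delta> (x \<oplus>\<^bsub>M\<^esub> y)) = \<pi> (\<delta> x) + \<pi> (\<delta> y)"
      by (simp only: diff_diff_add right_minus_eq)
  next
    fix c x assume x: "x \<in> carrier M"
    then have "\<delta> (sm c x) - sT c (\<delta> x) \<in> N" unfolding N_def rel_def by (intro T.span_base) blast
    from \<pi>N[OF this] show "\<pi> (\<delta> (sm c x)) = (\<lambda>t. c * \<pi> (\<delta> x) t)" unfolding \<pi>.diff \<pi>.scale right_minus_eq by (simp only: sT_def)
  qed
qed

lemma binomial_commuting:
  fixes a b :: "'a::ring_1"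
  assumes "a * b = b * a"
  shows "(a + b) ^ n = (\<Sum>k\<le>n. of_nat (n choose k) * a ^ k * b ^ (n - k))"
proof (induction n)
  case (Suc n)
  have c: "b * a ^ k = a ^ k * b" for k
    by (induction k) (simp_all add: mult.assoc[symmetric] assms[symmetric], simp add: mult.assoc)
  have o: "x * (of_nat m * y) = of_nat m * (x * y)" for x y :: 'a and m
    by (metis mult.assoc mult_of_nat_commute)
  have "(a + b) ^ Suc n = a * (a + b) ^ n + b * (a + b) ^ n" by (simp add: distrib_right)
  also have "a * (a + b) ^ n = (\<Sum>k\<le>n. of_nat (n choose k) * (a ^ Suc k * b ^ (n - k)))"
    unfolding Suc sum_distrib_left by (simp add: mult.assoc o)
  also have "\<dots> = (\<Sum>k\<in>{1..Suc n}. of_nat (n choose (k - 1)) * (a ^ k * b ^ (Suc n - k)))"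
    by (rule sum.reindex_bij_witness[of _ "\<lambda>k. k - 1" Suc]) (auto simp: Suc_diff_le)
  also have "\<dots> = (\<Sum>k\<le>Suc n. (if k = 0 then 0 else of_nat (n choose (k - 1))) * (a ^ k * b ^ (Suc n - k)))"
    by (rule sum.mono_neutral_cong_left) auto
  also have "b * (a + b) ^ n = (\<Sum>k\<le>n. of_nat (n choose k) * (a ^ k * b ^ (Suc n - k)))"
    unfolding Suc sum_distrib_left
  proof (rule sum.cong[OF refl])
    fix k assume "k \<in> {..n}"
    then have "b ^ (Suc n - k) = b * b ^ (n - k)" by (simp add: Suc_diff_le)
    then show "b * (of_nat (n choose k) * a ^ k * b ^ (n - k)) = of_nat (n choose k) * (a ^ k * b ^ (Suc n - k))"
      by (simp only: mult.assoc o) (simp only: mult.assoc[symmetric] c)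
  qed
  also have "\<dots> = (\<Sum>k\<le>Suc n. of_nat (n choose k) * (a ^ k * b ^ (Suc n - k)))"
    by (simp add: binomial_eq_0)
  finally have "(a + b) ^ Suc n = (\<Sum>k\<le>Suc n. ((if k = 0 then 0 else of_nat (n choose (k - 1))) + of_nat (n choose k)) * (a ^ k * b ^ (Suc n - k)))"
    by (simp only: sum.distrib[symmetric] distrib_right)
  also have "\<dots> = (\<Sum>k\<le>Suc n. of_nat (Suc n choose k) * a ^ k * b ^ (Suc n - k))"
  proof (rule sum.cong[OF refl])
    fix k
    show "((if k = 0 then 0 else of_nat (n choose (k - 1))) + of_nat (n choose k)) * (a ^ k * b ^ (Suc n - k))
        = of_nat (Suc n choose k) * a ^ k * b ^ (Suc n - k)"
      by (cases k) (simp_all add: mult.assoc)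
  qed
  finally show ?case .
qed simp

text \<open>The Frobenius identity inside a noncommutative ring. It is applied to a letter and a
  scalar, which commute.\<close>

lemma commuting_power_prime_CHAR:
  fixes a b :: "'a::ring_1"
  assumes "a * b = b * a" "prime p" "of_nat p = (0 :: 'a)"
  shows "(a + b) ^ p = a ^ p + b ^ p"
proof -
  have p: "p > 0" using assms(2) prime_gt_0_nat by blast
  have "(a + b) ^ p = (\<Sum>k\<le>p. if k = 0 then b ^ p else if k = p then a ^ p else 0)"
    unfolding binomial_commuting[OF assms(1)]
  proof (rule sum.cong[OF refl])
    fix k assume k: "k \<in> {..p}"
    have "of_nat (p choose k) = (0 :: 'a)" if "k \<noteq> 0" "k \<noteq> p"
    proof -
      have "p dvd p choose k" using that k assms(2) by (intro dvd_choose_prime) auto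
      then show ?thesis using assms(3) by (auto simp: dvd_def)
    qed
    then show "of_nat (p choose k) * a ^ k * b ^ (p - k) = (if k = 0 then b ^ p else if k = p then a ^ p else 0)"
      using k by auto
  qed
  also have "\<dots> = (\<Sum>k\<in>{0, p}. if k = 0 then b ^ p else if k = p then a ^ p else 0)"
    by (rule sum.mono_neutral_right) auto
  also have "\<dots> = a ^ p + b ^ p" using p by (simp add: add.commute)
  finally show ?thesis .
qed

section \<open>The free algebra and its quotients\<close>

lemma single_times_single: "Poly_Mapping.single u c * Poly_Mapping.single v d = Poly_Mapping.single (u @ v) (c * d)"
  by (simp add: mult_single plus_list_def)

lemma one_free: "(1 :: 'g list \<Rightarrow>\<^sub>0 'k::field) = Poly_Mapping.single [] 1"
  by (simp add: zero_list_def flip: single_one)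

lemma scalar_add: "scalar (a + b) = scalar a + scalar b"
  by (simp add: scalar_def single_add)

lemma scalar_mult: "scalar (a * b) = scalar a * scalar b"
  by (simp add: scalar_def single_times_single)

lemma scalar_1: "scalar 1 = 1"
  by (simp add: scalar_def one_free)

lemma scalar_0: "scalar 0 = 0"
  by (simp add: scalar_def)

lemma scalar_minus: "scalar (- a) = - scalar a"
  using scalar_add[of a "- a"] by (simp add: scalar_0 eq_neg_iff_add_eq_0 add.commute)

lemma scalar_of_nat: "scalar (of_nat n) = of_nat n"
  by (induction n) (simp_all add: scalar_0 scalar_add scalar_1)

lemma scalar_power: "scalar (a ^ n) = scalar a ^ n"
  by (induction n) (simp_all add: scalar_1 scalar_mult)

lemma scalar_single: "scalar c * Poly_Mapping.single w d = Poly_Mapping.single w (c * d)"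
  by (simp add: scalar_def single_times_single)

lemma poly_mapping_sum_single: "f = (\<Sum>w\<in>Poly_Mapping.keys f. Poly_Mapping.single w (Poly_Mapping.lookup f w))"
  by (rule poly_mapping_eqI) (simp add: lookup_sum lookup_single when_def in_keys_iff)

lemma scalar_comm:
  fixes f :: "'g list \<Rightarrow>\<^sub>0 'k::field"
  shows "scalar c * f = f * scalar c"
proof -
  have "scalar c * Poly_Mapping.single w d = Poly_Mapping.single w d * scalar c" for w :: "'g list" and d
    by (simp add: scalar_def single_times_single mult.commute)
  then have "scalar c * (\<Sum>w\<in>Poly_Mapping.keys f. Poly_Mapping.single w (Poly_Mapping.lookup f w))
     = (\<Sum>w\<in>Poly_Mapping.keys f. Poly_Mapping.single w (Poly_Mapping.lookup f w)) * scalar c"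
    by (simp add: sum_distrib_left sum_distrib_right)
  then show ?thesis using poly_mapping_sum_single[of f] by metis
qed

lemma carrier_free_alg: "f \<in> carrier (free_alg A) \<longleftrightarrow> (\<forall>w\<in>Poly_Mapping.keys f. set w \<subseteq> A)"
  by (simp add: free_alg_def)

lemma free_alg_simps [simp]: "mult (free_alg A) = (*)" "one (free_alg A) = 1" "zero (free_alg A) = 0"
  "add (free_alg A) = (+)"
  by (simp_all add: free_alg_def)

lemma free_alg_mono: "A \<subseteq> A' \<Longrightarrow> carrier (free_alg A) \<subseteq> carrier (free_alg A')"
  by (meson carrier_free_alg subsetI subset_trans)

lemma free_alg_closed:
  "0 \<in> carrier (free_alg A)" "1 \<in> carrier (free_alg A)" "scalar c \<in> carrier (free_alg A)"
  "x \<in> A \<Longrightarrow> letter x \<in> carrier (free_alg A)"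
  "f \<in> carrier (free_alg A) \<Longrightarrow> g \<in> carrier (free_alg A) \<Longrightarrow> f + g \<in> carrier (free_alg A)"
  "f \<in> carrier (free_alg A) \<Longrightarrow> g \<in> carrier (free_alg A) \<Longrightarrow> f * g \<in> carrier (free_alg A)"
  "f \<in> carrier (free_alg A) \<Longrightarrow> - f \<in> carrier (free_alg A)"
  "f \<in> carrier (free_alg A) \<Longrightarrow> g \<in> carrier (free_alg A) \<Longrightarrow> f - g \<in> carrier (free_alg A)"
  "f \<in> carrier (free_alg A) \<Longrightarrow> f ^ n \<in> carrier (free_alg A)"
proof -
  show one: "1 \<in> carrier (free_alg A)" by (simp add: carrier_free_alg one_free)
  show "0 \<in> carrier (free_alg A)" "scalar c \<in> carrier (free_alg A)" "x \<in> A \<Longrightarrow> letter x \<in> carrier (free_alg A)"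
    by (simp_all add: carrier_free_alg scalar_def letter_def)
  show "f + g \<in> carrier (free_alg A)" if "f \<in> carrier (free_alg A)" "g \<in> carrier (free_alg A)" for f g
    using that keys_add[of f g] unfolding carrier_free_alg by blast
  show m: "f * g \<in> carrier (free_alg A)" if "f \<in> carrier (free_alg A)" "g \<in> carrier (free_alg A)" for f g
    using that keys_mult[of f g] unfolding carrier_free_alg plus_list_def by fastforce
  show "- f \<in> carrier (free_alg A)" if "f \<in> carrier (free_alg A)" for f
    using that unfolding carrier_free_alg by simp
  show "f - g \<in> carrier (free_alg A)" if "f \<in> carrier (free_alg A)" "g \<in> carrier (free_alg A)" for f g
    using that keys_diff[of f g] unfolding carrier_free_alg by blast
  show "f ^ n \<in> carrier (free_alg A)" if "f \<in> carrier (free_alg A)" for f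
    using that by (induction n) (simp_all add: one m)
qed

lemma ring_free_alg: "ring (free_alg A)"
proof (rule ringI)
  show "abelian_group (free_alg A)"
  proof (rule abelian_groupI)
    fix f assume "f \<in> carrier (free_alg A)"
    then show "\<exists>g\<in>carrier (free_alg A). g \<oplus>\<^bsub>free_alg A\<^esub> f = \<zero>\<^bsub>free_alg A\<^esub>"
      by (intro bexI[of _ "- f"]) (simp_all add: free_alg_closed)
  qed (simp_all add: free_alg_closed ac_simps)
  show "monoid (free_alg A)" by (rule monoidI) (simp_all add: free_alg_closed mult.assoc)
qed (simp_all add: distrib_left distrib_right)

lemma free_alg_minus: "f \<in> carrier (free_alg A) \<Longrightarrow> \<ominus>\<^bsub>free_alg A\<^esub> f = - f"
proof -
  interpret ring "free_alg A" by (rule ring_free_alg)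
  assume f: "f \<in> carrier (free_alg A)"
  then show ?thesis by (intro minus_equality) (simp_all add: free_alg_closed)
qed

lemma free_alg_induct [consumes 1, case_names zero step]:
  fixes f :: "'g list \<Rightarrow>\<^sub>0 'k::field"
  assumes "f \<in> carrier (free_alg A)" "P 0"
    "\<And>c w g. set w \<subseteq> A \<Longrightarrow> g \<in> carrier (free_alg A) \<Longrightarrow> P g \<Longrightarrow> P (scalar c * Poly_Mapping.single w 1 + g)"
  shows "P f"
proof -
  have "P (\<Sum>w\<in>S. Poly_Mapping.single w (Poly_Mapping.lookup f w)) \<and>
      (\<Sum>w\<in>S. Poly_Mapping.single w (Poly_Mapping.lookup f w)) \<in> carrier (free_alg A)"
    if "finite S" "S \<subseteq> Poly_Mapping.keys f" for S
    using that
  proof (induction S rule: finite_induct)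
    case (insert w S)
    then have "set w \<subseteq> A" using assms(1) by (auto simp: carrier_free_alg)
    moreover from this have "Poly_Mapping.single w c \<in> carrier (free_alg A)" for c :: 'k by (simp add: carrier_free_alg)
    ultimately show ?case using insert assms(3)[of w _ "Poly_Mapping.lookup f w"]
      by (simp add: scalar_single free_alg_closed(5))
  qed (simp add: assms(2) free_alg_closed)
  then show ?thesis using poly_mapping_sum_single[of f] by (metis finite_keys order_refl)
qed

text \<open>Restricted subalgebras: closure under the \<open>p\<close>-map keeps the reduced
  relations of \<open>A\<close> inside \<open>free_alg A\<close>.\<close>

definition subalgebra :: "('k::field, 'g::ab_group_add) lsuper \<Rightarrow> 'g set \<Rightarrow> bool" where
  "subalgebra G A \<longleftrightarrow> module.subspace (scl G) A \<and> A \<subseteq> space_of G \<and> (\<forall>x\<in>A. \<forall>y\<in>A. brk G x y \<in> A) \<and>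
     (\<forall>x\<in>A \<inter> part G False. ppow G x \<in> A)"

lemma relations_carrier:
  assumes "lie_superalgebra G" "subalgebra G A"
  shows "tensor_relations G A \<union> enveloping_relations G A \<union> reduced_relations G chi A \<subseteq> carrier (free_alg A)"
proof -
  have "vector_space (scl G)" using assms(1) by (simp add: lie_superalgebra_def graded_space_def)
  then interpret vector_space "scl G" .
  have "x + y \<in> A" "scl G c x \<in> A" if "x \<in> A" "y \<in> A" for x y c
    using assms(2) that unfolding subalgebra_def by (auto intro: subspace_add subspace_scale)
  then show ?thesis using assms(2)
    unfolding subalgebra_def tensor_relations_def enveloping_relations_def reduced_relations_def
    by (auto intro!: free_alg_closed)
qed

lemma red_ideal_ideal:
  assumes "lie_superalgebra G" "subalgebra G A"
  shows "ideal (red_ideal G chi A) (free_alg A)"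
  unfolding red_ideal_def by (rule ring.genideal_ideal[OF ring_free_alg relations_carrier[OF assms]])

lemma red_ideal_relations:
  assumes "lie_superalgebra G" "subalgebra G A"
  shows "tensor_relations G A \<subseteq> red_ideal G chi A" "enveloping_relations G A \<subseteq> red_ideal G chi A"
    "reduced_relations G chi A \<subseteq> red_ideal G chi A"
  using ring.genideal_self[OF ring_free_alg relations_carrier[OF assms, of chi]] unfolding red_ideal_def by auto

lemma red_ideal_closed:
  assumes "lie_superalgebra G" "subalgebra G A"
  shows "red_ideal G chi A \<subseteq> carrier (free_alg A)" "0 \<in> red_ideal G chi A"
    "f \<in> red_ideal G chi A \<Longrightarrow> g \<in> red_ideal G chi A \<Longrightarrow> f + g \<in> red_ideal G chi A"
    "f \<in> red_ideal G chi A \<Longrightarrow> - f \<in> red_ideal G chi A"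
    "f \<in> red_ideal G chi A \<Longrightarrow> g \<in> carrier (free_alg A) \<Longrightarrow> g * f \<in> red_ideal G chi A"
    "f \<in> red_ideal G chi A \<Longrightarrow> g \<in> carrier (free_alg A) \<Longrightarrow> f * g \<in> red_ideal G chi A"
proof -
  interpret ideal "red_ideal G chi A" "free_alg A" by (rule red_ideal_ideal[OF assms])
  show 1: "red_ideal G chi A \<subseteq> carrier (free_alg A)" using a_subset .
  show "0 \<in> red_ideal G chi A" using additive_subgroup.zero_closed[OF is_additive_subgroup] by simp
  show "f \<in> red_ideal G chi A \<Longrightarrow> g \<in> red_ideal G chi A \<Longrightarrow> f + g \<in> red_ideal G chi A"
    using additive_subgroup.a_closed[OF is_additive_subgroup] by simp
  show "f \<in> red_ideal G chi A \<Longrightarrow> - f \<in> red_ideal G chi A"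
    using additive_subgroup.a_inv_closed[OF is_additive_subgroup, of f] free_alg_minus[of f A] 1 by auto
  show "f \<in> red_ideal G chi A \<Longrightarrow> g \<in> carrier (free_alg A) \<Longrightarrow> g * f \<in> red_ideal G chi A"
    using I_l_closed by simp
  show "f \<in> red_ideal G chi A \<Longrightarrow> g \<in> carrier (free_alg A) \<Longrightarrow> f * g \<in> red_ideal G chi A"
    using I_r_closed by simp
qed

text \<open>The larger ideal, cut down to \<open>free_alg A\<close>, is an ideal that contains the
  relations for \<open>A\<close>; the generated ideal is the least such.\<close>

lemma red_ideal_mono:
  fixes G :: "('k::field, 'g::ab_group_add) lsuper"
  assumes "lie_superalgebra G" "subalgebra G A" "subalgebra G A'" "A \<subseteq> A'"
  shows "red_ideal G chi A \<subseteq> red_ideal G chi A'"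
proof -
  define J where "J = red_ideal G chi A' \<inter> carrier (free_alg A)"
  have c: "carrier (free_alg A) \<subseteq> carrier (free_alg A')" using assms(4) by (rule free_alg_mono)
  have "ideal J (free_alg A)"
  proof (rule idealI[OF ring_free_alg])
    show "subgroup J (add_monoid (free_alg A))"
    proof
      fix f assume "f \<in> J"
      then show "inv\<^bsub>add_monoid (free_alg A)\<^esub> f \<in> J"
        using free_alg_minus[of f A] red_ideal_closed(4)[OF assms(1,3)] free_alg_closed(7)
        unfolding J_def a_inv_def[symmetric] by auto
    qed (use red_ideal_closed[OF assms(1,3)] in \<open>auto simp: J_def free_alg_closed\<close>)
    fix f g :: "'g list \<Rightarrow>\<^sub>0 'k"
    assume "f \<in> J" "g \<in> carrier (free_alg A)"
    then show "g \<otimes>\<^bsub>free_alg A\<^esub> f \<in> J" "f \<otimes>\<^bsub>free_alg A\<^esub> g \<in> J"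
      using red_ideal_closed(5,6)[OF assms(1,3)] c unfolding J_def by (auto simp: free_alg_closed)
  qed
  moreover have "tensor_relations G A \<union> enveloping_relations G A \<union> reduced_relations G chi A \<subseteq> J"
  proof -
    have "tensor_relations G A \<union> enveloping_relations G A \<union> reduced_relations G chi A
      \<subseteq> tensor_relations G A' \<union> enveloping_relations G A' \<union> reduced_relations G chi A'"
      using assms(4) unfolding tensor_relations_def enveloping_relations_def reduced_relations_def by blast
    then show ?thesis using relations_carrier[OF assms(1,2)] red_ideal_relations[OF assms(1,3)] unfolding J_def by blast
  qed
  ultimately have "red_ideal G chi A \<subseteq> J"
    unfolding red_ideal_def by (rule ring.genideal_minimal[OF ring_free_alg])
  then show ?thesis unfolding J_def by auto
qed

lemma coset_eq_iff:
  assumes "lie_superalgebra G" "subalgebra G A" "f \<in> carrier (free_alg A)" "g \<in> carrier (free_alg A)"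
  shows "red_ideal G chi A +>\<^bsub>free_alg A\<^esub> f = red_ideal G chi A +>\<^bsub>free_alg A\<^esub> g \<longleftrightarrow> f - g \<in> red_ideal G chi A"
proof -
  interpret ring "free_alg A" by (rule ring_free_alg)
  show ?thesis
    using quotient_eq_iff_same_a_r_cos[OF red_ideal_ideal[OF assms(1,2)] assms(3,4)] assms(4)
    unfolding a_minus_def by (simp add: free_alg_minus)
qed

lemma coset_set: "I +>\<^bsub>free_alg A\<^esub> f = {h + f | h. h \<in> I}"
  unfolding a_r_coset_def' by auto

text \<open>The canonical map of enveloping algebras, in the form in which
  \<open>restrict_module\<close> applies it: the smaller ideal is absorbed by the larger
  one.\<close>

lemma coset_enlarge:
  assumes "lie_superalgebra G" "subalgebra G A" "subalgebra G A'" "A \<subseteq> A'"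
  shows "(red_ideal G chi A +>\<^bsub>free_alg A\<^esub> f) <+>\<^bsub>free_alg A'\<^esub> red_ideal G chi A' = red_ideal G chi A' +>\<^bsub>free_alg A'\<^esub> f"
proof -
  have "\<exists>h'\<in>red_ideal G chi A'. h + f + g = h' + f" if "h \<in> red_ideal G chi A" "g \<in> red_ideal G chi A'" for h g
    using that subsetD[OF red_ideal_mono[OF assms]] red_ideal_closed(3)[OF assms(1,3)]
    by (intro bexI[of _ "h + g"]) (simp_all add: ac_simps)
  moreover have "\<exists>h\<in>red_ideal G chi A. \<exists>h'\<in>red_ideal G chi A'. g + f = h + f + h'" if "g \<in> red_ideal G chi A'" for g
    using that red_ideal_closed(2)[OF assms(1,2)]
    by (intro bexI[of _ 0] bexI[of _ g]) (auto simp: ac_simps)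
  ultimately show ?thesis unfolding coset_set set_add_def' by fastforce
qed

lemma red_env_simps:
  "carrier (red_env G chi A) = {red_ideal G chi A +>\<^bsub>free_alg A\<^esub> f | f. f \<in> carrier (free_alg A)}"
  "\<zero>\<^bsub>red_env G chi A\<^esub> = red_ideal G chi A"
  by (auto simp: red_env_def FactRing_def A_RCOSETS_def')

lemma red_env_hom:
  assumes "lie_superalgebra G" "subalgebra G A" "f \<in> carrier (free_alg A)" "g \<in> carrier (free_alg A)"
  shows "(red_ideal G chi A +>\<^bsub>free_alg A\<^esub> f) \<oplus>\<^bsub>red_env G chi A\<^esub> (red_ideal G chi A +>\<^bsub>free_alg A\<^esub> g)
      = red_ideal G chi A +>\<^bsub>free_alg A\<^esub> (f + g)"
    "(red_ideal G chi A +>\<^bsub>free_alg A\<^esub> f) \<otimes>\<^bsub>red_env G chi A\<^esub> (red_ideal G chi A +>\<^bsub>free_alg A\<^esub> g)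
      = red_ideal G chi A +>\<^bsub>free_alg A\<^esub> (f * g)"
    "\<one>\<^bsub>red_env G chi A\<^esub> = red_ideal G chi A +>\<^bsub>free_alg A\<^esub> 1"
proof -
  interpret ideal "red_ideal G chi A" "free_alg A" by (rule red_ideal_ideal[OF assms(1,2)])
  have h: "(+>\<^bsub>free_alg A\<^esub>) (red_ideal G chi A) \<in> ring_hom (free_alg A) (free_alg A Quot red_ideal G chi A)"
    by (rule rcos_ring_hom)
  show "(red_ideal G chi A +>\<^bsub>free_alg A\<^esub> f) \<oplus>\<^bsub>red_env G chi A\<^esub> (red_ideal G chi A +>\<^bsub>free_alg A\<^esub> g)
      = red_ideal G chi A +>\<^bsub>free_alg A\<^esub> (f + g)"
    using ring_hom_add[OF h assms(3,4)] by (simp add: red_env_def)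
  show "(red_ideal G chi A +>\<^bsub>free_alg A\<^esub> f) \<otimes>\<^bsub>red_env G chi A\<^esub> (red_ideal G chi A +>\<^bsub>free_alg A\<^esub> g)
      = red_ideal G chi A +>\<^bsub>free_alg A\<^esub> (f * g)"
    using ring_hom_mult[OF h assms(3,4)] by (simp add: red_env_def)
  show "\<one>\<^bsub>red_env G chi A\<^esub> = red_ideal G chi A +>\<^bsub>free_alg A\<^esub> 1"
    using ring_hom_one[OF h] by (simp add: red_env_def)
qed

lemma coset_zero:
  assumes "lie_superalgebra G" "subalgebra G A"
  shows "red_ideal G chi A +>\<^bsub>free_alg A\<^esub> 0 = red_ideal G chi A"
  unfolding coset_set by auto

lemma part_space:
  assumes "lie_superalgebra G"
  shows "part G a \<subseteq> space_of G"
proof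
  fix z assume z: "z \<in> part G a"
  have gs: "vector_space (scl G)" "\<And>a. module.subspace (scl G) (part G a)"
    using assms by (auto simp: lie_superalgebra_def graded_space_def)
  then interpret vector_space "scl G" by simp
  have "0 \<in> part G b" for b using gs(2) by (rule subspace_0)
  then show "z \<in> space_of G" unfolding total_def using z
    by (cases a) (force intro: exI[of _ 0] exI[of _ z])+
qed

text \<open>What the freeness argument asks of \<open>m\<close>. By \<open>iso\<close> no bracket of
  basis vectors has a constant term under \<open>chi\<close>; \<open>pow\<close> makes the
  \<open>p\<close>-map multiply depth by \<open>p\<close>; \<open>neg_span\<close> places all of
  degree -2 and below in \<open>m\<close>, degree by degree.\<close>

locale adapted_basis =
  fixes G :: "('k::field, 'g::ab_group_add) lsuper" and chi :: "'g \<Rightarrow> 'k" and gr :: "int \<Rightarrow> 'g set" and m :: "'g set"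
    and n :: nat and x y :: "nat \<Rightarrow> 'g" and kk :: "nat \<Rightarrow> nat" and pp :: "nat \<Rightarrow> bool"
  assumes lie: "lie_superalgebra G"
    and char: "CHAR('k) > 2"
    and sub_m: "subalgebra G m" and sub_space: "subalgebra G (space_of G)"
    and chi_add: "z \<in> space_of G \<Longrightarrow> z' \<in> space_of G \<Longrightarrow> chi (z + z') = chi z + chi z'"
    and chi_scale: "z \<in> space_of G \<Longrightarrow> chi (scl G c z) = c * chi z"
    and chi_odd: "z \<in> part G True \<Longrightarrow> chi z = 0"
    and chi_gr: "z \<in> gr l \<Longrightarrow> l \<noteq> -2 \<Longrightarrow> chi z = 0"
    and br_gr: "z \<in> gr l \<Longrightarrow> z' \<in> gr l' \<Longrightarrow> brk G z z' \<in> gr (l + l')"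
    and x: "i < n \<Longrightarrow> x i \<in> gr (- int (kk i))" "i < n \<Longrightarrow> x i \<in> part G (pp i)" "i < n \<Longrightarrow> kk i > 0"
    and y: "i < n \<Longrightarrow> y i \<in> gr (int (kk i) - 2)" "i < n \<Longrightarrow> y i \<in> part G (pp i)"
    and dual: "i < n \<Longrightarrow> j < n \<Longrightarrow> chi (brk G (x i) (y j)) = (if i = j then 1 else 0)"
    and kk_mono: "i \<le> j \<Longrightarrow> j < n \<Longrightarrow> kk i \<le> kk j"
    and m_span: "m = module.span (scl G) (x ` {..<n})"
    and neg_span: "z \<in> gr (- k) \<Longrightarrow> k \<ge> 2 \<Longrightarrow> z \<in> module.span (scl G) (x ` {i. i < n \<and> int (kk i) = k})"
    and iso: "i < n \<Longrightarrow> j < n \<Longrightarrow> chi (brk G (x i) (x j)) = 0"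
    and pow: "i < n \<Longrightarrow> \<not> pp i \<Longrightarrow> ppow G (x i) \<in> module.span (scl G) (x ` {l. l < n \<and> CHAR('k) * kk i \<le> kk l})"
begin

sublocale g: vector_space "scl G"
  using lie by (simp add: lie_superalgebra_def graded_space_def)

lemma m_space: "m \<subseteq> space_of G" using sub_m unfolding subalgebra_def by blast

lemma m_sub: "g.subspace m" using sub_m unfolding subalgebra_def by blast

lemma x_m: "i < n \<Longrightarrow> x i \<in> m" unfolding m_span by (auto intro: g.span_base)

lemma prime: "prime CHAR('k)"
  using char by (intro prime_CHAR_semidom) simp

lemma two: "(2::'k) \<noteq> 0"
proof
  assume "(2::'k) = 0"
  then have "CHAR('k) dvd 2" using of_nat_eq_0_iff_char_dvd[of 2, where 'a = 'k] by simp
  then show False using char dvd_imp_le by fastforce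
qed

abbreviation I where "I \<equiv> red_ideal G chi m"
text \<open>Since \<open>chi\<close> kills brackets inside \<open>m\<close>, the relations between
  the shifted generators have no constant terms.\<close>

definition e :: "nat \<Rightarrow> 'g list \<Rightarrow>\<^sub>0 'k" where "e i = letter (x i) - scalar (chi (x i))"
text \<open>With this weight the bracket of two elements of degrees \<open>-k\<close> and \<open>-l\<close> has larger weight than their product.\<close>

definition kap :: "nat \<Rightarrow> nat" where "kap i = 2 * kk i - 1"
definition sg :: "nat \<Rightarrow> nat \<Rightarrow> 'k" where "sg i j = ksign (pp i) (pp j)"
definition topx :: "nat \<Rightarrow> nat" where "topx i = (if pp i then 1 else CHAR('k) - 1)"
definition Top :: "nat multiset" where "Top = (\<Sum>i<n. replicate_mset (topx i) i)"

lemma count_Top: "count Top i = (if i < n then topx i else 0)"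
proof -
  have "count (\<Sum>i<k. replicate_mset (topx i) i) j = (if j < k then topx j else 0)" for k j
    by (induction k) auto
  then show ?thesis unfolding Top_def by blast
qed

lemma topx_pos: "topx i > 0"
  using char by (auto simp: topx_def)

abbreviation scU :: "'k \<Rightarrow> ('g list \<Rightarrow>\<^sub>0 'k) \<Rightarrow> ('g list \<Rightarrow>\<^sub>0 'k)" where "scU a u \<equiv> scalar a * u"

sublocale U: vector_space scU
  by unfold_locales (simp_all add: scalar_add scalar_mult scalar_1 algebra_simps)

lemmas Ic = red_ideal_closed[OF lie sub_m, where chi = chi]

lemma I_sub: "U.subspace I"
  using Ic(2,3) Ic(5)[OF _ free_alg_closed(3)] by (intro U.subspaceI) auto

lemma e_carrier: "i < n \<Longrightarrow> e i \<in> carrier (free_alg m)"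
  unfolding e_def using x_m by (intro free_alg_closed) auto

lemma letter_add: "z \<in> m \<Longrightarrow> z' \<in> m \<Longrightarrow> letter (z + z') - letter z - letter z' \<in> I"
  using red_ideal_relations(1)[OF lie sub_m, of chi] unfolding tensor_relations_def by blast

lemma letter_scale: "z \<in> m \<Longrightarrow> letter (scl G c z) - scU c (letter z) \<in> I"
  using red_ideal_relations(1)[OF lie sub_m, of chi] unfolding tensor_relations_def by blast

lemma letter_0: "letter 0 \<in> I"
  using letter_add[of 0 0] Ic(4)[of "- letter 0"] g.subspace_0[OF m_sub] by simp

lemma chi_0: "chi 0 = 0"
  using chi_scale[of 0 0] m_space g.subspace_0[OF m_sub] by auto

text \<open>Letters are additive and homogeneous modulo the tensor relations in \<open>I\<close>,
  and \<open>chi\<close> is linear, so the shift is compatible with linear combinations.\<close>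

lemma letter_span:
  assumes "S \<subseteq> {..<n}" "z \<in> g.span (x ` S)"
  shows "letter z - scalar (chi z) \<in> U.span (I \<union> e ` S)" (is "?P z")
proof -
  have "z \<in> m \<and> ?P z" using assms(2)
proof (induction rule: g.span_induct_alt)
  case base
  then show ?case using letter_0 g.subspace_0[OF m_sub] by (simp add: chi_0 scalar_0 U.span_base)
next
  case (step c z z')
  then obtain i where i: "i \<in> S" "z = x i" by auto
  then have zm: "z \<in> m" using assms(1) x_m by auto
  have z'm: "z' \<in> m" using step(2) by simp
  have czm: "scl G c z \<in> m" using zm m_sub by (rule g.subspace_scale[rotated])
  have "chi (scl G c z + z') = c * chi z + chi z'"
    using zm z'm czm m_space by (simp add: chi_add chi_scale subsetD)
  then have "letter (scl G c z + z') - scalar (chi (scl G c z + z'))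
     = (letter (scl G c z + z') - letter (scl G c z) - letter z') + (letter (scl G c z) - scU c (letter z))
       + (scU c (e i) + (letter z' - scalar (chi z')))"
    using i by (simp add: e_def scalar_add scalar_mult algebra_simps)
  moreover have "scU c (e i) \<in> U.span (I \<union> e ` S)" using i by (intro U.span_scale U.span_base) auto
  moreover have "letter (scl G c z + z') - letter (scl G c z) - letter z' \<in> U.span (I \<union> e ` S)"
    "letter (scl G c z) - scU c (letter z) \<in> U.span (I \<union> e ` S)"
    using letter_add[OF czm z'm] letter_scale[OF zm, of c] by (simp_all add: U.span_base)
  ultimately show ?case
    using step(2) g.subspace_add[OF m_sub czm z'm] by (simp only: U.span_add simp_thms)
qed
  then show ?thesis by simp
qed

lemma brk_x_span:
  assumes "i < n" "j < n"
  shows "brk G (x i) (x j) \<in> g.span (x ` {l. l < n \<and> kk l = kk i + kk j})"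
proof -
  have "brk G (x i) (x j) \<in> gr (- (int (kk i) + int (kk j)))"
    using br_gr[OF x(1)[OF assms(1)] x(1)[OF assms(2)]] by simp
  then have "brk G (x i) (x j) \<in> g.span (x ` {l. l < n \<and> int (kk l) = int (kk i) + int (kk j)})"
    using x(3)[OF assms(1)] x(3)[OF assms(2)] by (intro neg_span) auto
  moreover have "{l. l < n \<and> int (kk l) = int (kk i) + int (kk j)} = {l. l < n \<and> kk l = kk i + kk j}" by auto
  ultimately show ?thesis by simp
qed

text \<open>The enveloping relation supplies the bracket of \<open>x i\<close> and
  \<open>x j\<close>, on which \<open>chi\<close> vanishes. If both are odd their shifts are zero;
  otherwise the sign is 1 and the scalars cancel.\<close>

lemma e_commute:
  assumes "i < n" "j < n"
  shows "e i * e j - scU (sg i j) (e j * e i) \<in> U.span (I \<union> e ` {l. l < n \<and> kap i + kap j < kap l})"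
proof -
  define u where "u = letter (x i) * letter (x j) - scU (sg i j) (letter (x j)) * letter (x i) - letter (brk G (x i) (x j))"
  have u: "u \<in> I"
    using red_ideal_relations(2)[OF lie sub_m, of chi] x(2) x_m assms
    unfolding enveloping_relations_def u_def sg_def by blast
  have "e i * e j - scU (sg i j) (e j * e i) = u + (letter (brk G (x i) (x j)) - scalar (chi (brk G (x i) (x j))))"
  proof (cases "pp i \<and> pp j")
    case True
    then have "chi (x i) = 0" "chi (x j) = 0" using chi_odd x(2)[OF assms(1)] x(2)[OF assms(2)] by auto
    then show ?thesis by (simp add: e_def u_def iso[OF assms] scalar_0 mult.assoc)
  next
    case False
    then have "sg i j = 1" by (auto simp: sg_def ksign_def)
    then show ?thesis
      by (simp add: e_def u_def iso[OF assms] scalar_0 scalar_1 algebra_simps scalar_comm[of "chi (x i)" "letter (x j)"]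
          scalar_comm[of "chi (x j)" "letter (x i)"] flip: scalar_mult)
  qed
  moreover have "letter (brk G (x i) (x j)) - scalar (chi (brk G (x i) (x j)))
      \<in> U.span (I \<union> e ` {l. l < n \<and> kk l = kk i + kk j})"
    using brk_x_span[OF assms] by (intro letter_span) auto
  \<comment> \<open>With \<open>kk l = kk i + kk j\<close> the weight of \<open>l\<close> is
    \<open>2 * (kk i + kk j) - 1\<close>, one more than \<open>kap i + kap j\<close>.\<close>
  moreover have "U.span (I \<union> e ` {l. l < n \<and> kk l = kk i + kk j}) \<subseteq> U.span (I \<union> e ` {l. l < n \<and> kap i + kap j < kap l})"
    using x(3)[OF assms(1)] x(3)[OF assms(2)] by (intro U.span_mono) (auto simp: kap_def)
  moreover have "u \<in> U.span (I \<union> e ` {l. l < n \<and> kap i + kap j < kap l})" using u by (intro U.span_base) auto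
  ultimately show ?thesis by (auto intro: U.span_add)
qed

text \<open>For an odd generator the square is half the supercommutator. For an even one the
  Frobenius identity and the reduced relation leave \<open>ppow G (x i)\<close>, which lies
  \<open>p\<close> times as deep.\<close>

lemma e_power:
  assumes "i < n"
  shows "e i ^ Suc (count Top i) \<in> U.span (I \<union> e ` {l. l < n \<and> Suc (count Top i) * kap i < kap l})"
proof (cases "pp i")
  case True
  have "sg i i = - 1" using True by (simp add: sg_def ksign_def)
  then have "e i * e i + e i * e i \<in> U.span (I \<union> e ` {l. l < n \<and> 2 * kap i < kap l})"
    using e_commute[OF assms assms] by (simp add: scalar_minus scalar_1 mult_2)
  then have "scU (1 / 2) (e i * e i + e i * e i) \<in> U.span (I \<union> e ` {l. l < n \<and> 2 * kap i < kap l})"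
    by (rule U.span_scale)
  moreover have "scU (1 / 2) (e i * e i + e i * e i) = e i * e i"
  proof -
    have "e i * e i + e i * e i = scU 2 (e i * e i)"
    proof -
      have "scalar (2::'k) = (2 :: 'g list \<Rightarrow>\<^sub>0 'k)" using scalar_of_nat[of 2] by simp
      then show ?thesis by (simp only: mult_2)
    qed
    then show ?thesis using two by (simp add: mult.assoc[symmetric] scalar_1 flip: scalar_mult)
  qed
  ultimately show ?thesis using assms True by (simp add: count_Top topx_def numeral_2_eq_2)
next
  case False
  define p where "p = CHAR('k)"
  have p: "p > 2" "prime p" using char prime by (auto simp: p_def)
  have c: "Suc (count Top i) = p" using assms False p by (simp add: count_Top topx_def p_def)
  have xp: "x i \<in> part G False" using x(2)[OF assms] False by simp
  have p0: "of_nat p = (0 :: 'g list \<Rightarrow>\<^sub>0 'k)"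
  proof -
    have "scalar (of_nat p :: 'k) = (of_nat p :: 'g list \<Rightarrow>\<^sub>0 'k)" by (rule scalar_of_nat)
    moreover have "of_nat p = (0::'k)" unfolding p_def by simp
    ultimately show ?thesis by (simp add: scalar_0)
  qed
  have "e i ^ p = (letter (x i) + scalar (- chi (x i))) ^ p" by (simp add: e_def scalar_minus)
  also have "\<dots> = letter (x i) ^ p + scalar (- chi (x i)) ^ p"
    by (rule commuting_power_prime_CHAR[OF _ p(2) p0]) (rule scalar_comm[symmetric])
  \<comment> \<open>Here \<open>p\<close> is odd, so the sign comes out of the power.\<close>
  also have "scalar (- chi (x i)) ^ p = - scalar (chi (x i) ^ p)"
    using p prime_odd_nat[of p] by (simp add: scalar_minus scalar_power)
  finally have ep: "e i ^ p = letter (x i) ^ p - scalar (chi (x i) ^ p)" by simp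
  define u where "u = letter (x i) ^ p - letter (ppow G (x i)) - scalar (chi (x i) ^ p)"
  have u: "u \<in> I"
    using red_ideal_relations(3)[OF lie sub_m, of chi] xp x_m[OF assms]
    unfolding reduced_relations_def u_def p_def by blast
  define S where "S = {l. l < n \<and> p * kk i \<le> kk l}"
  have S: "ppow G (x i) \<in> g.span (x ` S)" using pow[OF assms False] unfolding S_def p_def .
  have "g.span (x ` S) \<subseteq> m \<inter> {z. chi z = 0}"
  proof (rule g.span_minimal)
    show "x ` S \<subseteq> m \<inter> {z. chi z = 0}"
    proof safe
      fix l assume l: "l \<in> S"
      then show "x l \<in> m" using x_m S_def by auto
      \<comment> \<open>Depth at least 3 is past degree -2, so \<open>chi\<close> vanishes on
        \<open>ppow G (x i)\<close>.\<close>
      have "3 * kk i \<le> p * kk i" using p by (intro mult_le_mono1) simp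
      moreover have "p * kk i \<le> kk l" using l unfolding S_def by simp
      ultimately have "kk l \<noteq> 2" using x(3)[OF assms] by linarith
      then show "chi (x l) = 0" using l unfolding S_def by (intro chi_gr[OF x(1)]) auto
    qed
    show "g.subspace (m \<inter> {z. chi z = 0})"
      using m_sub m_space chi_0 
      by (intro g.subspaceI) (auto simp: chi_add chi_scale subset_iff g.subspace_0 g.subspace_add g.subspace_scale)
  qed
  then have "chi (ppow G (x i)) = 0" using S by blast
  then have "e i ^ p = u + (letter (ppow G (x i)) - scalar (chi (ppow G (x i))))"
    unfolding ep u_def by (simp add: scalar_0)
  moreover have "letter (ppow G (x i)) - scalar (chi (ppow G (x i))) \<in> U.span (I \<union> e ` S)"
    using S by (intro letter_span) (auto simp: S_def)
  moreover have "U.span (I \<union> e ` S) \<subseteq> U.span (I \<union> e ` {l. l < n \<and> p * kap i < kap l})"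
  proof (intro U.span_mono Un_mono order_refl image_mono subsetI)
    fix l assume "l \<in> S"
    then have l: "l < n" "p * kk i \<le> kk l" unfolding S_def by auto
    \<comment> \<open>Thus \<open>p * kap i = 2 * p * kk i - p\<close>, which is less than
      \<open>2 * p * kk i - 1\<close> and hence than the weight of \<open>l\<close>.\<close>
    have "p * kap i + p = 2 * (p * kk i)"
      using x(3)[OF assms] unfolding kap_def by (simp add: diff_mult_distrib2)
    moreover have "p * kk i \<ge> 1" using p x(3)[OF assms] by simp
    ultimately have "p * kap i < kap l" using l p unfolding kap_def by linarith
    then show "l \<in> {l. l < n \<and> p * kap i < kap l}" using l by simp
  qed
  moreover have "u \<in> U.span (I \<union> e ` {l. l < n \<and> p * kap i < kap l})" using u by (intro U.span_base) auto
  ultimately show ?thesis unfolding c by (auto intro: U.span_add)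
qed

sublocale S: straightening scalar I n e kap sg Top
proof
  show "module.subspace scU I" by (rule I_sub)
  show "e i * f \<in> I" "f * e i \<in> I" if "i < n" "f \<in> I" for i f
    using Ic that e_carrier by auto
  show "kap i > 0" if "i < n" for i using x(3)[OF that] by (simp add: kap_def)
  show "set_mset Top = {..<n}"
    using topx_pos by (auto simp: count_Top simp flip: count_greater_zero_iff split: if_splits)
  show "sg i j = 1 \<or> sg i j = - 1" for i j by (simp add: sg_def ksign_def)
qed (use scalar_comm e_commute e_power in \<open>auto simp: scalar_add scalar_mult scalar_1\<close>)

text \<open>Words in the \<open>e i\<close> together with \<open>I\<close> span a space stable under
  left multiplication by letters, because a letter is a combination of generators plus a scalar,
  modulo \<open>I\<close>. They exhaust the free algebra, and straightening leaves the normal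
  monomials.\<close>

lemma carrier_good: 
  assumes "f \<in> carrier (free_alg m)"
  shows "f \<in> S.good 0"
proof -
  define T0 where "T0 = U.span (I \<union> S.P ` {is. set is \<subseteq> {..<n}})"
  have e_T0: "e i * f \<in> T0" if "f \<in> T0" "i < n" for f i
    using that(1) unfolding T0_def
  proof (induction rule: U.span_induct_alt)
    case base then show ?case by (simp add: U.span_zero)
  next
    case (step c u v)
    have "e i * u \<in> I \<union> S.P ` {is. set is \<subseteq> {..<n}}"
    proof (cases "u \<in> I")
      case True then show ?thesis using Ic e_carrier that(2) by auto
    next
      case False
      then obtain "is" where "u = S.P is" "set is \<subseteq> {..<n}" using step by auto
      then show ?thesis using that(2) by (intro UnI2 image_eqI[of _ _ "i # is"]) auto
    qed
    then have "scU c (e i * u) + e i * v \<in> U.span (I \<union> S.P ` {is. set is \<subseteq> {..<n}})"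
      by (rule U.span_add[OF U.span_scale[OF U.span_base] step(2)])
    then show ?case by (simp add: distrib_left S.sc_left)
  qed
  have T0c: "T0 \<subseteq> carrier (free_alg m)"
    unfolding T0_def
  proof (rule U.span_minimal)
    have "S.P is \<in> carrier (free_alg m)" if "set is \<subseteq> {..<n}" for "is"
      using that by (induction "is") (auto simp: free_alg_closed e_carrier)
    then show "I \<union> S.P ` {is. set is \<subseteq> {..<n}} \<subseteq> carrier (free_alg m)" using Ic(1) by auto
    show "U.subspace (carrier (free_alg m))" by (rule U.subspaceI) (simp_all add: free_alg_closed)
  qed
  have letter_T0: "letter z * f \<in> T0" if "z \<in> m" "f \<in> T0" for z f
  proof -
    have "letter z - scalar (chi z) \<in> U.span (I \<union> e ` {..<n})"
      using letter_span[OF order_refl] that(1) m_span by simp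
    then have "(letter z - scalar (chi z)) * f \<in> T0"
    proof (induction rule: U.span_induct_alt)
      case base then show ?case unfolding T0_def by (simp add: U.span_zero)
    next
      case (step c u v)
      have "u * f \<in> T0"
      proof (cases "u \<in> I")
        case True
        then have "u * f \<in> I" using Ic(6) that(2) T0c by auto
        then show ?thesis unfolding T0_def by (auto intro: U.span_base)
      next
        case False
        then show ?thesis using step(1) e_T0 that(2) by auto
      qed
      then show ?case using step(2) unfolding T0_def by (auto simp: distrib_right mult.assoc intro: U.span_add U.span_scale)
    qed
    moreover have "scU (chi z) f \<in> T0" using that(2) unfolding T0_def by (rule U.span_scale)
    ultimately have "(letter z - scalar (chi z)) * f + scU (chi z) f \<in> T0" unfolding T0_def by (rule U.span_add)
    then show ?thesis by (simp add: left_diff_distrib)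
  qed
  have word_T0: "Poly_Mapping.single w 1 \<in> T0" if "set w \<subseteq> m" for w
    using that
  proof (induction w)
    case Nil
    have "S.P [] \<in> S.P ` {is. set is \<subseteq> {..<n}}" by (rule imageI) simp
    then have "S.P [] \<in> T0" unfolding T0_def by (simp add: U.span_base)
    then show ?case by (simp add: one_free)
  next
    case (Cons z w)
    then have "letter z * Poly_Mapping.single w 1 \<in> T0" by (intro letter_T0) auto
    then show ?case by (simp add: letter_def single_times_single)
  qed
  have "f \<in> T0" using assms
  proof (induction rule: free_alg_induct)
    case zero then show ?case unfolding T0_def by (rule U.span_zero)
  next
    case (step c w g)
    show ?case using U.span_add[OF U.span_scale[OF word_T0[OF step(1), unfolded T0_def]] step(3)[unfolded T0_def]]
      unfolding T0_def .
  qed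
  also have "T0 \<subseteq> S.good 0"
    unfolding T0_def
  proof (rule U.span_minimal[OF _ S.good_sub], safe)
    fix f assume "f \<in> I" then show "f \<in> S.good 0" unfolding S.good_def by (auto intro: U.span_base)
  next
    fix "is" assume "set is \<subseteq> {..<n}"
    then have "S.P is \<in> S.good (S.wt is)" by (rule S.word_good)
    then show "S.P is \<in> S.good 0" using S.good_mono[of 0 "S.wt is"] by auto
  qed
  finally show ?thesis .
qed

end

context adapted_basis
begin

abbreviation J where "J \<equiv> red_ideal G chi (space_of G)"
abbreviation FG where "FG \<equiv> free_alg (space_of G)"

lemmas Jc = red_ideal_closed[OF lie sub_space, where chi = chi]

text \<open>The basis is the image under \<open>Y n\<close> of a homogeneous basis of
  \<open>W\<close>. \<open>free_spanning\<close> and \<open>free_independent\<close> give unique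
  coordinates indexed by monomials and basis vectors; collecting the monomials that belong to one
  basis vector gives its coefficient in the enveloping algebra of \<open>m\<close>.\<close>

theorem graded_free_over_subalgebra:
  fixes M :: "(('g list \<Rightarrow>\<^sub>0 'k) set, 'm) module" and Mp :: "bool \<Rightarrow> 'm set"
  assumes "graded_module (red_env G chi (space_of G)) (red_env_part G chi (space_of G)) M Mp"
  shows "graded_free (red_env G chi m) (restrict_module G chi M) Mp"
proof -

  \<comment> \<open>The module as a subspace of a function space\<close>
  define cls where "cls f = J +>\<^bsub>FG\<^esub> f" for f
  define R where "R = red_env G chi (space_of G)"
  note gm = assms[unfolded graded_module_def left_module_def, folded R_def]
  have mod: "ring R" "abelian_group M"
    by (rule gm[THEN conjunct1, THEN conjunct1], rule gm[THEN conjunct1, THEN conjunct2, THEN conjunct1])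
  have "\<forall>a\<in>carrier R. \<forall>b\<in>carrier R. \<forall>u\<in>carrier M. \<forall>v\<in>carrier M.
        a \<odot>\<^bsub>M\<^esub> u \<in> carrier M \<and>
        (a \<oplus>\<^bsub>R\<^esub> b) \<odot>\<^bsub>M\<^esub> u = a \<odot>\<^bsub>M\<^esub> u \<oplus>\<^bsub>M\<^esub> b \<odot>\<^bsub>M\<^esub> u \<and>
        a \<odot>\<^bsub>M\<^esub> (u \<oplus>\<^bsub>M\<^esub> v) = a \<odot>\<^bsub>M\<^esub> u \<oplus>\<^bsub>M\<^esub> a \<odot>\<^bsub>M\<^esub> v \<and>
        (a \<otimes>\<^bsub>R\<^esub> b) \<odot>\<^bsub>M\<^esub> u = a \<odot>\<^bsub>M\<^esub> (b \<odot>\<^bsub>M\<^esub> u) \<and>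
        \<one>\<^bsub>R\<^esub> \<odot>\<^bsub>M\<^esub> u = u" using gm by (elim conjE)
  note mod_ax = this[rule_format]
  have Mp_sub: "\<And>a. subgroup (Mp a) (add_monoid M)" and Mp_int: "Mp False \<inter> Mp True = {\<zero>\<^bsub>M\<^esub>}"
    and Mp_sum: "carrier M = {u \<oplus>\<^bsub>M\<^esub> v | u v. u \<in> Mp False \<and> v \<in> Mp True}"
    using gm by (elim conjE, blast)+
  have Mp_act: "\<And>a b u v. u \<in> red_env_part G chi (space_of G) a \<Longrightarrow> v \<in> Mp b \<Longrightarrow> u \<odot>\<^bsub>M\<^esub> v \<in> Mp (a \<noteq> b)"
    using gm by (elim conjE, blast)
  interpret M: abelian_group M by (rule mod(2))
  have cls_carrier: "cls f \<in> carrier R" if "f \<in> carrier FG" for f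
    using that unfolding cls_def R_def red_env_simps by blast
  note hom = red_env_hom[OF lie sub_space, where chi = chi, folded cls_def R_def]
  have act_closed: "cls f \<odot>\<^bsub>M\<^esub> u \<in> carrier M" if "f \<in> carrier FG" "u \<in> carrier M" for f u
    using mod_ax[OF cls_carrier cls_carrier that(2,2), OF that(1,1)] by blast
  have act_add: "cls (f + g) \<odot>\<^bsub>M\<^esub> u = cls f \<odot>\<^bsub>M\<^esub> u \<oplus>\<^bsub>M\<^esub> cls g \<odot>\<^bsub>M\<^esub> u"
    and act_mult: "cls (f * g) \<odot>\<^bsub>M\<^esub> u = cls f \<odot>\<^bsub>M\<^esub> (cls g \<odot>\<^bsub>M\<^esub> u)"
    if "f \<in> carrier FG" "g \<in> carrier FG" "u \<in> carrier M" for f g u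
    using mod_ax[OF cls_carrier[OF that(1)] cls_carrier[OF that(2)] that(3,3)] hom[OF that(1,2)] by auto
  have act_add_right: "cls f \<odot>\<^bsub>M\<^esub> (u \<oplus>\<^bsub>M\<^esub> v) = cls f \<odot>\<^bsub>M\<^esub> u \<oplus>\<^bsub>M\<^esub> cls f \<odot>\<^bsub>M\<^esub> v"
    if "f \<in> carrier FG" "u \<in> carrier M" "v \<in> carrier M" for f u v
    using mod_ax[OF cls_carrier[OF that(1)] cls_carrier[OF that(1)] that(2,3)] by auto
  have act_1: "cls 1 \<odot>\<^bsub>M\<^esub> u = u" if "u \<in> carrier M" for u
    using mod_ax[OF cls_carrier cls_carrier that that, of 1 1] hom(3)[of 1 1] free_alg_closed(2) by metis
  have cls_eq: "cls f = cls g" if "f - g \<in> J" "f \<in> carrier FG" "g \<in> carrier FG" for f g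
    using coset_eq_iff[OF lie sub_space that(2,3), of chi] that(1) unfolding cls_def by simp
  have FG0: "(0 :: 'g list \<Rightarrow>\<^sub>0 'k) \<in> carrier FG" by (rule free_alg_closed)
  have act_0: "cls 0 \<odot>\<^bsub>M\<^esub> u = \<zero>\<^bsub>M\<^esub>" if "u \<in> carrier M" for u
    using act_add[of 0 0 u] act_closed[of 0 u] that FG0 by simp
  have act_J: "cls f \<odot>\<^bsub>M\<^esub> u = \<zero>\<^bsub>M\<^esub>" if "f \<in> J" "u \<in> carrier M" for f u
    using cls_eq[of f 0] that Jc(1) FG0 act_0[OF that(2)] by auto
  define sm where "sm c u = cls (scalar c) \<odot>\<^bsub>M\<^esub> u" for c u
  have sc_carrier: "scalar c \<in> carrier FG" for c :: 'k by (rule free_alg_closed)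
  obtain \<iota> :: "'m \<Rightarrow> ('m \<Rightarrow> 'k)" where \<iota>_inj: "inj_on \<iota> (carrier M)"
    and \<iota>_add: "\<And>u v. u \<in> carrier M \<Longrightarrow> v \<in> carrier M \<Longrightarrow> \<iota> (u \<oplus>\<^bsub>M\<^esub> v) = \<iota> u + \<iota> v"
    and \<iota>_scale: "\<And>c u. u \<in> carrier M \<Longrightarrow> \<iota> (sm c u) = (\<lambda>t. c * \<iota> u t)"
  proof (rule record_space_embedding[OF mod(2), of sm])
    show "sm (c + d) u = sm c u \<oplus>\<^bsub>M\<^esub> sm d u" if "u \<in> carrier M" for c d u
      unfolding sm_def scalar_add by (rule act_add[OF sc_carrier sc_carrier that])
    show "sm (c * d) u = sm c (sm d u)" if "u \<in> carrier M" for c d u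
      unfolding sm_def scalar_mult by (rule act_mult[OF sc_carrier sc_carrier that])
  qed (auto simp: sm_def scalar_1 act_1 act_closed act_add_right sc_carrier)
  define sv where "sv c f = (\<lambda>t. c * f t)" for c and f :: "'m \<Rightarrow> 'k"
  interpret sv: vector_space sv
    by unfold_locales (auto simp: sv_def plus_fun_def fun_eq_iff algebra_simps)
  define V0 where "V0 = \<iota> ` carrier M"
  define \<kappa> where "\<kappa> = inv_into (carrier M) \<iota>"
  have \<kappa>: "\<kappa> v \<in> carrier M" "\<iota> (\<kappa> v) = v" if "v \<in> V0" for v
    using that unfolding \<kappa>_def V0_def by (auto intro: inv_into_into f_inv_into_f)
  have \<kappa>\<iota>: "\<kappa> (\<iota> u) = u" if "u \<in> carrier M" for u
    using that \<iota>_inj unfolding \<kappa>_def by simp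
  have \<iota>V: "\<iota> u \<in> V0" if "u \<in> carrier M" for u using that unfolding V0_def by blast
  define A where "A f v = \<iota> (cls f \<odot>\<^bsub>M\<^esub> \<kappa> v)" for f v
  have A_V0: "A f v \<in> V0" if "f \<in> carrier FG" "v \<in> V0" for f v
    unfolding A_def using that \<kappa> act_closed \<iota>V by blast
  have \<kappa>_add: "\<kappa> (u + v) = \<kappa> u \<oplus>\<^bsub>M\<^esub> \<kappa> v" if "u \<in> V0" "v \<in> V0" for u v
    using \<kappa>\<iota>[of "\<kappa> u \<oplus>\<^bsub>M\<^esub> \<kappa> v"] \<iota>_add[of "\<kappa> u" "\<kappa> v"] \<kappa>[OF that(1)] \<kappa>[OF that(2)] by simp
  have A_add: "A (f + g) v = A f v + A g v" if "f \<in> carrier FG" "g \<in> carrier FG" "v \<in> V0" for f g v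
    unfolding A_def using that \<kappa> act_closed by (simp only: act_add \<iota>_add)
  have A_mult: "A (f * g) v = A f (A g v)" if "f \<in> carrier FG" "g \<in> carrier FG" "v \<in> V0" for f g v
    unfolding A_def using that \<kappa>(1) act_closed by (simp only: act_mult \<kappa>\<iota>)
  have V0_add: "u + v \<in> V0" if "u \<in> V0" "v \<in> V0" for u v
    using \<iota>V[of "\<kappa> u \<oplus>\<^bsub>M\<^esub> \<kappa> v"] \<iota>_add[of "\<kappa> u" "\<kappa> v"] \<kappa>[OF that(1)] \<kappa>[OF that(2)] by simp
  have A_add_right: "A f (u + v) = A f u + A f v" if "f \<in> carrier FG" "u \<in> V0" "v \<in> V0" for f u v
    unfolding A_def \<kappa>_add[OF that(2,3)] using that \<kappa> act_closed by (simp only: act_add_right \<iota>_add)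
  have A_scalar: "A (scalar c) v = sv c v" if "v \<in> V0" for c v
    using \<iota>_scale[of "\<kappa> v" c] \<kappa>[OF that] unfolding A_def sm_def sv_def by simp
  have \<iota>_0: "\<iota> \<zero>\<^bsub>M\<^esub> = 0"
    using \<iota>_add[of "\<zero>\<^bsub>M\<^esub>" "\<zero>\<^bsub>M\<^esub>"] by simp
  have A_J: "A f v = 0" if "f \<in> J" "v \<in> V0" for f v
    unfolding A_def using act_J[OF that(1) \<kappa>(1)[OF that(2)]] \<iota>_0 by simp
  have V0_sub: "sv.subspace V0"
  proof (rule sv.subspaceI)
    show "0 \<in> V0" using \<iota>V[of "\<zero>\<^bsub>M\<^esub>"] \<iota>_0 by simp
    show "sv c v \<in> V0" if "v \<in> V0" for c v
      using A_V0[OF sc_carrier that] A_scalar[OF that] by simp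
  qed (rule V0_add)
  note V0_0 = sv.subspace_0[OF V0_sub]
  have A_sv: "A f (sv c v) = sv c (A f v)" if "f \<in> carrier FG" "v \<in> V0" for f c v
    using A_mult[OF that(1) sc_carrier that(2), of c] A_mult[OF sc_carrier that, of c] scalar_comm[of c f]
      A_scalar A_V0 that by metis
  define \<rho> where "\<rho> z v = A (letter z) v" for z v
  note ps = part_space[OF lie]
  have let_carrier: "letter z \<in> carrier FG" if "z \<in> part G a" for z a
    using that ps by (intro free_alg_closed(4)) auto
  have mFG: "carrier (free_alg m) \<subseteq> carrier FG" by (rule free_alg_mono[OF m_space])
  have IJ: "I \<subseteq> J" by (rule red_ideal_mono[OF lie sub_m sub_space m_space])
  have A_e': "A (letter z - scalar (chi z)) v = \<rho> z v - sv (chi z) v" if "z \<in> space_of G" "v \<in> V0" for z v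
  proof -
    have eq: "letter z - scalar (chi z) = letter z + scalar (- chi z)" by (simp add: scalar_minus)
    show ?thesis unfolding eq
      using A_add[OF free_alg_closed(4)[OF that(1)] sc_carrier that(2), of "- chi z"] A_scalar[OF that(2)]
      by (simp add: \<rho>_def)
  qed
  have \<rho>_br: "\<rho> z (\<rho> z' v) = sv (ksign a b) (\<rho> z' (\<rho> z v)) + \<rho> (brk G z z') v"
    if "z \<in> part G a" "z' \<in> part G b" "v \<in> V0" for z z' a b v
  proof -
    define u :: "'g list \<Rightarrow>\<^sub>0 'k" where "u = letter z * letter z' - scalar (ksign a b) * letter z' * letter z - letter (brk G z z')"
    have u: "u \<in> J"
      using red_ideal_relations(2)[OF lie sub_space, of chi] that ps
      unfolding enveloping_relations_def u_def by blast
    have bz: "brk G z z' \<in> space_of G" using sub_space that ps unfolding subalgebra_def by blast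
    have l: "(letter z :: 'g list \<Rightarrow>\<^sub>0 'k) \<in> carrier FG" "(letter z' :: 'g list \<Rightarrow>\<^sub>0 'k) \<in> carrier FG"
      "(letter (brk G z z') :: 'g list \<Rightarrow>\<^sub>0 'k) \<in> carrier FG" "u \<in> carrier FG"
      using that let_carrier free_alg_closed(4)[OF bz] u Jc(1) by auto
    then have l': "scalar (ksign a b :: 'k) * (letter z' * letter z) \<in> carrier FG"
      by (intro free_alg_closed(6) sc_carrier)
    have "letter z * letter z' = (scalar (ksign a b) * (letter z' * letter z) + letter (brk G z z')) + u"
      by (simp add: u_def mult.assoc)
    then have "A (letter z * letter z') v
       = (A (scalar (ksign a b) * (letter z' * letter z)) v + A (letter (brk G z z')) v) + A u v"
      using l l' that(3) by (simp add: A_add free_alg_closed(5))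
    moreover have "A (scalar (ksign a b :: 'k) * (letter z' * letter z)) v = sv (ksign a b) (\<rho> z' (\<rho> z v))"
      using l(1,2) that(3) by (simp add: A_mult A_scalar A_V0 sc_carrier free_alg_closed(6) \<rho>_def)
    ultimately show ?thesis using A_J[OF u that(3)] A_mult[OF l(1,2) that(3)] by (simp add: \<rho>_def)
  qed
  have \<rho>_V0: "\<rho> z v \<in> V0" if "z \<in> part G a" "v \<in> V0" for z a v
    unfolding \<rho>_def by (rule A_V0[OF let_carrier[OF that(1)] that(2)])

  \<comment> \<open>Whittaker vectors of the module\<close>
  interpret Wh: whittaker sv "part G" "brk G" gr chi V0 \<rho> n x y kk pp "CHAR('k)"
  proof (unfold_locales)
    show "sv.subspace V0" by (rule V0_sub)
    show "brk G z z' \<in> part G (a \<noteq> b)" if "z \<in> part G a" "z' \<in> part G b" for z z' a b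
      using lie that unfolding lie_superalgebra_def by blast
    show "\<rho> z (v + v') = \<rho> z v + \<rho> z v'" if "z \<in> part G a" "v \<in> V0" "v' \<in> V0" for z a v v'
      unfolding \<rho>_def by (rule A_add_right[OF let_carrier[OF that(1)] that(2,3)])
    show "\<rho> z (sv c v) = sv c (\<rho> z v)" if "z \<in> part G a" "v \<in> V0" for z a c v
      unfolding \<rho>_def by (rule A_sv[OF let_carrier[OF that(1)] that(2)])
  qed (fact \<rho>_V0 \<rho>_br br_gr chi_odd chi_gr x y dual kk_mono refl)+
  have bar_def: "A (letter z - scalar (chi z)) v = Wh.bar z v" if "z \<in> space_of G" "v \<in> V0" for z v
    unfolding Wh.bar_def by (rule A_e'[OF that])
  \<comment> \<open>For \<open>z\<close> in the span of the \<open>x i\<close>, the difference of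
    \<open>letter z\<close> and its value under \<open>chi\<close> is a combination of the
    \<open>e i\<close> modulo \<open>I\<close>, and all of these kill \<open>w\<close>.\<close>
  have bar_lin: "Wh.bar z w = 0" if "z \<in> g.span (x ` S)" "S \<subseteq> {..<n}" "w \<in> V0" "\<And>i. i < n \<Longrightarrow> Wh.bar (x i) w = 0" for z S w
  proof -
    have zs: "z \<in> space_of G" using that(1,2) m_space g.span_mono[of "x ` S" "x ` {..<n}"] unfolding m_span by blast
    have "letter z - scalar (chi z) \<in> U.span (I \<union> e ` S)" by (rule letter_span[OF that(2,1)])
    then have "letter z - scalar (chi z) \<in> carrier FG \<and> A (letter z - scalar (chi z)) w = 0"
    proof (induction rule: U.span_induct_alt)
      case base
      show ?case using A_J[OF Jc(2) that(3)] FG0 by blast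
    next
      case (step c u v)
      have u: "u \<in> carrier FG \<and> A u w = 0"
      proof (cases "u \<in> I")
        case True then show ?thesis using A_J[OF _ that(3)] IJ Jc(1) by blast
      next
        case False
        then obtain i where i: "i \<in> S" "u = e i" using step(1) by auto
        then have "i < n" using that(2) by auto
        then show ?thesis
          using i(2) e_carrier mFG bar_def[OF _ that(3), of "x i"] x_m m_space that(4) by (auto simp: e_def)
      qed
      then have "A (scU c u) w = 0"
        using A_mult[OF sc_carrier _ that(3), of u c] A_scalar[OF V0_0] by simp
      moreover have cu: "scU c u \<in> carrier FG" using u by (intro free_alg_closed(6) sc_carrier) simp
      ultimately show ?case using step(2) A_add[OF cu _ that(3), of v] free_alg_closed(5)[OF cu] by (metis add_0_left)
    qed
    then show ?thesis using bar_def[OF zs that(3)] by simp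
  qed
  interpret B: whittaker_module scalar I n e kap sg Top sv "part G" "brk G" gr chi V0 \<rho> x y kk pp "CHAR('k)"
    "carrier (free_alg m)" A
  proof (unfold_locales)
    show "Wh.bar z w = 0" if "z \<in> gr (- k)" "z \<in> part G a" "k \<ge> 2" "w \<in> V0" "\<And>i. i < n \<Longrightarrow> Wh.bar (x i) w = 0" for z k a w
      by (rule bar_lin[OF neg_span[OF that(1,3)] _ that(4,5)]) auto
    show "A (e i) v = Wh.bar (x i) v" if "i < n" "v \<in> V0" for i v
      unfolding e_def using that m_space x_m by (intro bar_def) auto
    show "count Top i = Wh.top i" if "i < n" for i
      using that by (simp add: count_Top topx_def Wh.top_def)
    show "0 < CHAR('k)" using char by simp
    show "A f v = 0" if "f \<in> I" "v \<in> V0" for f v using A_J IJ that by blast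
    show "A f v \<in> V0" if "f \<in> carrier (free_alg m)" "v \<in> V0" for f v using A_V0 mFG that by blast
    show "A (f + g) v = A f v + A g v" "A (f * g) v = A f (A g v)"
      if "f \<in> carrier (free_alg m)" "g \<in> carrier (free_alg m)" "v \<in> V0" for f g v
      using that mFG by (auto intro!: A_add A_mult)
    show "A f (u + v) = A f u + A f v" if "f \<in> carrier (free_alg m)" "u \<in> V0" "v \<in> V0" for f u v
      using that mFG by (auto intro!: A_add_right)
    show "A (scalar c) v = sv c v" if "v \<in> V0" for c v by (rule A_scalar[OF that])
  qed (use Ic(1) e_carrier in \<open>auto intro: free_alg_closed\<close>)

  \<comment> \<open>Parities and a homogeneous basis\<close>
  define Vp where "Vp a = \<iota> ` Mp a" for a
  have Mp_carrier: "Mp a \<subseteq> carrier M" for a using subgroup.subset[OF Mp_sub[of a]] by simp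
  have Vp_V0: "Vp a \<subseteq> V0" for a unfolding Vp_def V0_def using Mp_carrier by (intro image_mono)
  have part_cls: "cls f \<in> red_env_part G chi (space_of G) a"
    if "f \<in> carrier FG" "\<forall>w\<in>Poly_Mapping.keys f. hom_word G a w" for f a
    using that unfolding red_env_part_def cls_def by blast
  have Vp_A: "A f v \<in> Vp (a \<noteq> b)"
    if h: "f \<in> carrier FG" "\<forall>w\<in>Poly_Mapping.keys f. hom_word G a w" "v \<in> Vp b" for f a b v
  proof -
    obtain u where u: "u \<in> Mp b" "v = \<iota> u" using h(3) unfolding Vp_def by auto
    then have "\<kappa> v = u" using \<kappa>\<iota> Mp_carrier by blast
    then show ?thesis using Mp_act[OF part_cls[OF h(1,2)] u(1)] unfolding A_def Vp_def by auto
  qed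
  have Vp_\<rho>: "\<rho> z v \<in> Vp (a \<noteq> b)" if "z \<in> part G a" "v \<in> Vp b" for z a b v
    unfolding \<rho>_def using that by (intro Vp_A[OF let_carrier[OF that(1)]]) (auto simp: letter_def)
  have Vp_sub: "sv.subspace (Vp a)" for a
  proof (rule sv.subspaceI)
    show "0 \<in> Vp a" using subgroup.one_closed[OF Mp_sub[of a]] \<iota>_0 unfolding Vp_def by force
    show "u + v \<in> Vp a" if uv: "u \<in> Vp a" "v \<in> Vp a" for u v
    proof -
      obtain u' v' where "u' \<in> Mp a" "v' \<in> Mp a" "u = \<iota> u'" "v = \<iota> v'" using uv unfolding Vp_def by auto
      then show ?thesis using subgroup.m_closed[OF Mp_sub[of a], of u' v'] \<iota>_add[of u' v'] Mp_carrier[of a]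
        unfolding Vp_def by force
    qed
    show "sv c v \<in> Vp a" if "v \<in> Vp a" for c v
      using Vp_A[OF sc_carrier _ that, of c False] A_scalar[of v c] that Vp_V0[of a] by (auto simp: scalar_def split: if_splits)
  qed
  have Vp_int: "v = 0" if h: "v \<in> Vp a" "v \<in> Vp (\<not> a)" for v a
  proof -
    obtain u u' where "u \<in> Mp a" "u' \<in> Mp (\<not> a)" "v = \<iota> u" "v = \<iota> u'" using h unfolding Vp_def by auto
    moreover from this have "u = u'" using \<iota>_inj Mp_carrier unfolding inj_on_def by blast
    ultimately have "u \<in> Mp False \<inter> Mp True" by (cases a) auto
    then show ?thesis using Mp_int \<open>v = \<iota> u\<close> \<iota>_0 by simp
  qed
  have Vp_sum: "\<exists>u v. u \<in> Vp False \<and> v \<in> Vp True \<and> w = u + v" if "w \<in> V0" for w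
  proof -
    obtain t where t: "t \<in> carrier M" "w = \<iota> t" using \<open>w \<in> V0\<close> unfolding V0_def by auto
    then obtain u v where "u \<in> Mp False" "v \<in> Mp True" "t = u \<oplus>\<^bsub>M\<^esub> v" using Mp_sum by auto
    then show ?thesis using t(2) \<iota>_add[of u v] Mp_carrier unfolding Vp_def by blast
  qed
  \<comment> \<open>The shift by the scalar \<open>chi (x i)\<close> preserves parity, and it is
    zero when \<open>x i\<close> is odd; so \<open>bar (x i)\<close> is homogeneous.\<close>
  have bar_Vp: "Wh.bar (x i) v \<in> Vp (pp i \<noteq> b)" if "i < n" "v \<in> Vp b" for i b v
  proof (cases "pp i")
    case True
    then have "chi (x i) = 0" using chi_odd x(2)[OF that(1)] by simp
    then show ?thesis using Vp_\<rho>[OF x(2)[OF that(1)] that(2)] by (simp add: Wh.bar_def)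
  next
    case False
    then have "\<rho> (x i) v \<in> Vp b" using Vp_\<rho>[OF x(2)[OF that(1)] that(2)] by simp
    then show ?thesis using False that(2) sv.subspace_diff[OF Vp_sub] sv.subspace_scale[OF Vp_sub] by (simp add: Wh.bar_def)
  qed
  \<comment> \<open>The images of the even and the odd part under \<open>bar (x i)\<close> have
    opposite parities and sum to zero, so both vanish: \<open>W\<close> is a graded
    subspace.\<close>
  have W_split: "u \<in> Wh.W \<and> v \<in> Wh.W" if "u \<in> Vp False" "v \<in> Vp True" "u + v \<in> Wh.W" for u v
  proof -
    have uv: "u \<in> V0" "v \<in> V0" using that Vp_V0 by auto
    have "Wh.bar (x i) u = 0 \<and> Wh.bar (x i) v = 0" if i: "i < n" for i
    proof -
      have "Wh.bar (x i) u + Wh.bar (x i) v = 0"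
        using Wh.bar_add[OF x(2)[OF i] uv] \<open>u + v \<in> Wh.W\<close> i unfolding B.W_iff by simp
      then have e: "Wh.bar (x i) u = - Wh.bar (x i) v" by (simp only: eq_neg_iff_add_eq_0)
      have "Wh.bar (x i) u \<in> Vp (pp i \<noteq> False)" using bar_Vp[OF i] \<open>u \<in> Vp False\<close> .
      moreover have "Wh.bar (x i) u \<in> Vp (\<not> (pp i \<noteq> False))"
        using bar_Vp[OF i \<open>v \<in> Vp True\<close>] sv.subspace_neg[OF Vp_sub] unfolding e by (cases "pp i") auto
      ultimately have "Wh.bar (x i) u = 0" by (rule Vp_int)
      then show ?thesis using e by (metis neg_equal_0_iff_equal)
    qed
    then show ?thesis using uv unfolding B.W_iff by blast
  qed
  \<comment> \<open>Maximal independent among the homogeneous vectors of \<open>W\<close>; since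
    \<open>W\<close> contains the homogeneous parts of its elements, such a set spans
    \<open>W\<close>.\<close>
  obtain Bw where Bw: "Bw \<subseteq> Wh.W \<inter> (Vp False \<union> Vp True)" "sv.independent Bw"
    "Wh.W \<inter> (Vp False \<union> Vp True) \<subseteq> sv.span Bw"
    using sv.maximal_independent_subset by metis
  have Bw_span: "w \<in> sv.span Bw" if "w \<in> Wh.W" for w
  proof -
    have "w \<in> V0" using that unfolding B.W_iff by simp
    then obtain u v where uv: "u \<in> Vp False" "v \<in> Vp True" "w = u + v" using Vp_sum by blast
    then have "u \<in> Wh.W" "v \<in> Wh.W" using W_split that by auto
    then show ?thesis using uv Bw(3) sv.span_add by blast
  qed
  have BwW: "\<beta> \<in> Wh.W" if "\<beta> \<in> Bw" for \<beta> using Bw(1) that by auto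
  have Y_Vp: "\<exists>b. Wh.Y i v \<in> Vp b" if "v \<in> Vp b" "i \<le> n" for i v b
    using that(2)
  proof (induction i)
    case 0 then show ?case using that(1) by auto
  next
    case (Suc i)
    then obtain b where "Wh.Y i v \<in> Vp b" by auto
    then have "\<exists>b. (\<rho> (y i) ^^ t) (Wh.Y i v) \<in> Vp b" for t
    proof (induction t)
      case (Suc t)
      then show ?case using Vp_\<rho>[OF y(2)[of i]] \<open>Suc i \<le> n\<close> by auto
    qed auto
    then show ?case by simp
  qed
  \<comment> \<open>On \<open>W\<close> the operator \<open>X n\<close> inverts \<open>Y n\<close>
    up to a nonzero scalar.\<close>
  have Y_inj: "inj_on (Wh.Y n) Wh.W"
  proof
    fix u v assume "u \<in> Wh.W" "v \<in> Wh.W" "Wh.Y n u = Wh.Y n v"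
    then have "sv (Wh.cX n) u = sv (Wh.cX n) v" using Wh.X_Y(1) char by (metis gr_implies_not0 not_gr_zero)
    moreover have "Wh.cX n \<noteq> 0" using Wh.X_Y(2)[OF \<open>u \<in> Wh.W\<close>] char by simp
    ultimately show "u = v" by simp
  qed
  define bb where "bb \<beta> = \<kappa> (Wh.Y n \<beta>)" for \<beta>
  have \<iota>bb: "\<iota> (bb \<beta>) = Wh.Y n \<beta>" "bb \<beta> \<in> carrier M" if "\<beta> \<in> Bw" for \<beta>
    using \<kappa> B.Y_V0[OF BwW[OF that]] unfolding bb_def by auto
  have bb_inj: "inj_on bb Bw"
  proof
    fix u v assume uv: "u \<in> Bw" "v \<in> Bw" "bb u = bb v"
    then have "Wh.Y n u = Wh.Y n v" using \<iota>bb by metis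
    then show "u = v" using Y_inj BwW uv(1,2) unfolding inj_on_def by blast
  qed
  define bi where "bi = inv_into Bw bb"
  have bi: "bi (bb \<beta>) = \<beta>" if "\<beta> \<in> Bw" for \<beta> using bb_inj that unfolding bi_def by simp
  have bb_Mp: "bb ` Bw \<subseteq> Mp False \<union> Mp True"
  proof
    fix b assume "b \<in> bb ` Bw"
    then obtain \<beta> where \<beta>: "\<beta> \<in> Bw" "b = bb \<beta>" by auto
    then have "\<beta> \<in> Vp False \<or> \<beta> \<in> Vp True" using Bw(1) by auto
    then obtain a where "Wh.Y n \<beta> \<in> Vp a" using Y_Vp[OF _ order_refl] by metis
    then obtain u where u: "u \<in> Mp a" "Wh.Y n \<beta> = \<iota> u" unfolding Vp_def by auto
    have "u \<in> carrier M" using u(1) Mp_carrier by (rule subsetD[rotated])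
    then have "b = u" unfolding \<beta>(2) bb_def u(2) by (rule \<kappa>\<iota>)
    then have "b \<in> Mp a" using u(1) by simp
    then show "b \<in> Mp False \<union> Mp True" by (cases a) auto
  qed
  have A_sum: "(\<Sum>j\<in>S. f j) \<in> carrier FG \<and> A (\<Sum>j\<in>S. f j) v = (\<Sum>j\<in>S. A (f j) v)"
    if "finite S" "\<And>j. j \<in> S \<Longrightarrow> f j \<in> carrier FG" "v \<in> V0" for S and f :: "nat multiset \<Rightarrow> 'g list \<Rightarrow>\<^sub>0 'k" and v
    using that(1,2)
  proof (induction S rule: finite_induct)
    case empty then show ?case using A_J[OF Jc(2) that(3)] FG0 by (metis sum.empty)
  next
    case (insert j S)
    then show ?case using A_add[of "f j" "\<Sum>j\<in>S. f j" v] that(3) free_alg_closed(5)[of "f j" "space_of G"] by simp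
  qed
  have Pm_FG: "B.Pm T \<in> carrier FG" if "T \<in> B.TT" for T
    using B.Pm_C that mFG unfolding B.TT_def by blast
  have Y_sum: "Wh.Y n (\<Sum>\<beta>\<in>S. sv (r \<beta>) (g \<beta>)) = (\<Sum>\<beta>\<in>S. sv (r \<beta>) (Wh.Y n (g \<beta>))) \<and> (\<Sum>\<beta>\<in>S. sv (r \<beta>) (g \<beta>)) \<in> Wh.W"
    if "finite S" "\<And>\<beta>. \<beta> \<in> S \<Longrightarrow> g \<beta> \<in> Wh.W" for S r and g :: "'z \<Rightarrow> 'm \<Rightarrow> 'k"
    using that
  proof (induction S rule: finite_induct)
    case empty
    have "Wh.Y n (sv 0 0) = sv 0 (Wh.Y n 0)" using B.Y_lin[OF V0_0 V0_0] by blast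
    then show ?case using sv.subspace_0[OF Wh.W_sub] by (simp only: sum.empty sv.scale_zero_left)
  next
    case (insert \<beta> S)
    have g: "g \<beta> \<in> Wh.W" "sv (r \<beta>) (g \<beta>) \<in> Wh.W" using insert sv.subspace_scale[OF Wh.W_sub] by auto
    have "Wh.Y n (sv (r \<beta>) (g \<beta>) + (\<Sum>\<beta>\<in>S. sv (r \<beta>) (g \<beta>)))
        = Wh.Y n (sv (r \<beta>) (g \<beta>)) + Wh.Y n (\<Sum>\<beta>\<in>S. sv (r \<beta>) (g \<beta>))"
      using insert g B.Y_lin[of _ _ n] unfolding B.W_iff by blast
    moreover have "Wh.Y n (sv (r \<beta>) (g \<beta>)) = sv (r \<beta>) (Wh.Y n (g \<beta>))"
      using g(1) B.Y_lin[of _ V0_0 n] B.Y_lin[OF _ V0_0] unfolding B.W_iff by blast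
    ultimately show ?case using insert g sv.subspace_add[OF Wh.W_sub] by (simp only: sum.insert insert_iff simp_thms)
  qed

  \<comment> \<open>Coefficients in the reduced enveloping algebra of the subalgebra\<close>
  define cm where "cm f = I +>\<^bsub>free_alg m\<^esub> f" for f
  define RM where "RM = red_env G chi m"
  have RM: "carrier RM = {cm f | f. f \<in> carrier (free_alg m)}" "\<zero>\<^bsub>RM\<^esub> = I"
    unfolding RM_def cm_def by (rule red_env_simps)+
  have cm_eq: "cm f = cm g \<longleftrightarrow> f - g \<in> I" if "f \<in> carrier (free_alg m)" "g \<in> carrier (free_alg m)" for f g
    unfolding cm_def by (rule coset_eq_iff[OF lie sub_m that])
  have cm0: "cm 0 = I" unfolding cm_def by (rule coset_zero[OF lie sub_m])
  define N where "N = restrict_module G chi M"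
  have N_smult: "cm f \<odot>\<^bsub>N\<^esub> b = cls f \<odot>\<^bsub>M\<^esub> b" for f b
    unfolding N_def restrict_module_def cm_def cls_def by (simp add: coset_enlarge[OF lie sub_m sub_space m_space])
  have N_finsum: "finsum N = finsum M" "carrier N = carrier M"
    unfolding N_def restrict_module_def finsum_def by (auto simp: fun_eq_iff)
  have \<iota>_sum: "\<iota> (finsum M g S) = (\<Sum>b\<in>S. \<iota> (g b))" if "finite S" "\<And>b. b \<in> S \<Longrightarrow> g b \<in> carrier M" for g and S :: "'m set"
    using that
  proof (induction S rule: finite_induct)
    case empty then show ?case by (simp only: M.finsum_empty \<iota>_0 sum.empty)
  next
    case (insert b S)
    then have "finsum M g (insert b S) = g b \<oplus>\<^bsub>M\<^esub> finsum M g S" by (intro M.finsum_insert) auto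
    then show ?case using insert \<iota>_add[of "g b" "finsum M g S"] by (simp add: M.finsum_closed Pi_def)
  qed
  \<comment> \<open>Coefficients are cosets, and \<open>rp\<close> picks representatives.
    Representatives of zero act as zero, so a sum over the support of \<open>c\<close> may be taken
    over any larger finite set.\<close>
  define rp where "rp c = (SOME f. f \<in> carrier (free_alg m) \<and> c = cm f)" for c
  have rp: "rp c \<in> carrier (free_alg m)" "cm (rp c) = c" if "c \<in> carrier RM" for c
    using someI_ex[of "\<lambda>f. f \<in> carrier (free_alg m) \<and> c = cm f"] that unfolding rp_def RM by auto
  have exp: "\<iota> (finsum N (\<lambda>b. c b \<odot>\<^bsub>N\<^esub> b) {b. c b \<noteq> \<zero>\<^bsub>RM\<^esub>}) = (\<Sum>b\<in>S. A (rp (c b)) (\<iota> b))"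
    if c: "\<And>b. c b \<in> carrier RM" "{b. c b \<noteq> \<zero>\<^bsub>RM\<^esub>} \<subseteq> S" "finite S" "S \<subseteq> carrier M" for c S
  proof -
    have ac: "c b \<odot>\<^bsub>N\<^esub> b = cls (rp (c b)) \<odot>\<^bsub>M\<^esub> b" for b using rp[OF c(1)] N_smult by metis
    have cl: "cls (rp (c b)) \<odot>\<^bsub>M\<^esub> b \<in> carrier M" if "b \<in> carrier M" for b
      using act_closed[OF _ that] rp(1)[OF c(1)] mFG by blast
    have "\<iota> (finsum N (\<lambda>b. c b \<odot>\<^bsub>N\<^esub> b) {b. c b \<noteq> \<zero>\<^bsub>RM\<^esub>}) = (\<Sum>b | c b \<noteq> \<zero>\<^bsub>RM\<^esub>. \<iota> (cls (rp (c b)) \<odot>\<^bsub>M\<^esub> b))"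
      unfolding N_finsum ac using c(2,3,4) cl by (intro \<iota>_sum) (auto intro: finite_subset)
    also have "\<dots> = (\<Sum>b | c b \<noteq> \<zero>\<^bsub>RM\<^esub>. A (rp (c b)) (\<iota> b))"
      using c(2,4) \<kappa>\<iota> unfolding A_def by (intro sum.cong) (auto simp: subset_iff)
    also have "\<dots> = (\<Sum>b\<in>S. A (rp (c b)) (\<iota> b))"
    proof (rule sum.mono_neutral_left[OF c(3,2)], rule ballI)
      fix b assume b: "b \<in> S - {b. c b \<noteq> \<zero>\<^bsub>RM\<^esub>}"
      then have "cm (rp (c b)) = cm 0" using trans[OF rp(2)[OF c(1)], of b I] cm0 RM(2) by simp
      then have "rp (c b) \<in> I" using cm_eq[OF rp(1)[OF c(1)] free_alg_closed(1)] by simp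
      then show "A (rp (c b)) (\<iota> b) = 0" using A_J IJ \<iota>V b c(4) by blast
    qed
    finally show ?thesis .
  qed
  show ?thesis
    unfolding graded_free_def RM_def[symmetric] N_def[symmetric]
  proof (intro exI[of _ "bb ` Bw"] conjI bb_Mp ballI)
    fix u assume "u \<in> carrier N"
    then have u: "u \<in> carrier M" by (simp add: N_finsum)
    define good_c where "good_c c \<longleftrightarrow> (\<forall>b. c b \<in> carrier RM) \<and> {b. c b \<noteq> \<zero>\<^bsub>RM\<^esub>} \<subseteq> bb ` Bw \<and>
        finite {b. c b \<noteq> \<zero>\<^bsub>RM\<^esub>} \<and> u = finsum N (\<lambda>b. c b \<odot>\<^bsub>N\<^esub> b) {b. c b \<noteq> \<zero>\<^bsub>RM\<^esub>}" for c
    have bbM: "bb ` Bw \<subseteq> carrier M" using \<iota>bb(2) by auto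

    \<comment> \<open>Existence of coordinates\<close>
    have "\<exists>c. good_c c"
    proof -
      obtain w where w: "\<And>T. T \<in> B.TT \<Longrightarrow> w T \<in> Wh.W" "\<iota> u = (\<Sum>T\<in>B.TT. A (B.Pm T) (Wh.Y n (w T)))"
        using B.free_spanning[OF \<iota>V[OF u]] by blast
      define r where "r T = sv.representation Bw (w T)" for T
      define S where "S = (\<Union>T\<in>B.TT. {\<beta>. r T \<beta> \<noteq> 0})"
      have S: "finite S" "S \<subseteq> Bw"
        unfolding S_def r_def using B.finite_TT sv.finite_representation sv.representation_ne_zero by blast+
      have wr: "w T = (\<Sum>\<beta>\<in>S. sv (r T \<beta>) \<beta>)" if "T \<in> B.TT" for T
      proof -
        have "w T = (\<Sum>\<beta> | r T \<beta> \<noteq> 0. sv (r T \<beta>) \<beta>)"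
          unfolding r_def using sv.sum_nonzero_representation_eq[OF Bw(2) Bw_span[OF w(1)[OF that]]] by simp
        also have "\<dots> = (\<Sum>\<beta>\<in>S. sv (r T \<beta>) \<beta>)"
          using that S(1) by (intro sum.mono_neutral_left) (auto simp: S_def)
        finally show ?thesis .
      qed
      \<comment> \<open>Interchange of the two summations: the coefficient of \<open>\<beta>\<close>
        collects the \<open>\<beta>\<close>-coordinates of all the \<open>w T\<close>.\<close>
      define f where "f \<beta> = (\<Sum>T\<in>B.TT. scalar (r T \<beta>) * B.Pm T)" for \<beta>
      have fm: "f \<beta> \<in> carrier (free_alg m)" for \<beta>
      proof -
        have "finite Z \<Longrightarrow> Z \<subseteq> B.TT \<Longrightarrow> (\<Sum>T\<in>Z. scalar (r T \<beta>) * B.Pm T) \<in> carrier (free_alg m)" for Z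
        proof (induction Z rule: finite_induct)
          case (insert T Z)
          then have "B.Pm T \<in> carrier (free_alg m)" using B.Pm_C unfolding B.TT_def by blast
          then have "scalar (r T \<beta>) * B.Pm T \<in> carrier (free_alg m)" by (intro free_alg_closed(6,3))
          then show ?case using insert free_alg_closed(5) by simp
        qed (simp add: free_alg_closed(1))
        then show ?thesis unfolding f_def using B.finite_TT by blast
      qed
      have Af: "A (f \<beta>) v = (\<Sum>T\<in>B.TT. sv (r T \<beta>) (A (B.Pm T) v))" if "v \<in> V0" for \<beta> v
      proof -
        have "A (f \<beta>) v = (\<Sum>T\<in>B.TT. A (scalar (r T \<beta>) * B.Pm T) v)"
          unfolding f_def using A_sum[OF B.finite_TT, of "\<lambda>T. scalar (r T \<beta>) * B.Pm T" v] Pm_FG that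
            free_alg_closed(6)[OF sc_carrier] by blast
        also have "\<dots> = (\<Sum>T\<in>B.TT. sv (r T \<beta>) (A (B.Pm T) v))"
          using A_mult[OF sc_carrier Pm_FG that] A_scalar A_V0[OF Pm_FG that] by (intro sum.cong) auto
        finally show ?thesis .
      qed
      have \<iota>u: "\<iota> u = (\<Sum>\<beta>\<in>S. A (f \<beta>) (Wh.Y n \<beta>))"
      proof -
        have "A (B.Pm T) (Wh.Y n (w T)) = (\<Sum>\<beta>\<in>S. sv (r T \<beta>) (A (B.Pm T) (Wh.Y n \<beta>)))" if T: "T \<in> B.TT" for T
        proof -
          have PC: "B.Pm T \<in> carrier (free_alg m)" using B.Pm_C T unfolding B.TT_def by blast
          have YV: "Wh.Y n \<beta> \<in> V0" if "\<beta> \<in> S" for \<beta> using B.Y_V0 BwW S(2) that by blast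
          have "Wh.Y n (w T) = (\<Sum>\<beta>\<in>S. sv (r T \<beta>) (Wh.Y n \<beta>))"
            unfolding wr[OF T] using Y_sum[OF S(1), of "\<lambda>\<beta>. \<beta>"] BwW S(2) by blast
          then have "A (B.Pm T) (Wh.Y n (w T)) = (\<Sum>\<beta>\<in>S. A (B.Pm T) (sv (r T \<beta>) (Wh.Y n \<beta>)))"
            using B.A_sum_right[OF PC, of S "\<lambda>\<beta>. sv (r T \<beta>) (Wh.Y n \<beta>)"] YV sv.subspace_scale[OF V0_sub] by simp
          also have "\<dots> = (\<Sum>\<beta>\<in>S. sv (r T \<beta>) (A (B.Pm T) (Wh.Y n \<beta>)))"
            using B.A_sv[OF PC YV] by (intro sum.cong) auto
          finally show ?thesis .
        qed
        then have "\<iota> u = (\<Sum>T\<in>B.TT. \<Sum>\<beta>\<in>S. sv (r T \<beta>) (A (B.Pm T) (Wh.Y n \<beta>)))" using w(2) by simp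
        also have "\<dots> = (\<Sum>\<beta>\<in>S. \<Sum>T\<in>B.TT. sv (r T \<beta>) (A (B.Pm T) (Wh.Y n \<beta>)))" by (rule sum.swap)
        also have "\<dots> = (\<Sum>\<beta>\<in>S. A (f \<beta>) (Wh.Y n \<beta>))"
          using B.Y_V0 BwW S(2) by (intro sum.cong refl) (simp add: Af subset_iff)
        finally show ?thesis .
      qed
      define c where "c b = (if b \<in> bb ` S then cm (f (bi b)) else I)" for b
      have c1: "c b \<in> carrier RM" for b
        unfolding c_def RM(1) using fm free_alg_closed(1)[of m] cm0 by (auto split: if_splits)
      have c2: "{b. c b \<noteq> \<zero>\<^bsub>RM\<^esub>} \<subseteq> bb ` S" unfolding c_def RM(2) by auto
      have bbS: "bb ` S \<subseteq> carrier M" "finite (bb ` S)" using S bbM by auto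
      have "\<iota> (finsum N (\<lambda>b. c b \<odot>\<^bsub>N\<^esub> b) {b. c b \<noteq> \<zero>\<^bsub>RM\<^esub>}) = (\<Sum>b\<in>bb ` S. A (rp (c b)) (\<iota> b))"
        by (rule exp[OF c1 c2 bbS(2,1)])
      also have "\<dots> = (\<Sum>\<beta>\<in>S. A (rp (c (bb \<beta>))) (\<iota> (bb \<beta>)))"
        using bb_inj S(2) by (intro sum.reindex_cong[of bb S]) (auto intro: inj_on_subset)
      also have "\<dots> = (\<Sum>\<beta>\<in>S. A (f \<beta>) (Wh.Y n \<beta>))"
      proof (rule sum.cong[OF refl])
        fix \<beta> assume \<beta>: "\<beta> \<in> S"
        then have "c (bb \<beta>) = cm (f \<beta>)" unfolding c_def using bi S(2) by auto
        then have "cm (rp (c (bb \<beta>))) = cm (f \<beta>)" using trans[OF rp(2)[OF c1]] by blast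
        then have "rp (c (bb \<beta>)) - f \<beta> \<in> I" using cm_eq[OF rp(1)[OF c1] fm] by blast
        then have "cls (rp (c (bb \<beta>))) = cls (f \<beta>)" using cls_eq IJ rp(1)[OF c1] fm mFG by blast
        then show "A (rp (c (bb \<beta>))) (\<iota> (bb \<beta>)) = A (f \<beta>) (Wh.Y n \<beta>)"
          using \<iota>bb(1) \<beta> S(2) unfolding A_def by auto
      qed
      finally have e: "\<iota> (finsum N (\<lambda>b. c b \<odot>\<^bsub>N\<^esub> b) {b. c b \<noteq> \<zero>\<^bsub>RM\<^esub>}) = \<iota> u" using \<iota>u by simp
      have "finsum N (\<lambda>b. c b \<odot>\<^bsub>N\<^esub> b) {b. c b \<noteq> \<zero>\<^bsub>RM\<^esub>} \<in> carrier M"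
        unfolding N_finsum
      proof (rule M.finsum_closed, rule Pi_I)
        fix b assume "b \<in> {b. c b \<noteq> \<zero>\<^bsub>RM\<^esub>}"
        then have "b \<in> carrier M" using c2 bbS by auto
        then have "cls (rp (c b)) \<odot>\<^bsub>M\<^esub> b \<in> carrier M" using act_closed rp(1)[OF c1] mFG by blast
        then show "c b \<odot>\<^bsub>N\<^esub> b \<in> carrier M" using rp(2)[OF c1] N_smult by metis
      qed
      from inj_onD[OF \<iota>_inj e this u] have "u = finsum N (\<lambda>b. c b \<odot>\<^bsub>N\<^esub> b) {b. c b \<noteq> \<zero>\<^bsub>RM\<^esub>}"
        by (rule sym)
      moreover have "finite {b. c b \<noteq> \<zero>\<^bsub>RM\<^esub>}" using c2 bbS(2) by (rule finite_subset)
      moreover have "{b. c b \<noteq> \<zero>\<^bsub>RM\<^esub>} \<subseteq> bb ` Bw" using c2 S(2) by blast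
      ultimately have "good_c c" unfolding good_c_def by (intro conjI allI c1) 
      then show "\<exists>c. good_c c" by (intro exI[where x = c])
    qed

    \<comment> \<open>Uniqueness of coordinates\<close>
    moreover have "c = c'" if good: "good_c c" "good_c c'" for c c'
    proof -
      define S where "S = {b. c b \<noteq> \<zero>\<^bsub>RM\<^esub>} \<union> {b. c' b \<noteq> \<zero>\<^bsub>RM\<^esub>}"
      have S: "finite S" "S \<subseteq> bb ` Bw" using good unfolding good_c_def S_def by (elim conjE, simp)+
      have S3: "S \<subseteq> carrier M" using S(2) bbM by (rule subset_trans)
      have cR: "c b \<in> carrier RM" "c' b \<in> carrier RM" for b using good unfolding good_c_def by auto
      have cS: "{b. c b \<noteq> \<zero>\<^bsub>RM\<^esub>} \<subseteq> S" "{b. c' b \<noteq> \<zero>\<^bsub>RM\<^esub>} \<subseteq> S" unfolding S_def by auto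
      define d where "d b = rp (c b) - rp (c' b)" for b
      have dm: "d b \<in> carrier (free_alg m)" for b unfolding d_def by (intro free_alg_closed(8) rp(1) cR)
      have Ad: "A (d b) v = A (rp (c b)) v - A (rp (c' b)) v" if "v \<in> V0" for b v
      proof -
        have "A (d b + rp (c' b)) v = A (d b) v + A (rp (c' b)) v"
          using dm rp(1)[OF cR(2)] mFG that by (intro A_add) auto
        then show ?thesis by (simp only: d_def diff_add_cancel eq_diff_eq)
      qed
      have "(\<Sum>b\<in>S. A (rp (c b)) (\<iota> b)) = (\<Sum>b\<in>S. A (rp (c' b)) (\<iota> b))"
        using exp[OF cR(1) cS(1) S(1) S3] exp[OF cR(2) cS(2) S(1) S3] good unfolding good_c_def by metis
      then have d0: "(\<Sum>b\<in>S. A (d b) (\<iota> b)) = 0"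
        using S3 \<iota>V by (simp add: Ad subset_iff sum_subtractf)
      \<comment> \<open>\<open>carrier_good\<close> reduces the difference of two coefficients to
        normal monomials modulo \<open>I\<close>.\<close>
      have ex: "\<exists>q. d b - (\<Sum>T\<in>B.TT. scalar (q T) * B.Pm T) \<in> I" for b
      proof -
        have "d b \<in> S.good 0" by (rule carrier_good[OF dm])
        then show ?thesis
          unfolding S.good_def
        proof (induction rule: U.span_induct_alt)
          case base
          show ?case using Ic(2) by (intro exI[of _ "\<lambda>T. 0"]) (simp add: scalar_0)
        next
          case (step a f g)
          then obtain q where q: "g - (\<Sum>T\<in>B.TT. scalar (q T) * B.Pm T) \<in> I" by blast
          show ?case
          proof (cases "f \<in> I")
            case True
            then have "scU a f + (g - (\<Sum>T\<in>B.TT. scalar (q T) * B.Pm T)) \<in> I"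
              using q U.subspace_add[OF I_sub] U.subspace_scale[OF I_sub] by blast
            then show ?thesis by (intro exI[of _ q]) (simp add: add_diff_eq)
          next
            case False
            then obtain T where T: "f = B.Pm T" "T \<in> B.TT" using step(1) unfolding B.TT_def by auto
            have "(\<Sum>T'\<in>B.TT. scalar ((q(T := q T + a)) T') * B.Pm T')
              = (\<Sum>T'\<in>B.TT. scalar (q T') * B.Pm T' + (if T' = T then scU a f else 0))"
              using T by (intro sum.cong refl) (simp add: scalar_add distrib_right)
            also have "\<dots> = (\<Sum>T'\<in>B.TT. scalar (q T') * B.Pm T') + scU a f"
              using T(2) B.finite_TT by (simp add: sum.distrib)
            finally have "scU a f + g - (\<Sum>T'\<in>B.TT. scalar ((q(T := q T + a)) T') * B.Pm T')
              = g - (\<Sum>T\<in>B.TT. scalar (q T) * B.Pm T)" by simp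
            then show ?thesis using q by (intro exI[of _ "q(T := q T + a)"]) (simp only:)
          qed
        qed
      qed
      have "\<exists>q. \<forall>b. d b - (\<Sum>T\<in>B.TT. scalar (q b T) * B.Pm T) \<in> I"
        using ex by (intro choice allI)
      then obtain q where q: "\<And>b. d b - (\<Sum>T\<in>B.TT. scalar (q b T) * B.Pm T) \<in> I" by blast
      have Aq: "A (d b) v = (\<Sum>T\<in>B.TT. sv (q b T) (A (B.Pm T) v))" if v: "v \<in> V0" for b v
      proof -
        have s: "(\<Sum>T\<in>B.TT. scalar (q b T) * B.Pm T) \<in> carrier FG"
          "A (\<Sum>T\<in>B.TT. scalar (q b T) * B.Pm T) v = (\<Sum>T\<in>B.TT. A (scalar (q b T) * B.Pm T) v)"
          using A_sum[OF B.finite_TT, of "\<lambda>T. scalar (q b T) * B.Pm T" v] Pm_FG v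
            free_alg_closed(6)[OF sc_carrier] by blast+
        have "A (d b) v = A ((d b - (\<Sum>T\<in>B.TT. scalar (q b T) * B.Pm T)) + (\<Sum>T\<in>B.TT. scalar (q b T) * B.Pm T)) v"
          by simp
        also have "\<dots> = A (d b - (\<Sum>T\<in>B.TT. scalar (q b T) * B.Pm T)) v + A (\<Sum>T\<in>B.TT. scalar (q b T) * B.Pm T) v"
          using q[of b] IJ Jc(1) s(1) v by (intro A_add) auto
        also have "\<dots> = (\<Sum>T\<in>B.TT. A (scalar (q b T) * B.Pm T) v)" using q[of b] IJ A_J[OF _ v] s(2) by (simp add: subset_iff)
        also have "\<dots> = (\<Sum>T\<in>B.TT. sv (q b T) (A (B.Pm T) v))"
          using A_mult[OF sc_carrier Pm_FG v] A_scalar A_V0[OF Pm_FG v] by (intro sum.cong) auto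
        finally show ?thesis .
      qed
      \<comment> \<open>The vanishing sum is regrouped by monomials. Then
        \<open>free_independent\<close> gives \<open>w T = 0\<close>, and the independence of
        \<open>Bw\<close> kills every \<open>q b T\<close>.\<close>
      define w where "w T = (\<Sum>b\<in>S. sv (q b T) (bi b))" for T
      have biB: "bi b \<in> Bw" "\<iota> b = Wh.Y n (bi b)" if b: "b \<in> S" for b
      proof -
        obtain \<beta> where "\<beta> \<in> Bw" "b = bb \<beta>" using S(2) b by auto
        then show "bi b \<in> Bw" "\<iota> b = Wh.Y n (bi b)" using bi \<iota>bb(1) by auto
      qed
      have wY: "Wh.Y n (w T) = (\<Sum>b\<in>S. sv (q b T) (\<iota> b))" "w T \<in> Wh.W" for T
        unfolding w_def using Y_sum[OF S(1), of bi "\<lambda>b. q b T"] biB BwW by auto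
      have "(\<Sum>T\<in>B.TT. A (B.Pm T) (Wh.Y n (w T))) = (\<Sum>T\<in>B.TT. \<Sum>b\<in>S. sv (q b T) (A (B.Pm T) (\<iota> b)))"
      proof (rule sum.cong[OF refl])
        fix T assume T: "T \<in> B.TT"
        have PC: "B.Pm T \<in> carrier (free_alg m)" using B.Pm_C T unfolding B.TT_def by blast
        have bV: "\<iota> b \<in> V0" if "b \<in> S" for b using \<iota>V S3 that by blast
        have "A (B.Pm T) (Wh.Y n (w T)) = (\<Sum>b\<in>S. A (B.Pm T) (sv (q b T) (\<iota> b)))"
          unfolding wY using bV sv.subspace_scale[OF V0_sub] by (intro B.A_sum_right[OF PC]) blast
        also have "\<dots> = (\<Sum>b\<in>S. sv (q b T) (A (B.Pm T) (\<iota> b)))"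
          using B.A_sv[OF PC bV] by (intro sum.cong) auto
        finally show "A (B.Pm T) (Wh.Y n (w T)) = (\<Sum>b\<in>S. sv (q b T) (A (B.Pm T) (\<iota> b)))" .
      qed
      also have "\<dots> = (\<Sum>b\<in>S. \<Sum>T\<in>B.TT. sv (q b T) (A (B.Pm T) (\<iota> b)))" by (rule sum.swap)
      also have "\<dots> = (\<Sum>b\<in>S. A (d b) (\<iota> b))" using \<iota>V S3 by (intro sum.cong refl) (simp add: Aq subset_iff)
      finally have "(\<Sum>T\<in>B.TT. A (B.Pm T) (Wh.Y n (w T))) = 0" using d0 by simp
      then have w0: "w T = 0" if "T \<in> B.TT" for T using B.free_independent[of w] wY(2) that by blast
      have bi_inj: "inj_on bi S" unfolding bi_def using S(2) by (rule inj_on_inv_into)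
      have q0: "q b T = 0" if b: "b \<in> S" and T: "T \<in> B.TT" for b T
      proof -
        have "(\<Sum>\<beta>\<in>bi ` S. sv (q (inv_into S bi \<beta>) T) \<beta>) = w T"
          unfolding w_def using bi_inj by (intro sum.reindex_cong[of bi S]) auto
        then have "(\<Sum>\<beta>\<in>bi ` S. sv (q (inv_into S bi \<beta>) T) \<beta>) = 0" using w0[OF T] by simp
        moreover have "finite (bi ` S)" "bi ` S \<subseteq> Bw" "bi b \<in> bi ` S" using S(1) biB b by auto
        ultimately have "q (inv_into S bi (bi b)) T = 0"
          using sv.independentD[OF Bw(2), of "bi ` S" "\<lambda>\<beta>. q (inv_into S bi \<beta>) T" "bi b"] by blast
        then show ?thesis using bi_inj b by simp
      qed
      show "c = c'"
      proof
        fix b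
        show "c b = c' b"
        proof (cases "b \<in> S")
          case True
          have "(\<Sum>T\<in>B.TT. scalar (q b T) * B.Pm T) = 0" using q0[OF True] by (intro sum.neutral) (simp add: scalar_0)
          then have "rp (c b) - rp (c' b) \<in> I" using q[of b] by (simp add: d_def)
          then have "cm (rp (c b)) = cm (rp (c' b))" using cm_eq rp(1) cR by blast
          then show ?thesis using rp(2)[OF cR(1)] rp(2)[OF cR(2)] by metis
        next
          case False
          then show ?thesis unfolding S_def by simp
        qed
      qed
    qed
    ultimately have "\<exists>!c. good_c c" by (rule ex_ex1I)
    then show "\<exists>!c. (\<forall>b. c b \<in> carrier RM) \<and> {b. c b \<noteq> \<zero>\<^bsub>RM\<^esub>} \<subseteq> bb ` Bw \<and> finite {b. c b \<noteq> \<zero>\<^bsub>RM\<^esub>} \<and>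
        u = finsum N (\<lambda>b. c b \<odot>\<^bsub>N\<^esub> b) {b. c b \<noteq> \<zero>\<^bsub>RM\<^esub>}"
      unfolding good_c_def .
  qed
qed

end

section \<open>The subalgebra attached to a grading\<close>

text \<open>Gram-Schmidt for a pairing that is nondegenerate on the side of \<open>W\<close>: a new
  vector is made orthogonal to the old dual vectors, and its partner to the old basis.\<close>

lemma (in vector_space) dual_family:
  assumes "finite B" "independent B" "subspace U"
    and lin: "\<And>z z' u c. z \<in> W \<Longrightarrow> z' \<in> W \<Longrightarrow> u \<in> U \<Longrightarrow> \<beta> (z + z') u = \<beta> z u + \<beta> z' u"
      "\<And>z u c. z \<in> W \<Longrightarrow> u \<in> U \<Longrightarrow> \<beta> (scale c z) u = c * \<beta> z u"
      "\<And>z u u'. z \<in> W \<Longrightarrow> u \<in> U \<Longrightarrow> u' \<in> U \<Longrightarrow> \<beta> z (u + u') = \<beta> z u + \<beta> z u'"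
      "\<And>z u c. z \<in> W \<Longrightarrow> u \<in> U \<Longrightarrow> \<beta> z (scale c u) = c * \<beta> z u"
    and W: "subspace W" "B \<subseteq> W"
    and nondeg: "\<And>z. z \<in> W \<Longrightarrow> z \<noteq> 0 \<Longrightarrow> \<exists>u\<in>U. \<beta> z u \<noteq> 0"
  shows "\<exists>y. \<forall>b\<in>B. y b \<in> U \<and> (\<forall>b'\<in>B. \<beta> b' (y b) = (if b' = b then 1 else 0))"
  using assms(1,2,9)
proof (induction B rule: finite_induct)
  case (insert b B)
  have "independent B" using insert.prems(1) by (rule independent_mono) auto
  then obtain y where "\<forall>c\<in>B. y c \<in> U \<and> (\<forall>c'\<in>B. \<beta> c' (y c) = (if c' = c then 1 else 0))"
    using insert.IH insert.prems(2) by blast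
  then have y: "\<And>c. c \<in> B \<Longrightarrow> y c \<in> U" 
    "\<And>c c'. c \<in> B \<Longrightarrow> c' \<in> B \<Longrightarrow> \<beta> c' (y c) = (if c' = c then 1 else 0)" by blast+
  have bW: "b \<in> W" "B \<subseteq> W" using insert by auto
  have \<beta>_sum: "\<beta> z (\<Sum>c\<in>S. scale (r c) (u c)) = (\<Sum>c\<in>S. r c * \<beta> z (u c)) \<and> (\<Sum>c\<in>S. scale (r c) (u c)) \<in> U"
    if "z \<in> W" "finite S" "\<And>c. c \<in> S \<Longrightarrow> u c \<in> U" for z S r u
    using that(2,3)
  proof (induction S rule: finite_induct)
    case empty
    have "\<beta> z (scale 0 0) = 0 * \<beta> z 0" by (rule lin(4)[OF that(1) subspace_0[OF assms(3)]])
    then show ?case using subspace_0[OF assms(3)] by simp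
  next
    case (insert c S)
    then have "u c \<in> U" "scale (r c) (u c) \<in> U" using subspace_scale[OF assms(3)] by auto
    then show ?case using insert lin(3)[OF that(1)] lin(4)[OF that(1)] subspace_add[OF assms(3)] by simp
  qed
  have \<beta>_suml: "\<beta> (\<Sum>c\<in>S. scale (r c) (z c)) u = (\<Sum>c\<in>S. r c * \<beta> (z c) u) \<and> (\<Sum>c\<in>S. scale (r c) (z c)) \<in> W"
    if "u \<in> U" "finite S" "\<And>c. c \<in> S \<Longrightarrow> z c \<in> W" for u S r z
    using that(2,3)
  proof (induction S rule: finite_induct)
    case empty
    have "\<beta> (scale 0 0) u = 0 * \<beta> 0 u" by (rule lin(2)[OF subspace_0[OF W(1)] that(1)])
    then show ?case using subspace_0[OF W(1)] by simp
  next
    case (insert c S)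
    then have "z c \<in> W" "scale (r c) (z c) \<in> W" using subspace_scale[OF W(1)] by auto
    then show ?case using insert lin(1)[OF _ _ that(1)] lin(2)[OF _ that(1)] subspace_add[OF W(1)] by simp
  qed
  \<comment> \<open>\<open>z\<close> pairs to zero with every old \<open>y c\<close>, and it is
    nonzero because \<open>b\<close> lies outside the span of \<open>B\<close>.\<close>
  define z where "z = b + (\<Sum>c\<in>B. scale (- \<beta> b (y c)) c)"
  have s: "(\<Sum>c\<in>B. scale (- \<beta> b (y c)) c) \<in> span B" by (intro span_sum span_scale span_base)
  have sW: "(\<Sum>c\<in>B. scale (- \<beta> b (y c)) c) \<in> W"
    by (intro subspace_sum[OF W(1)] subspace_scale[OF W(1)]) (use bW in auto)
  have "b \<notin> span B" using insert(2,4) independent_insert by simp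
  moreover have "b = z - (\<Sum>c\<in>B. scale (- \<beta> b (y c)) c)" unfolding z_def by simp
  ultimately have "z \<noteq> 0" using span_neg[OF s] by auto
  moreover have "z \<in> W" unfolding z_def using bW sW subspace_add[OF W(1)] by blast
  ultimately obtain u where u: "u \<in> U" "\<beta> z u \<noteq> 0" using nondeg by blast
  \<comment> \<open>The correction makes \<open>u'\<close> orthogonal to \<open>B\<close>; its
    pairing with \<open>b\<close> becomes that of \<open>u\<close> with \<open>z\<close>, which is
    nonzero.\<close>
  define u' where "u' = u + (\<Sum>c\<in>B. scale (- \<beta> c u) (y c))"
  have sU: "(\<Sum>c\<in>B. scale (- \<beta> c u) (y c)) \<in> U"
    by (intro subspace_sum[OF assms(3)] subspace_scale[OF assms(3)] y)
  have u'U: "u' \<in> U" unfolding u'_def using u sU subspace_add[OF assms(3)] by blast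
  have \<beta>u': "\<beta> c u' = 0" if "c \<in> B" for c
  proof -
    have cW: "c \<in> W" using that bW by auto
    have "\<beta> c u' = \<beta> c u + (\<Sum>c'\<in>B. - \<beta> c' u * \<beta> c (y c'))"
      unfolding u'_def using lin(3)[OF cW u(1) sU] \<beta>_sum[OF cW insert(1), of y "\<lambda>c. - \<beta> c u"] y by simp
    also have "(\<Sum>c'\<in>B. - \<beta> c' u * \<beta> c (y c')) = (\<Sum>c'\<in>B. if c' = c then - \<beta> c u else 0)"
      using y that by (intro sum.cong) auto
    finally show ?thesis using that insert(1) by simp
  qed
  have "\<beta> b u' = \<beta> z u"
  proof -
    have "\<beta> b u' = \<beta> b u + (\<Sum>c\<in>B. - \<beta> c u * \<beta> b (y c))"
      unfolding u'_def using lin(3)[OF bW(1) u(1) sU] \<beta>_sum[OF bW(1) insert(1), of y "\<lambda>c. - \<beta> c u"] y by simp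
    moreover have "\<beta> z u = \<beta> b u + (\<Sum>c\<in>B. - \<beta> b (y c) * \<beta> c u)"
      unfolding z_def using lin(1)[OF bW(1) sW u(1)] \<beta>_suml[OF u(1) insert(1), of "\<lambda>c. c" "\<lambda>c. - \<beta> b (y c)"] bW by auto
    ultimately show ?thesis by (simp add: mult.commute)
  qed
  define t where "t = scale (inverse (\<beta> z u)) u'"
  have t: "t \<in> U" "\<beta> b t = 1" "\<And>c. c \<in> B \<Longrightarrow> \<beta> c t = 0"
    unfolding t_def using u'U \<open>\<beta> b u' = \<beta> z u\<close> u(2) \<beta>u' bW lin(4) subspace_scale[OF assms(3)] by auto
  \<comment> \<open>The old dual vectors are made orthogonal to \<open>b\<close>. Their pairings
    with \<open>B\<close> do not change, as \<open>t\<close> is orthogonal to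
    \<open>B\<close>.\<close>
  define y' where "y' c = (if c = b then t else y c + scale (- \<beta> b (y c)) t)" for c
  have y'U: "y' c \<in> U" if "c \<in> insert b B" for c
    unfolding y'_def using that t(1) subspace_add[OF assms(3) y(1)[of c] subspace_scale[OF assms(3) t(1)]]
    by (cases "c = b") (simp_all only: if_True if_False insert_iff simp_thms)
  have "\<beta> c' (y' c) = (if c' = c then 1 else 0)" if "c \<in> insert b B" "c' \<in> insert b B" for c c'
  proof (cases "c = b")
    case True then show ?thesis using t that insert(2) by (auto simp: y'_def)
  next
    case False
    then have cB: "c \<in> B" using that by auto
    have c'W: "c' \<in> W" using that bW by auto
    have "\<beta> c' (y' c) = \<beta> c' (y c) + - \<beta> b (y c) * \<beta> c' t"
      using False lin(3)[OF c'W y(1)[OF cB] subspace_scale[OF assms(3) t(1)]] lin(4)[OF c'W t(1)]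
      unfolding y'_def by (simp only: if_False)
    then show ?thesis using t y(2)[OF cB] that(2) cB insert(2) by auto
  qed
  then show ?case using y'U by (intro exI[of _ y'] ballI conjI)
qed simp

lemma (in vector_space) finite_independent:
  assumes "finite B" "V \<subseteq> span B" "S \<subseteq> V" "independent S"
  shows "finite S"
  using independent_span_bound[OF assms(1,4)] assms(2,3) by blast

text \<open>The interface between the two halves of the proof: the freeness argument rests on these
  properties, and each family of superalgebras has to supply them.\<close>

locale graded_character =
  fixes G :: "('k::field, 'g::ab_group_add) lsuper" and chi :: "'g \<Rightarrow> 'k" and gr :: "int \<Rightarrow> 'g set"
  assumes restricted: "restricted_lie_superalgebra G"
    and char: "CHAR('k) > 2"
    and chi_add: "z \<in> space_of G \<Longrightarrow> z' \<in> space_of G \<Longrightarrow> chi (z + z') = chi z + chi z'"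
    and chi_scale: "z \<in> space_of G \<Longrightarrow> chi (scl G c z) = c * chi z"
    and chi_odd: "z \<in> part G True \<Longrightarrow> chi z = 0"
    and chi_gr: "z \<in> gr l \<Longrightarrow> l \<noteq> -2 \<Longrightarrow> chi z = 0"
    and ds: "direct_sum (space_of G) gr"
    and gr_sub: "module.subspace (scl G) (gr k)"
    and br_gr: "z \<in> gr l \<Longrightarrow> z' \<in> gr l' \<Longrightarrow> brk G z z' \<in> gr (l + l')"
    and gr_par: "gr k = total (\<lambda>a. gr k \<inter> part G a)"
    and nondeg: "z \<in> gr k \<Longrightarrow> k < 0 \<Longrightarrow> (\<And>u. u \<in> space_of G \<Longrightarrow> chi (brk G z u) = 0) \<Longrightarrow> z = 0"
    and ppow_fil: "d \<ge> 1 \<Longrightarrow> z \<in> part G False \<Longrightarrow> z \<in> module.span (scl G) (\<Union>k\<in>{d..}. gr (- k)) \<Longrightarrow>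
        ppow G z \<in> module.span (scl G) (\<Union>k\<in>{int CHAR('k) * d..}. gr (- k))"
    and fd: "\<exists>B. finite B \<and> space_of G \<subseteq> module.span (scl G) B"
begin

lemma lie: "lie_superalgebra G" using restricted by (simp add: restricted_lie_superalgebra_def)

sublocale g: vector_space "scl G"
  using lie by (simp add: lie_superalgebra_def graded_space_def)

lemma part_sub: "g.subspace (part G a)" using lie by (simp add: lie_superalgebra_def graded_space_def)

lemma space_sub: "g.subspace (space_of G)"
  unfolding total_def using g.subspace_sums[OF part_sub part_sub] .

lemma br_lin:
  assumes "u \<in> space_of G" "v \<in> space_of G" "w \<in> space_of G"
  shows "brk G (u + v) w = brk G u w + brk G v w" "brk G u (v + w) = brk G u v + brk G u w"
    "brk G (scl G c u) w = scl G c (brk G u w)" "brk G u (scl G c w) = scl G c (brk G u w)"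
  using lie assms unfolding lie_superalgebra_def by blast+

lemma br_part: "z \<in> part G a \<Longrightarrow> z' \<in> part G b \<Longrightarrow> brk G z z' \<in> part G (a \<noteq> b)"
  using lie unfolding lie_superalgebra_def by blast

lemma br_space: "u \<in> space_of G \<Longrightarrow> v \<in> space_of G \<Longrightarrow> brk G u v \<in> space_of G"
proof -
  assume uv: "u \<in> space_of G" "v \<in> space_of G"
  obtain u0 u1 where u: "u0 \<in> part G False" "u1 \<in> part G True" "u = u0 + u1" using uv(1) unfolding total_def by auto
  obtain v0 v1 where v: "v0 \<in> part G False" "v1 \<in> part G True" "v = v0 + v1" using uv(2) unfolding total_def by auto
  note ps = subsetD[OF part_space[OF lie]]
  have "brk G u v = (brk G u0 v0 + brk G u0 v1) + (brk G u1 v0 + brk G u1 v1)"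
    unfolding u(3) v(3) using ps[OF u(1)] ps[OF u(2)] ps[OF v(1)] ps[OF v(2)] g.subspace_add[OF space_sub] by (simp add: br_lin)
  moreover have "brk G u0 v0 \<in> space_of G" "brk G u0 v1 \<in> space_of G" "brk G u1 v0 \<in> space_of G" "brk G u1 v1 \<in> space_of G"
    using ps br_part u v by blast+
  ultimately show ?thesis by (simp add: g.subspace_add[OF space_sub])
qed

lemma gr_space: "gr k \<subseteq> space_of G" using ds unfolding direct_sum_def by blast

lemma chi_0: "chi 0 = 0" using chi_scale[of 0 0] g.subspace_0[OF space_sub] by simp

text \<open>By uniqueness of decompositions, a degree can be nonzero only if it occurs in one of
  finitely many basis vectors.\<close>

lemma finite_degrees: "\<exists>K\<ge>0. \<forall>k>K. gr (- int k) = {0}"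
proof -
  obtain B where B: "finite B" "space_of G \<subseteq> g.span B" using fd by blast
  obtain S where S: "S \<subseteq> space_of G" "g.independent S" "space_of G \<subseteq> g.span S"
    using g.maximal_independent_subset by metis
  have fS: "finite S" by (rule g.finite_independent[OF B S(1,2)])
  have "\<forall>s\<in>S. \<exists>c. (\<forall>k. c k \<in> gr k) \<and> finite {k. c k \<noteq> 0} \<and> s = (\<Sum>k | c k \<noteq> 0. c k)"
    using ds S(1) unfolding direct_sum_def by blast
  then obtain c where c: "\<And>s. s \<in> S \<Longrightarrow> (\<forall>k. c s k \<in> gr k) \<and> finite {k. c s k \<noteq> 0} \<and> s = (\<Sum>k | c s k \<noteq> 0. c s k)"
    by metis
  define D where "D = (\<Union>s\<in>S. {k. c s k \<noteq> 0})"
  have fD: "finite D" unfolding D_def using fS c by blast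
  have zero: "gr k = {0}" if k: "k \<notin> D" for k
  proof -
    have "z = 0" if z: "z \<in> gr k" for z
    proof -
      have "z \<in> g.span S" using z gr_space S(3) by blast
      then obtain r where r: "z = (\<Sum>s\<in>S. scl G (r s) s)" using g.span_finite[OF fS] by auto
      define d where "d j = (\<Sum>s\<in>S. scl G (r s) (c s j))" for j
      have dg: "d j \<in> gr j" for j
        unfolding d_def using c by (intro g.subspace_sum[OF gr_sub] g.subspace_scale[OF gr_sub]) auto
      have dD: "{j. d j \<noteq> 0} \<subseteq> D" unfolding d_def D_def by (auto intro: ccontr sum.neutral)
      have "z = (\<Sum>s\<in>S. scl G (r s) (\<Sum>j\<in>D. c s j))"
        unfolding r
      proof (rule sum.cong[OF refl])
        fix s assume s: "s \<in> S"
        have "s = (\<Sum>j | c s j \<noteq> 0. c s j)" using c s by blast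
        also have "\<dots> = (\<Sum>j\<in>D. c s j)" using fD s by (intro sum.mono_neutral_left) (auto simp: D_def)
        finally show "scl G (r s) s = scl G (r s) (\<Sum>j\<in>D. c s j)" by simp
      qed
      also have "\<dots> = (\<Sum>j\<in>D. d j)" unfolding d_def g.scale_sum_right by (rule sum.swap)
      also have "\<dots> = (\<Sum>j | d j \<noteq> 0. d j)" using fD dD by (intro sum.mono_neutral_right) auto
      finally have 1: "z = (\<Sum>j | d j \<noteq> 0. d j)" .
      define e where "e j = (if j = k then z else 0)" for j
      have eg: "e j \<in> gr j" for j unfolding e_def using z g.subspace_0[OF gr_sub] by simp
      have es: "{j. e j \<noteq> 0} \<subseteq> {k}" unfolding e_def by auto
      have "(\<Sum>j | e j \<noteq> 0. e j) = (\<Sum>j\<in>{k}. e j)" using es by (intro sum.mono_neutral_left) auto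
      then have 2: "z = (\<Sum>j | e j \<noteq> 0. e j)" by (simp add: e_def)
      have "z \<in> space_of G" using z gr_space by blast
      then have "\<exists>!c. (\<forall>k. c k \<in> gr k) \<and> finite {k. c k \<noteq> 0} \<and> z = (\<Sum>k | c k \<noteq> 0. c k)"
        using ds unfolding direct_sum_def by blast
      moreover have "finite {j. d j \<noteq> 0}" "finite {j. e j \<noteq> 0}"
        using dD es fD by (auto intro: finite_subset)
      ultimately have "d = e" using 1 2 dg eg by blast
      moreover have "d k = 0" using k dD by auto
      ultimately show "z = 0" by (simp add: e_def)
    qed
    then show ?thesis using g.subspace_0[OF gr_sub] by blast
  qed
  define K where "K = nat (Max (insert 0 (uminus ` D)))"
  have "gr (- int k) = {0}" if "k > K" for k
  proof (rule zero, rule notI)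
    assume "- int k \<in> D"
    then have "int k \<in> uminus ` D" by force
    then have "int k \<le> Max (insert 0 (uminus ` D))" using fD by (intro Max_ge) auto
    then show False using that unfolding K_def by linarith
  qed
  then show ?thesis by blast
qed

text \<open>\<open>chi\<close> lives in degree -2 and even parity, so a homogeneous \<open>z\<close>
  can pair nontrivially only with elements of complementary degree and the same parity.\<close>

lemma nondeg_homogeneous:
  assumes "z \<in> gr (- k)" "z \<in> part G a" "k \<ge> 1" "z \<noteq> 0"
  shows "\<exists>u\<in>gr (k - 2) \<inter> part G a. chi (brk G z u) \<noteq> 0"
proof (rule ccontr)
  assume neg: "\<not> ?thesis"
  have zs: "z \<in> space_of G" using assms(1) gr_space by blast
  have hom: "chi (brk G z u) = 0" if "u \<in> gr j" "u \<in> part G b" for u j b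
  proof -
    have "chi (brk G z u) = 0" if "j \<noteq> k - 2"
      using br_gr[OF assms(1) \<open>u \<in> gr j\<close>] that by (intro chi_gr) auto
    moreover have "chi (brk G z u) = 0" if "b \<noteq> a"
      using br_part[OF assms(2) \<open>u \<in> part G b\<close>] that by (intro chi_odd) auto
    ultimately show ?thesis using neg that by blast
  qed
  have gru: "chi (brk G z u) = 0" if "u \<in> gr j" for u j
  proof -
    have "u \<in> total (\<lambda>a. gr j \<inter> part G a)" using that gr_par by blast
    then obtain u0 u1 where u: "u0 \<in> gr j \<inter> part G False" "u1 \<in> gr j \<inter> part G True" "u = u0 + u1"
      unfolding total_def by blast
    then have us: "u0 \<in> space_of G" "u1 \<in> space_of G" using gr_space by auto
    have "chi (brk G z u) = chi (brk G z u0) + chi (brk G z u1)"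
      unfolding u(3) using br_lin(2)[OF zs us] chi_add br_space zs us by simp
    then show ?thesis using hom u by auto
  qed
  have "chi (brk G z u) = 0" if u: "u \<in> space_of G" for u
  proof -
    obtain c where c: "\<And>k. c k \<in> gr k" "finite {k. c k \<noteq> 0}" "u = (\<Sum>k | c k \<noteq> 0. c k)"
      using ds u unfolding direct_sum_def by blast
    have "finite S \<Longrightarrow> chi (brk G z (\<Sum>k\<in>S. c k)) = 0 \<and> (\<Sum>k\<in>S. c k) \<in> space_of G" for S
    proof (induction S rule: finite_induct)
      case empty
      have "brk G z (scl G 0 0) = scl G 0 (brk G z 0)" using zs g.subspace_0[OF space_sub] by (intro br_lin) auto
      then show ?case using chi_0 g.subspace_0[OF space_sub] by simp
    next
      case (insert j S)
      have cj: "c j \<in> space_of G" using c(1) gr_space by blast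
      have "brk G z (c j + (\<Sum>k\<in>S. c k)) = brk G z (c j) + brk G z (\<Sum>k\<in>S. c k)"
        using insert zs cj by (intro br_lin) auto
      then show ?case using insert gru[OF c(1)] chi_add br_space zs cj g.subspace_add[OF space_sub cj] by simp
    qed
    then show ?thesis using c by blast
  qed
  then have "z = 0" using assms by (intro nondeg[of z "- k"]) auto
  then show False using assms by simp
qed

abbreviation Fil where "Fil d \<equiv> g.span (\<Union>k\<in>{d..}. gr (- k))"

lemma Fil_mono: "d' \<le> d \<Longrightarrow> Fil d \<subseteq> Fil d'"
  by (intro g.span_mono) fastforce

lemma Fil_space: "Fil d \<subseteq> space_of G"
  using gr_space by (intro g.span_minimal[OF _ space_sub]) blast

lemma br_Fil:
  assumes "z \<in> Fil d" "z' \<in> Fil d'"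
  shows "brk G z z' \<in> Fil (d + d')"
proof -
  have z's: "z' \<in> space_of G" using assms(2) Fil_space by blast
  have 1: "brk G u z' \<in> Fil (d + d') \<and> z' \<in> Fil d'" if u: "u \<in> gr (- k)" "k \<ge> d" for u k
    using assms(2)
  proof (induction rule: g.span_induct_alt)
    case base
    have "brk G u (scl G 0 0) = scl G 0 (brk G u 0)" using u gr_space g.subspace_0[OF space_sub] by (intro br_lin) auto
    then show ?case by (simp add: g.span_zero)
  next
    case (step c v w)
    then obtain j where j: "v \<in> gr (- j)" "j \<ge> d'" by auto
    have us: "u \<in> space_of G" "v \<in> space_of G" "w \<in> space_of G" "scl G c v \<in> space_of G"
      using u j gr_space step Fil_space g.subspace_scale[OF space_sub] by blast+
    have "brk G u (scl G c v + w) = scl G c (brk G u v) + brk G u w"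
      using br_lin(2)[OF us(1,4,3)] br_lin(4)[OF us(1,1,2)] by simp
    moreover have "brk G u v \<in> gr (- (k + j))" using br_gr[OF u(1) j(1)] by (simp add: algebra_simps)
    then have "brk G u v \<in> Fil (d + d')" using u j by (intro g.span_base UN_I[of "k + j"]) auto
    moreover have "scl G c v + w \<in> Fil d'" using j step by (intro g.span_add g.span_scale g.span_base[of v]) auto
    ultimately show ?case using step by (auto intro: g.span_add g.span_scale)
  qed
  have "brk G z z' \<in> Fil (d + d') \<and> z \<in> Fil d"
    using assms(1)
  proof (induction rule: g.span_induct_alt)
    case base
    have "brk G (scl G 0 0) z' = scl G 0 (brk G 0 z')" using z's g.subspace_0[OF space_sub] by (intro br_lin) auto
    then show ?case by (simp add: g.span_zero)
  next
    case (step c v w)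
    then obtain j where j: "v \<in> gr (- j)" "j \<ge> d" by auto
    have us: "v \<in> space_of G" "w \<in> space_of G" "scl G c v \<in> space_of G"
      using j gr_space step Fil_space g.subspace_scale[OF space_sub] by blast+
    have "brk G (scl G c v + w) z' = scl G c (brk G v z') + brk G w z'"
      using br_lin(1)[OF us(3,2) z's] br_lin(3)[OF us(1,1) z's] by simp
    moreover have "scl G c v + w \<in> Fil d" using j step by (intro g.span_add g.span_scale g.span_base[of v]) auto
    ultimately show ?case using 1[OF j] step by (auto intro: g.span_add g.span_scale)
  qed
  then show ?thesis by simp
qed

lemma gr_part_sub: "g.subspace (gr k \<inter> part G a)" by (rule g.subspace_inter[OF gr_sub part_sub])

text \<open>Bases of the homogeneous parts of \<open>m\<close> are listed by increasing depth, and
  dual vectors are found part by part. \<open>m\<close> is a restricted subalgebra because brackets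
  and \<open>p\<close>-th powers land in degree -2 and below, all of which it contains.\<close>

theorem graded_free_associated:
  fixes M :: "(('g list \<Rightarrow>\<^sub>0 'k) set, 'm) module"
  assumes "associated_subalgebra G chi gr m"
    and "graded_module (red_env G chi (space_of G)) (red_env_part G chi (space_of G)) M Mp"
  shows "graded_free (red_env G chi m) (restrict_module G chi M) Mp"
proof -
  obtain E and v :: "nat \<Rightarrow> 'g" and r where E: "maximal_isotropic G chi (gr (- 1) \<inter> part G False) E"
    and v: "inj_on v {1..r}" "g.independent (v ` {1..r})" "g.span (v ` {1..r}) = gr (- 1) \<inter> part G True"
      "\<forall>i\<in>{1..r}. \<forall>j\<in>{1..r}. chi (brk G (v i) (v j)) = (if i + j = r + 1 then 1 else 0)"
    and m: "m = g.span ((\<Union>k\<in>{2..}. gr (- k)) \<union> E \<union> v ` {1..r div 2})"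
    using assms(1) unfolding associated_subalgebra_def by blast
  have E': "g.subspace E" "E \<subseteq> gr (- 1) \<inter> part G False" "\<And>u u'. u \<in> E \<Longrightarrow> u' \<in> E \<Longrightarrow> chi (brk G u u') = 0"
    using E unfolding maximal_isotropic_def isotropic_def by auto
  have v': "v ` {1..r div 2} \<subseteq> gr (- 1) \<inter> part G True"
    using v(3) g.span_superset[of "v ` {1..r}"] image_mono[of "{1..r div 2}" "{1..r}" v] by fastforce
  \<comment> \<open>For indices up to \<open>r div 2\<close> the sum \<open>i + j\<close> stays
    below \<open>r + 1\<close>.\<close>
  have viso: "chi (brk G u u') = 0" if h: "u \<in> v ` {1..r div 2}" "u' \<in> v ` {1..r div 2}" for u u'
  proof -
    obtain i j where ij: "u = v i" "u' = v j" "i \<in> {1..r div 2}" "j \<in> {1..r div 2}" using h by blast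
    then have "i \<in> {1..r}" "j \<in> {1..r}" "i + j \<noteq> r + 1" by auto
    then show ?thesis using v(4) ij by simp
  qed
  obtain B where B: "finite B" "space_of G \<subseteq> g.span B" using fd by blast
  \<comment> \<open>For \<open>k \<ge> 1\<close> this is the part of \<open>m\<close> of degree
    \<open>- k\<close> and parity \<open>a\<close>.\<close>
  define U where "U k a = (if k = 1 then (if a then g.span (v ` {1..r div 2}) else E) else gr (- int k) \<inter> part G a)" for k :: nat and a
  have U_sub: "g.subspace (U k a)" for k a unfolding U_def using E'(1) gr_part_sub by simp
  have U_gr: "U k a \<subseteq> gr (- int k) \<inter> part G a" for k a
    unfolding U_def using E'(2) g.span_minimal[OF v' gr_part_sub] by auto
  \<comment> \<open>In the odd part of degree -1 the given vectors \<open>v i\<close> themselves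
    serve as basis, so that isotropy can be read off from their pairings.\<close>
  have "\<exists>S. S \<subseteq> U k a \<and> g.independent S \<and> g.span S = U k a \<and> (k = 1 \<and> a \<longrightarrow> S = v ` {1..r div 2})" for k a
  proof (cases "k = 1 \<and> a")
    case True
    have "g.independent (v ` {1..r div 2})" using v(2) by (rule g.independent_mono) auto
    then show ?thesis using True g.span_superset by (intro exI[of _ "v ` {1..r div 2}"]) (auto simp: U_def)
  next
    case False
    obtain S where "S \<subseteq> U k a" "g.independent S" "U k a \<subseteq> g.span S" using g.maximal_independent_subset by metis
    then have "g.span S = U k a" using U_sub by (intro g.span_subspace)
    then show ?thesis using False \<open>S \<subseteq> U k a\<close> \<open>g.independent S\<close> by (intro exI[of _ S]) auto
  qed
  then obtain bs where bs: "\<And>k a. bs k a \<subseteq> U k a" "\<And>k a. g.independent (bs k a)" "\<And>k a. g.span (bs k a) = U k a"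
      "bs 1 True = v ` {1..r div 2}" by metis
  have bs_gr: "bs k a \<subseteq> gr (- int k) \<inter> part G a" for k a using bs(1) U_gr by blast
  have bs_fin: "finite (bs k a)" for k a
    using g.finite_independent[OF B _ bs(2)] bs_gr gr_space by blast
  have bs_nz: "b \<noteq> 0" if "b \<in> bs k a" for b k a using bs(2) that g.dependent_zero by blast
  obtain K where K: "\<And>k. k > K \<Longrightarrow> gr (- int k) = {0}" using finite_degrees by blast
  define Ix where "Ix = (SIGMA k:{1..K}. SIGMA a:UNIV. bs k a)"
  have Ix: "(k, a, b) \<in> Ix \<longleftrightarrow> k \<ge> 1 \<and> b \<in> bs k a" for k a b
    unfolding Ix_def using K[of k] bs_gr[of k a] bs_nz[of b k a] by (auto simp: not_less[symmetric])
  have "finite Ix" unfolding Ix_def using bs_fin by (intro finite_SigmaI) auto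
  then obtain xs where xs: "set xs = Ix" "distinct xs" using finite_distinct_list by blast
  \<comment> \<open>Sorting by the first component, the depth, is what makes \<open>kk\<close>
    monotone.\<close>
  define L where "L = sort_key fst xs"
  have L: "set L = Ix" "distinct L" "sorted (map fst L)" unfolding L_def using xs by auto
  define n where "n = length L"
  define x where "x i = snd (snd (L ! i))" for i
  define kk where "kk i = fst (L ! i)" for i
  define pp where "pp i = fst (snd (L ! i))" for i
  have Li: "x i \<in> bs (kk i) (pp i)" "kk i \<ge> 1" "L ! i = (kk i, pp i, x i)" if "i < n" for i
  proof -
    show *: "L ! i = (kk i, pp i, x i)" by (simp add: x_def kk_def pp_def)
    have "L ! i \<in> Ix" using L(1) that unfolding n_def by (metis nth_mem)
    then show "x i \<in> bs (kk i) (pp i)" "kk i \<ge> 1" unfolding * Ix by auto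
  qed
  have Lex: "\<exists>i<n. kk i = k \<and> pp i = a \<and> x i = b" if "k \<ge> 1" "b \<in> bs k a" for k a b
  proof -
    have "(k, a, b) \<in> set L" using that Ix L(1) by simp
    then obtain i where "i < n" "L ! i = (k, a, b)" unfolding n_def by (metis in_set_conv_nth)
    then show ?thesis by (intro exI[of _ i]) (auto simp: x_def kk_def pp_def)
  qed
  have Linj: "i = j" if "i < n" "j < n" "kk i = kk j" "pp i = pp j" "x i = x j" for i j
  proof -
    have "L ! i = L ! j" using that(3-5) Li(3)[OF that(1)] Li(3)[OF that(2)] by simp
    then show ?thesis using that(1,2) L(2) unfolding n_def by (simp add: nth_eq_iff_index_eq)
  qed
  have xg: "x i \<in> gr (- int (kk i)) \<inter> part G (pp i)" if "i < n" for i using Li(1)[OF that] bs_gr by blast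
  have "\<exists>y. \<forall>b\<in>bs k a. y b \<in> gr (int k - 2) \<inter> part G a \<and> (\<forall>b'\<in>bs k a. chi (brk G b' (y b)) = (if b' = b then 1 else 0))"
    if k: "k \<ge> 1" for k a
  proof (rule g.dual_family[OF bs_fin bs(2), where W = "gr (- int k) \<inter> part G a"])
    have s: "z \<in> space_of G" if "z \<in> gr j \<inter> part G a" for z j using that gr_space by blast
    show "g.subspace (gr (int k - 2) \<inter> part G a)" "g.subspace (gr (- int k) \<inter> part G a)" by (rule gr_part_sub)+
    show "bs k a \<subseteq> gr (- int k) \<inter> part G a" by (rule bs_gr)
    show "\<exists>u\<in>gr (int k - 2) \<inter> part G a. chi (brk G z u) \<noteq> 0" if "z \<in> gr (- int k) \<inter> part G a" "z \<noteq> 0" for z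
      using that k by (intro nondeg_homogeneous) auto
    show "chi (brk G (z + z') u) = chi (brk G z u) + chi (brk G z' u)"
      if "z \<in> gr (- int k) \<inter> part G a" "z' \<in> gr (- int k) \<inter> part G a" "u \<in> gr (int k - 2) \<inter> part G a" for z z' u
      using s[OF that(1)] s[OF that(2)] s[OF that(3)] by (simp add: br_lin chi_add br_space)
    show "chi (brk G (scl G c z) u) = c * chi (brk G z u)"
      if "z \<in> gr (- int k) \<inter> part G a" "u \<in> gr (int k - 2) \<inter> part G a" for z u c
      using s[OF that(1)] s[OF that(2)] by (simp add: br_lin(3)[of _ u] chi_scale br_space)
    show "chi (brk G z (u + u')) = chi (brk G z u) + chi (brk G z u')"
      if "z \<in> gr (- int k) \<inter> part G a" "u \<in> gr (int k - 2) \<inter> part G a" "u' \<in> gr (int k - 2) \<inter> part G a" for z u u'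
      using s[OF that(1)] s[OF that(2)] s[OF that(3)] by (simp add: br_lin chi_add br_space)
    show "chi (brk G z (scl G c u)) = c * chi (brk G z u)"
      if "z \<in> gr (- int k) \<inter> part G a" "u \<in> gr (int k - 2) \<inter> part G a" for z u c
      using s[OF that(1)] s[OF that(2)] by (simp add: br_lin(4)[of z z] chi_scale br_space)
  qed
  then obtain Y where Y: "\<And>k a b. k \<ge> 1 \<Longrightarrow> b \<in> bs k a \<Longrightarrow> Y k a b \<in> gr (int k - 2) \<inter> part G a"
    "\<And>k a b b'. k \<ge> 1 \<Longrightarrow> b \<in> bs k a \<Longrightarrow> b' \<in> bs k a \<Longrightarrow> chi (brk G b' (Y k a b)) = (if b' = b then 1 else 0)"
    by metis
  define y where "y i = Y (kk i) (pp i) (x i)" for i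
  have yg: "y i \<in> gr (int (kk i) - 2) \<inter> part G (pp i)" if "i < n" for i
    unfolding y_def using Y(1) Li that by blast
  have neg_span: "z \<in> g.span (x ` {i. i < n \<and> int (kk i) = k})" if z: "z \<in> gr (- k)" "k \<ge> 2" for z k
  proof -
    obtain k' where k': "k = int k'" "k' \<ge> 2" using z(2) by (metis nat_int_comparison(3) nonneg_int_cases of_nat_numeral order_trans zero_le_numeral)
    have "z \<in> total (\<lambda>a. gr (- k) \<inter> part G a)" using z gr_par by blast
    then obtain z0 z1 where zz: "z0 \<in> gr (- k) \<inter> part G False" "z1 \<in> gr (- k) \<inter> part G True" "z = z0 + z1"
      unfolding total_def by blast
    have sub: "gr (- k) \<inter> part G a \<subseteq> g.span (x ` {i. i < n \<and> int (kk i) = k})" for a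
    proof -
      have "gr (- k) \<inter> part G a = g.span (bs k' a)" unfolding bs(3) U_def k'(1) using k'(2) by simp
      also have "\<dots> \<subseteq> g.span (x ` {i. i < n \<and> int (kk i) = k})"
        using Lex[of k' _ a] k' by (intro g.span_mono) fastforce
      finally show ?thesis .
    qed
    then show ?thesis unfolding zz(3) using zz(1,2) by (intro g.span_add) auto
  qed
  have m_span: "m = g.span (x ` {..<n})"
  proof
    have "gr (- k) \<subseteq> g.span (x ` {..<n})" if "k \<ge> 2" for k
      using neg_span that g.span_mono[of "x ` {i. i < n \<and> int (kk i) = k}" "x ` {..<n}"] by blast
    moreover have "U 1 a \<subseteq> g.span (x ` {..<n})" for a
      unfolding bs(3)[symmetric] using Lex[of 1 _ a] by (intro g.span_mono) fastforce
    from this[of False] this[of True]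
    have "E \<subseteq> g.span (x ` {..<n})" "g.span (v ` {1..r div 2}) \<subseteq> g.span (x ` {..<n})"
      unfolding U_def by simp_all
    then have "E \<subseteq> g.span (x ` {..<n})" "v ` {1..r div 2} \<subseteq> g.span (x ` {..<n})"
      using g.span_superset by blast+
    ultimately show "m \<subseteq> g.span (x ` {..<n})" unfolding m by (intro g.span_minimal) auto
    show "g.span (x ` {..<n}) \<subseteq> m"
    proof (rule g.span_minimal)
      show "x ` {..<n} \<subseteq> m"
      proof safe
        fix i assume i: "i < n"
        have "x i \<in> U (kk i) (pp i)" using Li(1)[OF i] bs(1) by blast
        moreover have "U (kk i) (pp i) \<subseteq> m"
        proof (cases "kk i = 1")
          case True
          have "g.span (v ` {1..r div 2}) \<subseteq> m" unfolding m by (intro g.span_mono) blast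
          moreover have "E \<subseteq> m" unfolding m by (rule order_trans[OF _ g.span_superset]) blast
          ultimately show ?thesis using True unfolding U_def by (cases "pp i") simp_all
        next
          case False
          then have "int (kk i) \<ge> 2" using Li(2)[OF i] by simp
          then have "gr (- int (kk i)) \<subseteq> m" unfolding m by (auto intro!: g.span_base)
          then show ?thesis using False unfolding U_def by auto
        qed
        ultimately show "x i \<in> m" by blast
      qed
    qed (simp add: m)
  qed
  have mFil: "m \<subseteq> Fil 1"
    unfolding m_span
  proof (rule g.span_minimal)
    show "x ` {..<n} \<subseteq> Fil 1"
    proof safe
      fix i assume "i < n"
      then show "x i \<in> Fil 1" using xg Li(2) by (intro g.span_base UN_I[of "int (kk i)"]) auto
    qed
  qed simp
  have Film: "Fil 2 \<subseteq> m" unfolding m by (rule g.span_mono) auto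
  have p3: "CHAR('k) \<ge> 3" using char by simp
  have "adapted_basis G chi gr m n x y kk pp"
  proof
    show "lie_superalgebra G" by (rule lie)
    show "subalgebra G m"
      unfolding subalgebra_def
    proof (intro conjI ballI)
      show "g.subspace m" by (simp add: m)
      show "m \<subseteq> space_of G" using mFil Fil_space by blast
      show "brk G u w \<in> m" if "u \<in> m" "w \<in> m" for u w
        using br_Fil[of u 1 w 1] that mFil Film by auto
      show "ppow G u \<in> m" if "u \<in> m \<inter> part G False" for u
      proof -
        have "ppow G u \<in> Fil (int CHAR('k) * 1)" using that mFil by (intro ppow_fil) auto
        then show ?thesis using Fil_mono[of 2 "int CHAR('k) * 1"] p3 Film by auto
      qed
    qed
    show "subalgebra G (space_of G)"
      unfolding subalgebra_def
      using space_sub br_space restricted part_space[OF lie, of False] unfolding restricted_lie_superalgebra_def by blast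
    show "m = g.span (x ` {..<n})" by (rule m_span)
    show "x i \<in> gr (- int (kk i))" "x i \<in> part G (pp i)" "0 < kk i" if "i < n" for i
      using xg[OF that] Li(2)[OF that] by auto
    show "y i \<in> gr (int (kk i) - 2)" "y i \<in> part G (pp i)" if "i < n" for i
      using yg[OF that] by auto
    show "chi (brk G (x i) (y j)) = (if i = j then 1 else 0)" if ij: "i < n" "j < n" for i j
    proof (cases "kk i = kk j \<and> pp i = pp j")
      case True
      then have "chi (brk G (x i) (y j)) = (if x i = x j then 1 else 0)"
        unfolding y_def using Y(2)[OF Li(2,1)[OF ij(2)]] Li(1)[OF ij(1)] by simp
      then show ?thesis using Linj[OF ij] True by auto
    next
      case False
      then have "i \<noteq> j" by auto
      \<comment> \<open>Different depths put the bracket outside degree -2, different parities make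
        it odd; \<open>chi\<close> vanishes in both cases.\<close>
      have "chi (brk G (x i) (y j)) = 0" if "kk i \<noteq> kk j"
      proof (rule chi_gr)
        show "brk G (x i) (y j) \<in> gr (- int (kk i) + (int (kk j) - 2))"
          using xg[OF ij(1)] yg[OF ij(2)] by (intro br_gr) auto
      qed (use that in auto)
      moreover have "chi (brk G (x i) (y j)) = 0" if "pp i \<noteq> pp j"
        using br_part[of "x i" "pp i" "y j" "pp j"] xg[OF ij(1)] yg[OF ij(2)] that by (intro chi_odd) auto
      ultimately show ?thesis using False \<open>i \<noteq> j\<close> by auto
    qed
    show "kk i \<le> kk j" if "i \<le> j" "j < n" for i j
      using L(3) that unfolding n_def kk_def sorted_iff_nth_mono by simp
    show "z \<in> g.span (x ` {i. i < n \<and> int (kk i) = k})" if "z \<in> gr (- k)" "2 \<le> k" for z k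
      by (rule neg_span[OF that])
    show "chi (brk G (x i) (x j)) = 0" if ij: "i < n" "j < n" for i j
    proof (cases "kk i = 1 \<and> kk j = 1")
      case True
      show ?thesis
      proof (cases "pp i = pp j")
        case same: True
        show ?thesis
        proof (cases "pp i")
          case True
          then show ?thesis using viso Li(1)[OF ij(1)] Li(1)[OF ij(2)] bs(4) same \<open>kk i = 1 \<and> kk j = 1\<close> by auto
        next
          case False
          then have "x i \<in> U 1 False" "x j \<in> U 1 False"
            using bs(1) Li(1)[OF ij(1)] Li(1)[OF ij(2)] same \<open>kk i = 1 \<and> kk j = 1\<close> by auto
          then show ?thesis using E'(3) unfolding U_def by simp
        qed
      next
        case False
        then show ?thesis using br_part[of "x i" "pp i" "x j" "pp j"] xg[OF ij(1)] xg[OF ij(2)] by (intro chi_odd) auto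
      qed
    next
      case False
      \<comment> \<open>Unless both depths are 1, the bracket has degree at most -3.\<close>
      show ?thesis
      proof (rule chi_gr)
        show "brk G (x i) (x j) \<in> gr (- int (kk i) + - int (kk j))"
          using xg[OF ij(1)] xg[OF ij(2)] by (intro br_gr) auto
      qed (use False Li(2)[OF ij(1)] Li(2)[OF ij(2)] in auto)
    qed
    show "ppow G (x i) \<in> g.span (x ` {l. l < n \<and> CHAR('k) * kk i \<le> kk l})" if i: "i < n" "\<not> pp i" for i
    proof -
      have "x i \<in> Fil (int (kk i))" using xg[OF i(1)] by (intro g.span_base UN_I[of "int (kk i)"]) auto
      then have "ppow G (x i) \<in> Fil (int CHAR('k) * int (kk i))"
        using Li(2)[OF i(1)] xg[OF i(1)] i(2) by (intro ppow_fil) auto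
      also have "\<dots> \<subseteq> g.span (x ` {l. l < n \<and> CHAR('k) * kk i \<le> kk l})"
      proof (rule g.span_minimal, safe)
        fix k z assume kz: "int CHAR('k) * int (kk i) \<le> k" "z \<in> gr (- k)"
        have "3 * 1 \<le> CHAR('k) * kk i" using p3 Li(2)[OF i(1)] by (rule mult_le_mono)
        then have "int (CHAR('k) * kk i) \<ge> 3" by linarith
        then have "z \<in> g.span (x ` {l. l < n \<and> int (kk l) = k})" using kz by (intro neg_span) auto
        also have "\<dots> \<subseteq> g.span (x ` {l. l < n \<and> CHAR('k) * kk i \<le> kk l})"
          using kz(1) by (intro g.span_mono image_mono) (auto simp flip: of_nat_mult)
        finally show "z \<in> g.span (x ` {l. l < n \<and> CHAR('k) * kk i \<le> kk l})" .
      qed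
      finally show ?thesis .
    qed
  qed (fact char chi_add chi_scale chi_odd chi_gr br_gr)+
  then show ?thesis using assms(2) by (rule adapted_basis.graded_free_over_subalgebra)
qed

end

section \<open>Endomorphisms of a space with a homogeneous graded basis\<close>

text \<open>\<open>dg\<close> is a function on all vectors, but it carries meaning on the basis
  \<open>Eb\<close> alone.\<close>

locale graded_basis = vector_space s
  for s :: "'k::field \<Rightarrow> 'v::ab_group_add \<Rightarrow> 'v" +
  fixes V :: "bool \<Rightarrow> 'v set" and Eb :: "'v set" and dg :: "'v \<Rightarrow> int"
  assumes V_sub: "subspace (V a)" and V_int: "V False \<inter> V True = {0}"
    and Eb: "finite Eb" "independent Eb" "span Eb = total V" "Eb \<subseteq> V False \<union> V True"
begin

abbreviation VV where "VV \<equiv> total V"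

text \<open>Follows the convention of \<open>gl_part\<close>: operators vanish outside the space, so
  that agreement on \<open>Eb\<close> already gives equality of functions.\<close>

definition lin :: "('v \<Rightarrow> 'v) \<Rightarrow> bool" where
  "lin f \<longleftrightarrow> (\<forall>x\<in>VV. \<forall>y\<in>VV. f (x + y) = f x + f y) \<and> (\<forall>c. \<forall>x\<in>VV. f (s c x) = s c (f x)) \<and>
     (\<forall>x. x \<notin> VV \<longrightarrow> f x = 0) \<and> (\<forall>x\<in>VV. f x \<in> VV)"

definition ext :: "('v \<Rightarrow> 'v) \<Rightarrow> 'v \<Rightarrow> 'v" where
  "ext T v = (if v \<in> VV then \<Sum>b\<in>Eb. s (representation Eb v b) (T b) else 0)"

definition Vk :: "int \<Rightarrow> 'v set" where "Vk l = span {b \<in> Eb. dg b = l}"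

definition pr :: "int \<Rightarrow> 'v \<Rightarrow> 'v" where "pr l = ext (\<lambda>b. if dg b = l then b else 0)"

definition deg :: "('v \<Rightarrow> 'v) \<Rightarrow> int \<Rightarrow> bool" where "deg f k \<longleftrightarrow> (\<forall>l. f ` Vk l \<subseteq> Vk (l + k))"

abbreviation Dg where "Dg \<equiv> dg ` Eb"

lemma VV_sub: "subspace VV" unfolding Eb(3)[symmetric] by simp

lemma VV_simps: "0 \<in> VV" "x \<in> VV \<Longrightarrow> y \<in> VV \<Longrightarrow> x + y \<in> VV" "x \<in> VV \<Longrightarrow> y \<in> VV \<Longrightarrow> x - y \<in> VV"
  "x \<in> VV \<Longrightarrow> s c x \<in> VV" "x \<in> VV \<Longrightarrow> - x \<in> VV"
  using VV_sub by (auto intro: subspace_0 subspace_add subspace_diff subspace_scale subspace_neg)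

lemma Eb_VV: "b \<in> Eb \<Longrightarrow> b \<in> VV" using Eb(3) span_superset by blast

lemma V_VV: "V a \<subseteq> VV"
  unfolding total_def using subspace_0[OF V_sub] by (cases a) force+

lemma VV_split: "v \<in> VV \<Longrightarrow> \<exists>u w. u \<in> V False \<and> w \<in> V True \<and> v = u + w"
  unfolding total_def by blast

lemma expand: "v \<in> VV \<Longrightarrow> (\<Sum>b\<in>Eb. s (representation Eb v b) b) = v"
  using sum_representation_eq[OF Eb(2) _ Eb(1)] Eb(3) by simp

lemma Vk_VV: "Vk l \<subseteq> VV" unfolding Vk_def Eb(3)[symmetric] by (rule span_mono) auto

lemma Vk_sub: "subspace (Vk l)" unfolding Vk_def by simp

lemma Vk_basis: "b \<in> Eb \<Longrightarrow> b \<in> Vk (dg b)" unfolding Vk_def by (auto intro: span_base)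

lemma linD:
  assumes "lin f"
  shows "x \<in> VV \<Longrightarrow> y \<in> VV \<Longrightarrow> f (x + y) = f x + f y" "x \<in> VV \<Longrightarrow> f (s c x) = s c (f x)"
    "x \<notin> VV \<Longrightarrow> f x = 0" "x \<in> VV \<Longrightarrow> f x \<in> VV" "f 0 = 0" "x \<in> VV \<Longrightarrow> y \<in> VV \<Longrightarrow> f (x - y) = f x - f y"
    "f x \<in> VV"
proof -
  show 1: "x \<in> VV \<Longrightarrow> y \<in> VV \<Longrightarrow> f (x + y) = f x + f y" "x \<in> VV \<Longrightarrow> f (s c x) = s c (f x)"
    "x \<notin> VV \<Longrightarrow> f x = 0" "x \<in> VV \<Longrightarrow> f x \<in> VV" for x y c using assms unfolding lin_def by blast+
  show "f 0 = 0" using 1(2)[of 0 0] VV_simps by simp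
  show "f (x - y) = f x - f y" if "x \<in> VV" "y \<in> VV"
    using 1(1)[of x "s (-1) y"] 1(2)[of y "-1"] VV_simps that by simp
  show "f x \<in> VV" using 1(3,4) VV_simps(1) by metis
qed

lemma lin_sum: "lin f \<Longrightarrow> (\<And>j. j \<in> S \<Longrightarrow> u j \<in> VV) \<Longrightarrow> f (\<Sum>j\<in>S. u j) = (\<Sum>j\<in>S. f (u j))"
proof (induction S rule: infinite_finite_induct)
  case (insert j S)
  then have "(\<Sum>j\<in>S. u j) \<in> VV" by (intro subspace_sum[OF VV_sub]) auto
  then show ?case using insert linD(1)[OF insert.prems(1), of "u j"] by simp
qed (simp_all add: linD)

lemma lin_expand:
  assumes "lin f" "v \<in> VV"
  shows "f v = (\<Sum>b\<in>Eb. s (representation Eb v b) (f b))"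
proof -
  have "f (\<Sum>b\<in>Eb. s (representation Eb v b) b) = (\<Sum>b\<in>Eb. f (s (representation Eb v b) b))"
    using assms Eb_VV VV_simps by (intro lin_sum) auto
  then show ?thesis using expand[OF assms(2)] linD(2)[OF assms(1) Eb_VV] by simp
qed

lemma lin_eqI:
  assumes "lin f" "lin g" "\<And>b. b \<in> Eb \<Longrightarrow> f b = g b"
  shows "f = g"
proof
  fix v show "f v = g v"
    using linD(3)[OF assms(1)] linD(3)[OF assms(2)] lin_expand[OF assms(1)] lin_expand[OF assms(2)] assms(3)
    by (cases "v \<in> VV") auto
qed

lemma lin_ext: "(\<And>b. b \<in> Eb \<Longrightarrow> T b \<in> VV) \<Longrightarrow> lin (ext T)"
  unfolding lin_def ext_def using Eb(2,3)
  by (auto simp: VV_simps representation_add representation_scale scale_left_distrib sum.distrib scale_sum_right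
      intro!: subspace_sum[OF VV_sub])

lemma ext_basis: "b \<in> Eb \<Longrightarrow> ext T b = T b"
proof -
  assume b: "b \<in> Eb"
  have "(\<Sum>b'\<in>Eb. s (representation Eb b b') (T b')) = (\<Sum>b'\<in>Eb. if b' = b then T b else 0)"
    using b by (intro sum.cong) (auto simp: representation_basis[OF Eb(2)])
  then show ?thesis using b Eb(1) Eb_VV by (simp add: ext_def)
qed

lemma lin_comp: "lin f \<Longrightarrow> lin g \<Longrightarrow> lin (\<lambda>v. f (g v))"
  unfolding lin_def[of "\<lambda>v. f (g v)"] by (simp add: linD)

lemma lin_add: "lin f \<Longrightarrow> lin g \<Longrightarrow> lin (\<lambda>v. f v + g v)"
  unfolding lin_def[of "\<lambda>v. f v + g v"] by (auto simp: linD VV_simps scale_right_distrib)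

lemma lin_scale: "lin f \<Longrightarrow> lin (\<lambda>v. s c (f v))"
  unfolding lin_def[of "\<lambda>v. s c (f v)"] by (auto simp: linD VV_simps scale_right_distrib scale_left_commute)

lemma lin_diff: "lin f \<Longrightarrow> lin g \<Longrightarrow> lin (\<lambda>v. f v - g v)"
  using lin_add[of f "\<lambda>v. s (-1) (g v)"] lin_scale[of g "-1"] by simp

lemma lin_zero: "lin (\<lambda>v. 0)"
  unfolding lin_def by (simp add: VV_simps)

lemma lin_setsum: "(\<And>j. j \<in> S \<Longrightarrow> lin (f j)) \<Longrightarrow> lin (\<lambda>v. \<Sum>j\<in>S. f j v)"
  by (induction S rule: infinite_finite_induct) (simp_all add: lin_zero lin_add)

text \<open>The basis vectors are homogeneous, so what an element of \<open>V a\<close> has outside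
  \<open>Eb \<inter> V a\<close> belongs to the other parity and vanishes.\<close>

lemma V_basis: "V a = span (Eb \<inter> V a)"
proof
  show "span (Eb \<inter> V a) \<subseteq> V a" using V_sub by (intro span_minimal) auto
  show "V a \<subseteq> span (Eb \<inter> V a)"
  proof
    fix v assume v: "v \<in> V a"
    then have vV: "v \<in> VV" using V_VV by blast
    define u where "u = (\<Sum>b\<in>Eb \<inter> V a. s (representation Eb v b) b)"
    define w where "w = (\<Sum>b\<in>Eb - V a. s (representation Eb v b) b)"
    have vuw: "v = u + w"
      using expand[OF vV] sum.Int_Diff[OF Eb(1), of "\<lambda>b. s (representation Eb v b) b" "V a"] unfolding u_def w_def by simp
    have u: "u \<in> span (Eb \<inter> V a)" "u \<in> V a"
      unfolding u_def by (auto intro: span_sum span_scale span_base subspace_sum[OF V_sub] subspace_scale[OF V_sub])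
    have "w \<in> V (\<not> a)"
      unfolding w_def
    proof (intro subspace_sum[OF V_sub] subspace_scale[OF V_sub])
      fix b assume "b \<in> Eb - V a"
      then show "b \<in> V (\<not> a)" using Eb(4) by (cases a) auto
    qed
    moreover have "w \<in> V a" using vuw v u(2) subspace_diff[OF V_sub, of v a u] by simp
    ultimately have "w = 0" using V_int by (cases a) auto
    then show "v \<in> span (Eb \<inter> V a)" using vuw u by simp
  qed
qed

lemma gl_part_iff: "f \<in> gl_part s V a \<longleftrightarrow> lin f \<and> (\<forall>q. \<forall>x\<in>V q. f x \<in> V (a \<noteq> q))"
proof
  assume f: "f \<in> gl_part s V a"
  have "f x \<in> VV" if "x \<in> VV" for x
  proof -
    obtain u w where "u \<in> V False" "w \<in> V True" "x = u + w" using VV_split \<open>x \<in> VV\<close> by blast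
    moreover from this have "f u \<in> VV" "f w \<in> VV" using f V_VV unfolding gl_part_def by blast+
    moreover have "f (u + w) = f u + f w" using f calculation V_VV unfolding gl_part_def by blast
    ultimately show ?thesis using VV_simps(2) by simp
  qed
  then show "lin f \<and> (\<forall>q. \<forall>x\<in>V q. f x \<in> V (a \<noteq> q))" using f unfolding gl_part_def lin_def by blast
next
  assume "lin f \<and> (\<forall>q. \<forall>x\<in>V q. f x \<in> V (a \<noteq> q))"
  then show "f \<in> gl_part s V a" unfolding gl_part_def lin_def by blast
qed

lemma gl_partI:
  assumes "lin f" "\<And>b q. b \<in> Eb \<Longrightarrow> b \<in> V q \<Longrightarrow> f b \<in> V (a \<noteq> q)"
  shows "f \<in> gl_part s V a"
  unfolding gl_part_iff
proof (intro conjI allI ballI assms(1))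
  fix q x assume "x \<in> V q"
  then have "x \<in> span (Eb \<inter> V q)" using V_basis by blast
  then have "f x \<in> V (a \<noteq> q) \<and> x \<in> VV"
  proof (induction rule: span_induct_alt)
    case base then show ?case using linD(5)[OF assms(1)] subspace_0[OF V_sub] VV_simps(1) by simp
  next
    case (step c x y)
    then show ?case using assms V_VV subspace_add[OF V_sub] subspace_scale[OF V_sub]
      by (auto simp: linD Eb_VV VV_simps)
  qed
  then show "f x \<in> V (a \<noteq> q)" by simp
qed

lemma pr_lin: "lin (pr l)" unfolding pr_def by (rule lin_ext) (auto simp: VV_simps Eb_VV)

lemma pr_basis: "b \<in> Eb \<Longrightarrow> pr l b = (if dg b = l then b else 0)"
  unfolding pr_def by (rule ext_basis)

lemma pr_gl: "pr l \<in> gl_part s V False"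
  by (rule gl_partI[OF pr_lin]) (auto simp: pr_basis subspace_0[OF V_sub])

lemma pr_Vk: "pr l v \<in> Vk l"
proof (cases "v \<in> VV")
  case True
  have "s c (pr l b) \<in> Vk l" if "b \<in> Eb" for b c
    using that subspace_0[OF Vk_sub] subspace_scale[OF Vk_sub] Vk_basis[of b] by (auto simp: pr_basis)
  then show ?thesis unfolding lin_expand[OF pr_lin True] by (intro subspace_sum[OF Vk_sub])
qed (simp add: linD(3)[OF pr_lin] subspace_0[OF Vk_sub])

lemma pr_on_Vk: "v \<in> Vk m \<Longrightarrow> pr l v = (if l = m then v else 0)"
proof -
  assume "v \<in> Vk m"
  then have "v \<in> VV \<and> pr l v = (if l = m then v else 0)" unfolding Vk_def
  proof (induction rule: span_induct_alt)
    case base then show ?case by (simp add: linD[OF pr_lin] VV_simps)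
  next
    case (step c x y)
    then show ?case by (auto simp: linD[OF pr_lin] Eb_VV VV_simps pr_basis)
  qed
  then show ?thesis by simp
qed

lemma pr_sum: "v \<in> VV \<Longrightarrow> finite S \<Longrightarrow> Dg \<subseteq> S \<Longrightarrow> (\<Sum>l\<in>S. pr l v) = v"
proof -
  assume v: "v \<in> VV" and S: "finite S" "Dg \<subseteq> S"
  have "(\<lambda>v. \<Sum>l\<in>S. pr l v) = ext (\<lambda>b. b)"
  proof (rule lin_eqI)
    fix b assume b: "b \<in> Eb"
    then have "(\<Sum>l\<in>S. pr l b) = (\<Sum>l\<in>S. if l = dg b then b else 0)" by (intro sum.cong) (auto simp: pr_basis)
    then show "(\<Sum>l\<in>S. pr l b) = ext (\<lambda>b. b) b" using b S by (auto simp: ext_basis)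
  qed (auto intro: lin_setsum pr_lin lin_ext Eb_VV)
  then have "(\<Sum>l\<in>S. pr l v) = ext (\<lambda>b. b) v" by (simp add: fun_eq_iff)
  then show ?thesis using v expand by (simp add: ext_def)
qed

lemma Vk_zero: "l \<notin> Dg \<Longrightarrow> Vk l = {0}"
proof -
  assume "l \<notin> Dg"
  then have "{b \<in> Eb. dg b = l} = {}" by auto
  then show ?thesis unfolding Vk_def by (simp only: span_empty)
qed

lemma pr_zero: "l \<notin> Dg \<Longrightarrow> pr l v = 0" using pr_Vk[of l v] Vk_zero by blast

lemma degI:
  assumes "lin f" "\<And>b. b \<in> Eb \<Longrightarrow> f b \<in> Vk (dg b + k)"
  shows "deg f k"
  unfolding deg_def
proof safe
  fix l v assume "v \<in> Vk l"
  then have "v \<in> VV \<and> f v \<in> Vk (l + k)" unfolding Vk_def[of l]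
  proof (induction rule: span_induct_alt)
    case base then show ?case using linD(5)[OF assms(1)] subspace_0[OF Vk_sub] VV_simps by simp
  next
    case (step c x y)
    then show ?case using assms(2)[of x] subspace_add[OF Vk_sub] subspace_scale[OF Vk_sub]
      by (auto simp: linD[OF assms(1)] Eb_VV VV_simps)
  qed
  then show "f v \<in> Vk (l + k)" by simp
qed

lemma degD: "deg f k \<Longrightarrow> v \<in> Vk l \<Longrightarrow> f v \<in> Vk (l + k)" unfolding deg_def by blast

text \<open>On a basis vector the summands land in distinct degrees, so a projection isolates one of
  them.\<close>

lemma deg_unique:
  assumes "finite K" "\<And>k. k \<in> K \<Longrightarrow> lin (c k)" "\<And>k. k \<in> K \<Longrightarrow> deg (c k) k" "j \<in> K" "b \<in> Eb"
  shows "pr (dg b + j) (\<Sum>k\<in>K. c k b) = c j b"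
proof -
  have cV: "c k b \<in> Vk (dg b + k)" if "k \<in> K" for k using assms(3)[OF that] Vk_basis[OF assms(5)] degD by blast
  then have "pr (dg b + j) (\<Sum>k\<in>K. c k b) = (\<Sum>k\<in>K. pr (dg b + j) (c k b))"
    using Vk_VV by (intro lin_sum[OF pr_lin]) blast
  also have "\<dots> = (\<Sum>k\<in>K. if k = j then c j b else 0)"
    using pr_on_Vk[OF cV] by (intro sum.cong) auto
  finally show ?thesis using assms(1,4) by simp
qed

end

text \<open>Each string \<open>w i\<close>, \<open>N (w i)\<close>, ... is centred at degree 0, as
  for a representation of \<open>sl(2)\<close>; unlike the latter, this structure exists in every
  characteristic.\<close>

locale jordan_graded = graded_basis s V Eb dg
  for s :: "'k::field \<Rightarrow> 'v::ab_group_add \<Rightarrow> 'v" and V :: "bool \<Rightarrow> 'v set" and Eb :: "'v set" and dg :: "'v \<Rightarrow> int" +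
  fixes N :: "'v \<Rightarrow> 'v" and r :: nat and w :: "nat \<Rightarrow> 'v" and lam :: "nat \<Rightarrow> nat"
  assumes N: "N \<in> gl_part s V False"
    and Eb_def: "Eb = {(N ^^ j) (w i) | i j. i < r \<and> j < lam i}"
    and e_inj: "i < r \<Longrightarrow> j < lam i \<Longrightarrow> i' < r \<Longrightarrow> j' < lam i' \<Longrightarrow> (N ^^ j) (w i) = (N ^^ j') (w i') \<Longrightarrow> i = i' \<and> j = j'"
    and dg_e: "i < r \<Longrightarrow> j < lam i \<Longrightarrow> dg ((N ^^ j) (w i)) = 2 * int j + 1 - int (lam i)"
    and lam: "i < r \<Longrightarrow> lam i \<ge> 1" "i < r \<Longrightarrow> (N ^^ lam i) (w i) = 0"
begin

lemma N_lin: "lin N" using N gl_part_iff by blast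

lemma Npow_lin: "lin (N ^^ Suc j)"
proof (induction j)
  case (Suc j)
  have "N ^^ Suc (Suc j) = (\<lambda>v. N ((N ^^ Suc j) v))" by (simp add: fun_eq_iff)
  then show ?case using lin_comp[OF N_lin Suc] by simp
qed (simp add: N_lin)

lemma Npow_simps:
  "x \<in> VV \<Longrightarrow> y \<in> VV \<Longrightarrow> (N ^^ j) (x + y) = (N ^^ j) x + (N ^^ j) y"
  "x \<in> VV \<Longrightarrow> (N ^^ j) (s c x) = s c ((N ^^ j) x)"
  "x \<in> VV \<Longrightarrow> (N ^^ j) x \<in> VV" "(N ^^ j) 0 = 0"
  using linD[OF Npow_lin] by (cases j; simp)+

lemma Npow_part: "x \<in> V q \<Longrightarrow> (N ^^ j) x \<in> V q"
  using N unfolding gl_part_iff by (induction j) auto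

lemma e_Eb: "i < r \<Longrightarrow> j < lam i \<Longrightarrow> (N ^^ j) (w i) \<in> Eb" unfolding Eb_def by blast

lemma w_Eb: "i < r \<Longrightarrow> w i \<in> Eb" using e_Eb[of i 0] lam(1)[of i] by simp

lemma w_Vk: "i < r \<Longrightarrow> w i \<in> Vk (1 - int (lam i))"
  using Vk_basis[OF w_Eb[of i]] dg_e[of i 0] lam(1)[of i] by simp

lemma N_deg: "deg N 2"
proof (rule degI[OF N_lin])
  fix b assume "b \<in> Eb"
  then obtain i j where ij: "b = (N ^^ j) (w i)" "i < r" "j < lam i" unfolding Eb_def by blast
  show "N b \<in> Vk (dg b + 2)"
  proof (cases "Suc j < lam i")
    case True
    have "dg (N b) = dg b + 2" using dg_e[OF ij(2) True] dg_e[OF ij(2,3)] ij(1) by simp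
    then show ?thesis using Vk_basis[OF e_Eb[OF ij(2) True]] ij(1) by simp
  next
    case False
    then have "lam i = Suc j" using ij(3) by simp
    then have "N b = 0" using lam(2)[OF ij(2)] ij(1) by simp
    then show ?thesis using subspace_0[OF Vk_sub] by simp
  qed
qed

lemma Npow_Vk: "v \<in> Vk l \<Longrightarrow> (N ^^ j) v \<in> Vk (l + 2 * int j)"
proof (induction j)
  case (Suc j)
  then show ?case using degD[OF N_deg, of "(N ^^ j) v" "l + 2 * int j"] by (simp add: algebra_simps)
qed simp

text \<open>At position \<open>j\<close> of a string, \<open>2 * j + 1 - lam i \<le> - n\<close>
  implies \<open>n + j < lam i\<close>, so \<open>n\<close> further steps stay inside the string.
  Hence \<open>N ^^ n\<close> maps the basis vectors of this degree injectively into the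
  basis.\<close>

lemma Npow_injective:
  assumes "v \<in> Vk d" "d \<le> - int n" "(N ^^ n) v = 0"
  shows "v = 0"
proof -
  define S where "S = {b \<in> Eb. dg b = d}"
  have S: "finite S" "S \<subseteq> Eb" unfolding S_def using Eb(1) by auto
  have rep: "\<exists>i j. b = (N ^^ j) (w i) \<and> i < r \<and> n + j < lam i" if h: "b \<in> S" for b
  proof -
    obtain i j where ij: "b = (N ^^ j) (w i)" "i < r" "j < lam i" using h unfolding S_def Eb_def by blast
    then have "2 * int j + 1 - int (lam i) \<le> - int n" using that dg_e assms(2) unfolding S_def by auto
    then show ?thesis using ij by (intro exI[of _ i] exI[of _ j]) auto
  qed
  have NEb: "(N ^^ n) ` S \<subseteq> Eb"
  proof safe
    fix b assume "b \<in> S"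
    from rep[OF this] obtain i j where "b = (N ^^ j) (w i)" "i < r" "n + j < lam i" by blast
    then show "(N ^^ n) b \<in> Eb" using e_Eb[of i "n + j"] by (simp add: funpow_add)
  qed
  have inj: "inj_on (N ^^ n) S"
  proof
    fix b b' assume bb: "b \<in> S" "b' \<in> S" "(N ^^ n) b = (N ^^ n) b'"
    from rep[OF bb(1)] obtain i j where ij: "b = (N ^^ j) (w i)" "i < r" "n + j < lam i" by blast
    from rep[OF bb(2)] obtain i' j' where ij': "b' = (N ^^ j') (w i')" "i' < r" "n + j' < lam i'" by blast
    have "(N ^^ (n + j)) (w i) = (N ^^ (n + j')) (w i')" using bb(3) ij(1) ij'(1) by (simp add: funpow_add)
    then have "i = i'" "j = j'" using e_inj[OF ij(2,3) ij'(2,3)] by auto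
    then show "b = b'" using ij ij' by simp
  qed
  have "v \<in> span S" using assms(1) unfolding Vk_def S_def .
  then obtain c where c: "v = (\<Sum>b\<in>S. s (c b) b)" using span_finite[OF S(1)] by auto
  have "(N ^^ n) v = (\<Sum>b\<in>S. s (c b) ((N ^^ n) b))"
  proof -
    have "finite Z \<Longrightarrow> Z \<subseteq> S \<Longrightarrow> (N ^^ n) (\<Sum>b\<in>Z. s (c b) b) = (\<Sum>b\<in>Z. s (c b) ((N ^^ n) b)) \<and> (\<Sum>b\<in>Z. s (c b) b) \<in> VV" for Z
    proof (induction Z rule: finite_induct)
      case (insert b Z)
      then have "b \<in> VV" using S(2) Eb_VV by auto
      then show ?case using insert by (simp add: Npow_simps VV_simps)
    qed (simp add: Npow_simps VV_simps)
    then show ?thesis using S(1) c by blast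
  qed
  also have "\<dots> = (\<Sum>b\<in>(N ^^ n) ` S. s (c (inv_into S (N ^^ n) b)) b)"
    using inj by (subst sum.reindex) (auto intro!: sum.cong)
  finally have "(\<Sum>b\<in>(N ^^ n) ` S. s (c (inv_into S (N ^^ n) b)) b) = 0" using assms(3) by simp
  then have "c (inv_into S (N ^^ n) ((N ^^ n) b)) = 0" if "b \<in> S" for b
    using that S(1) NEb independentD[OF Eb(2), of "(N ^^ n) ` S" "\<lambda>b. c (inv_into S (N ^^ n) b)" "(N ^^ n) b"] by blast
  then have "c b = 0" if "b \<in> S" for b using inj that by simp
  then show "v = 0" using c by simp
qed

text \<open>The value of \<open>z\<close> at the start of a string is killed by
  \<open>N ^^ lam i\<close> and has degree at most \<open>- lam i\<close>, where that power is
  injective. Commutation spreads the vanishing along the string.\<close>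

lemma commute_zero:
  assumes "lin z" "deg z k" "k < 0" "\<And>v. v \<in> VV \<Longrightarrow> N (z v) = z (N v)"
  shows "z = (\<lambda>v. 0)"
proof (rule lin_eqI[OF assms(1) lin_zero])
  fix b assume "b \<in> Eb"
  then obtain i j where ij: "b = (N ^^ j) (w i)" "i < r" "j < lam i" unfolding Eb_def by blast
  have wV: "w i \<in> VV" using w_Eb[OF ij(2)] Eb_VV by blast
  have comm: "z ((N ^^ a) (w i)) = (N ^^ a) (z (w i))" for a
    by (induction a) (simp_all add: assms(4)[symmetric] Npow_simps wV)
  have "z (w i) = 0"
  proof (rule Npow_injective)
    show "z (w i) \<in> Vk (1 - int (lam i) + k)" by (rule degD[OF assms(2) w_Vk[OF ij(2)]])
    show "(N ^^ lam i) (z (w i)) = 0" using comm[of "lam i"] lam(2)[OF ij(2)] linD(5)[OF assms(1)] by simp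
  qed (use assms(3) in simp)
  then show "z b = 0" using comm[of j] ij(1) by (simp add: Npow_simps)
qed

text \<open>Dual to \<open>Npow_injective\<close>: a basis vector of degree at least
  \<open>n\<close> has at least \<open>n\<close> predecessors in its string.\<close>

lemma Npow_surjective:
  assumes "u \<in> Vk d" "u \<in> V q" "d \<ge> int n"
  shows "\<exists>t. t \<in> Vk (d - 2 * int n) \<and> t \<in> V q \<and> (N ^^ n) t = u"
proof -
  have uV: "u \<in> VV" using assms(1) Vk_VV by blast
  have supp: "dg b = d \<and> b \<in> V q" if "representation Eb u b \<noteq> 0" for b
  proof -
    have "u \<in> span {b \<in> Eb. dg b = d}" using assms(1) unfolding Vk_def .
    then have "representation Eb u = representation {b \<in> Eb. dg b = d} u"
      using representation_extend[OF Eb(2), of u "{b \<in> Eb. dg b = d}"] by blast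
    moreover have "u \<in> span (Eb \<inter> V q)" using assms(2) V_basis by blast
    then have "representation Eb u = representation (Eb \<inter> V q) u"
      using representation_extend[OF Eb(2), of u "Eb \<inter> V q"] by blast
    ultimately show ?thesis
      using representation_ne_zero[of "{b \<in> Eb. dg b = d}" u b] representation_ne_zero[of "Eb \<inter> V q" u b] that by auto
  qed
  have "\<exists>t. t \<in> Vk (d - 2 * int n) \<and> t \<in> V q \<and> (N ^^ n) t = b" if b: "b \<in> Eb" "dg b = d" "b \<in> V q" for b
  proof -
    obtain i j where ij: "b = (N ^^ j) (w i)" "i < r" "j < lam i" using b(1) unfolding Eb_def by blast
    have "d = 2 * int j + 1 - int (lam i)" using dg_e[OF ij(2,3)] b(2) ij(1) by simp
    then have jn: "j \<ge> n" using ij(3) assms(3) by linarith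
    define t where "t = (N ^^ (j - n)) (w i)"
    have tE: "t \<in> Eb" unfolding t_def using ij by (intro e_Eb) auto
    have Nt: "(N ^^ n) t = b" unfolding t_def ij(1) using jn by (metis funpow_add o_apply le_add_diff_inverse)
    have "dg t = d - 2 * int n" using dg_e[OF ij(2), of "j - n"] dg_e[OF ij(2,3)] b(2) ij(1,3) jn unfolding t_def by simp
    moreover have "t \<in> V q"
    proof (rule ccontr)
      assume "t \<notin> V q"
      then have "t \<in> V (\<not> q)" using tE Eb(4) by (cases q) auto
      then have "b \<in> V (\<not> q)" using Npow_part[of t "\<not> q" n] Nt by simp
      then have "b = 0" using b(3) V_int by (cases q) auto
      then show False using b(1) Eb(2) dependent_zero by blast
    qed
    ultimately show ?thesis using Vk_basis[OF tE] Nt by auto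
  qed
  then obtain T where T: "\<And>b. b \<in> Eb \<Longrightarrow> dg b = d \<Longrightarrow> b \<in> V q \<Longrightarrow> T b \<in> Vk (d - 2 * int n) \<and> T b \<in> V q \<and> (N ^^ n) (T b) = b"
    by metis
  define S where "S = {b \<in> Eb. dg b = d \<and> b \<in> V q}"
  have S: "finite S" unfolding S_def using Eb(1) by simp
  define t where "t = (\<Sum>b\<in>S. s (representation Eb u b) (T b))"
  have "(N ^^ n) (\<Sum>b\<in>Z. s (representation Eb u b) (T b)) = (\<Sum>b\<in>Z. s (representation Eb u b) b) \<and>
      (\<Sum>b\<in>Z. s (representation Eb u b) (T b)) \<in> Vk (d - 2 * int n) \<inter> V q" if "finite Z" "Z \<subseteq> S" for Z
    using that
  proof (induction Z rule: finite_induct)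
    case empty then show ?case using subspace_0[OF Vk_sub] subspace_0[OF V_sub] by (simp add: Npow_simps)
  next
    case (insert b Z)
    then have Tb: "T b \<in> Vk (d - 2 * int n)" "T b \<in> V q" "(N ^^ n) (T b) = b" using T[of b] unfolding S_def by auto
    have TV: "T b \<in> VV" "(\<Sum>b\<in>Z. s (representation Eb u b) (T b)) \<in> VV" using Tb(2) insert V_VV by auto
    show ?case using insert Tb TV
      by (simp add: Npow_simps VV_simps subspace_add[OF Vk_sub] subspace_add[OF V_sub] subspace_scale[OF Vk_sub] subspace_scale[OF V_sub])
  qed
  from this[OF S order_refl] have t: "(N ^^ n) t = (\<Sum>b\<in>S. s (representation Eb u b) b)" "t \<in> Vk (d - 2 * int n)" "t \<in> V q"
    unfolding t_def by auto
  have "(\<Sum>b\<in>S. s (representation Eb u b) b) = (\<Sum>b\<in>Eb. s (representation Eb u b) b)"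
    using supp Eb(1) by (intro sum.mono_neutral_left) (auto simp: S_def)
  then show ?thesis using t expand[OF uV] by auto
qed

text \<open>A solution is determined by its values \<open>t i\<close> at the starts of the strings.
  The one condition comes from \<open>(N ^^ lam i) (w i) = 0\<close>: it reads
  \<open>(N ^^ lam i) (t i) = Q i (lam i)\<close> and is solvable because the right side has degree
  at least \<open>lam i\<close>.\<close>

lemma ad_surjective:
  assumes y: "y \<in> gl_part s V False" "deg y l" "l \<ge> 1"
  shows "\<exists>z. z \<in> gl_part s V False \<and> deg z (l - 2) \<and> (\<forall>v. N (z v) - z (N v) = y v)"
proof -
  have ylin: "lin y" and ypart: "\<And>q x. x \<in> V q \<Longrightarrow> y x \<in> V q" using y(1) unfolding gl_part_iff by auto
  \<comment> \<open>The value at \<open>w i\<close> of the commutator of \<open>N ^^ j\<close> with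
    the sought \<open>z\<close>, expanded by the product rule.\<close>
  define Q where "Q i j = (\<Sum>a<j. (N ^^ a) (y ((N ^^ (j - 1 - a)) (w i))))" for i j
  have Q_Vk: "Q i j \<in> Vk (1 - int (lam i) + 2 * int j - 2 + l)" if "i < r" for i j
    unfolding Q_def
  proof (rule subspace_sum[OF Vk_sub])
    fix a assume "a \<in> {..<j}"
    then have a: "int (j - 1 - a) = int j - 1 - int a" by auto
    have "(N ^^ a) (y ((N ^^ (j - 1 - a)) (w i))) \<in> Vk (1 - int (lam i) + 2 * int (j - 1 - a) + l + 2 * int a)"
      by (intro Npow_Vk degD[OF y(2)] w_Vk that)
    then show "(N ^^ a) (y ((N ^^ (j - 1 - a)) (w i))) \<in> Vk (1 - int (lam i) + 2 * int j - 2 + l)"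
      unfolding a by (simp add: algebra_simps)
  qed
  have Q_part: "Q i j \<in> V q" if "w i \<in> V q" for i j q
    unfolding Q_def by (intro subspace_sum[OF V_sub] Npow_part ypart that)
  have "\<exists>t. t \<in> Vk (1 - int (lam i) + (l - 2)) \<and> (\<forall>q. w i \<in> V q \<longrightarrow> t \<in> V q) \<and> (N ^^ lam i) t = Q i (lam i)" if i: "i < r" for i
  proof -
    obtain q where q: "w i \<in> V q" using w_Eb[OF i] Eb(4) by blast
    have wn: "w i \<noteq> 0"
    proof
      assume "w i = 0"
      then have "0 \<in> Eb" using w_Eb[OF i] by simp
      then show False using Eb(2) dependent_zero[of Eb] by simp
    qed
    have uq: "q' = q" if "w i \<in> V q'" for q'
    proof (rule ccontr)
      assume "q' \<noteq> q"
      then have "w i \<in> V False \<inter> V True" using q that by (cases q) auto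
      then show False using wn V_int by auto
    qed
    have "Q i (lam i) \<in> Vk (int (lam i) - 1 + l)" using Q_Vk[OF i, of "lam i"] by (simp add: algebra_simps)
    from Npow_surjective[OF this Q_part[OF q], of "lam i"] obtain t
      where "t \<in> Vk (int (lam i) - 1 + l - 2 * int (lam i))" "t \<in> V q" "(N ^^ lam i) t = Q i (lam i)"
      using y(3) by auto
    then show ?thesis using uq by (intro exI[of _ t]) (auto simp: algebra_simps)
  qed
  then obtain t where t: "\<And>i. i < r \<Longrightarrow> t i \<in> Vk (1 - int (lam i) + (l - 2))"
    "\<And>i q. i < r \<Longrightarrow> w i \<in> V q \<Longrightarrow> t i \<in> V q" "\<And>i. i < r \<Longrightarrow> (N ^^ lam i) (t i) = Q i (lam i)" by metis
  \<comment> \<open>The value that the equation forces on \<open>z\<close> at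
    \<open>(N ^^ j) (w i)\<close>.\<close>
  define Z where "Z i j = (N ^^ j) (t i) - Q i j" for i j
  have Z_Vk: "Z i j \<in> Vk (2 * int j + 1 - int (lam i) + (l - 2))" if "i < r" for i j
    unfolding Z_def using Npow_Vk[OF t(1)[OF that], of j] Q_Vk[OF that, of j]
    by (intro subspace_diff[OF Vk_sub]) (simp_all add: algebra_simps)
  have Z_part: "Z i j \<in> V q" if "i < r" "w i \<in> V q" for i j q
    unfolding Z_def by (intro subspace_diff[OF V_sub] Npow_part t(2) Q_part that)
  have Z_step: "N (Z i j) - Z i (Suc j) = y ((N ^^ j) (w i))" if "i < r" for i j
  proof -
    have wV: "w i \<in> VV" using w_Eb[OF that] Eb_VV by blast
    have tV: "t i \<in> VV" using t(1)[OF that] Vk_VV by blast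
    have "(N ^^ a) (y ((N ^^ b) (w i))) \<in> VV" for a b using wV by (simp add: Npow_simps linD[OF ylin])
    then have NQ: "N (Q i j) = (\<Sum>a<j. (N ^^ Suc a) (y ((N ^^ (j - 1 - a)) (w i))))" "Q i j \<in> VV"
      unfolding Q_def by (auto simp: lin_sum[OF N_lin] intro: subspace_sum[OF VV_sub])
    have "Q i (Suc j) = y ((N ^^ j) (w i)) + (\<Sum>a<j. (N ^^ Suc a) (y ((N ^^ (j - Suc a)) (w i))))"
      unfolding Q_def by (subst sum.lessThan_Suc_shift) simp
    then have "Q i (Suc j) = y ((N ^^ j) (w i)) + N (Q i j)" unfolding NQ(1) by simp
    moreover have "N (Z i j) = (N ^^ Suc j) (t i) - N (Q i j)"
      unfolding Z_def using NQ(2) tV by (simp add: linD[OF N_lin] Npow_simps)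
    ultimately show ?thesis unfolding Z_def by simp
  qed
  have Z_end: "Z i (lam i) = 0" if "i < r" for i unfolding Z_def using t(3)[OF that] by simp
  \<comment> \<open>A basis vector determines its string and its position, so the values fit
    together to a function on \<open>Eb\<close>.\<close>
  have "\<forall>b\<in>Eb. \<exists>u. \<forall>i j. i < r \<longrightarrow> j < lam i \<longrightarrow> b = (N ^^ j) (w i) \<longrightarrow> u = Z i j"
  proof
    fix b assume "b \<in> Eb"
    then obtain i j where ij: "b = (N ^^ j) (w i)" "i < r" "j < lam i" unfolding Eb_def by blast
    have "Z i j = Z i' j'" if "i' < r" "j' < lam i'" "b = (N ^^ j') (w i')" for i' j'
      using e_inj[OF ij(2,3) that(1,2)] ij(1) that(3) by auto
    then show "\<exists>u. \<forall>i j. i < r \<longrightarrow> j < lam i \<longrightarrow> b = (N ^^ j) (w i) \<longrightarrow> u = Z i j" by (intro exI[of _ "Z i j"]) auto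
  qed
  then obtain T where T: "\<And>i j. i < r \<Longrightarrow> j < lam i \<Longrightarrow> T ((N ^^ j) (w i)) = Z i j" using e_Eb by metis
  define z where "z = ext T"
  have TVk: "T b \<in> Vk (dg b + (l - 2))" if "b \<in> Eb" for b
  proof -
    obtain i j where ij: "b = (N ^^ j) (w i)" "i < r" "j < lam i" using \<open>b \<in> Eb\<close> unfolding Eb_def by blast
    then show ?thesis using T[OF ij(2,3)] Z_Vk[OF ij(2), of j] dg_e[OF ij(2,3)] by simp
  qed
  have zlin: "lin z" unfolding z_def using TVk Vk_VV by (intro lin_ext) blast
  have zb: "z ((N ^^ j) (w i)) = Z i j" if "i < r" "j \<le> lam i" for i j
  proof (cases "j = lam i")
    case True then show ?thesis using lam(2) Z_end that linD(5)[OF zlin] by simp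
  next
    case False then show ?thesis unfolding z_def using that T e_Eb by (simp add: ext_basis)
  qed
  have "(\<lambda>v. N (z v) - z (N v)) = y"
  proof (rule lin_eqI[OF _ ylin])
    show "lin (\<lambda>v. N (z v) - z (N v))" by (rule lin_diff[OF lin_comp[OF N_lin zlin] lin_comp[OF zlin N_lin]])
    fix b assume "b \<in> Eb"
    then obtain i j where ij: "b = (N ^^ j) (w i)" "i < r" "j < lam i" unfolding Eb_def by blast
    then have "N (z b) - z (N b) = N (Z i j) - Z i (Suc j)" using zb[of i j] zb[of i "Suc j"] by simp
    then show "N (z b) - z (N b) = y b" using Z_step ij by simp
  qed
  moreover have "deg z (l - 2)" using TVk by (intro degI[OF zlin]) (simp add: z_def ext_basis)
  moreover have "z \<in> gl_part s V False"
  proof (rule gl_partI[OF zlin])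
    fix b q assume b: "b \<in> Eb" "b \<in> V q"
    then obtain i j where ij: "b = (N ^^ j) (w i)" "i < r" "j < lam i" unfolding Eb_def by blast
    have "w i \<in> V q"
    proof (rule ccontr)
      assume "w i \<notin> V q"
      then have "w i \<in> V (\<not> q)" using w_Eb[OF ij(2)] Eb(4) by (cases q) auto
      then have "b \<in> V (\<not> q)" using Npow_part ij(1) by blast
      then have "b = 0" using b(2) V_int by (cases q) auto
      then show False using b(1) Eb(2) dependent_zero by blast
    qed
    then show "z b \<in> V (False \<noteq> q)" using zb[OF ij(2)] ij Z_part[OF ij(2)] by simp
  qed
  ultimately show ?thesis by (intro exI[of _ z]) (auto dest: fun_cong)
qed

end

section \<open>Restricted structure and gradings\<close>

text \<open>The functionals embed \<open>W\<close> into the functions on the finite set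
  \<open>J\<close>, which bounds the size of independent sets.\<close>

lemma (in vector_space) finite_span_of_functionals:
  fixes F :: "'j \<Rightarrow> 'b \<Rightarrow> 'a"
  assumes "subspace W" "finite J"
    and add: "\<And>j x y. j \<in> J \<Longrightarrow> x \<in> W \<Longrightarrow> y \<in> W \<Longrightarrow> F j (x + y) = F j x + F j y"
    and scale: "\<And>j c x. j \<in> J \<Longrightarrow> x \<in> W \<Longrightarrow> F j (scale c x) = c * F j x"
    and inj: "\<And>x. x \<in> W \<Longrightarrow> (\<And>j. j \<in> J \<Longrightarrow> F j x = 0) \<Longrightarrow> x = 0"
  shows "\<exists>B. finite B \<and> W \<subseteq> span B"
proof -
  define sJ where "sJ c f = (\<lambda>t. c * f t)" for c and f :: "'j \<Rightarrow> 'a"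
  interpret J: vector_space sJ
    by unfold_locales (auto simp: sJ_def plus_fun_def fun_eq_iff algebra_simps)
  define \<delta> where "\<delta> j = (\<lambda>t. if t = j then 1 else (0::'a))" for j :: 'j
  define T where "T x = (\<lambda>j. if j \<in> J then F j x else 0)" for x
  have F_sum: "F j (\<Sum>v\<in>t. scale (c v) v) = (\<Sum>v\<in>t. c v * F j v) \<and> (\<Sum>v\<in>t. scale (c v) v) \<in> W"
    if "finite t" "t \<subseteq> W" "j \<in> J" for t c j
    using that(1,2)
  proof (induction t rule: finite_induct)
    case empty
    have "F j (scale 0 0) = 0 * F j 0" using that(3) subspace_0[OF assms(1)] by (rule scale)
    then show ?case using subspace_0[OF assms(1)] by simp
  next
    case (insert v t)
    then show ?case using add[OF that(3)] scale[OF that(3)] by (simp add: subspace_add subspace_scale assms(1))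
  qed
  obtain S where S: "S \<subseteq> W" "independent S" "W \<subseteq> span S" using maximal_independent_subset by metis
  have inj_T: "inj_on T S"
  proof
    fix x y assume xy: "x \<in> S" "y \<in> S" "T x = T y"
    then have "F j x = F j y" if "j \<in> J" for j using that unfolding T_def by (metis (full_types))
    moreover have "F j (x + scale (-1) y) = F j x - F j y" if "j \<in> J" for j
    proof -
      have W: "x \<in> W" "y \<in> W" "scale (-1) y \<in> W" using xy S(1) subspace_neg[OF assms(1), of y] by auto
      show ?thesis unfolding add[OF that W(1,3)] scale[OF that W(2)] by simp
    qed
    ultimately have "x + scale (-1) y = 0"
      using xy S(1) subspace_diff[OF assms(1), of x y] by (intro inj) auto
    then show "x = y" by simp
  qed
  have indep: "J.independent (T ` S)"
    unfolding J.independent_explicit_module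
  proof (intro allI impI)
    fix t u v assume t: "finite t" "t \<subseteq> T ` S" "(\<Sum>v\<in>t. sJ (u v) v) = 0" "v \<in> t"
    obtain S' where S': "S' \<subseteq> S" "t = T ` S'" using t(2) by (meson subset_imageE)
    have iS': "inj_on T S'" using inj_T S'(1) by (rule inj_on_subset)
    have fS': "finite S'" using t(1) S'(2) iS' finite_imageD by blast
    have "F j (\<Sum>x\<in>S'. scale (u (T x)) x) = 0" if j: "j \<in> J" for j
    proof -
      have "(\<Sum>v\<in>t. sJ (u v) v) j = (\<Sum>v\<in>t. u v * v j)"
        using t(1) by (induction t rule: finite_induct) (auto simp: sJ_def plus_fun_def)
      then have "(\<Sum>v\<in>t. u v * v j) = 0" using t(3) by simp
      then have "(\<Sum>x\<in>S'. u (T x) * T x j) = 0" unfolding S'(2) by (subst (asm) sum.reindex[OF iS']) simp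
      then have "(\<Sum>x\<in>S'. u (T x) * F j x) = 0" using j unfolding T_def by simp
      then show ?thesis using F_sum[OF fS' _ j, of "\<lambda>x. u (T x)"] S'(1) S(1) by auto
    qed
    moreover have "(\<Sum>x\<in>S'. scale (u (T x)) x) \<in> W"
      using S'(1) S(1) by (intro subspace_sum[OF assms(1)] subspace_scale[OF assms(1)]) auto
    ultimately have "(\<Sum>x\<in>S'. scale (u (T x)) x) = 0" by (intro inj)
    moreover obtain x where "x \<in> S'" "v = T x" using t(4) S'(2) by auto
    ultimately show "u v = 0"
      using independentD[OF S(2) fS' S'(1), of "\<lambda>x. u (T x)"] by blast
  qed
  have "T ` S \<subseteq> J.span (\<delta> ` J)"
  proof
    fix f assume "f \<in> T ` S"
    then have f: "j \<notin> J \<Longrightarrow> f j = 0" for j unfolding T_def by auto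
    have "f = (\<Sum>j\<in>J. sJ (f j) (\<delta> j))"
    proof
      fix i
      have "(\<Sum>j\<in>Z. sJ (f j) (\<delta> j)) i = (\<Sum>j\<in>Z. if j = i then f i else 0)" if "finite Z" for Z
        using that by (induction Z rule: finite_induct) (auto simp: sJ_def \<delta>_def plus_fun_def)
      then show "f i = (\<Sum>j\<in>J. sJ (f j) (\<delta> j)) i" using assms(2) f by simp
    qed
    moreover have "(\<Sum>j\<in>J. sJ (f j) (\<delta> j)) \<in> J.span (\<delta> ` J)"
      by (intro J.span_sum J.span_scale J.span_base) auto
    ultimately show "f \<in> J.span (\<delta> ` J)" by simp
  qed
  then have "finite (T ` S)" using J.independent_span_bound[OF _ indep] assms(2) by blast
  then have "finite S" using inj_T finite_imageD by blast
  then show ?thesis using S(3) by blast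
qed

text \<open>One set of axioms for two uses: the natural representation of the linear superalgebras
  and the adjoint representation of the exceptional ones. In both, \<open>ppow\<close> acts as the
  \<open>p\<close>-th power.\<close>

locale graded_rep = U: vector_space sU + g: vector_space "scl G"
  for sU :: "'k::field \<Rightarrow> 'v::ab_group_add \<Rightarrow> 'v" and G :: "('k, 'g::ab_group_add) lsuper" +
  fixes gr :: "int \<Rightarrow> 'g set" and Uk :: "int \<Rightarrow> 'v set" and \<rho> :: "'g \<Rightarrow> 'v \<Rightarrow> 'v"
  assumes part_sub: "g.subspace (part G a)" and part_int: "part G False \<inter> part G True = {0}"
    and gr_sub: "g.subspace (gr k)" and gr_par: "gr k = total (\<lambda>a. gr k \<inter> part G a)"
    and ds: "direct_sum (space_of G) gr"
    and Uk_sub: "U.subspace (Uk l)"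
    and Uk_indep: "finite K \<Longrightarrow> (\<And>k. k \<in> K \<Longrightarrow> u k \<in> Uk k) \<Longrightarrow> (\<Sum>k\<in>K. u k) = 0 \<Longrightarrow> j \<in> K \<Longrightarrow> u j = 0"
    and \<rho>_gr: "z \<in> gr k \<Longrightarrow> v \<in> Uk l \<Longrightarrow> \<rho> z v \<in> Uk (l + k)"
    and \<rho>_add: "z \<in> space_of G \<Longrightarrow> z' \<in> space_of G \<Longrightarrow> v \<in> U.span (\<Union>l. Uk l) \<Longrightarrow> \<rho> (z + z') v = \<rho> z v + \<rho> z' v"
    and \<rho>_scale: "z \<in> space_of G \<Longrightarrow> v \<in> U.span (\<Union>l. Uk l) \<Longrightarrow> \<rho> (scl G c z) v = sU c (\<rho> z v)"
    and \<rho>_add_right: "z \<in> space_of G \<Longrightarrow> v \<in> U.span (\<Union>l. Uk l) \<Longrightarrow> v' \<in> U.span (\<Union>l. Uk l) \<Longrightarrow> \<rho> z (v + v') = \<rho> z v + \<rho> z v'"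
    and \<rho>_scale_right: "z \<in> space_of G \<Longrightarrow> v \<in> U.span (\<Union>l. Uk l) \<Longrightarrow> \<rho> z (sU c v) = sU c (\<rho> z v)"
    and faithful: "z \<in> gr k \<Longrightarrow> z \<in> part G False \<Longrightarrow> (\<And>l v. v \<in> Uk l \<Longrightarrow> \<rho> z v = 0) \<Longrightarrow> z = 0"
    and ppow_even: "z \<in> part G False \<Longrightarrow> ppow G z \<in> part G False"
    and \<rho>_ppow: "z \<in> part G False \<Longrightarrow> v \<in> Uk l \<Longrightarrow> \<rho> (ppow G z) v = (\<rho> z ^^ CHAR('k)) v"
begin

lemma gr_space: "gr k \<subseteq> space_of G" using ds unfolding direct_sum_def by blast

lemma space_sub: "g.subspace (space_of G)"
  unfolding total_def using g.subspace_sums[OF part_sub part_sub] .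

lemma even_components:
  assumes "z \<in> part G False" "z \<in> space_of G"
  shows "\<exists>S c. finite S \<and> (\<forall>k\<in>S. c k \<in> gr k \<inter> part G False) \<and> z = (\<Sum>k\<in>S. c k)"
proof -
  obtain c where c: "\<And>k. c k \<in> gr k" "finite {k. c k \<noteq> 0}" "z = (\<Sum>k | c k \<noteq> 0. c k)"
    using ds assms(2) unfolding direct_sum_def by blast
  have "\<forall>k. \<exists>u v. u \<in> gr k \<inter> part G False \<and> v \<in> gr k \<inter> part G True \<and> c k = u + v"
    using c(1) gr_par unfolding total_def by blast
  then obtain u v where uv: "\<And>k. u k \<in> gr k \<inter> part G False" "\<And>k. v k \<in> gr k \<inter> part G True" "\<And>k. c k = u k + v k"
    by metis
  define S where "S = {k. c k \<noteq> 0}"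
  have zz: "z = (\<Sum>k\<in>S. u k) + (\<Sum>k\<in>S. v k)" using c(3) by (simp add: S_def uv(3) sum.distrib)
  have "(\<Sum>k\<in>S. u k) \<in> part G False" "(\<Sum>k\<in>S. v k) \<in> part G True"
    using uv by (auto intro: g.subspace_sum[OF part_sub])
  then have "(\<Sum>k\<in>S. v k) \<in> part G False \<inter> part G True"
    using zz assms(1) g.subspace_diff[OF part_sub, of z False "\<Sum>k\<in>S. u k"] by simp
  then have "z = (\<Sum>k\<in>S. u k)" using zz part_int by simp
  then show ?thesis using uv(1) c(2) unfolding S_def by blast
qed

text \<open>\<open>x\<close> lowers the degree filtration of the representation by \<open>d\<close>,
  so its \<open>p\<close>-th power lowers it by \<open>p * d\<close>. A component of
  \<open>ppow G x\<close> of degree above \<open>- p * d\<close> must then act as zero, and it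
  vanishes by faithfulness.\<close>

lemma ppow_filtration:
  assumes d: "d \<ge> 1" and x: "x \<in> part G False" "x \<in> g.span (\<Union>k\<in>{d..}. gr (- k))"
    and ps: "ppow G x \<in> space_of G"
  shows "ppow G x \<in> g.span (\<Union>k\<in>{int CHAR('k) * d..}. gr (- k))"
proof -
  define TF where "TF m = U.span (\<Union>j\<in>{..m}. Uk j)" for m
  have TFU: "TF m \<subseteq> U.span (\<Union>l. Uk l)" for m unfolding TF_def by (intro U.span_mono) auto
  have TF_mono: "m \<le> m' \<Longrightarrow> TF m \<subseteq> TF m'" for m m' unfolding TF_def by (intro U.span_mono) fastforce
  have xs: "x \<in> space_of G"
    using x(2) g.span_minimal[OF _ space_sub, of "\<Union>k\<in>{d..}. gr (- k)"] gr_space by blast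
  have gTF: "\<rho> z v \<in> TF (m - k)" if z: "z \<in> gr (- k)" and v: "v \<in> TF m" for z k v m
  proof -
    have zs: "z \<in> space_of G" using z gr_space by blast
    have "\<rho> z v \<in> TF (m - k) \<and> v \<in> TF m" using v unfolding TF_def[of m]
    proof (induction rule: U.span_induct_alt)
      case base
      have "\<rho> z (sU 0 0) = sU 0 (\<rho> z 0)" using zs U.span_zero by (rule \<rho>_scale_right)
      then show ?case unfolding TF_def by (simp add: U.span_zero)
    next
      case (step c u w)
      then obtain j where j: "j \<le> m" "u \<in> Uk j" by auto
      have uw: "u \<in> U.span (\<Union>l. Uk l)" "w \<in> U.span (\<Union>l. Uk l)" "sU c u \<in> U.span (\<Union>l. Uk l)"
        using j step TFU[of m] unfolding TF_def by (auto intro: U.span_base U.span_scale)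
      have "\<rho> z u \<in> Uk (j + - k)" by (rule \<rho>_gr[OF z j(2)])
      then have "\<rho> z u \<in> TF (m - k)" using j(1) unfolding TF_def by (intro U.span_base UN_I[of "j + - k"]) auto
      then have "sU c (\<rho> z u) + \<rho> z w \<in> TF (m - k)" using step unfolding TF_def by (intro U.span_add U.span_scale) auto
      moreover have "\<rho> z (sU c u + w) = sU c (\<rho> z u) + \<rho> z w"
        using \<rho>_add_right[OF zs uw(3,2)] \<rho>_scale_right[OF zs uw(1)] by simp
      moreover have "sU c u + w \<in> U.span (\<Union>j\<in>{..m}. Uk j)"
        using step j by (intro U.span_add U.span_scale U.span_base[of u]) auto
      ultimately show ?case by simp
    qed
    then show ?thesis by simp
  qed
  have xTF: "\<rho> x v \<in> TF (m - d)" if v: "v \<in> TF m" for v m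
  proof -
    have vU: "v \<in> U.span (\<Union>l. Uk l)" using v TFU by blast
    have "\<rho> x v \<in> TF (m - d) \<and> x \<in> space_of G" using x(2)
    proof (induction rule: g.span_induct_alt)
      case base
      have "\<rho> (scl G 0 0) v = sU 0 (\<rho> 0 v)" using g.subspace_0[OF space_sub] vU by (rule \<rho>_scale)
      then show ?case unfolding TF_def using g.subspace_0[OF space_sub] by (simp add: U.span_zero)
    next
      case (step c z w)
      then obtain k where k: "k \<ge> d" "z \<in> gr (- k)" by auto
      have zs: "z \<in> space_of G" "scl G c z \<in> space_of G" using k gr_space g.subspace_scale[OF space_sub] by blast+
      have "\<rho> z v \<in> TF (m - d)" using gTF[OF k(2) v] TF_mono[of "m - k" "m - d"] k(1) by auto
      then have "sU c (\<rho> z v) + \<rho> w v \<in> TF (m - d)" using step unfolding TF_def by (intro U.span_add U.span_scale) auto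
      moreover have "\<rho> (scl G c z + w) v = sU c (\<rho> z v) + \<rho> w v"
        using \<rho>_add[OF zs(2) _ vU, of w] \<rho>_scale[OF zs(1) vU] step by simp
      ultimately show ?case using step zs g.subspace_add[OF space_sub] by simp
    qed
    then show ?thesis by simp
  qed
  have xpow: "(\<rho> x ^^ a) v \<in> TF (m - int a * d)" if "v \<in> TF m" for v m a
  proof (induction a)
    case (Suc a)
    then show ?case using xTF[OF Suc] by (simp add: algebra_simps)
  qed (use that in simp)
  define q where "q = int CHAR('k) * d"
  obtain S c where c: "finite S" "\<And>k. k \<in> S \<Longrightarrow> c k \<in> gr k \<inter> part G False" "ppow G x = (\<Sum>k\<in>S. c k)"
    using even_components[OF ppow_even[OF x(1)] ps] by blast
  have "c k = 0" if k: "k \<in> S" "k > - q" for k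
  proof (rule faithful)
    show "c k \<in> gr k" "c k \<in> part G False" using c(2)[OF k(1)] by auto
    fix l v assume v: "v \<in> Uk l"
    have vTF: "v \<in> TF l" unfolding TF_def using v by (intro U.span_base) auto
    have vU: "v \<in> U.span (\<Union>l. Uk l)" using vTF TFU by blast
    have sum: "\<rho> (\<Sum>k\<in>Z. c k) v = (\<Sum>k\<in>Z. \<rho> (c k) v) \<and> (\<Sum>k\<in>Z. c k) \<in> space_of G" if "finite Z" "Z \<subseteq> S" for Z
      using that
    proof (induction Z rule: finite_induct)
      case empty
      have "\<rho> (scl G 0 0) v = sU 0 (\<rho> 0 v)" using g.subspace_0[OF space_sub] vU by (rule \<rho>_scale)
      then show ?case using g.subspace_0[OF space_sub] by simp
    next
      case (insert k Z)
      then have "c k \<in> space_of G" using c(2)[of k] gr_space by blast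
      then show ?case using insert \<rho>_add[OF _ _ vU, of "c k"] g.subspace_add[OF space_sub] by simp
    qed
    have "\<rho> (ppow G x) v \<in> TF (l - q)" unfolding \<rho>_ppow[OF x(1) v] q_def by (rule xpow[OF vTF])
    then have tTF: "(\<Sum>k\<in>S. \<rho> (c k) v) \<in> TF (l - q)" using sum[OF c(1) order_refl] unfolding c(3) by simp
    have "\<exists>K t. finite K \<and> K \<subseteq> {..m} \<and> (\<forall>j\<in>K. t j \<in> Uk j) \<and> u = (\<Sum>j\<in>K. t j)" if "u \<in> TF m" for u m
      using that unfolding TF_def
    proof (induction rule: U.span_induct_alt)
      case base then show ?case by (intro exI[of _ "{}"]) simp
    next
      case (step a u w)
      then obtain K t where Kt: "finite K" "K \<subseteq> {..m}" "\<forall>j\<in>K. t j \<in> Uk j" "w = (\<Sum>j\<in>K. t j)" by blast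
      obtain j where j: "j \<le> m" "u \<in> Uk j" using step(1) by auto
      define t' where "t' i = (if i \<in> K then t i else 0) + (if i = j then sU a u else 0)" for i
      have "t' i \<in> Uk i" for i
        unfolding t'_def using Kt(3) j(2) U.subspace_0[OF Uk_sub] U.subspace_add[OF Uk_sub] U.subspace_scale[OF Uk_sub] by auto
      moreover have "(\<Sum>i\<in>insert j K. t' i) = (\<Sum>i\<in>insert j K. if i \<in> K then t i else 0) + (\<Sum>i\<in>insert j K. if i = j then sU a u else 0)"
        unfolding t'_def by (rule sum.distrib)
      moreover have "(\<Sum>i\<in>insert j K. if i \<in> K then t i else 0) = w"
        unfolding Kt(4) using Kt(1) by (intro sum.mono_neutral_cong_right) auto
      moreover have "(\<Sum>i\<in>insert j K. if i = j then sU a u else 0) = sU a u" using Kt(1) by simp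
      ultimately show ?case using Kt(1,2) j(1)
        by (intro exI[of _ "insert j K"] exI[of _ t']) (auto simp: add.commute)
    qed
    from this[OF tTF] obtain K t where Kt: "finite K" "K \<subseteq> {..l - q}" "\<And>j. j \<in> K \<Longrightarrow> t j \<in> Uk j"
      "(\<Sum>k\<in>S. \<rho> (c k) v) = (\<Sum>j\<in>K. t j)" by blast
    define f where "f i = (if i - l \<in> S then \<rho> (c (i - l)) v else 0) - (if i \<in> K then t i else 0)" for i
    define Z where "Z = (\<lambda>k. l + k) ` S \<union> K"
    have Z: "finite Z" unfolding Z_def using c(1) Kt(1) by simp
    have fU: "f i \<in> Uk i" for i
    proof -
      have "(if i - l \<in> S then \<rho> (c (i - l)) v else 0) \<in> Uk i"
        using \<rho>_gr[of "c (i - l)" "i - l" v l] c(2)[of "i - l"] v U.subspace_0[OF Uk_sub] by auto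
      moreover have "(if i \<in> K then t i else 0) \<in> Uk i" using Kt(3) U.subspace_0[OF Uk_sub] by auto
      ultimately show ?thesis unfolding f_def by (rule U.subspace_diff[OF Uk_sub])
    qed
    have "(\<Sum>i\<in>Z. f i) = (\<Sum>i\<in>Z. if i - l \<in> S then \<rho> (c (i - l)) v else 0) - (\<Sum>i\<in>Z. if i \<in> K then t i else 0)"
      unfolding f_def by (rule sum_subtractf)
    also have "(\<Sum>i\<in>Z. if i - l \<in> S then \<rho> (c (i - l)) v else 0) = (\<Sum>i\<in>(\<lambda>k. l + k) ` S. \<rho> (c (i - l)) v)"
      using Z by (intro sum.mono_neutral_cong_right) (auto simp: Z_def intro: rev_image_eqI)
    also have "\<dots> = (\<Sum>k\<in>S. \<rho> (c k) v)" by (subst sum.reindex) (auto simp: inj_on_def)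
    also have "(\<Sum>i\<in>Z. if i \<in> K then t i else 0) = (\<Sum>j\<in>K. t j)"
      using Z by (intro sum.mono_neutral_cong_right) (auto simp: Z_def)
    finally have "(\<Sum>i\<in>Z. f i) = 0" using Kt(4) by simp
    then have "f (l + k) = 0" using Uk_indep[OF Z fU, of "l + k"] k(1) unfolding Z_def by blast
    moreover have "l + k \<notin> K" using Kt(2) k(2) by auto
    ultimately show "\<rho> (c k) v = 0" unfolding f_def using k(1) by simp
  qed
  then have "c k \<in> g.span (\<Union>k\<in>{q..}. gr (- k))" if "k \<in> S" for k
  proof (cases "k > - q")
    case False
    have "c k \<in> gr (- (- k))" using c(2)[OF that] by simp
    then show ?thesis using False by (intro g.span_base UN_I[of "- k"]) auto
  qed (use that in \<open>simp add: g.span_zero\<close>)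
  then show ?thesis unfolding c(3) q_def[symmetric] by (intro g.span_sum)
qed

end

text \<open>
  Used with the tori acting by \<open>d a\<close>: a block \<open>B \<rightarrow> A\<close> of \<open>X\<close> and a block \<open>D \<rightarrow> C\<close> of negative degree other than \<open>-2\<close>
  have weights whose sum is nonzero in every characteristic other than \<open>2\<close>.
\<close>

lemma odd_weight_exists:
  fixes A B C D :: int
  assumes AB: "A = B + 2" and CD: "C < D" "D \<noteq> C + 2"
  defines "d \<equiv> \<lambda>a k :: int. (if k = a then 1 else 0) - (if k = - a then 1 else 0 :: int)"
  shows "\<exists>a. d a A - d a B + d a C - d a D \<notin> {0, 3, - 3}"
proof (rule ccontr)
  assume "\<not> ?thesis"
  then have n: "d a A - d a B + d a C - d a D = 0 \<or> d a A - d a B + d a C - d a D = 3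
     \<or> d a A - d a B + d a C - d a D = - 3" for a by blast
  have d0: "d a k = 0" if "k \<noteq> a" "k \<noteq> - a" for a k using that by (simp add: d_def)
  have d1: "d a a = 1" if "a \<noteq> 0" for a using that by (simp add: d_def)
  have d2: "d a (- a) = - 1" if "a \<noteq> 0" for a using that by (simp add: d_def)
  have cases: "d a k = 0 \<or> d a k = 1 \<and> k = a \<or> d a k = - 1 \<and> k = - a" for a k by (auto simp: d_def)
  \<comment> \<open>The block of \<open>X\<close> is its own transpose, or it touches degree 0, or
    neither.\<close>
  consider "B = -1" | "B = 0 \<or> B = -2" | "B \<noteq> 0" "A \<noteq> 0" "A \<noteq> - B" using AB by force
  then show False
  proof cases
    case 1
    then have A: "A = 1" using AB by simp
    have "d 1 C - d 1 D = - 2 \<or> d 1 C - d 1 D = 1"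
      using n[of 1] cases[of 1 C] cases[of 1 D] d1[of 1] d2[of 1] unfolding A 1 by auto
    then have "C = -1 \<and> D = 1 \<or> C = 1 \<and> D \<noteq> 1 \<or> D = -1 \<and> C \<noteq> -1"
      using cases[of 1 C] cases[of 1 D] by auto
    then show False
    proof (elim disjE conjE)
      assume "C = 1" "D \<noteq> 1"
      then show False using CD n[of D] d0[of 1 D] d0[of "-1" D] d0[of 1 D] d1[of D] unfolding A 1 by auto
    next
      assume "D = -1" "C \<noteq> -1"
      then show False using CD n[of C] d0[of 1 C] d0[of "-1" C] d1[of C] unfolding A 1 by auto
    qed (use CD in simp)
  next
    case 2
    have "d a 0 = 0" "d a (- 2) = - d a 2" for a by (auto simp: d_def)
    then have A: "d a A - d a B = d a 2" for a using 2 AB by auto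
    have "d 2 C - d 2 D = - 1 \<or> d 2 C - d 2 D = 2"
      using n[of 2] cases[of 2 C] cases[of 2 D] d1[of 2] unfolding A by auto
    then have c: "C = 2 \<and> D = -2 \<or> C = -2 \<and> D \<noteq> -2 \<and> D \<noteq> 2 \<or> D = 2 \<and> C \<noteq> 2 \<and> C \<noteq> -2"
      using cases[of 2 C] cases[of 2 D] d1[of 2] d2[of 2] CD(1) by auto
    then show False
    proof (elim disjE conjE)
      assume "C = -2" "D \<noteq> -2" "D \<noteq> 2"
      moreover from this have "D \<noteq> 0" using CD by auto
      ultimately show False using n[of D] d0[of 2 D] d0[of "-2" D] d1[of D] unfolding A by auto
    next
      assume "D = 2" "C \<noteq> 2" "C \<noteq> -2"
      moreover from this have "C \<noteq> 0" using CD by auto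
      ultimately show False using n[of C] d0[of 2 C] d1[of C] unfolding A by auto
    qed (use CD in simp)
  next
    case 3
    \<comment> \<open>The tests \<open>a = A\<close> and \<open>a = B\<close> are compatible only
      for blocks of degree -2, opposite to the block of \<open>X\<close> or to its transpose; these
      are excluded.\<close>
    have z: "d A B = 0" "d B A = 0" using AB 3 by (auto intro!: d0)
    have "d A C - d A D = - 1 \<or> d A C - d A D = 2"
      using n[of A] cases[of A C] cases[of A D] d1[of A] 3 unfolding z by auto
    then have p: "C = - A \<or> D = A \<or> C = A \<and> D = - A"
      using cases[of A C] cases[of A D] by (elim disjE) simp_all
    have "d B C - d B D = 1 \<or> d B C - d B D = - 2"
      using n[of B] cases[of B C] cases[of B D] d1[of B] 3 unfolding z by auto
    then have "C = B \<or> D = - B \<or> C = - B \<and> D = B"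
      using cases[of B C] cases[of B D] by (elim disjE) simp_all
    then show False using p AB CD 3 by presburger
  qed
qed

section \<open>Superalgebras with an invariant form\<close>

locale formed_superalgebra =
  fixes G :: "('k::field, 'g::ab_group_add) lsuper" and B :: "'g \<Rightarrow> 'g \<Rightarrow> 'k" and X :: 'g and chi :: "'g \<Rightarrow> 'k"
  assumes restricted: "restricted_lie_superalgebra G"
    and char: "CHAR('k) > 2"
    and form: "invariant_form G B"
    and X_even: "X \<in> part G False"
    and chi_eq: "z \<in> space_of G \<Longrightarrow> chi z = B X z"
begin

lemma lie: "lie_superalgebra G" using restricted unfolding restricted_lie_superalgebra_def by blast

lemma gs: "graded_space (scl G) (part G)" using lie unfolding lie_superalgebra_def by blast

sublocale g: vector_space "scl G" using gs unfolding graded_space_def by blast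

lemma part_sub: "g.subspace (part G a)" using gs unfolding graded_space_def by blast

lemma part_int: "part G False \<inter> part G True = {0}" using gs unfolding graded_space_def by blast

lemma space_sub: "g.subspace (space_of G)"
  unfolding total_def using g.subspace_sums[OF part_sub part_sub] .

lemma part_space: "part G a \<subseteq> space_of G"
  unfolding total_def using g.subspace_0[OF part_sub] by (cases a) force+

lemma X_space: "X \<in> space_of G" using X_even part_space by blast

lemma space_closed:
  "0 \<in> space_of G" "x \<in> space_of G \<Longrightarrow> y \<in> space_of G \<Longrightarrow> x + y \<in> space_of G"
  "x \<in> space_of G \<Longrightarrow> y \<in> space_of G \<Longrightarrow> x - y \<in> space_of G" "x \<in> space_of G \<Longrightarrow> scl G c x \<in> space_of G"
  using space_sub by (auto intro: g.subspace_0 g.subspace_add g.subspace_diff g.subspace_scale)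

lemma space_split: "x \<in> space_of G \<Longrightarrow> \<exists>u v. u \<in> part G False \<and> v \<in> part G True \<and> x = u + v"
  unfolding total_def by blast

lemma brk_linear:
  assumes "x \<in> space_of G" "y \<in> space_of G" "z \<in> space_of G"
  shows "brk G (x + y) z = brk G x z + brk G y z" "brk G x (y + z) = brk G x y + brk G x z"
    "brk G (scl G c x) y = scl G c (brk G x y)" "brk G x (scl G c y) = scl G c (brk G x y)"
  using lie assms unfolding lie_superalgebra_def by blast+

lemma brk_part: "x \<in> part G a \<Longrightarrow> y \<in> part G b \<Longrightarrow> brk G x y \<in> part G (a \<noteq> b)"
  using lie unfolding lie_superalgebra_def by blast

lemma brk_skew: "x \<in> part G a \<Longrightarrow> y \<in> part G b \<Longrightarrow> brk G x y = - scl G (ksign a b) (brk G y x)"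
  using lie unfolding lie_superalgebra_def by blast

lemma brk_space: "x \<in> space_of G \<Longrightarrow> y \<in> space_of G \<Longrightarrow> brk G x y \<in> space_of G"
proof -
  assume "x \<in> space_of G" "y \<in> space_of G"
  then obtain a b u v where uv: "x = a + b" "a \<in> part G False" "b \<in> part G True" "y = u + v" "u \<in> part G False" "v \<in> part G True"
    using space_split by metis
  have sp: "a \<in> space_of G" "b \<in> space_of G" "u \<in> space_of G" "v \<in> space_of G" using uv part_space by blast+
  have "brk G x y = brk G a u + brk G a v + (brk G b u + brk G b v)"
    unfolding uv(1,4) using sp by (simp add: brk_linear space_closed)
  moreover have "brk G c d \<in> space_of G" if "c \<in> part G p" "d \<in> part G q" for c d p q
    using brk_part[OF that] part_space by blast
  ultimately show ?thesis using uv by (metis space_closed(2))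
qed

lemma ppow_even: "x \<in> part G False \<Longrightarrow> ppow G x \<in> part G False"
  and ppow_brk: "x \<in> part G False \<Longrightarrow> y \<in> space_of G \<Longrightarrow> brk G (ppow G x) y = (brk G x ^^ CHAR('k)) y"
  using restricted unfolding restricted_lie_superalgebra_def by blast+

lemma B_linear:
  assumes "x \<in> space_of G" "y \<in> space_of G" "z \<in> space_of G"
  shows "B (x + y) z = B x z + B y z" "B x (y + z) = B x y + B x z"
    "B (scl G c x) y = c * B x y" "B x (scl G c y) = c * B x y" "B (brk G x y) z = B x (brk G y z)"
  using form assms unfolding invariant_form_def by blast+

lemma B_comm: "x \<in> part G a \<Longrightarrow> y \<in> part G b \<Longrightarrow> B x y = ksign a b * B y x"
  and B_odd: "x \<in> part G a \<Longrightarrow> y \<in> part G b \<Longrightarrow> a \<noteq> b \<Longrightarrow> B x y = 0"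
  and B_nondeg: "x \<in> space_of G \<Longrightarrow> (\<And>y. y \<in> space_of G \<Longrightarrow> B x y = 0) \<Longrightarrow> x = 0"
  using form unfolding invariant_form_def by blast+

lemma chi_add: "z \<in> space_of G \<Longrightarrow> z' \<in> space_of G \<Longrightarrow> chi (z + z') = chi z + chi z'"
  by (simp add: chi_eq space_closed B_linear X_space)

lemma chi_scale: "z \<in> space_of G \<Longrightarrow> chi (scl G c z) = c * chi z"
  using B_linear(4)[OF X_space _ X_space] by (simp add: chi_eq space_closed)

lemma chi_odd: "z \<in> part G True \<Longrightarrow> chi z = 0"
  using B_odd[OF X_even, of z True] part_space[of True] by (auto simp: chi_eq)

text \<open>Invariance moves the bracket, \<open>chi (brk G z u) = B (brk G X z) u\<close>, and the
  form is nondegenerate.\<close>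

lemma centralizes_X: "z \<in> space_of G \<Longrightarrow> (\<And>u. u \<in> space_of G \<Longrightarrow> chi (brk G z u) = 0) \<Longrightarrow> brk G X z = 0"
  by (rule B_nondeg) (simp_all add: B_linear X_space brk_space flip: chi_eq)

lemma two_ne_0: "(2::'k) \<noteq> 0"
proof
  assume "(2::'k) = 0"
  then have "of_nat 2 = (0::'k)" by simp
  then have "CHAR('k) dvd 2" by (simp only: of_nat_eq_0_iff_char_dvd)
  then show False using char by (auto dest: dvd_imp_le)
qed

text \<open>Invariance of the form under \<open>T\<close>: the orthogonality of weight spaces whose
  weights are not opposite.\<close>

lemma B_weight:
  assumes T: "T \<in> part G False" and xy: "x \<in> part G False" "y \<in> part G False"
    and "brk G T x = scl G a x" "brk G T y = scl G b y"
  shows "(a + b) * B x y = 0"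
proof -
  have sp: "T \<in> space_of G" "x \<in> space_of G" "y \<in> space_of G" using T xy part_space by blast+
  have "brk G x T = - scl G (ksign False False) (brk G T x)" using xy(1) T by (rule brk_skew)
  then have "brk G x T = - scl G 1 (brk G T x)" unfolding ksign_def by simp
  then have xT: "brk G x T = scl G (- a) x" using assms(4) by simp
  have "B (brk G x T) y = B x (brk G T y)" by (rule B_linear(5)[OF sp(2,1,3)])
  then have "(- a) * B x y = b * B x y"
    unfolding xT assms(5) B_linear(3)[OF sp(2,3,3)] B_linear(4)[OF sp(2,3,3)] .
  then have "a * B x y + b * B x y = 0" by (simp flip: eq_neg_iff_add_eq_0) (metis minus_minus)
  then show ?thesis by (simp add: distrib_right)
qed

text \<open>By invariance the value is \<open>B (brk G X X) z\<close>, and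
  \<open>brk G X X = 0\<close> because 2 is invertible.\<close>

lemma chi_brk_X: "z \<in> part G False \<Longrightarrow> chi (brk G X z) = 0"
proof -
  assume z: "z \<in> part G False"
  have zs: "z \<in> space_of G" using z part_space by blast
  have "brk G X X = - scl G (ksign False False) (brk G X X)" by (rule brk_skew[OF X_even X_even])
  then have "brk G X X + brk G X X = 0" unfolding ksign_def by (simp add: eq_neg_iff_add_eq_0)
  then have "scl G 2 (brk G X X) = 0" using g.scale_left_distrib[of 1 1 "brk G X X"] by simp
  then have XX: "brk G X X = 0" using two_ne_0 by simp
  have "B X (brk G X z) = B (brk G X X) z" using B_linear(5)[OF X_space X_space zs] by simp
  also have "\<dots> = B (scl G 0 X) z" unfolding XX by simp
  also have "\<dots> = 0" unfolding B_linear(3)[OF X_space zs zs] by simp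
  finally show ?thesis using brk_space[OF X_space zs] by (simp add: chi_eq)
qed

end

context graded_basis
begin

definition hcomp :: "int \<Rightarrow> ('v \<Rightarrow> 'v) \<Rightarrow> 'v \<Rightarrow> 'v" where "hcomp k f v = (\<Sum>l\<in>Dg. pr (l + k) (f (pr l v)))"

definition shifts :: "int set" where "shifts = (\<lambda>(a, b). a - b) ` (Dg \<times> Dg)"

lemma finite_shifts: "finite shifts" unfolding shifts_def using Eb(1) by simp

lemma comp_lin: "lin f \<Longrightarrow> lin (hcomp k f)"
  unfolding hcomp_def using lin_comp[OF pr_lin lin_comp[OF _ pr_lin]] by (intro lin_setsum)

lemma comp_basis: "lin f \<Longrightarrow> b \<in> Eb \<Longrightarrow> hcomp k f b = pr (dg b + k) (f b)"
proof -
  assume f: "lin f" and b: "b \<in> Eb"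
  have "hcomp k f b = (\<Sum>l\<in>Dg. if l = dg b then pr (dg b + k) (f b) else 0)"
    unfolding hcomp_def using b by (intro sum.cong) (auto simp: pr_basis linD(5)[OF f] linD(5)[OF pr_lin])
  then show ?thesis using b Eb(1) by simp
qed

lemma comp_deg: "lin f \<Longrightarrow> deg (hcomp k f) k"
  by (rule degI[OF comp_lin]) (auto simp: comp_basis pr_Vk)

lemma comp_sum:
  assumes "lin f" "finite K" "shifts \<subseteq> K"
  shows "f = (\<lambda>v. \<Sum>k\<in>K. hcomp k f v)"
proof (rule lin_eqI[OF assms(1) lin_setsum[OF comp_lin[OF assms(1)]]])
  fix b assume b: "b \<in> Eb"
  have "(\<Sum>k\<in>K. hcomp k f b) = (\<Sum>k\<in>K. pr (dg b + k) (f b))" using comp_basis[OF assms(1) b] by simp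
  also have "\<dots> = (\<Sum>j\<in>(\<lambda>k. dg b + k) ` K. pr j (f b))" by (subst sum.reindex) (auto simp: inj_on_def)
  also have "\<dots> = f b"
  proof (rule pr_sum)
    show "Dg \<subseteq> (\<lambda>k. dg b + k) ` K"
    proof
      fix j assume "j \<in> Dg"
      then have "j - dg b \<in> K" using b
        by (intro subsetD[OF assms(3)]) (force simp: shifts_def)
      then show "j \<in> (\<lambda>k. dg b + k) ` K" by (intro image_eqI[of _ _ "j - dg b"]) auto
    qed
  qed (use assms b linD(7)[OF assms(1)] in auto)
  finally show "f b = (\<Sum>k\<in>K. hcomp k f b)" by simp
qed

text \<open>The block from \<open>l\<close> to \<open>l + k\<close> is paired with its transpose
  from \<open>- (l + k)\<close> to \<open>- l\<close>, so every block is counted twice; hence the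
  factor 2. Unlike single blocks, these sums stay inside the ortho-symplectic superalgebras.\<close>

lemma comp_pieces:
  assumes "lin f"
  shows "\<exists>D. finite D \<and> (\<forall>v. s 2 (hcomp k f v) =
     (\<Sum>l\<in>D. pr (l + k) (f (pr l v)) + pr (- l) (f (pr (- (l + k)) v))))"
proof -
  \<comment> \<open>The index set is made stable under the involution sending \<open>l\<close> to
    \<open>- (l + k)\<close>.\<close>
  define D where "D = Dg \<union> (\<lambda>l. - (l + k)) ` Dg"
  have D: "finite D" "Dg \<subseteq> D" unfolding D_def using Eb(1) by auto
  have bij: "bij_betw (\<lambda>l. - (l + k)) D D"
    by (rule bij_betwI[of _ _ _ "\<lambda>l. - (l + k)"]) (auto simp: D_def image_iff)
  have "s 2 (hcomp k f v) = (\<Sum>l\<in>D. pr (l + k) (f (pr l v)) + pr (- l) (f (pr (- (l + k)) v)))" for v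
  proof -
    have 1: "hcomp k f v = (\<Sum>l\<in>D. pr (l + k) (f (pr l v)))"
      unfolding hcomp_def using D pr_zero linD(5)[OF assms] linD(5)[OF pr_lin]
      by (intro sum.mono_neutral_left) auto
    also have "\<dots> = (\<Sum>l\<in>D. pr (- (l + k) + k) (f (pr (- (l + k)) v)))"
      by (rule sum.reindex_bij_betw[OF bij, symmetric])
    finally have 2: "hcomp k f v = (\<Sum>l\<in>D. pr (- l) (f (pr (- (l + k)) v)))" by simp
    have "s 2 (hcomp k f v) = hcomp k f v + hcomp k f v"
      using scale_left_distrib[of 1 1] by simp
    then show ?thesis using 1 2 by (simp add: sum.distrib)
  qed
  then show ?thesis using D(1) by blast
qed

end

text \<open>
  In the axiom on \<open>f\<close>, a block and its transpose with respect to the pairing of \<open>Vk j\<close> and \<open>Vk (- j)\<close> are kept together,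
  which makes it true for the ortho-symplectic superalgebras. Degree \<open>2\<close> is excluded in the last axiom because
  the supertrace of a solution of degree \<open>0\<close> need not vanish.
\<close>

locale classical = jordan_graded s V Eb dg N r w lam + formed_superalgebra G B X chi
  for s :: "'k::field \<Rightarrow> 'v::ab_group_add \<Rightarrow> 'v" and V Eb dg N r w lam
    and G :: "('k, 'g::ab_group_add) lsuper" and B X chi +
  fixes L :: "bool \<Rightarrow> ('v \<Rightarrow> 'v) set" and \<Phi> :: "'g \<Rightarrow> 'v \<Rightarrow> 'v"
  assumes real: "linear_realization G s L \<Phi>"
    and L_gl: "L a \<subseteq> gl_part s V a"
    and \<Phi>_X: "\<Phi> X = N"
    and piece: "f \<in> L q \<Longrightarrow> i \<noteq> j \<Longrightarrow> (\<lambda>v. pr i (f (pr j v)) + pr (- j) (f (pr (- i) v))) \<in> L q"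
    and torus: "(\<And>k. c (- k) = - c k) \<Longrightarrow> \<exists>T\<in>L False. \<exists>t. \<forall>l. \<forall>v\<in>Vk l. T v = s (c l + t) v"
    and surjective: "y \<in> L False \<Longrightarrow> deg y l \<Longrightarrow> l \<ge> 1 \<Longrightarrow> l \<noteq> 2 \<Longrightarrow> \<exists>z\<in>L False. \<forall>v. N (z v) - z (N v) = y v"
begin

definition gr :: "int \<Rightarrow> 'g set" where "gr k = {z \<in> space_of G. deg (\<Phi> z) k}"

lemma gr_eq: "gr = shift_grading G \<Phi> Vk"
  unfolding gr_def shift_grading_def deg_def by simp

lemma \<Phi>_add: "x \<in> space_of G \<Longrightarrow> y \<in> space_of G \<Longrightarrow> \<Phi> (x + y) = (\<lambda>v. \<Phi> x v + \<Phi> y v)"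
  and \<Phi>_scale: "x \<in> space_of G \<Longrightarrow> \<Phi> (scl G c x) = (\<lambda>v. s c (\<Phi> x v))"
  and \<Phi>_brk: "x \<in> part G a \<Longrightarrow> y \<in> part G b \<Longrightarrow>
     \<Phi> (brk G x y) = (\<lambda>v. \<Phi> x (\<Phi> y v) - s (ksign a b) (\<Phi> y (\<Phi> x v)))"
  and \<Phi>_ppow: "x \<in> part G False \<Longrightarrow> \<Phi> (ppow G x) = \<Phi> x ^^ CHAR('k)"
  and \<Phi>_inj: "inj_on \<Phi> (space_of G)"
  and \<Phi>_part: "\<Phi> ` part G a = L a"
  using real unfolding linear_realization_def bij_betw_def plus_fun_def by blast+

lemma \<Phi>_L: "x \<in> part G a \<Longrightarrow> \<Phi> x \<in> L a" using \<Phi>_part by blast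

lemma L_obtain: "f \<in> L a \<Longrightarrow> \<exists>x\<in>part G a. \<Phi> x = f" unfolding \<Phi>_part[symmetric] by blast

lemma \<Phi>_zero: "\<Phi> 0 = (\<lambda>v. 0)" using \<Phi>_scale[OF space_closed(1), of 0] by simp

lemma \<Phi>_sum: "(\<And>j. j \<in> S \<Longrightarrow> x j \<in> space_of G) \<Longrightarrow> \<Phi> (\<Sum>j\<in>S. x j) = (\<lambda>v. \<Sum>j\<in>S. \<Phi> (x j) v)"
proof (induction S rule: infinite_finite_induct)
  case (insert j S)
  then have "(\<Sum>j\<in>S. x j) \<in> space_of G" by (intro g.subspace_sum[OF space_sub]) auto
  then show ?case using insert \<Phi>_add[of "x j"] by simp
qed (simp_all add: \<Phi>_zero)

lemma \<Phi>_eq_zero: "x \<in> space_of G \<Longrightarrow> \<Phi> x = (\<lambda>v. 0) \<Longrightarrow> x = 0"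
  using \<Phi>_inj space_closed(1) \<Phi>_zero unfolding inj_on_def by metis

lemma L_lin: "f \<in> L a \<Longrightarrow> lin f" using L_gl gl_part_iff by blast

lemma \<Phi>_lin: "x \<in> space_of G \<Longrightarrow> lin (\<Phi> x)"
proof -
  assume "x \<in> space_of G"
  then obtain u v where uv: "u \<in> part G False" "v \<in> part G True" "x = u + v" using space_split by blast
  then have "\<Phi> x = (\<lambda>t. \<Phi> u t + \<Phi> v t)" using \<Phi>_add part_space by blast
  moreover have "lin (\<lambda>t. \<Phi> u t + \<Phi> v t)" by (rule lin_add[OF L_lin[OF \<Phi>_L[OF uv(1)]] L_lin[OF \<Phi>_L[OF uv(2)]]])
  ultimately show ?thesis by simp
qed

lemma L_closed:
  "(\<lambda>v. 0) \<in> L a" "f \<in> L a \<Longrightarrow> g \<in> L a \<Longrightarrow> (\<lambda>v. f v + g v) \<in> L a" "f \<in> L a \<Longrightarrow> (\<lambda>v. s c (f v)) \<in> L a"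
proof -
  show "(\<lambda>v. 0) \<in> L a" using \<Phi>_L[OF g.subspace_0[OF part_sub]] \<Phi>_zero by simp
  show "(\<lambda>v. f v + g v) \<in> L a" if h: "f \<in> L a" "g \<in> L a"
  proof -
    obtain x y where xy: "x \<in> part G a" "\<Phi> x = f" "y \<in> part G a" "\<Phi> y = g" using L_obtain h by metis
    have "\<Phi> (x + y) = (\<lambda>v. f v + g v)" using \<Phi>_add[of x y] xy part_space by blast
    then show ?thesis using \<Phi>_L[OF g.subspace_add[OF part_sub xy(1,3)]] by simp
  qed
  show "(\<lambda>v. s c (f v)) \<in> L a" if h: "f \<in> L a"
  proof -
    obtain x where x: "x \<in> part G a" "\<Phi> x = f" using L_obtain h by metis
    have "\<Phi> (scl G c x) = (\<lambda>v. s c (f v))" using \<Phi>_scale[of x] x part_space by blast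
    then show ?thesis using \<Phi>_L[OF g.subspace_scale[OF part_sub x(1)]] by metis
  qed
qed

lemma L_sum: "(\<And>j. j \<in> S \<Longrightarrow> f j \<in> L a) \<Longrightarrow> (\<lambda>v. \<Sum>j\<in>S. f j v) \<in> L a"
  by (induction S rule: infinite_finite_induct) (simp_all add: L_closed)

text \<open>Components of nonzero degree are halves of sums of pieces. As \<open>piece\<close>
  excludes \<open>i = j\<close>, the component of degree 0 is obtained by subtracting all the others
  from \<open>f\<close>.\<close>

lemma comp_L: "f \<in> L a \<Longrightarrow> hcomp k f \<in> L a"
proof -
  assume f: "f \<in> L a"
  have nz: "hcomp k f \<in> L a" if "k \<noteq> 0" for k
  proof -
    obtain D where D: "finite D" "\<And>v. s 2 (hcomp k f v) =
       (\<Sum>l\<in>D. pr (l + k) (f (pr l v)) + pr (- l) (f (pr (- (l + k)) v)))"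
      using comp_pieces[OF L_lin[OF f]] by blast
    have "(\<lambda>v. \<Sum>l\<in>D. pr (l + k) (f (pr l v)) + pr (- l) (f (pr (- (l + k)) v))) \<in> L a"
      using that by (intro L_sum piece[OF f]) simp
    then have "(\<lambda>v. s (1 / 2) (s 2 (hcomp k f v))) \<in> L a" unfolding D(2) by (rule L_closed(3))
    then show ?thesis using two_ne_0 by simp
  qed
  show ?thesis
  proof (cases "k = 0")
    case True
    define K where "K = shifts \<union> {0}"
    have K: "finite K" "0 \<in> K" unfolding K_def using finite_shifts by auto
    have "f = (\<lambda>v. \<Sum>k\<in>K. hcomp k f v)" unfolding K_def using finite_shifts by (intro comp_sum L_lin[OF f]) auto
    also have "\<dots> = (\<lambda>v. hcomp 0 f v + (\<Sum>k\<in>K - {0}. hcomp k f v))" by (intro ext sum.remove[OF K])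
    finally have fe: "f v = hcomp 0 f v + (\<Sum>k\<in>K - {0}. hcomp k f v)" for v by (simp add: fun_eq_iff)
    have "(\<lambda>v. \<Sum>k\<in>K - {0}. hcomp k f v) \<in> L a" by (intro L_sum nz) auto
    then have "(\<lambda>v. f v + s (- 1) (\<Sum>k\<in>K - {0}. hcomp k f v)) \<in> L a" by (intro L_closed(2,3) f)
    moreover have "(\<lambda>v. f v + s (- 1) (\<Sum>k\<in>K - {0}. hcomp k f v)) = hcomp k f" unfolding True by (simp add: fun_eq_iff fe)
    ultimately show ?thesis by simp
  qed (rule nz)
qed

lemma homogeneous_component:
  assumes "z \<in> part G a"
  shows "\<exists>u\<in>gr k \<inter> part G a. \<Phi> u = hcomp k (\<Phi> z)"
proof -
  obtain u where u: "u \<in> part G a" "\<Phi> u = hcomp k (\<Phi> z)" using L_obtain[OF comp_L[OF \<Phi>_L[OF assms]]] by blast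
  then have "u \<in> gr k"
    unfolding gr_def using comp_deg[OF L_lin[OF \<Phi>_L[OF assms]], of k] part_space by auto
  then show ?thesis using u by blast
qed

lemma gr_space: "gr k \<subseteq> space_of G" unfolding gr_def by blast

lemma gr_sub: "g.subspace (gr k)"
proof (rule g.subspaceI)
  show "0 \<in> gr k" unfolding gr_def deg_def using space_closed(1) \<Phi>_zero subspace_0[OF Vk_sub] by auto
  show "x + y \<in> gr k" if h: "x \<in> gr k" "y \<in> gr k" for x y
  proof -
    have "x \<in> space_of G" "y \<in> space_of G" using h gr_space by blast+
    then show ?thesis using h space_closed(2) unfolding gr_def deg_def
      by (auto simp: \<Phi>_add image_subset_iff intro!: subspace_add[OF Vk_sub])
  qed
  show "scl G c x \<in> gr k" if h: "x \<in> gr k" for c x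
  proof -
    have "x \<in> space_of G" using h gr_space by blast
    then show ?thesis using h space_closed(4) unfolding gr_def deg_def
      by (auto simp: \<Phi>_scale image_subset_iff intro!: subspace_scale[OF Vk_sub])
  qed
qed

lemma gr_par: "gr k = total (\<lambda>a. gr k \<inter> part G a)"
proof
  show "total (\<lambda>a. gr k \<inter> part G a) \<subseteq> gr k" unfolding total_def using g.subspace_add[OF gr_sub] by auto
  show "gr k \<subseteq> total (\<lambda>a. gr k \<inter> part G a)"
  proof
    fix z assume z: "z \<in> gr k"
    then have zs: "z \<in> space_of G" using gr_space by blast
    then obtain u v where uv: "u \<in> part G False" "v \<in> part G True" "z = u + v" using space_split by blast
    obtain u' v' where u': "u' \<in> gr k \<inter> part G False" "\<Phi> u' = hcomp k (\<Phi> u)"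
      and v': "v' \<in> gr k \<inter> part G True" "\<Phi> v' = hcomp k (\<Phi> v)" using homogeneous_component uv by meson
    have sp: "u \<in> space_of G" "v \<in> space_of G" "u' \<in> space_of G" "v' \<in> space_of G" using uv u' v' part_space by blast+
    have "\<Phi> z = \<Phi> (u' + v')"
    proof (rule lin_eqI[OF \<Phi>_lin[OF zs] \<Phi>_lin[OF space_closed(2)[OF sp(3,4)]]])
      fix b assume b: "b \<in> Eb"
      have "\<Phi> z b \<in> Vk (dg b + k)" using z Vk_basis[OF b] degD unfolding gr_def by blast
      then have "\<Phi> z b = pr (dg b + k) (\<Phi> z b)" using pr_on_Vk by simp
      also have "\<dots> = pr (dg b + k) (\<Phi> u b) + pr (dg b + k) (\<Phi> v b)"
        using linD(7)[OF \<Phi>_lin] sp by (simp add: uv(3) \<Phi>_add linD(1)[OF pr_lin])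
      finally show "\<Phi> z b = \<Phi> (u' + v') b"
        using comp_basis[OF \<Phi>_lin b] sp by (simp add: \<Phi>_add u' v')
    qed
    then have "z = u' + v'" using \<Phi>_inj zs space_closed(2)[OF sp(3,4)] unfolding inj_on_def by blast
    then show "z \<in> total (\<lambda>a. gr k \<inter> part G a)" unfolding total_def using u' v' by blast
  qed
qed

lemma component_unique:
  assumes "\<And>k. c k \<in> gr k" "finite K" "{k. c k \<noteq> 0} \<subseteq> K" "b \<in> Eb"
  shows "\<Phi> (c k) b = pr (dg b + k) (\<Phi> (\<Sum>k | c k \<noteq> 0. c k) b)"
proof -
  have sp: "c k \<in> space_of G" for k using assms(1) gr_space by blast
  have "(\<Sum>k | c k \<noteq> 0. c k) = (\<Sum>k\<in>insert k K. c k)" using assms(2,3) by (intro sum.mono_neutral_left) auto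
  then have "\<Phi> (\<Sum>k | c k \<noteq> 0. c k) b = (\<Sum>k\<in>insert k K. \<Phi> (c k) b)" using \<Phi>_sum[of "insert k K" c] sp by simp
  moreover have "pr (dg b + k) (\<Sum>k\<in>insert k K. \<Phi> (c k) b) = \<Phi> (c k) b"
    using assms(1,2) sp by (intro deg_unique \<Phi>_lin assms(4)) (auto simp: gr_def)
  ultimately show ?thesis by simp
qed

lemma ds: "direct_sum (space_of G) gr"
  unfolding direct_sum_def
proof (intro conjI allI ballI gr_space)
  fix z assume z: "z \<in> space_of G"
  then obtain u v where uv: "u \<in> part G False" "v \<in> part G True" "z = u + v" using space_split by blast
  have "\<exists>f. \<forall>k. f k \<in> gr k \<and> \<Phi> (f k) = hcomp k (\<Phi> x)" if "x \<in> part G a" for x a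
    using homogeneous_component[OF that] by (intro choice) blast
  then obtain f g where f: "\<And>k. f k \<in> gr k" "\<And>k. \<Phi> (f k) = hcomp k (\<Phi> u)"
    and g: "\<And>k. g k \<in> gr k" "\<And>k. \<Phi> (g k) = hcomp k (\<Phi> v)" using uv(1,2) by meson
  have sp: "u \<in> space_of G" "v \<in> space_of G" "f k \<in> space_of G" "g k \<in> space_of G" for k
    using uv part_space f(1) g(1) gr_space by blast+
  define c where "c k = (if k \<in> shifts then f k + g k else 0)" for k
  have cg: "c k \<in> gr k" for k
    unfolding c_def using g.subspace_add[OF gr_sub f(1) g(1)] g.subspace_0[OF gr_sub] by simp
  have fc: "{k. c k \<noteq> 0} \<subseteq> shifts" unfolding c_def by auto
  have "\<Phi> z = \<Phi> (\<Sum>k\<in>shifts. c k)"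
  proof
    fix t
    have "\<Phi> z t = (\<Sum>k\<in>shifts. hcomp k (\<Phi> u) t) + (\<Sum>k\<in>shifts. hcomp k (\<Phi> v) t)"
      using comp_sum[OF \<Phi>_lin finite_shifts order_refl] sp(1,2) by (simp add: uv(3) \<Phi>_add fun_eq_iff)
    also have "\<dots> = (\<Sum>k\<in>shifts. \<Phi> (c k) t)"
      unfolding sum.distrib[symmetric] using sp f(2) g(2) by (intro sum.cong) (auto simp: c_def \<Phi>_add)
    also have "\<dots> = \<Phi> (\<Sum>k\<in>shifts. c k) t" using \<Phi>_sum[of shifts c] subsetD[OF gr_space cg] by simp
    finally show "\<Phi> z t = \<Phi> (\<Sum>k\<in>shifts. c k) t" .
  qed
  then have "z = (\<Sum>k\<in>shifts. c k)"
    using \<Phi>_inj z g.subspace_sum[OF space_sub, of shifts c] cg gr_space unfolding inj_on_def by blast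
  also have "\<dots> = (\<Sum>k | c k \<noteq> 0. c k)" using fc finite_shifts by (intro sum.mono_neutral_right) auto
  finally have zc: "z = (\<Sum>k | c k \<noteq> 0. c k)" .
  show "\<exists>!c. (\<forall>k. c k \<in> gr k) \<and> finite {k. c k \<noteq> 0} \<and> z = (\<Sum>k | c k \<noteq> 0. c k)"
  proof (rule ex1I[of _ c])
    show "(\<forall>k. c k \<in> gr k) \<and> finite {k. c k \<noteq> 0} \<and> z = (\<Sum>k | c k \<noteq> 0. c k)"
      using cg zc finite_subset[OF fc finite_shifts] by blast
    fix d assume d: "(\<forall>k. d k \<in> gr k) \<and> finite {k. d k \<noteq> 0} \<and> z = (\<Sum>k | d k \<noteq> 0. d k)"
    show "d = c"
    proof
      fix k
      have "\<Phi> (d k) = \<Phi> (c k)"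
      proof (rule lin_eqI)
        fix b assume b: "b \<in> Eb"
        have "\<Phi> (d k) b = pr (dg b + k) (\<Phi> z b)" using component_unique[of d "{k. d k \<noteq> 0}" b k] d b by auto
        also have "\<dots> = \<Phi> (c k) b" using component_unique[OF cg finite_shifts fc b, of k] zc by auto
        finally show "\<Phi> (d k) b = \<Phi> (c k) b" .
      qed (use d cg gr_space \<Phi>_lin in blast)+
      then show "d k = c k" using \<Phi>_inj d cg gr_space unfolding inj_on_def by blast
    qed
  qed
qed

lemma gr_degree: "z \<in> gr k \<Longrightarrow> deg (\<Phi> z) k" unfolding gr_def by blast

lemma br_gr:
  assumes "x \<in> gr k" "y \<in> gr l"
  shows "brk G x y \<in> gr (k + l)"
proof -
  have hom: "brk G u v \<in> gr (k + l)" if h: "u \<in> gr k" "u \<in> part G a" "v \<in> gr l" "v \<in> part G b" for u v a b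
  proof -
    have "\<Phi> u (\<Phi> v t) - s (ksign a b) (\<Phi> v (\<Phi> u t)) \<in> Vk (i + (k + l))" if t: "t \<in> Vk i" for t i
    proof -
      have "\<Phi> u (\<Phi> v t) \<in> Vk (i + l + k)" "\<Phi> v (\<Phi> u t) \<in> Vk (i + k + l)"
        using degD[OF gr_degree[OF h(1)]] degD[OF gr_degree[OF h(3)]] t by blast+
      then show ?thesis
        by (intro subspace_diff[OF Vk_sub] subspace_scale[OF Vk_sub]) (simp_all add: algebra_simps)
    qed
    then have "deg (\<Phi> (brk G u v)) (k + l)" unfolding deg_def \<Phi>_brk[OF h(2,4)] by blast
    moreover have "brk G u v \<in> space_of G" using h gr_space brk_space by blast
    ultimately show ?thesis unfolding gr_def by blast
  qed
  obtain x0 x1 where x: "x0 \<in> gr k" "x0 \<in> part G False" "x1 \<in> gr k" "x1 \<in> part G True" "x = x0 + x1"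
    using assms(1) gr_par unfolding total_def by blast
  obtain y0 y1 where y: "y0 \<in> gr l" "y0 \<in> part G False" "y1 \<in> gr l" "y1 \<in> part G True" "y = y0 + y1"
    using assms(2) gr_par unfolding total_def by blast
  have sp: "x0 \<in> space_of G" "x1 \<in> space_of G" "y0 \<in> space_of G" "y1 \<in> space_of G" using x y part_space by blast+
  have "brk G x y = brk G x0 y0 + brk G x0 y1 + (brk G x1 y0 + brk G x1 y1)"
    unfolding x(5) y(5) using sp by (simp add: brk_linear space_closed)
  then show ?thesis
    using hom x y by (metis g.subspace_add[OF gr_sub])
qed

text \<open>By invariance \<open>z\<close> commutes with \<open>X\<close>. Since \<open>X\<close> is
  even, no sign arises for the odd part of \<open>z\<close>, and \<open>commute_zero\<close> applies
  to the whole operator.\<close>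

lemma nondeg:
  assumes "z \<in> gr k" "k < 0" "\<And>u. u \<in> space_of G \<Longrightarrow> chi (brk G z u) = 0"
  shows "z = 0"
proof -
  have zs: "z \<in> space_of G" using assms(1) gr_space by blast
  obtain z0 z1 where z: "z0 \<in> part G False" "z1 \<in> part G True" "z = z0 + z1" using space_split[OF zs] by blast
  have sp: "z0 \<in> space_of G" "z1 \<in> space_of G" using z part_space by blast+
  have "brk G X z = 0" by (rule centralizes_X[OF zs assms(3)])
  then have "brk G X z0 + brk G X z1 = 0" using brk_linear(2)[OF X_space sp] z(3) by simp
  then have "\<Phi> (brk G X z0 + brk G X z1) = (\<lambda>v. 0)" using \<Phi>_zero by simp
  then have "(\<lambda>v. (N (\<Phi> z0 v) - \<Phi> z0 (N v)) + (N (\<Phi> z1 v) - \<Phi> z1 (N v))) = (\<lambda>v. 0)"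
    unfolding \<Phi>_add[OF brk_space[OF X_space sp(1)] brk_space[OF X_space sp(2)]] \<Phi>_brk[OF X_even z(1)] \<Phi>_brk[OF X_even z(2)] \<Phi>_X
    by (simp add: ksign_def)
  then have e: "(N (\<Phi> z0 v) - \<Phi> z0 (N v)) + (N (\<Phi> z1 v) - \<Phi> z1 (N v)) = 0" for v by meson
  have "N (\<Phi> z v) = \<Phi> z (N v)" if "v \<in> VV" for v
    using e[of v] linD(1)[OF N_lin] linD(7)[OF \<Phi>_lin] sp by (simp add: z(3) \<Phi>_add algebra_simps)
  then have "\<Phi> z = (\<lambda>v. 0)" using commute_zero[OF \<Phi>_lin[OF zs] gr_degree[OF assms(1)] assms(2)] by blast
  then show ?thesis by (rule \<Phi>_eq_zero[OF zs])
qed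

text \<open>The operator of \<open>T\<close> is scalar on each \<open>Vk l\<close>, so its
  commutator multiplies a map from \<open>Vk l\<close> to \<open>Vk m\<close> by
  \<open>c m - c l\<close>; the common shift \<open>t\<close> drops out.\<close>

lemma torus_weight:
  assumes c: "\<And>k. c (- k) = - c k"
  shows "\<exists>T\<in>part G False. \<forall>y\<in>part G False. \<forall>a. (\<forall>l. \<forall>v\<in>Vk l. \<Phi> y v \<noteq> 0 \<longrightarrow> (\<exists>m. \<Phi> y v \<in> Vk m \<and> c m - c l = a))
     \<longrightarrow> brk G T y = scl G a y"
proof -
  obtain h t where h: "h \<in> L False" "\<And>l v. v \<in> Vk l \<Longrightarrow> h v = s (c l + t) v" using torus[of c, OF c] by blast
  obtain T where T: "T \<in> part G False" "\<Phi> T = h" using L_obtain[OF h(1)] by blast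
  have "brk G T y = scl G a y"
    if y: "y \<in> part G False" and a: "\<And>l v. v \<in> Vk l \<Longrightarrow> \<Phi> y v \<noteq> 0 \<Longrightarrow> \<exists>m. \<Phi> y v \<in> Vk m \<and> c m - c l = a" for y a
  proof -
    have sp: "y \<in> space_of G" "T \<in> space_of G" using y T part_space by blast+
    have yl: "lin (\<Phi> y)" by (rule \<Phi>_lin[OF sp(1)])
    have "\<Phi> (brk G T y) = \<Phi> (scl G a y)"
    proof (rule lin_eqI)
      fix b assume b: "b \<in> Eb"
      have bV: "b \<in> VV" using Eb_VV[OF b] .
      have "\<Phi> (brk G T y) b = h (\<Phi> y b) - \<Phi> y (s (c (dg b) + t) b)"
        unfolding \<Phi>_brk[OF T(1) y] T(2) h(2)[OF Vk_basis[OF b]] by (simp add: ksign_def)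
      also have "\<dots> = h (\<Phi> y b) - s (c (dg b) + t) (\<Phi> y b)" using linD(2)[OF yl bV] by simp
      also have "\<dots> = s a (\<Phi> y b)"
      proof (cases "\<Phi> y b = 0")
        case True then show ?thesis using linD(5)[OF L_lin[OF h(1)]] by simp
      next
        case False
        then obtain m where m: "\<Phi> y b \<in> Vk m" "c m - c (dg b) = a" using a[OF Vk_basis[OF b]] by blast
        show ?thesis unfolding h(2)[OF m(1)] m(2)[symmetric] by (simp flip: scale_left_diff_distrib)
      qed
      finally show "\<Phi> (brk G T y) b = \<Phi> (scl G a y) b" by (simp add: \<Phi>_scale[OF sp(1)])
    qed (intro \<Phi>_lin brk_space space_closed(4) sp)+
    then show ?thesis using \<Phi>_inj sp brk_space space_closed(4) unfolding inj_on_def by blast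
  qed
  then show ?thesis using T(1) by blast
qed

lemma weight_orthogonal:
  fixes c :: "int \<Rightarrow> 'k"
  assumes c: "\<And>k. c (- k) = - c k" and xy: "x \<in> part G False" "y \<in> part G False"
    and a: "\<And>l v. v \<in> Vk l \<Longrightarrow> \<Phi> x v \<noteq> 0 \<Longrightarrow> \<exists>m. \<Phi> x v \<in> Vk m \<and> c m - c l = a"
    and b: "\<And>l v. v \<in> Vk l \<Longrightarrow> \<Phi> y v \<noteq> 0 \<Longrightarrow> \<exists>m. \<Phi> y v \<in> Vk m \<and> c m - c l = b"
    and "a + b \<noteq> 0"
  shows "B x y = 0"
proof -
  obtain T where T: "T \<in> part G False" "\<And>y a. y \<in> part G False \<Longrightarrow>
     (\<And>l v. v \<in> Vk l \<Longrightarrow> \<Phi> y v \<noteq> 0 \<Longrightarrow> \<exists>m. \<Phi> y v \<in> Vk m \<and> c m - c l = a) \<Longrightarrow> brk G T y = scl G a y"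
    using torus_weight[of c] c by metis
  have "brk G T x = scl G a x" "brk G T y = scl G b y" using T(2)[OF xy(1) a] T(2)[OF xy(2) b] by blast+
  then have "(a + b) * B x y = 0" by (rule B_weight[OF T(1) xy])
  then show ?thesis using assms(6) by simp
qed

text \<open>Since \<open>c\<close> is an odd function, the block from \<open>j\<close> to
  \<open>i\<close> and the block from \<open>- i\<close> to \<open>- j\<close> have the same
  weight.\<close>

lemma piece_weight:
  fixes c :: "int \<Rightarrow> 'k"
  assumes c: "\<And>k. c (- k) = - c k" and f: "lin f" and v: "v \<in> Vk l"
    and nz: "pr i (f (pr j v)) + pr (- j) (f (pr (- i) v)) \<noteq> 0"
  shows "\<exists>m. pr i (f (pr j v)) + pr (- j) (f (pr (- i) v)) \<in> Vk m \<and> c m - c l = c i - c j"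
proof -
  have 1: "pr i (f (pr j v)) = (if l = j then pr i (f v) else 0)"
    using pr_on_Vk[OF v] by (auto simp: linD(5)[OF f] linD(5)[OF pr_lin])
  have 2: "pr (- j) (f (pr (- i) v)) = (if l = - i then pr (- j) (f v) else 0)"
    using pr_on_Vk[OF v] by (auto simp: linD(5)[OF f] linD(5)[OF pr_lin])
  consider "l = j" "l \<noteq> - i" | "l \<noteq> j" "l = - i" | "l = j" "l = - i" using nz unfolding 1 2 by (auto split: if_splits)
  then show ?thesis
  proof cases
    case 1
    then show ?thesis unfolding \<open>pr i (f (pr j v)) = _\<close> 2 using pr_Vk by (intro exI[of _ i]) auto
  next
    case 2
    then show ?thesis unfolding 1 \<open>pr (- j) (f (pr (- i) v)) = _\<close> using pr_Vk[of "- j"] c by (intro exI[of _ "- j"]) auto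
  next
    case 3
    then have "- j = i" by simp
    then show ?thesis unfolding 1 2 using 3 pr_Vk[of i] by (intro exI[of _ i]) (auto intro: subspace_add[OF Vk_sub])
  qed
qed

lemma piece_decomposition:
  assumes y: "y \<in> part G False" "y \<in> gr k" "k \<noteq> 0"
  shows "\<exists>D u. finite D \<and> (\<forall>i. u i \<in> part G False) \<and> scl G 2 y = (\<Sum>i\<in>D. u i) \<and>
    (\<forall>i. \<Phi> (u i) = (\<lambda>v. pr (i + k) (\<Phi> y (pr i v)) + pr (- i) (\<Phi> y (pr (- (i + k)) v))))"
proof -
  define P where "P i = (\<lambda>v. pr (i + k) (\<Phi> y (pr i v)) + pr (- i) (\<Phi> y (pr (- (i + k)) v)))" for i
  have ys: "y \<in> space_of G" using y part_space by blast
  have "\<exists>x. x \<in> part G False \<and> \<Phi> x = P i" for i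
    unfolding P_def using L_obtain[OF piece[OF \<Phi>_L[OF y(1)], of "i + k" i]] y(3) by auto
  then obtain u where u: "\<And>i. u i \<in> part G False" "\<And>i. \<Phi> (u i) = P i" by metis
  obtain D where D: "finite D" "\<And>v. s 2 (hcomp k (\<Phi> y) v) = (\<Sum>l\<in>D. P l v)"
    using comp_pieces[OF \<Phi>_lin[OF ys], of k] unfolding P_def by blast
  have "hcomp k (\<Phi> y) = \<Phi> y"
  proof (rule lin_eqI[OF comp_lin[OF \<Phi>_lin[OF ys]] \<Phi>_lin[OF ys]])
    fix b assume b: "b \<in> Eb"
    have "\<Phi> y b \<in> Vk (dg b + k)" using degD[OF gr_degree[OF y(2)] Vk_basis[OF b]] .
    then show "hcomp k (\<Phi> y) b = \<Phi> y b" using comp_basis[OF \<Phi>_lin[OF ys] b] pr_on_Vk by simp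
  qed
  then have "\<Phi> (scl G 2 y) = (\<lambda>v. \<Sum>l\<in>D. P l v)" using D(2) \<Phi>_scale[OF ys] by simp
  also have "\<dots> = \<Phi> (\<Sum>i\<in>D. u i)" using \<Phi>_sum[of D u] u subsetD[OF part_space u(1)] by simp
  finally have "scl G 2 y = (\<Sum>i\<in>D. u i)"
    using \<Phi>_inj space_closed(4)[OF ys] g.subspace_sum[OF space_sub, of D u] u(1) part_space unfolding inj_on_def by blast
  then show ?thesis using D(1) u unfolding P_def by blast
qed

lemma B_sum:
  assumes "\<And>i. i \<in> D \<Longrightarrow> x i \<in> space_of G" "\<And>j. j \<in> E \<Longrightarrow> y j \<in> space_of G"
    and "\<And>i j. i \<in> D \<Longrightarrow> j \<in> E \<Longrightarrow> B (x i) (y j) = 0"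
  shows "B (\<Sum>i\<in>D. x i) (\<Sum>j\<in>E. y j) = 0"
proof -
  have z: "B 0 t = 0" "B t 0 = 0" if "t \<in> space_of G" for t
    using B_linear(3)[OF space_closed(1) that that, of 0] B_linear(4)[OF that space_closed(1) that, of 0] by simp_all
  have 1: "B (x i) (\<Sum>j\<in>E. y j) = 0 \<and> (\<Sum>j\<in>E. y j) \<in> space_of G" if "i \<in> D" for i
    using assms(2,3) that
  proof (induction E rule: infinite_finite_induct)
    case (insert j E)
    then show ?case using B_linear(2)[OF assms(1)[OF that], of "y j" "\<Sum>j\<in>E. y j"] space_closed(1) by (simp add: space_closed)
  qed (use z assms(1) space_closed(1) in auto)
  have "(\<Sum>j\<in>E. y j) \<in> space_of G" using assms(2) by (intro g.subspace_sum[OF space_sub])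
  then have "B (\<Sum>i\<in>D. x i) (\<Sum>j\<in>E. y j) = 0 \<and> (\<Sum>i\<in>D. x i) \<in> space_of G" using assms(1) 1
  proof (induction D rule: infinite_finite_induct)
    case (insert i D)
    then show ?case using B_linear(1)[of "x i" "\<Sum>i\<in>D. x i" "\<Sum>j\<in>E. y j"] by (simp add: space_closed)
  qed (use z space_closed(1) in auto)
  then show ?thesis by simp
qed

lemma four_ne_0: "(4::'k) \<noteq> 0"
proof -
  have "(4::'k) = 2 * 2" by simp
  then show ?thesis using two_ne_0 by (metis mult_eq_0_iff)
qed

text \<open>The torus with \<open>c l = l\<close> settles every degree for which
  \<open>2 + k\<close> is nonzero in the field. Among the degrees congruent to -2 modulo
  \<open>p\<close>, positive ones consist of brackets with \<open>X\<close>, and negative ones are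
  cut into blocks that finer tori separate from the blocks of \<open>X\<close>.\<close>

lemma chi_gr:
  assumes z: "z \<in> gr k" "k \<noteq> -2"
  shows "chi z = 0"
proof -
  obtain y y' where y: "y \<in> gr k" "y \<in> part G False" "y' \<in> part G True" "z = y + y'"
    using z(1) gr_par unfolding total_def by blast
  have ys: "y \<in> space_of G" "y' \<in> space_of G" using y part_space by blast+
  have X_gr: "X \<in> gr 2" unfolding gr_def using X_space N_deg by (simp add: \<Phi>_X)
  have "B X y = 0"
  proof (cases "2 + of_int k = (0::'k)")
    case False
    have "\<exists>m. \<Phi> u v \<in> Vk m \<and> of_int m - of_int l = (of_int j :: 'k)" if "u \<in> gr j" "v \<in> Vk l" for u j v l
      using degD[OF gr_degree[OF that(1)] that(2)] by (intro exI[of _ "l + j"]) simp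
    from this[OF X_gr] this[OF y(1)] False show ?thesis
      by (intro weight_orthogonal[of of_int X y 2 "of_int k"] X_even y(2)) auto
  next
    case True
    consider "k \<ge> 1" | "k = 0" | "k < 0" by linarith
    then show ?thesis
    proof cases
      case 1
      \<comment> \<open>For \<open>k = 2\<close> the sum \<open>2 + k\<close> would be 4, which is
        invertible.\<close>
      have "k \<noteq> 2" using True four_ne_0 by auto
      then obtain f where f: "f \<in> L False" "\<And>v. N (f v) - f (N v) = \<Phi> y v"
        using surjective[OF \<Phi>_L[OF y(2)] gr_degree[OF y(1)] 1] by blast
      obtain u where u: "u \<in> part G False" "\<Phi> u = f" using L_obtain[OF f(1)] by blast
      have "\<Phi> (brk G X u) = \<Phi> y" unfolding \<Phi>_brk[OF X_even u(1)] u(2) \<Phi>_X ksign_def using f(2) by simp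
      moreover have "brk G X u \<in> space_of G" using X_space u(1) part_space brk_space by blast
      ultimately have "brk G X u = y" using \<Phi>_inj ys unfolding inj_on_def by blast
      then show ?thesis using chi_brk_X[OF u(1)] chi_eq ys by simp
    next
      case 2 then show ?thesis using True two_ne_0 by simp
    next
      case 3
      obtain D x where x: "finite D" "\<And>i. x i \<in> part G False" "scl G 2 X = (\<Sum>i\<in>D. x i)"
        "\<And>i. \<Phi> (x i) = (\<lambda>v. pr (i + 2) (N (pr i v)) + pr (- i) (N (pr (- (i + 2)) v)))"
        using piece_decomposition[OF X_even X_gr] unfolding \<Phi>_X by auto
      obtain E u where u: "finite E" "\<And>i. u i \<in> part G False" "scl G 2 y = (\<Sum>i\<in>E. u i)"
        "\<And>i. \<Phi> (u i) = (\<lambda>v. pr (i + k) (\<Phi> y (pr i v)) + pr (- i) (\<Phi> y (pr (- (i + k)) v)))"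
        using piece_decomposition[OF y(2,1)] 3 by auto
      have "B (x j) (u i) = 0" for i j
      proof -
        define d where "d a l = (if l = a then 1 else 0) - (if l = - a then 1 else 0 :: int)" for a l :: int
        \<comment> \<open>The block of \<open>y\<close> from \<open>i\<close> to
          \<open>i + k\<close> has negative degree other than -2, as
          \<open>odd_weight_exists\<close> requires.\<close>
        have "i + k < i" "i \<noteq> i + k + 2" using 3 z(2) by auto
        then have "\<exists>a. d a (j + 2) - d a j + d a (i + k) - d a i \<notin> {0, 3, - 3}"
          unfolding d_def by (rule odd_weight_exists[OF refl])
        then obtain a where a: "d a (j + 2) - d a j + d a (i + k) - d a i \<notin> {0, 3, - 3}" by blast
        define n where "n = d a (j + 2) - d a j + d a (i + k) - d a i"
        have "- 1 \<le> d a l \<and> d a l \<le> 1" for l unfolding d_def by auto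
        from this[of "j + 2"] this[of j] this[of "i + k"] this[of i]
        have "- 4 \<le> n" "n \<le> 4" "n \<noteq> 0" "n \<noteq> 3" "n \<noteq> - 3" using a unfolding n_def by auto
        \<comment> \<open>The remaining values are powers of 2 up to sign, hence nonzero in the
          field.\<close>
        then have "n = - 4 \<or> n = - 2 \<or> n = - 1 \<or> n = 1 \<or> n = 2 \<or> n = 4" by presburger
        then have n: "(of_int n :: 'k) \<noteq> 0" using two_ne_0 four_ne_0 by auto
        define c where "c l = (of_int (d a l) :: 'k)" for l
        have c: "c (- l) = - c l" for l unfolding c_def d_def by auto
        show ?thesis
        proof (rule weight_orthogonal[of c, OF c x(2) u(2)])
          show "\<exists>m. \<Phi> (x j) v \<in> Vk m \<and> c m - c l = c (j + 2) - c j" if "v \<in> Vk l" "\<Phi> (x j) v \<noteq> 0" for l v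
            using that unfolding x(4) by (intro piece_weight c N_lin)
          show "\<exists>m. \<Phi> (u i) v \<in> Vk m \<and> c m - c l = c (i + k) - c i" if "v \<in> Vk l" "\<Phi> (u i) v \<noteq> 0" for l v
            using that unfolding u(4) by (intro piece_weight c \<Phi>_lin ys)
          show "c (j + 2) - c j + (c (i + k) - c i) \<noteq> 0" using n unfolding n_def c_def by (simp add: add_diff_eq)
        qed
      qed
      then have "B (scl G 2 X) (scl G 2 y) = 0"
        unfolding x(3) u(3) using subsetD[OF part_space x(2)] subsetD[OF part_space u(2)] by (intro B_sum)
      moreover have "B (scl G 2 X) (scl G 2 y) = 2 * (2 * B X y)"
        using B_linear(3)[OF X_space space_closed(4)[OF ys(1)] X_space] B_linear(4)[OF X_space ys(1) X_space] by simp
      ultimately show ?thesis using four_ne_0 by simp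
    qed
  qed
  then show ?thesis using chi_add[OF ys] chi_odd[OF y(3)] chi_eq[OF ys(1)] y(4) by simp
qed

text \<open>The matrix entries in the basis \<open>Eb\<close> are finitely many functionals that
  separate the elements.\<close>

lemma finite_dimensional: "\<exists>S. finite S \<and> space_of G \<subseteq> g.span S"
proof (rule g.finite_span_of_functionals[OF space_sub, where J = "Eb \<times> Eb" and F = "\<lambda>(b, b') z. representation Eb (\<Phi> z b) b'"])
  show "finite (Eb \<times> Eb)" using Eb(1) by simp
  have sp: "\<Phi> z b \<in> span Eb" if "z \<in> space_of G" for z b using linD(7)[OF \<Phi>_lin[OF that]] Eb(3) by simp
  show "(case j of (b, b') \<Rightarrow> \<lambda>z. representation Eb (\<Phi> z b) b') (x + y) =
     (case j of (b, b') \<Rightarrow> \<lambda>z. representation Eb (\<Phi> z b) b') x + (case j of (b, b') \<Rightarrow> \<lambda>z. representation Eb (\<Phi> z b) b') y"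
    if "x \<in> space_of G" "y \<in> space_of G" for j x y
    using that sp by (auto simp: \<Phi>_add representation_add[OF Eb(2)] split: prod.split)
  show "(case j of (b, b') \<Rightarrow> \<lambda>z. representation Eb (\<Phi> z b) b') (scl G c x) =
     c * (case j of (b, b') \<Rightarrow> \<lambda>z. representation Eb (\<Phi> z b) b') x" if "x \<in> space_of G" for j c x
    using that sp by (auto simp: \<Phi>_scale representation_scale[OF Eb(2)] split: prod.split)
  fix x assume x: "x \<in> space_of G" "\<And>j. j \<in> Eb \<times> Eb \<Longrightarrow> (case j of (b, b') \<Rightarrow> \<lambda>z. representation Eb (\<Phi> z b) b') x = 0"
  have "\<Phi> x = (\<lambda>v. 0)"
  proof (rule lin_eqI[OF \<Phi>_lin[OF x(1)] lin_zero])
    fix b assume b: "b \<in> Eb"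
    have "representation Eb (\<Phi> x b) b' = 0" if "b' \<in> Eb" for b' using x(2)[of "(b, b')"] b that by simp
    then show "\<Phi> x b = 0" using expand[OF linD(7)[OF \<Phi>_lin[OF x(1)]], of b] by simp
  qed
  then show "x = 0" by (rule \<Phi>_eq_zero[OF x(1)])
qed

lemma Vk_independent:
  assumes "finite K" "\<And>k. k \<in> K \<Longrightarrow> u k \<in> Vk k" "(\<Sum>k\<in>K. u k) = 0" "j \<in> K"
  shows "u j = 0"
proof -
  have "pr j (\<Sum>k\<in>K. u k) = (\<Sum>k\<in>K. pr j (u k))" using assms(2) Vk_VV by (intro lin_sum[OF pr_lin]) blast
  also have "\<dots> = (\<Sum>k\<in>K. if k = j then u j else 0)" using pr_on_Vk[OF assms(2)] by (intro sum.cong) auto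
  also have "\<dots> = u j" using assms(1,4) by simp
  finally show ?thesis using assms(3) linD(5)[OF pr_lin] by simp
qed

sublocale rep: graded_rep s G gr Vk \<Phi>
proof unfold_locales
  have VkV: "span (\<Union>l. Vk l) \<subseteq> VV" using Vk_VV VV_sub by (intro span_minimal) auto
  show "\<Phi> (z + z') v = \<Phi> z v + \<Phi> z' v" if "z \<in> space_of G" "z' \<in> space_of G" for z z' v
    using that by (simp add: \<Phi>_add)
  show "\<Phi> (scl G c z) v = s c (\<Phi> z v)" if "z \<in> space_of G" for c z v
    using that by (simp add: \<Phi>_scale)
  show "\<Phi> z (v + v') = \<Phi> z v + \<Phi> z v'" if "z \<in> space_of G" "v \<in> span (\<Union>l. Vk l)" "v' \<in> span (\<Union>l. Vk l)" for z v v'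
    using that VkV by (intro linD(1)[OF \<Phi>_lin]) auto
  show "\<Phi> z (s c v) = s c (\<Phi> z v)" if "z \<in> space_of G" "v \<in> span (\<Union>l. Vk l)" for c z v
    using that VkV by (intro linD(2)[OF \<Phi>_lin]) auto
  show "\<Phi> z v \<in> Vk (l + k)" if "z \<in> gr k" "v \<in> Vk l" for z k v l
    using degD[OF gr_degree[OF that(1)] that(2)] .
  show "z = 0" if "z \<in> gr k" "\<And>l v. v \<in> Vk l \<Longrightarrow> \<Phi> z v = 0" for z k
  proof (rule \<Phi>_eq_zero)
    show zs: "z \<in> space_of G" using that gr_space by blast
    show "\<Phi> z = (\<lambda>v. 0)" using that(2) Vk_basis by (intro lin_eqI[OF \<Phi>_lin[OF zs] lin_zero]) blast
  qed
  show "\<Phi> (ppow G z) v = (\<Phi> z ^^ CHAR('k)) v" if "z \<in> part G False" for z v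
    using \<Phi>_ppow[OF that] by simp
  show "gr k = total (\<lambda>a. gr k \<inter> part G a)" for k by (rule gr_par)
  show "u j = 0" if "finite K" "\<And>k. k \<in> K \<Longrightarrow> u k \<in> Vk k" "(\<Sum>k\<in>K. u k) = 0" "j \<in> K" for K u j
    using that by (rule Vk_independent)
qed (fact part_sub part_int gr_sub ds Vk_sub ppow_even)+

lemma graded_character: "graded_character G chi gr"
proof (unfold_locales, goal_cases)
  case (12 d z)
  then show ?case using ppow_even[OF 12(2)] part_space by (intro rep.ppow_filtration) auto
next
  case 11
  then show ?case using nondeg by blast
qed (use gr_par in \<open>blast intro: restricted char chi_add chi_scale chi_odd chi_gr ds gr_sub br_gr finite_dimensional\<close>)+

end

section \<open>The series gl, sl and osp\<close>

text \<open>\<open>trace_on\<close> uses an arbitrarily chosen basis \<open>E\<close>; the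
  coordinate matrices between \<open>E\<close> and \<open>B\<close> are inverse to each
  other.\<close>

lemma (in vector_space) trace_on_basis:
  assumes B: "finite B" "independent B" "span B = W"
    and add: "\<And>x y. x \<in> W \<Longrightarrow> y \<in> W \<Longrightarrow> f (x + y) = f x + f y"
    and scale: "\<And>c x. x \<in> W \<Longrightarrow> f (scale c x) = scale c (f x)"
    and closed: "\<And>x. x \<in> W \<Longrightarrow> f x \<in> W"
  shows "trace_on scale W f = (\<Sum>b\<in>B. representation B (f b) b)"
proof -
  define E where "E = (SOME B. \<not> dependent B \<and> span B = W)"
  have E: "independent E" "span E = W" using someI[of "\<lambda>B. \<not> dependent B \<and> span B = W" B] B unfolding E_def by auto
  have fE: "finite E" using independent_span_bound[OF B(1) E(1)] span_superset[of E] B(3) E(2) by blast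
  have W: "subspace W" unfolding E(2)[symmetric] by simp
  have BW: "b \<in> B \<Longrightarrow> b \<in> W" and EW: "e \<in> E \<Longrightarrow> e \<in> W" for b e using B(3) E(2) span_superset by blast+
  have f_sum: "f (\<Sum>e\<in>Z. scale (c e) e) = (\<Sum>e\<in>Z. scale (c e) (f e)) \<and> (\<Sum>e\<in>Z. scale (c e) e) \<in> W"
    if "finite Z" "Z \<subseteq> W" for Z c
    using that
  proof (induction Z rule: finite_induct)
    case empty
    have "f (scale 0 0) = scale 0 (f 0)" using subspace_0[OF W] by (rule scale)
    then show ?case using subspace_0[OF W] by simp
  next
    case (insert e Z)
    then show ?case by (simp add: add scale subspace_add[OF W] subspace_scale[OF W])
  qed
  have exp: "(\<Sum>e\<in>E. scale (representation E v e) e) = v" if "v \<in> W" for v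
    using sum_representation_eq[OF E(1) _ fE] that E(2) by simp
  have expB: "(\<Sum>b\<in>B. scale (representation B v b) b) = v" if "v \<in> W" for v
    using sum_representation_eq[OF B(2) _ B(1)] that B(3) by simp
  have rsum: "representation D (\<Sum>e\<in>Z. scale (c e) (g e)) t = (\<Sum>e\<in>Z. c e * representation D (g e) t)"
    if "independent D" "span D = W" "\<And>e. e \<in> Z \<Longrightarrow> g e \<in> W" for D Z c g t
    using that by (simp add: representation_sum representation_scale subspace_scale[OF W])
  have fb: "representation B (f b) b = (\<Sum>e'\<in>E. \<Sum>e\<in>E. representation E b e' * representation E (f e') e * representation B e b)"
    if b: "b \<in> B" for b
  proof -
    have "f (\<Sum>e'\<in>E. scale (representation E b e') e') = (\<Sum>e'\<in>E. scale (representation E b e') (f e'))"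
      using f_sum[OF fE] EW by blast
    then have "f b = (\<Sum>e'\<in>E. scale (representation E b e') (f e'))" unfolding exp[OF BW[OF b]] .
    then have 1: "representation E (f b) e = (\<Sum>e'\<in>E. representation E b e' * representation E (f e') e)" for e
      using rsum[OF E, of E f "\<lambda>e'. representation E b e'"] closed EW by simp
    have "representation B (\<Sum>e\<in>E. scale (representation E (f b) e) e) b = (\<Sum>e\<in>E. representation E (f b) e * representation B e b)"
      by (rule rsum[OF B(2,3) EW])
    then show ?thesis unfolding exp[OF closed[OF BW[OF b]]] unfolding 1 by (subst sum.swap) (simp add: sum_distrib_right)
  qed
  have inv: "(\<Sum>b\<in>B. representation B e b * representation E b e') = (if e = e' then 1 else 0)" if e: "e \<in> E" for e e'
  proof -
    have "representation E (\<Sum>b\<in>B. scale (representation B e b) b) e' = (\<Sum>b\<in>B. representation B e b * representation E b e')"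
      by (rule rsum[OF E BW])
    then show ?thesis unfolding expB[OF EW[OF e]] representation_basis[OF E(1) e] by auto
  qed
  have "(\<Sum>b\<in>B. representation B (f b) b)
      = (\<Sum>b\<in>B. \<Sum>e'\<in>E. \<Sum>e\<in>E. representation E b e' * representation E (f e') e * representation B e b)"
    using fb by (rule sum.cong[OF refl])
  also have "\<dots> = (\<Sum>e'\<in>E. \<Sum>e\<in>E. \<Sum>b\<in>B. representation E b e' * representation E (f e') e * representation B e b)"
    by (subst sum.swap) (intro sum.cong refl sum.swap)
  also have "\<dots> = (\<Sum>e'\<in>E. \<Sum>e\<in>E. representation E (f e') e * (\<Sum>b\<in>B. representation B e b * representation E b e'))"
    by (simp add: sum_distrib_left mult_ac)
  also have "\<dots> = (\<Sum>e'\<in>E. \<Sum>e\<in>E. if e = e' then representation E (f e') e' else 0)"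
    using inv by (intro sum.cong) auto
  also have "\<dots> = (\<Sum>e'\<in>E. representation E (f e') e')" using fE by (intro sum.cong) auto
  finally show ?thesis unfolding trace_on_def E_def Let_def by simp
qed

context graded_basis
begin

definition diag :: "(int \<Rightarrow> 'k) \<Rightarrow> 'v \<Rightarrow> 'v" where "diag c = ext (\<lambda>b. s (c (dg b)) b)"

lemma diag_basis: "b \<in> Eb \<Longrightarrow> diag c b = s (c (dg b)) b"
  unfolding diag_def by (rule ext_basis)

lemma diag_lin: "lin (diag c)"
  unfolding diag_def by (rule lin_ext) (simp add: VV_simps Eb_VV)

lemma diag_gl: "diag c \<in> gl_part s V False"
  by (rule gl_partI[OF diag_lin]) (simp add: diag_basis subspace_scale[OF V_sub])

lemma diag_sum: "v \<in> VV \<Longrightarrow> finite D \<Longrightarrow> Dg \<subseteq> D \<Longrightarrow> diag c v = (\<Sum>l\<in>D. s (c l) (pr l v))"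
proof -
  assume v: "v \<in> VV" and D: "finite D" "Dg \<subseteq> D"
  have "diag c = (\<lambda>v. \<Sum>l\<in>D. s (c l) (pr l v))"
  proof (rule lin_eqI[OF diag_lin lin_setsum[OF lin_scale[OF pr_lin]]])
    fix b assume b: "b \<in> Eb"
    have "(\<Sum>l\<in>D. s (c l) (pr l b)) = (\<Sum>l\<in>D. if l = dg b then s (c (dg b)) b else 0)"
      using b by (intro sum.cong) (auto simp: pr_basis)
    then show "diag c b = (\<Sum>l\<in>D. s (c l) (pr l b))" using b D by (auto simp: diag_basis)
  qed
  then show ?thesis by simp
qed

lemma diag_Vk: "v \<in> Vk l \<Longrightarrow> diag c v = s (c l) v"
proof -
  assume v: "v \<in> Vk l"
  have "diag c v = (\<Sum>j\<in>insert l Dg. s (c j) (pr j v))" using v Vk_VV Eb(1) by (intro diag_sum) auto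
  also have "\<dots> = (\<Sum>j\<in>insert l Dg. if j = l then s (c l) v else 0)" using pr_on_Vk[OF v] by (intro sum.cong) auto
  finally show ?thesis using Eb(1) by simp
qed

lemma gl_part_closed:
  "f \<in> gl_part s V a \<Longrightarrow> g \<in> gl_part s V a \<Longrightarrow> (\<lambda>v. f v + g v) \<in> gl_part s V a"
  "f \<in> gl_part s V a \<Longrightarrow> (\<lambda>v. s c (f v)) \<in> gl_part s V a"
  unfolding gl_part_iff
  by (auto simp: lin_add lin_scale subspace_add[OF V_sub] subspace_scale[OF V_sub])

lemma gl_part_comp: "f \<in> gl_part s V a \<Longrightarrow> g \<in> gl_part s V b \<Longrightarrow> (\<lambda>v. f (g v)) \<in> gl_part s V (a \<noteq> b)"
  unfolding gl_part_iff
proof (safe, goal_cases)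
  case (2 q x)
  then have "f (g x) \<in> V (a \<noteq> (b \<noteq> q))" by blast
  moreover have "(a \<noteq> (b \<noteq> q)) = ((a \<noteq> b) \<noteq> q)" by auto
  ultimately show ?case by simp
qed (rule lin_comp)

lemma gl_piece: "f \<in> gl_part s V q \<Longrightarrow> (\<lambda>v. pr i (f (pr j v)) + pr i' (f (pr j' v))) \<in> gl_part s V q"
  using gl_part_comp[OF pr_gl gl_part_comp[OF _ pr_gl]] by (intro gl_part_closed(1)) fastforce+

lemma V_trace:
  assumes "f \<in> gl_part s V False"
  shows "trace_on s (V q) f = (\<Sum>b\<in>Eb \<inter> V q. representation Eb (f b) b)"
proof -
  have f: "lin f" "\<And>x. x \<in> V q \<Longrightarrow> f x \<in> V q" using assms unfolding gl_part_iff by auto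
  have ind: "independent (Eb \<inter> V q)" using Eb(2) by (rule independent_mono) auto
  have VqV: "x \<in> V q \<Longrightarrow> x \<in> VV" for x using V_VV by blast
  have "trace_on s (V q) f = (\<Sum>b\<in>Eb \<inter> V q. representation (Eb \<inter> V q) (f b) b)"
    using Eb(1) ind V_basis f VqV linD[OF f(1)] by (intro trace_on_basis) auto
  also have "\<dots> = (\<Sum>b\<in>Eb \<inter> V q. representation Eb (f b) b)"
    using f(2) V_basis by (intro sum.cong refl) (metis IntE Int_lower1 Eb(2) representation_extend)
  finally show ?thesis .
qed

lemma representation_Vk: "v \<in> Vk l \<Longrightarrow> dg b \<noteq> l \<Longrightarrow> representation Eb v b = 0"
proof -
  assume v: "v \<in> Vk l" and b: "dg b \<noteq> l"
  have "representation Eb v = representation {b \<in> Eb. dg b = l} v"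
    using v unfolding Vk_def by (intro representation_extend[OF Eb(2)]) auto
  then show ?thesis using b representation_ne_zero[of "{b \<in> Eb. dg b = l}" v b] by auto
qed

text \<open>In a homogeneous basis a map of nonzero degree has no diagonal entries.\<close>

lemma trace_deg: "f \<in> gl_part s V False \<Longrightarrow> deg f k \<Longrightarrow> k \<noteq> 0 \<Longrightarrow> trace_on s (V q) f = 0"
  unfolding V_trace using degD[OF _ Vk_basis] representation_Vk by (intro sum.neutral) fastforce

text \<open>For \<open>i \<noteq> j\<close> both blocks lie off the diagonal.\<close>

lemma trace_piece:
  assumes "f \<in> gl_part s V False" "i \<noteq> j"
  shows "trace_on s (V q) (\<lambda>v. pr i (f (pr j v)) + pr (- j) (f (pr (- i) v))) = 0"
  unfolding V_trace[OF gl_piece[OF assms(1)]]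
proof (rule sum.neutral, rule ballI)
  fix b assume "b \<in> Eb \<inter> V q"
  then have b: "b \<in> Eb" by blast
  have f: "lin f" using assms(1) gl_part_iff by blast
  have z: "representation Eb (pr i (f (pr j b))) b = 0" if "i \<noteq> j" for i j
    using that b pr_Vk[of i] representation_Vk[of _ i b]
    by (cases "dg b = j") (auto simp: pr_basis linD(5)[OF f] linD(5)[OF pr_lin] representation_zero)
  have sp: "pr i v \<in> span Eb" for i v using linD(7)[OF pr_lin] Eb(3) by simp
  show "representation Eb (pr i (f (pr j b)) + pr (- j) (f (pr (- i) b))) b = 0"
    using z[of i j] z[of "- j" "- i"] assms(2) by (simp add: representation_add[OF Eb(2)] sp)
qed

lemma trace_add:
  assumes "f \<in> gl_part s V False" "g \<in> gl_part s V False"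
  shows "trace_on s (V q) (\<lambda>v. s a (f v) + s c (g v)) = a * trace_on s (V q) f + c * trace_on s (V q) g"
proof -
  have sp: "f v \<in> span Eb" "g v \<in> span Eb" for v using assms linD(7) Eb(3) unfolding gl_part_iff by auto
  have "(\<lambda>v. s a (f v) + s c (g v)) \<in> gl_part s V False"
    by (rule gl_part_closed(1)[OF gl_part_closed(2)[OF assms(1)] gl_part_closed(2)[OF assms(2)]])
  then show ?thesis
    by (simp add: V_trace assms representation_add[OF Eb(2)] representation_scale[OF Eb(2)] sp span_scale
        sum.distrib sum_distrib_left)
qed

text \<open>The identity, cut off outside the space to fit the convention of
  \<open>gl_part\<close>.\<close>

definition idV :: "'v \<Rightarrow> 'v" where "idV v = (if v \<in> VV then v else 0)"

lemma idV_gl: "idV \<in> gl_part s V False"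
proof (rule gl_partI)
  show "lin idV" unfolding lin_def idV_def by (auto simp: VV_simps)
qed (simp add: idV_def Eb_VV)

lemma trace_idV: "trace_on s (V q) idV = of_nat (dim (V q))"
proof -
  have "dim (V q) = card (Eb \<inter> V q)"
  proof (rule dim_eq_card)
    show "span (Eb \<inter> V q) = span (V q)" using V_basis[of q] V_sub[of q] by (metis span_eq_iff)
  qed (rule independent_mono[OF Eb(2)], simp)
  moreover have "(\<Sum>b\<in>Eb \<inter> V q. representation Eb (idV b) b) = (\<Sum>b\<in>Eb \<inter> V q. 1)"
    by (intro sum.cong) (auto simp: idV_def Eb_VV representation_basis[OF Eb(2)])
  ultimately show ?thesis by (simp add: V_trace[OF idV_gl])
qed

end

context jordan_graded
begin

text \<open>A multiple of the identity corrects the supertrace of the diagonal operator. This is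
  possible because the supertrace of the identity is the superdimension, which is nonzero in the
  field.\<close>

lemma sl_torus:
  assumes "of_nat (dim (V False)) - of_nat (dim (V True)) \<noteq> (0::'k)"
  shows "\<exists>T\<in>sl_part s V False. \<exists>t. \<forall>l. \<forall>v\<in>Vk l. T v = s (c l + t) v"
proof -
  define st where "st f = trace_on s (V False) f - trace_on s (V True) f" for f
  define t where "t = - st (diag c) / st idV"
  have st: "st idV \<noteq> 0" unfolding st_def trace_idV using assms .
  define T where "T = (\<lambda>v. s 1 (diag c v) + s t (idV v))"
  have "T \<in> gl_part s V False" unfolding T_def
    by (rule gl_part_closed(1)[OF gl_part_closed(2)[OF diag_gl] gl_part_closed(2)[OF idV_gl]])
  moreover have "st T = 0"
  proof -
    have "st T = st (diag c) + t * st idV"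
      unfolding st_def T_def trace_add[OF diag_gl idV_gl] by (simp add: right_diff_distrib)
    then show ?thesis unfolding t_def using st by simp
  qed
  ultimately have "T \<in> sl_part s V False" unfolding sl_part_def st_def by simp
  moreover have "T v = s (c l + t) v" if "v \<in> Vk l" for v l
    using that Vk_VV unfolding T_def by (auto simp: diag_Vk idV_def scale_left_distrib)
  ultimately show ?thesis by blast
qed

text \<open>The solution found in \<open>gl\<close> has degree \<open>l - 2\<close>, which is
  nonzero, so its traces on both parities vanish.\<close>

lemma sl_surjective:
  assumes "y \<in> sl_part s V False" "deg y l" "l \<ge> 1" "l \<noteq> 2"
  shows "\<exists>z\<in>sl_part s V False. \<forall>v. N (z v) - z (N v) = y v"
proof -
  obtain z where z: "z \<in> gl_part s V False" "deg z (l - 2)" "\<forall>v. N (z v) - z (N v) = y v"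
    using ad_surjective[of y l] assms unfolding sl_part_def by blast
  then have "trace_on s (V q) z = 0" for q using assms(4) by (intro trace_deg) auto
  then show ?thesis using z unfolding sl_part_def by auto
qed

lemma sl_piece:
  assumes "f \<in> sl_part s V q" "i \<noteq> j"
  shows "(\<lambda>v. pr i (f (pr j v)) + pr (- j) (f (pr (- i) v))) \<in> sl_part s V q"
  using assms gl_piece trace_piece unfolding sl_part_def by (cases q) auto

end

locale jordan_osp = jordan_graded s V Eb dg N r w lam
  for s :: "'k::field \<Rightarrow> 'v::ab_group_add \<Rightarrow> 'v" and V Eb dg N r w lam +
  fixes \<phi> :: "'v \<Rightarrow> 'v \<Rightarrow> 'k"
  assumes form: "osp_form s V \<phi>"
    and orth: "k + l \<noteq> 0 \<Longrightarrow> x \<in> Vk k \<Longrightarrow> y \<in> Vk l \<Longrightarrow> \<phi> x y = 0"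
    and N_osp: "N \<in> osp_part s V \<phi> False"
    and two: "(2::'k) \<noteq> 0"
begin

lemma \<phi>_linear:
  "x \<in> VV \<Longrightarrow> y \<in> VV \<Longrightarrow> z \<in> VV \<Longrightarrow> \<phi> (x + y) z = \<phi> x z + \<phi> y z"
  "x \<in> VV \<Longrightarrow> y \<in> VV \<Longrightarrow> z \<in> VV \<Longrightarrow> \<phi> x (y + z) = \<phi> x y + \<phi> x z"
  "x \<in> VV \<Longrightarrow> y \<in> VV \<Longrightarrow> \<phi> (s c x) y = c * \<phi> x y" "x \<in> VV \<Longrightarrow> y \<in> VV \<Longrightarrow> \<phi> x (s c y) = c * \<phi> x y"
  using form unfolding osp_form_def by blast+

lemma \<phi>_comm: "x \<in> V a \<Longrightarrow> y \<in> V b \<Longrightarrow> \<phi> x y = ksign a b * \<phi> y x"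
  and \<phi>_odd: "x \<in> V a \<Longrightarrow> y \<in> V b \<Longrightarrow> a \<noteq> b \<Longrightarrow> \<phi> x y = 0"
  and \<phi>_nondeg: "x \<in> VV \<Longrightarrow> (\<And>y. y \<in> VV \<Longrightarrow> \<phi> x y = 0) \<Longrightarrow> x = 0"
  using form unfolding osp_form_def by blast+

lemma \<phi>_zero: "x \<in> VV \<Longrightarrow> \<phi> 0 x = 0" "x \<in> VV \<Longrightarrow> \<phi> x 0 = 0"
  using \<phi>_linear(3)[of 0 x 0] \<phi>_linear(4)[of x 0 0] VV_simps(1) by simp_all

lemma \<phi>_sum: "(\<And>j. j \<in> S \<Longrightarrow> u j \<in> VV) \<Longrightarrow> y \<in> VV \<Longrightarrow> \<phi> (\<Sum>j\<in>S. u j) y = (\<Sum>j\<in>S. \<phi> (u j) y)"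
  "(\<And>j. j \<in> S \<Longrightarrow> u j \<in> VV) \<Longrightarrow> y \<in> VV \<Longrightarrow> \<phi> y (\<Sum>j\<in>S. u j) = (\<Sum>j\<in>S. \<phi> y (u j))"
proof (induction S rule: infinite_finite_induct)
  case (insert j S)
  have s: "(\<Sum>j\<in>S. u j) \<in> VV" if "\<And>j. j \<in> S \<Longrightarrow> u j \<in> VV" using that by (intro subspace_sum[OF VV_sub])
  { case 1 then show ?case using insert s \<phi>_linear(1)[of "u j" "\<Sum>j\<in>S. u j" y] by simp }
  { case 2 then show ?case using insert s \<phi>_linear(2)[of y "u j" "\<Sum>j\<in>S. u j"] by simp }
qed (simp_all add: \<phi>_zero)

text \<open>Supersymmetry turns left into right nondegeneracy, separately on each parity.\<close>

lemma \<phi>_nondeg_right: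
  assumes "y \<in> VV" "\<And>x. x \<in> VV \<Longrightarrow> \<phi> x y = 0"
  shows "y = 0"
proof (rule \<phi>_nondeg[OF assms(1)])
  obtain y0 y1 where y: "y0 \<in> V False" "y1 \<in> V True" "y = y0 + y1" using VV_split[OF assms(1)] by blast
  fix x assume x: "x \<in> VV"
  obtain x0 x1 where x: "x0 \<in> V False" "x1 \<in> V True" "x = x0 + x1" using VV_split[OF x] by blast
  have sp: "x0 \<in> VV" "x1 \<in> VV" "y0 \<in> VV" "y1 \<in> VV" using x y V_VV by blast+
  have z: "\<phi> y0 x1 = 0" "\<phi> y1 x0 = 0" "\<phi> x0 y1 = 0" "\<phi> x1 y0 = 0" using x y by (auto intro: \<phi>_odd)
  have "\<phi> x0 y = 0" "\<phi> x1 y = 0" using assms(2) sp by auto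
  then have "\<phi> x0 y0 = 0" "\<phi> x1 y1 = 0" using z sp unfolding y(3) by (simp_all add: \<phi>_linear)
  then have "\<phi> y0 x0 = 0" "\<phi> y1 x1 = 0" using \<phi>_comm[OF y(1) x(1)] \<phi>_comm[OF y(2) x(2)] by auto
  then show "\<phi> y x = 0" unfolding x(3) y(3) using sp z by (simp add: \<phi>_linear VV_simps)
qed

text \<open>\<open>Vk l\<close> pairs only with \<open>Vk (- l)\<close>, so both sides equal the
  pairing of \<open>pr l x\<close> with \<open>pr (- l) y\<close>.\<close>

lemma pr_adjoint: "x \<in> VV \<Longrightarrow> y \<in> VV \<Longrightarrow> \<phi> (pr l x) y = \<phi> x (pr (- l) y)"
proof -
  assume xy: "x \<in> VV" "y \<in> VV"
  define D where "D = Dg \<union> {l, - l}"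
  have D: "finite D" "Dg \<subseteq> D" "l \<in> D" "- l \<in> D" unfolding D_def using Eb(1) by auto
  have pV: "pr j v \<in> VV" for j v by (rule linD(7)[OF pr_lin])
  have "\<phi> (pr l x) (\<Sum>j\<in>D. pr j y) = (\<Sum>j\<in>D. \<phi> (pr l x) (pr j y))" by (rule \<phi>_sum(2)[OF pV pV])
  also have "\<dots> = (\<Sum>j\<in>D. if j = - l then \<phi> (pr l x) (pr (- l) y) else 0)"
    using orth[OF _ pr_Vk pr_Vk, of l] by (intro sum.cong) auto
  finally have 1: "\<phi> (pr l x) y = \<phi> (pr l x) (pr (- l) y)" using pr_sum[OF xy(2) D(1,2)] D by simp
  have "\<phi> (\<Sum>j\<in>D. pr j x) (pr (- l) y) = (\<Sum>j\<in>D. \<phi> (pr j x) (pr (- l) y))" by (rule \<phi>_sum(1)[OF pV pV])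
  also have "\<dots> = (\<Sum>j\<in>D. if j = l then \<phi> (pr l x) (pr (- l) y) else 0)"
    using orth[OF _ pr_Vk pr_Vk, of _ "- l"] by (intro sum.cong) auto
  finally have 2: "\<phi> x (pr (- l) y) = \<phi> (pr l x) (pr (- l) y)" using pr_sum[OF xy(1) D(1,2)] D by simp
  show ?thesis using 1 2 by simp
qed

lemma ospD: "f \<in> osp_part s V \<phi> a \<Longrightarrow> x \<in> V b \<Longrightarrow> y \<in> VV \<Longrightarrow> \<phi> (f x) y = - ksign a b * \<phi> x (f y)"
  unfolding osp_part_def by blast

lemma ospD_even: "f \<in> osp_part s V \<phi> False \<Longrightarrow> x \<in> VV \<Longrightarrow> y \<in> VV \<Longrightarrow> \<phi> (f x) y = - \<phi> x (f y)"
proof -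
  assume f: "f \<in> osp_part s V \<phi> False" and x: "x \<in> VV" and y: "y \<in> VV"
  obtain x0 x1 where x: "x0 \<in> V False" "x1 \<in> V True" "x = x0 + x1" using VV_split[OF x] by blast
  have sp: "x0 \<in> VV" "x1 \<in> VV" using x V_VV by blast+
  have l: "lin f" using f gl_part_iff unfolding osp_part_def by blast
  have "\<phi> (f x0) y = - \<phi> x0 (f y)" "\<phi> (f x1) y = - \<phi> x1 (f y)"
    using ospD[OF f x(1) y] ospD[OF f x(2) y] by (simp_all add: ksign_def)
  then show ?thesis unfolding x(3) using sp y linD[OF l] by (simp add: \<phi>_linear)
qed

text \<open>Taking adjoints exchanges the two blocks, with the same sign as in the definition of the
  superalgebra.\<close>

lemma osp_piece:
  assumes "f \<in> osp_part s V \<phi> q"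
  shows "(\<lambda>v. pr i (f (pr j v)) + pr (- j) (f (pr (- i) v))) \<in> osp_part s V \<phi> q"
proof -
  have f: "f \<in> gl_part s V q" "lin f" using assms gl_part_iff unfolding osp_part_def by blast+
  have pV: "pr j v \<in> VV" "f v \<in> VV" for j v using linD(7)[OF pr_lin] linD(7)[OF f(2)] by blast+
  have "\<phi> (pr i (f (pr j x)) + pr (- j) (f (pr (- i) x))) y
      = - ksign q b * \<phi> x (pr i (f (pr j y)) + pr (- j) (f (pr (- i) y)))" if x: "x \<in> V b" and y: "y \<in> VV" for b x y
  proof -
    have xV: "x \<in> VV" using x V_VV by blast
    have prb: "pr l x \<in> V b" for l using pr_gl[of l] x unfolding gl_part_iff by auto
    have "\<phi> (pr i (f (pr j x))) y = - ksign q b * \<phi> x (pr (- j) (f (pr (- i) y)))" for i j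
      unfolding pr_adjoint[OF pV(2) y] ospD[OF assms prb pV(1)] pr_adjoint[OF xV pV(2)] ..
    from this[of i j] this[of "- j" "- i"] show ?thesis using xV y pV by (simp add: \<phi>_linear algebra_simps)
  qed
  then show ?thesis unfolding osp_part_def using gl_piece[OF f(1)] by blast
qed

text \<open>Degree \<open>l\<close> is paired with degree \<open>- l\<close>, so an odd function
  \<open>c\<close> gives a skew operator.\<close>

lemma osp_torus:
  assumes c: "\<And>k. c (- k) = - c k"
  shows "diag c \<in> osp_part s V \<phi> False"
proof -
  have "\<phi> (diag c x) y = - \<phi> x (diag c y)" if xy: "x \<in> VV" "y \<in> VV" for x y
  proof -
    define D where "D = Dg \<union> uminus ` Dg"
    have D: "finite D" "Dg \<subseteq> D" unfolding D_def using Eb(1) by auto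
    have bij: "bij_betw uminus D D" by (rule bij_betwI[of _ _ _ uminus]) (auto simp: D_def image_iff)
    have pV: "pr j v \<in> VV" for j v by (rule linD(7)[OF pr_lin])
    have "\<phi> (diag c x) y = (\<Sum>l\<in>D. c l * \<phi> (pr l x) y)"
      unfolding diag_sum[OF xy(1) D] using xy pV by (simp add: \<phi>_sum \<phi>_linear VV_simps)
    also have "\<dots> = (\<Sum>l\<in>D. - (c (- l) * \<phi> x (pr (- l) y)))"
      using pr_adjoint[OF xy] c by simp
    also have "\<dots> = (\<Sum>l\<in>D. - (c l * \<phi> x (pr l y)))" by (rule sum.reindex_bij_betw[OF bij])
    also have "\<dots> = - \<phi> x (diag c y)"
      unfolding diag_sum[OF xy(2) D] using xy pV by (simp add: \<phi>_sum \<phi>_linear VV_simps sum_negf)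
    finally show ?thesis .
  qed
  then have "\<phi> (diag c x) y = - ksign False b * \<phi> x (diag c y)" if "x \<in> V b" "y \<in> VV" for b x y
    using that V_VV[of b] unfolding ksign_def by auto
  then show ?thesis unfolding osp_part_def using diag_gl by blast
qed

text \<open>The adjoint is written down with a family dual to \<open>Eb\<close>. That it preserves
  parity follows because the component of wrong parity is orthogonal to everything.\<close>

lemma adjoint_exists:
  assumes z: "z \<in> gl_part s V False"
  shows "\<exists>z'\<in>gl_part s V False. \<forall>x\<in>VV. \<forall>y\<in>VV. \<phi> (z x) y = \<phi> x (z' y)"
proof -
  have zl: "lin z" using z gl_part_iff by blast
  have "\<exists>d. \<forall>b\<in>Eb. d b \<in> VV \<and> (\<forall>b'\<in>Eb. \<phi> b' (d b) = (if b' = b then 1 else 0))"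
  proof (rule dual_family[OF Eb(1,2) VV_sub, where W = VV])
    show "\<exists>u\<in>VV. \<phi> x u \<noteq> 0" if "x \<in> VV" "x \<noteq> 0" for x using \<phi>_nondeg that by blast
  qed (use \<phi>_linear Eb_VV VV_sub in auto)
  then obtain d where d: "\<And>b. b \<in> Eb \<Longrightarrow> d b \<in> VV" "\<And>b b'. b \<in> Eb \<Longrightarrow> b' \<in> Eb \<Longrightarrow> \<phi> b' (d b) = (if b' = b then 1 else 0)"
    by blast
  define z' where "z' y = (if y \<in> VV then \<Sum>b\<in>Eb. s (\<phi> (z b) y) (d b) else 0)" for y
  have l: "lin z'"
    unfolding lin_def z'_def using d(1) linD(7)[OF zl]
    by (auto simp: VV_simps \<phi>_linear scale_left_distrib sum.distrib scale_sum_right intro!: subspace_sum[OF VV_sub])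
  have adj: "\<phi> (z x) y = \<phi> x (z' y)" if xy: "x \<in> VV" "y \<in> VV" for x y
  proof -
    have b: "\<phi> b (z' y) = \<phi> (z b) y" if b: "b \<in> Eb" for b
    proof -
      have "\<phi> b (z' y) = (\<Sum>b'\<in>Eb. \<phi> (z b') y * \<phi> b (d b'))"
        unfolding z'_def using xy d(1) Eb_VV[OF b] by (simp add: \<phi>_sum \<phi>_linear VV_simps)
      also have "\<dots> = (\<Sum>b'\<in>Eb. if b' = b then \<phi> (z b) y else 0)" using d(2) b by (intro sum.cong) auto
      finally show ?thesis using b Eb(1) by simp
    qed
    have zV: "z v \<in> VV" "z' v \<in> VV" for v using linD(7)[OF zl] linD(7)[OF l] by blast+
    have "\<phi> (z x) y = (\<Sum>b\<in>Eb. representation Eb x b * \<phi> (z b) y)"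
      unfolding lin_expand[OF zl xy(1)] using xy zV by (simp add: \<phi>_sum \<phi>_linear VV_simps)
    also have "\<dots> = (\<Sum>b\<in>Eb. \<phi> (s (representation Eb x b) b) (z' y))"
      using b zV Eb_VV by (intro sum.cong) (simp_all add: \<phi>_linear)
    also have "\<dots> = \<phi> (\<Sum>b\<in>Eb. s (representation Eb x b) b) (z' y)"
      using zV Eb_VV VV_simps by (intro \<phi>_sum(1)[symmetric]) auto
    finally show ?thesis unfolding expand[OF xy(1)] .
  qed
  have "z' y \<in> V q" if y: "y \<in> V q" for q y
  proof -
    have yV: "y \<in> VV" using y V_VV by blast
    obtain u0 u1 where u01: "u0 \<in> V False" "u1 \<in> V True" "z' y = u0 + u1" using VV_split[OF linD(7)[OF l]] by metis
    obtain u v where u: "u \<in> V q" "v \<in> V (\<not> q)" "z' y = u + v" using u01 by (cases q) (auto simp: add.commute)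
    have sp: "u \<in> VV" "v \<in> VV" using u V_VV by blast+
    have "v = 0"
    proof (rule \<phi>_nondeg_right[OF sp(2)])
      have h: "\<phi> x v = 0" if x: "x \<in> V p" for x p
      proof (cases "p = q")
        case True then show ?thesis using \<phi>_odd[OF x u(2)] by simp
      next
        case False
        have xV: "x \<in> VV" using x V_VV by blast
        have "z x \<in> V p" using z x unfolding gl_part_iff by auto
        then have "\<phi> (z x) y = 0" using \<phi>_odd y False by blast
        moreover have "\<phi> x u = 0" using \<phi>_odd[OF x u(1)] False by simp
        ultimately show ?thesis using adj[OF xV yV] sp xV unfolding u(3) by (simp add: \<phi>_linear)
      qed
      fix x assume "x \<in> VV"
      then obtain x0 x1 where x: "x0 \<in> V False" "x1 \<in> V True" "x = x0 + x1" using VV_split by blast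
      then have "x0 \<in> VV" "x1 \<in> VV" using V_VV by blast+
      then show "\<phi> x v = 0" unfolding x(3) using h[OF x(1)] h[OF x(2)] sp by (simp add: \<phi>_linear)
    qed
    then show ?thesis using u by simp
  qed
  then have "z' \<in> gl_part s V False" unfolding gl_part_iff using l by auto
  then show ?thesis using adj by blast
qed

text \<open>Let \<open>z'\<close> be the adjoint of a solution \<open>z\<close> in
  \<open>gl\<close>. As \<open>N\<close> and \<open>y\<close> are skew, \<open>- z'\<close> solves
  the same equation, and the mean of \<open>z\<close> and \<open>- z'\<close> is a skew
  solution.\<close>

lemma osp_surjective:
  assumes "y \<in> osp_part s V \<phi> False" "deg y l" "l \<ge> 1"
  shows "\<exists>z\<in>osp_part s V \<phi> False. \<forall>v. N (z v) - z (N v) = y v"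
proof -
  have y: "y \<in> gl_part s V False" using assms(1) unfolding osp_part_def by blast
  have yl: "lin y" using y gl_part_iff by blast
  obtain z where z: "z \<in> gl_part s V False" "\<And>v. N (z v) - z (N v) = y v"
    using ad_surjective[OF y assms(2,3)] by blast
  obtain z' where z': "z' \<in> gl_part s V False" "\<And>x y. x \<in> VV \<Longrightarrow> y \<in> VV \<Longrightarrow> \<phi> (z x) y = \<phi> x (z' y)"
    using adjoint_exists[OF z(1)] by blast
  have zl: "lin z" "lin z'" using z(1) z'(1) gl_part_iff by blast+
  have V: "z v \<in> VV" "z' v \<in> VV" "N v \<in> VV" "y v \<in> VV" for v
    using linD(7)[OF zl(1)] linD(7)[OF zl(2)] linD(7)[OF N_lin] linD(7)[OF yl] by blast+
  have sub: "\<phi> a (b - c) = \<phi> a b - \<phi> a c" "\<phi> (b - c) a = \<phi> b a - \<phi> c a" if "a \<in> VV" "b \<in> VV" "c \<in> VV" for a b c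
    using \<phi>_linear(2)[of a b "s (-1) c"] \<phi>_linear(4)[of a c "-1"] \<phi>_linear(1)[of b "s (-1) c" a]
      \<phi>_linear(3)[of c a "-1"] that VV_simps by simp_all
  have Nz': "N (z' v) - z' (N v) = - y v" for v
  proof (cases "v \<in> VV")
    case v: True
    have "N (z' v) - z' (N v) - (- y v) = 0"
    proof (rule \<phi>_nondeg_right)
      show "N (z' v) - z' (N v) - (- y v) \<in> VV" using V VV_simps by simp
      fix x assume x: "x \<in> VV"
      have e1: "\<phi> x (N (z' v)) = - \<phi> (z (N x)) v"
        using ospD_even[OF N_osp x V(2)] z'(2)[OF V(3) v] by simp
      have e2: "\<phi> x (z' (N v)) = - \<phi> (N (z x)) v"
        using ospD_even[OF N_osp V(1) v] z'(2)[OF x V(3)] by simp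
      have "\<phi> (N (z x)) v - \<phi> (z (N x)) v = - \<phi> x (y v)"
        using ospD_even[OF assms(1) x v] sub(2)[OF v V(3) V(1)] unfolding z(2)[symmetric] by metis
      then show "\<phi> x (N (z' v) - z' (N v) - (- y v)) = 0"
        using sub[OF x] V VV_simps x e1 e2 \<phi>_linear(2)[OF x] by (simp add: VV_simps)
    qed
    then show ?thesis unfolding right_minus_eq .
  next
    case False
    then show ?thesis using linD(3)[OF N_lin] linD(3)[OF zl(2)] linD(3)[OF yl] linD(5)[OF N_lin] linD(5)[OF zl(2)] by simp
  qed
  \<comment> \<open>For even \<open>z\<close> the two signs from supersymmetry cancel, so
    \<open>z\<close> is also the adjoint of \<open>z'\<close>.\<close>
  have adj': "\<phi> (z' x) t = \<phi> x (z t)" if x: "x \<in> V q" and t: "t \<in> V p" for x t p q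
  proof -
    have xt: "x \<in> VV" "t \<in> VV" using x t V_VV by blast+
    have zV: "z t \<in> V p" "z' x \<in> V q" using z(1) z'(1) x t unfolding gl_part_iff by auto
    show ?thesis
    proof (cases "p = q")
      case True
      then show ?thesis using \<phi>_comm[OF zV(2) t] \<phi>_comm[OF x zV(1)] z'(2)[OF xt(2,1)] by simp
    next
      case False then show ?thesis using \<phi>_odd[OF zV(2) t] \<phi>_odd[OF x zV(1)] by auto
    qed
  qed
  define u where "u = (\<lambda>v. s (1/2) (z v) + s (- 1/2) (z' v))"
  have u: "u \<in> gl_part s V False" unfolding u_def
    by (rule gl_part_closed(1)[OF gl_part_closed(2)[OF z(1)] gl_part_closed(2)[OF z'(1)]])
  have "\<phi> (u x) t = - \<phi> x (u t)" if x: "x \<in> V q" and t: "t \<in> VV" for x t q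
  proof -
    have xV: "x \<in> VV" using x V_VV by blast
    obtain t0 t1 where t': "t0 \<in> V False" "t1 \<in> V True" "t = t0 + t1" using VV_split[OF t] by blast
    have sp: "t0 \<in> VV" "t1 \<in> VV" using t' V_VV by blast+
    have "\<phi> (z' x) t = \<phi> x (z t)"
      unfolding t'(3) using adj'[OF x t'(1)] adj'[OF x t'(2)] sp xV V linD(1)[OF zl(1)] by (simp add: \<phi>_linear)
    then show ?thesis unfolding u_def using z'(2)[OF xV t] xV t V
      by (simp add: \<phi>_linear VV_simps sub)
  qed
  then have "u \<in> osp_part s V \<phi> False" unfolding osp_part_def using u by (simp add: ksign_def)
  moreover have "N (u v) - u (N v) = y v" for v
  proof -
    have "N (u v) - u (N v) = s (1/2) (N (z v) - z (N v)) + s (- 1/2) (N (z' v) - z' (N v))"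
      unfolding u_def using V VV_simps by (simp add: linD[OF N_lin] scale_right_diff_distrib)
    also have "\<dots> = s (1/2 + 1/2) (y v)" unfolding z(2) Nz' scale_left_distrib by simp
    finally show ?thesis using two by (simp flip: mult_2)
  qed
  ultimately show ?thesis by blast
qed

end

text \<open>Translates the indexed Jordan basis into a set of vectors with a degree function;
  injectivity of the indexing makes the degree of a vector well defined.\<close>

lemma jordan_graded_exists:
  fixes s :: "'k::field \<Rightarrow> 'v::ab_group_add \<Rightarrow> 'v"
  assumes gs: "graded_space s V" and f: "f \<in> gl_part s V False" and jb: "jordan_basis s V f r w lam"
  shows "\<exists>Eb dg. jordan_graded s V Eb dg f r w lam \<and> graded_basis.Vk s Eb dg = jordan_piece s f r w lam"
proof -
  interpret vector_space s using gs unfolding graded_space_def by blast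
  define J where "J = {(i, j). i < r \<and> j < lam i}"
  define e where "e = (\<lambda>(i, j). (f ^^ j) (w i))"
  define Eb where "Eb = e ` J"
  define dg where "dg b = (case inv_into J e b of (i, j) \<Rightarrow> 2 * int j + 1 - int (lam i))" for b
  have inj: "inj_on e J" and ind: "independent Eb" and sp: "span Eb = total V"
    using jb unfolding jordan_basis_def Let_def J_def e_def Eb_def by blast+
  have w: "w i \<in> V False \<union> V True" "lam i \<ge> 1" "(f ^^ lam i) (w i) = 0" if "i < r" for i
    using jb that unfolding jordan_basis_def by blast+
  have "J = Sigma {..<r} (\<lambda>i. {..<lam i})" unfolding J_def by auto
  then have "finite Eb" unfolding Eb_def by simp
  have fV: "(f ^^ j) v \<in> V q" if "v \<in> V q" for v q j
    using that f unfolding gl_part_def by (induction j) auto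
  have EbV: "Eb \<subseteq> V False \<union> V True"
  proof
    fix b assume "b \<in> Eb"
    then obtain i j where "b = (f ^^ j) (w i)" "i < r" unfolding Eb_def e_def J_def by auto
    then show "b \<in> V False \<union> V True" using w(1)[of i] fV[of "w i" _ j] by auto
  qed
  have Eb_eq: "Eb = {(f ^^ j) (w i) | i j. i < r \<and> j < lam i}" unfolding Eb_def e_def J_def by auto
  have dg_e: "dg ((f ^^ j) (w i)) = 2 * int j + 1 - int (lam i)" if "i < r" "j < lam i" for i j
  proof -
    have "inv_into J e (e (i, j)) = (i, j)" using that inj by (intro inv_into_f_f) (auto simp: J_def)
    then show ?thesis unfolding dg_def e_def by simp
  qed
  have e_inj: "i = i' \<and> j = j'"
    if "i < r" "j < lam i" "i' < r" "j' < lam i'" "(f ^^ j) (w i) = (f ^^ j') (w i')" for i j i' j'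
    using inj_onD[OF inj, of "(i, j)" "(i', j')"] that unfolding e_def J_def by auto
  interpret gb: graded_basis s V Eb dg
    using gs \<open>finite Eb\<close> ind sp EbV unfolding graded_space_def by unfold_locales blast+
  have "jordan_graded s V Eb dg f r w lam"
    by unfold_locales (use f Eb_eq e_inj dg_e w in blast)+
  moreover have "gb.Vk l = jordan_piece s f r w lam l" for l
  proof -
    have "{b \<in> Eb. dg b = l} = {(f ^^ j) (w i) | i j. i < r \<and> j < lam i \<and> 2 * int j + 1 - int (lam i) = l}"
      unfolding Eb_eq by safe (use dg_e in metis)+
    then show ?thesis unfolding gb.Vk_def jordan_piece_def by simp
  qed
  ultimately show ?thesis by blast
qed

lemma (in formed_superalgebra) gl_sl_character:
  assumes "gl_sl_grading G X gr"
  shows "graded_character G chi gr"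
proof -
  obtain V \<Phi> r w lam where V: "natural_space V"
    and real: "linear_realization G seq_scale (gl_part seq_scale V) \<Phi> \<or>
      \<not> int CHAR('k) dvd int (vector_space.dim seq_scale (V False)) - int (vector_space.dim seq_scale (V True)) \<and>
      linear_realization G seq_scale (sl_part seq_scale V) \<Phi>"
    and jb: "jordan_basis seq_scale V (\<Phi> X) r w lam"
    and gr: "gr = shift_grading G \<Phi> (jordan_piece seq_scale (\<Phi> X) r w lam)"
    using assms unfolding gl_sl_grading_def gl_realization_def sl_realization_def by blast
  have gs: "graded_space seq_scale V" using V unfolding natural_space_def by blast
  have "\<Phi> ` part G False = gl_part seq_scale V False \<or> \<Phi> ` part G False = sl_part seq_scale V False"
    using real unfolding linear_realization_def by (elim disjE conjE) simp_all
  moreover have "sl_part seq_scale V False \<subseteq> gl_part seq_scale V False" unfolding sl_part_def by blast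
  ultimately have N: "\<Phi> X \<in> gl_part seq_scale V False" using X_even by blast
  obtain Eb dg where jg: "jordan_graded seq_scale V Eb dg (\<Phi> X) r w lam"
    and Vk: "graded_basis.Vk seq_scale Eb dg = jordan_piece seq_scale (\<Phi> X) r w lam"
    using jordan_graded_exists[OF gs N jb] by blast
  interpret jg: jordan_graded seq_scale V Eb dg "\<Phi> X" r w lam by (rule jg)
  obtain L where L: "classical seq_scale V Eb dg (\<Phi> X) r w lam G B X chi L \<Phi>"
  proof (cases "linear_realization G seq_scale (gl_part seq_scale V) \<Phi>")
    case True
    have "classical seq_scale V Eb dg (\<Phi> X) r w lam G B X chi (gl_part seq_scale V) \<Phi>"
    proof (unfold_locales, goal_cases)
      case (5 c)
      show ?case using jg.diag_gl jg.diag_Vk by (intro bexI[of _ "jg.diag c"] exI[of _ 0]) auto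
    next
      case (6 y l)
      then show ?case using jg.ad_surjective by blast
    qed (use True jg.gl_piece in auto)
    then show ?thesis by (rule that)
  next
    case False
    then have real: "linear_realization G seq_scale (sl_part seq_scale V) \<Phi>"
      and d: "\<not> int CHAR('k) dvd int (jg.dim (V False)) - int (jg.dim (V True))"
      using real by blast+
    \<comment> \<open>Non-divisibility by the characteristic means that the superdimension is
      nonzero in the field.\<close>
    have "of_int (int (jg.dim (V False)) - int (jg.dim (V True))) \<noteq> (0::'k)"
      using d by (simp only: of_int_eq_0_iff_char_dvd not_False_eq_True)
    then have d: "of_nat (jg.dim (V False)) - of_nat (jg.dim (V True)) \<noteq> (0::'k)" by simp
    have "classical seq_scale V Eb dg (\<Phi> X) r w lam G B X chi (sl_part seq_scale V) \<Phi>"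
    proof (unfold_locales, goal_cases)
      case (5 c)
      show ?case using jg.sl_torus[OF d] by blast
    next
      case (6 y l)
      then show ?case using jg.sl_surjective by blast
    next
      case 4 then show ?case using jg.sl_piece by blast
    qed (use real in \<open>auto simp: sl_part_def\<close>)
    then show ?thesis by (rule that)
  qed
  interpret classical seq_scale V Eb dg "\<Phi> X" r w lam G B X chi L \<Phi> by (rule L)
  have "gr = local.gr" unfolding gr gr_eq Vk ..
  then show ?thesis using graded_character by simp
qed

lemma (in formed_superalgebra) osp_character:
  assumes "osp_grading G X gr"
  shows "graded_character G chi gr"
proof -
  obtain V \<phi> \<Phi> r w lam where V: "natural_space V" "osp_form seq_scale V \<phi>"
    and real: "linear_realization G seq_scale (osp_part seq_scale V \<phi>) \<Phi>"
    and jb: "jordan_basis seq_scale V (\<Phi> X) r w lam"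
    and orth: "\<And>k l x y. k + l \<noteq> 0 \<Longrightarrow> x \<in> jordan_piece seq_scale (\<Phi> X) r w lam k \<Longrightarrow>
       y \<in> jordan_piece seq_scale (\<Phi> X) r w lam l \<Longrightarrow> \<phi> x y = 0"
    and gr: "gr = shift_grading G \<Phi> (jordan_piece seq_scale (\<Phi> X) r w lam)"
    using assms unfolding osp_grading_def osp_realization_def by blast
  have gs: "graded_space seq_scale V" using V unfolding natural_space_def by blast
  have N: "\<Phi> X \<in> osp_part seq_scale V \<phi> False"
    using real X_even unfolding linear_realization_def by blast
  then have Ngl: "\<Phi> X \<in> gl_part seq_scale V False" unfolding osp_part_def by blast
  obtain Eb dg where jg: "jordan_graded seq_scale V Eb dg (\<Phi> X) r w lam"
    and Vk: "graded_basis.Vk seq_scale Eb dg = jordan_piece seq_scale (\<Phi> X) r w lam"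
    using jordan_graded_exists[OF gs Ngl jb] by blast
  have "jordan_osp seq_scale V Eb dg (\<Phi> X) r w lam \<phi>"
    using jg V(2) orth N two_ne_0 unfolding jordan_osp_def jordan_osp_axioms_def Vk by blast
  then interpret jo: jordan_osp seq_scale V Eb dg "\<Phi> X" r w lam \<phi> .
  interpret classical seq_scale V Eb dg "\<Phi> X" r w lam G B X chi "osp_part seq_scale V \<phi>" \<Phi>
  proof (unfold_locales, goal_cases)
    case (5 c)
    then have "jo.diag c \<in> osp_part seq_scale V \<phi> False" by (intro jo.osp_torus)
    then show ?case using jo.diag_Vk by (intro bexI[of _ "jo.diag c"] exI[of _ 0]) auto
  next
    case (6 y l)
    then show ?case using jo.osp_surjective by blast
  next
    case (4 f q i j)
    then show ?case by (intro jo.osp_piece)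
  qed (use real in \<open>auto simp: osp_part_def\<close>)
  have "gr = local.gr" unfolding gr gr_eq Vk ..
  then show ?thesis using graded_character by simp
qed

section \<open>The exceptional superalgebras\<close>

lemma mat_scale_simps:
  fixes A :: "'k::field^'n^'m" and B :: "'k^'l^'n"
  shows "A ** mat_scale c B = mat_scale c (A ** B)" "mat_scale c A ** B = mat_scale c (A ** B)"
    "mat_scale c (A + A') = mat_scale c A + mat_scale c A'" "mat_scale c (mat_scale d A) = mat_scale (c * d) A"
  unfolding mat_scale_def matrix_matrix_mult_def
  by (simp_all add: vec_eq_iff sum_distrib_left mult_ac distrib_left)

lemma matrix_add_rdistrib: "(A + B) ** C = A ** C + B ** (C :: 'k::semiring_1^'l^'n)"
  unfolding matrix_matrix_mult_def by (simp add: vec_eq_iff sum.distrib distrib_right)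

lemma conj_by_linear:
  "conj_by g (A + B) = conj_by g A + conj_by g B" "conj_by g (mat_scale c A) = mat_scale c (conj_by g A)"
  unfolding conj_by_def by (simp_all add: matrix_add_ldistrib matrix_add_rdistrib mat_scale_simps)

context formed_superalgebra
begin

text \<open>Used for the degrees of the exceptional gradings, which are eigenspaces of a
  one-parameter group pulled back along the realization.\<close>

lemma eigenspace_subspace:
  assumes \<theta>: "\<And>x y. x \<in> space_of G \<Longrightarrow> y \<in> space_of G \<Longrightarrow> \<theta> (x + y) = \<theta> x + \<theta> y"
      "\<And>x c. x \<in> space_of G \<Longrightarrow> \<theta> (scl G c x) = sc c (\<theta> x)"
    and A: "\<And>t x y. A t (x + y) = A t x + A t y" "\<And>t c x. A t (sc c x) = sc c (A t x)"
    and sc: "\<And>c x y. sc c (x + y) = sc c x + sc c y" "\<And>c d x. sc c (sc d x) = sc (c * d) x"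
  shows "g.subspace {z \<in> space_of G. \<forall>t. t \<noteq> 0 \<longrightarrow> A t (\<theta> z) = (sc (t powi k) (\<theta> z) :: 'h::ab_group_add)}"
proof (rule g.subspaceI)
  have "\<theta> 0 = 0" using \<theta>(1)[of 0 0] space_closed(1) by simp
  moreover have "A t 0 = 0" "sc c 0 = 0" for t c using A(1)[of t 0 0] sc(1)[of c 0 0] by simp_all
  ultimately show "0 \<in> {z \<in> space_of G. \<forall>t. t \<noteq> 0 \<longrightarrow> A t (\<theta> z) = sc (t powi k) (\<theta> z)}"
    using space_closed(1) by simp
qed (auto simp: \<theta> A sc space_closed mult.commute)

lemma direct_sum_independent:
  assumes ds: "direct_sum W gr" and gr: "\<And>k. g.subspace (gr k)"
    and K: "finite K" "\<And>k. k \<in> K \<Longrightarrow> u k \<in> gr k" "(\<Sum>k\<in>K. u k) = 0" "j \<in> K"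
  shows "u j = 0"
proof -
  have "0 \<in> W" using ds g.subspace_0[OF gr] unfolding direct_sum_def by blast
  then have u: "\<exists>!c. (\<forall>k. c k \<in> gr k) \<and> finite {k. c k \<noteq> 0} \<and> 0 = (\<Sum>k | c k \<noteq> 0. c k)"
    using ds unfolding direct_sum_def by blast
  define c where "c k = (if k \<in> K then u k else 0)" for k
  obtain c0 where c0: "\<And>c. (\<forall>k. c k \<in> gr k) \<and> finite {k. c k \<noteq> 0} \<and> 0 = (\<Sum>k | c k \<noteq> 0. c k) \<Longrightarrow> c = c0"
    using u by (elim ex1E) blast
  have "(\<Sum>k | c k \<noteq> 0. c k) = (\<Sum>k\<in>K. u k)" using K(1) by (intro sum.mono_neutral_cong_left) (auto simp: c_def)
  then have "c = c0"
    using K g.subspace_0[OF gr] finite_subset[of "{k. c k \<noteq> 0}" K] by (intro c0) (auto simp: c_def)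
  moreover have "(\<lambda>_. 0) = c0" using g.subspace_0[OF gr] by (intro c0) simp
  ultimately have "c = (\<lambda>_. 0)" by simp
  then show ?thesis using K(4) unfolding c_def by meson
qed

text \<open>Vanishing of \<open>chi\<close> and injectivity in negative degrees come with the
  grading. Compatibility of the \<open>p\<close>-map with degrees is obtained from the adjoint
  representation, which is faithful on the even part by \<open>centre\<close>.\<close>

lemma good_grading_character:
  assumes gg: "good_grading G B X gr" and gr_sub: "\<And>k. g.subspace (gr k)"
    and fd: "\<exists>S. finite S \<and> space_of G \<subseteq> g.span S"
    and centre: "\<And>z. z \<in> part G False \<Longrightarrow> (\<And>y. y \<in> space_of G \<Longrightarrow> brk G z y = 0) \<Longrightarrow> z = 0"
  shows "graded_character G chi gr"
proof -
  have ds: "direct_sum (space_of G) gr" and br_gr: "\<And>k l x y. x \<in> gr k \<Longrightarrow> y \<in> gr l \<Longrightarrow> brk G x y \<in> gr (k + l)"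
    and gr_par: "\<And>k. gr k = total (\<lambda>a. gr k \<inter> part G a)" and X_gr: "X \<in> gr 2"
    and orth: "\<And>k l x y. k + l \<noteq> 0 \<Longrightarrow> x \<in> gr k \<Longrightarrow> y \<in> gr l \<Longrightarrow> B x y = 0"
    and cent: "\<And>k. k < 0 \<Longrightarrow> centralizer G X \<inter> gr k = {0}"
    using gg unfolding good_grading_def by blast+
  have gr_space: "gr k \<subseteq> space_of G" for k using ds unfolding direct_sum_def by blast
  have span: "g.span (\<Union>l. gr l) \<subseteq> space_of G" using gr_space space_sub by (intro g.span_minimal) auto
  interpret rep: graded_rep "scl G" G gr gr "brk G"
  proof unfold_locales
    show "brk G (z + z') v = brk G z v + brk G z' v"
      if "z \<in> space_of G" "z' \<in> space_of G" "v \<in> g.span (\<Union>l. gr l)" for z z' v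
      using that span by (intro brk_linear(1)) auto
    show "brk G (scl G c z) v = scl G c (brk G z v)" if "z \<in> space_of G" "v \<in> g.span (\<Union>l. gr l)" for c z v
      using that span by (intro brk_linear(3)[of _ _ v]) auto
    show "brk G z (v + v') = brk G z v + brk G z v'"
      if "z \<in> space_of G" "v \<in> g.span (\<Union>l. gr l)" "v' \<in> g.span (\<Union>l. gr l)" for z v v'
      using that span by (intro brk_linear(2)) auto
    show "brk G z (scl G c v) = scl G c (brk G z v)" if "z \<in> space_of G" "v \<in> g.span (\<Union>l. gr l)" for c z v
      using that span by (intro brk_linear(4)[of _ _ v]) auto
    show "brk G z v \<in> gr (l + k)" if "z \<in> gr k" "v \<in> gr l" for z k v l
      using br_gr[OF that] by (simp add: add.commute)
    show "z = 0" if z: "z \<in> part G False" "\<And>l v. v \<in> gr l \<Longrightarrow> brk G z v = 0" for z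
    proof (rule centre[OF z(1)])
      have zs: "z \<in> space_of G" using z(1) part_space by blast
      fix y assume "y \<in> space_of G"
      then obtain c where c: "\<And>k. c k \<in> gr k" "y = (\<Sum>k | c k \<noteq> 0. c k)" using ds unfolding direct_sum_def by blast
      have "brk G z (\<Sum>k\<in>K. c k) = 0 \<and> (\<Sum>k\<in>K. c k) \<in> space_of G" for K
      proof (induction K rule: infinite_finite_induct)
        case (insert k K)
        have "c k \<in> space_of G" using c(1) gr_space by blast
        then show ?case using insert z(2)[OF c(1)] brk_linear(2)[OF zs] by (simp add: space_closed)
      qed (use brk_linear(4)[OF zs space_closed(1) zs, of 0] space_closed(1) in auto)
      then show "brk G z y = 0" unfolding c(2) by blast
    qed
    show "brk G (ppow G z) v = (brk G z ^^ CHAR('k)) v" if "z \<in> part G False" "v \<in> gr l" for z v l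
      using that gr_space by (intro ppow_brk) auto
    show "gr k = total (\<lambda>a. gr k \<inter> part G a)" for k by (rule gr_par)
    show "u j = 0" if "finite K" "\<And>k. k \<in> K \<Longrightarrow> u k \<in> gr k" "(\<Sum>k\<in>K. u k) = 0" "j \<in> K" for K u j
      using that by (rule direct_sum_independent[OF ds gr_sub])
  qed (fact part_sub part_int gr_sub ds ppow_even)+
  show ?thesis
  proof (unfold_locales, goal_cases)
    case (6 z l)
    then have "z \<in> space_of G" "2 + l \<noteq> 0" using gr_space by auto
    then show ?case using orth[OF _ X_gr 6(1)] chi_eq by simp
  next
    case (11 z k)
    then have "z \<in> space_of G" using gr_space by blast
    then have "z \<in> centralizer G X \<inter> gr k" using 11 centralizes_X unfolding centralizer_def by blast
    then show ?case using cent[OF 11(2)] by blast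
  next
    case (12 d z)
    then show ?case using ppow_even[OF 12(2)] part_space by (intro rep.ppow_filtration) auto
  qed (use gr_par in \<open>blast intro: restricted char chi_add chi_scale chi_odd ds gr_sub br_gr fd\<close>)+
qed

text \<open>Even central elements form a graded ideal, which is not everything because some bracket
  is nonzero.\<close>

lemma simple_centre:
  assumes "simple_lsuper G" and z: "z \<in> part G False" "\<And>y. y \<in> space_of G \<Longrightarrow> brk G z y = 0"
  shows "z = 0"
proof -
  define I where "I a = (if a then {0} else {z \<in> part G False. \<forall>y\<in>space_of G. brk G z y = 0})" for a
  have tot: "total I = {z \<in> part G False. \<forall>y\<in>space_of G. brk G z y = 0}" unfolding total_def I_def by simp
  have z0: "brk G 0 y = 0" if "y \<in> space_of G" for y
    using brk_linear(3)[OF space_closed(1) that that, of 0] by simp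
  have 0: "0 \<in> total I" unfolding tot using z0 g.subspace_0[OF part_sub] by simp
  have "g.subspace (I a)" for a
  proof (cases a)
    case False
    have "g.subspace {z \<in> part G False. \<forall>y\<in>space_of G. brk G z y = 0}"
    proof (rule g.subspaceI)
      show "0 \<in> {z \<in> part G False. \<forall>y\<in>space_of G. brk G z y = 0}" using 0 tot by simp
    qed (use part_space in \<open>auto simp: brk_linear subset_iff g.subspace_add[OF part_sub] g.subspace_scale[OF part_sub]\<close>)
    then show ?thesis using False unfolding I_def by simp
  qed (simp add: I_def)
  moreover have "I a \<subseteq> part G a" for a unfolding I_def using g.subspace_0[OF part_sub] by auto
  moreover have "brk G x y \<in> total I" if x: "x \<in> space_of G" and y: "y \<in> total I" for x y
  proof -
    obtain x0 x1 where x: "x0 \<in> part G False" "x1 \<in> part G True" "x = x0 + x1" using space_split[OF x] by blast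
    have sp: "x0 \<in> space_of G" "x1 \<in> space_of G" "y \<in> space_of G" using x y part_space unfolding tot by blast+
    have y': "y \<in> part G False" "brk G y x0 = 0" "brk G y x1 = 0" using y sp unfolding tot by auto
    have "brk G x0 y = 0" "brk G x1 y = 0" using brk_skew[OF x(1) y'(1)] brk_skew[OF x(2) y'(1)] y' by simp_all
    then have "brk G x y = 0" unfolding x(3) using brk_linear(1)[OF sp] by simp
    then show ?thesis using 0 by simp
  qed
  ultimately have "total I = {0} \<or> total I = space_of G" using assms(1) unfolding simple_lsuper_def by blast
  moreover have "total I \<noteq> space_of G" using assms(1) unfolding simple_lsuper_def tot by blast
  moreover have "z \<in> total I" using z unfolding tot by blast
  ultimately show ?thesis by blast
qed

lemma finite_span_of_coordinates:
  fixes \<theta> :: "'g \<Rightarrow> 'h::ab_group_add"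
  assumes \<theta>: "\<And>x y. x \<in> space_of G \<Longrightarrow> y \<in> space_of G \<Longrightarrow> \<theta> (x + y) = \<theta> x + \<theta> y"
      "\<And>x c. x \<in> space_of G \<Longrightarrow> \<theta> (scl G c x) = sc c (\<theta> x)" "inj_on \<theta> (space_of G)"
    and J: "finite J" "\<And>f x y. f \<in> J \<Longrightarrow> f (x + y) = f x + f y" "\<And>f c x. f \<in> J \<Longrightarrow> f (sc c x) = c * f x"
      "\<And>x. (\<And>f. f \<in> J \<Longrightarrow> f x = 0) \<Longrightarrow> x = 0"
  shows "\<exists>S. finite S \<and> space_of G \<subseteq> g.span S"
proof (rule g.finite_span_of_functionals[OF space_sub J(1), where F = "\<lambda>f z. f (\<theta> z)"])
  fix x assume x: "x \<in> space_of G" "\<And>f. f \<in> J \<Longrightarrow> f (\<theta> x) = 0"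
  have "\<theta> 0 = 0" using \<theta>(1)[of 0 0] space_closed(1) by simp
  moreover have "\<theta> x = 0" using x(2) by (rule J(4))
  ultimately show "x = 0" using inj_onD[OF \<theta>(3), of x 0] x(1) space_closed(1) by simp
qed (simp_all add: \<theta> J)

lemma tmod_character:
  fixes \<theta> :: "'g \<Rightarrow> ('k, 'n::finite) tmod"
  assumes r: "tmod_realization G L \<theta>" and gr: "tmod_grading G B X gr Q \<theta>"
  shows "graded_character G chi gr"
proof -
  have \<theta>: "\<And>x y. x \<in> space_of G \<Longrightarrow> y \<in> space_of G \<Longrightarrow> \<theta> (x + y) = \<theta> x + \<theta> y"
      "\<And>x c. x \<in> space_of G \<Longrightarrow> \<theta> (scl G c x) = tmod_scale c (\<theta> x)" "inj_on \<theta> (space_of G)"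
    and simple: "simple_lsuper G"
    using r unfolding tmod_realization_def by blast+
  obtain \<gamma>1 \<gamma>2 where gr_eq: "gr = (\<lambda>k. {z \<in> space_of G. \<forall>t. t \<noteq> 0 \<longrightarrow>
                  tmod_Ad (\<gamma>1 t, \<gamma>2 t) (\<theta> z) = tmod_scale (t powi k) (\<theta> z)})"
    and good: "good_grading G B X gr"
    using gr unfolding tmod_grading_def by blast
  show ?thesis
  proof (rule good_grading_character[OF good])
    show "g.subspace (gr k)" for k
      unfolding gr_eq
      by (rule eigenspace_subspace[OF \<theta>(1,2)])
        (simp_all add: tmod_Ad_def tmod_scale_def conj_by_linear matrix_add_ldistrib matrix_add_rdistrib mat_scale_simps split: prod.split)
    define f1 where "f1 i j x = fst (fst (x :: ('k, 'n) tmod)) $ i $ j" for i j x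
    define f2 where "f2 i j x = snd (fst (x :: ('k, 'n) tmod)) $ i $ j" for i j x
    define f3 where "f3 i j x = snd (x :: ('k, 'n) tmod) $ i $ j" for i j x
    define J where "J = (\<Union>i j. {f1 i j}) \<union> (\<Union>i j. {f2 i j}) \<union> (\<Union>i j. {f3 i j})"
    show "\<exists>S. finite S \<and> space_of G \<subseteq> g.span S"
    proof (rule finite_span_of_coordinates[OF \<theta>, of J])
      show "finite J" unfolding J_def by simp
      show "f (x + y) = f x + f y" "f (tmod_scale c x) = c * f x" if "f \<in> J" for f c x y
        using that unfolding J_def f1_def f2_def f3_def tmod_scale_def mat_scale_def by (auto split: prod.splits)
      show "x = 0" if x: "\<And>f. f \<in> J \<Longrightarrow> f x = 0" for x
      proof -
        have J: "f1 i j \<in> J" "f2 k l \<in> J" "f3 i l \<in> J" for i j k l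
          unfolding J_def by (simp_all only: UN_iff Un_iff singleton_iff) blast+
        have "fst (fst x) $ i $ j = 0" "snd (fst x) $ k $ l = 0" "snd x $ i $ l = 0" for i j k l
          using x[OF J(1)] x[OF J(2)] x[OF J(3)] unfolding f1_def f2_def f3_def .
        then show ?thesis by (simp add: prod_eq_iff vec_eq_iff)
      qed
    qed
  qed (rule simple_centre[OF simple])
qed

text \<open>The realization describes the bracket explicitly, so the absence of even central
  elements is computed directly from the action on the odd part.\<close>

lemma d21_character:
  assumes "d21_grading G B X gr"
  shows "graded_character G chi gr"
proof -
  obtain \<alpha> \<theta> \<gamma>1 \<gamma>2 \<gamma>3 where r: "d21_realization G \<alpha> \<theta>"
    and gr_eq: "gr = (\<lambda>k. {z \<in> space_of G. \<forall>t. t \<noteq> 0 \<longrightarrow>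
                  d21_Ad (\<gamma>1 t, \<gamma>2 t, \<gamma>3 t) (\<theta> z) = d21_scale (t powi k) (\<theta> z)})"
    and good: "good_grading G B X gr"
    using assms unfolding d21_grading_def by blast
  have \<theta>: "\<And>x y. x \<in> space_of G \<Longrightarrow> y \<in> space_of G \<Longrightarrow> \<theta> (x + y) = \<theta> x + \<theta> y"
      "\<And>x c. x \<in> space_of G \<Longrightarrow> \<theta> (scl G c x) = d21_scale c (\<theta> x)" "inj_on \<theta> (space_of G)"
    and \<theta>_part: "\<theta> ` part G False = (sl2 \<times> sl2 \<times> sl2) \<times> {0}" "\<theta> ` part G True = {0} \<times> UNIV"
    and \<theta>_brk: "\<And>x y. x \<in> space_of G \<Longrightarrow> y \<in> space_of G \<Longrightarrow> \<theta> (brk G x y) = d21_brk \<alpha> (\<theta> x) (\<theta> y)"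
    using r unfolding d21_realization_def by blast+
  have \<theta>0: "\<theta> 0 = 0" using \<theta>(1)[of 0 0] space_closed(1) by simp
  show ?thesis
  proof (rule good_grading_character[OF good])
    show "g.subspace (gr k)" for k
      unfolding gr_eq
      by (rule eigenspace_subspace[OF \<theta>(1,2)])
        (simp_all add: d21_Ad_def d21_scale_def case_prod_beta prod_eq_iff conj_by_linear mat_scale_simps vec_eq_iff
          distrib_left sum.distrib sum_distrib_left mult_ac)
    define f1 where "f1 i j x = fst (fst (x :: 'k d21)) $ i $ j" for i j x
    define f2 where "f2 i j x = fst (snd (fst (x :: 'k d21))) $ i $ j" for i j x
    define f3 where "f3 i j x = snd (snd (fst (x :: 'k d21))) $ i $ j" for i j x
    define f4 where "f4 i j k x = snd (x :: 'k d21) $ i $ j $ k" for i j k x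
    define J where "J = (\<Union>i j. {f1 i j}) \<union> (\<Union>i j. {f2 i j}) \<union> (\<Union>i j. {f3 i j}) \<union> (\<Union>i j k. {f4 i j k})"
    show "\<exists>S. finite S \<and> space_of G \<subseteq> g.span S"
    proof (rule finite_span_of_coordinates[OF \<theta>, of J])
      show "finite J" unfolding J_def by simp
      show "f (x + y) = f x + f y" "f (d21_scale c x) = c * f x" if "f \<in> J" for f c x y
        using that unfolding J_def f1_def f2_def f3_def f4_def d21_scale_def mat_scale_def by (auto split: prod.splits)
      show "x = 0" if x: "\<And>f. f \<in> J \<Longrightarrow> f x = 0" for x
      proof -
        have J: "f1 i j \<in> J" "f2 i j \<in> J" "f3 i j \<in> J" "f4 i j k \<in> J" for i j k
          unfolding J_def by (simp_all only: UN_iff Un_iff singleton_iff) blast+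
        have "fst (fst x) $ i $ j = 0" "fst (snd (fst x)) $ i $ j = 0" "snd (snd (fst x)) $ i $ j = 0" "snd x $ i $ j $ k = 0" for i j k
          using x[OF J(1)] x[OF J(2)] x[OF J(3)] x[OF J(4)] unfolding f1_def f2_def f3_def f4_def .
        then show ?thesis by (simp add: prod_eq_iff vec_eq_iff)
      qed
    qed
    fix z assume z: "z \<in> part G False" "\<And>y. y \<in> space_of G \<Longrightarrow> brk G z y = 0"
    obtain P Q R where PQR: "\<theta> z = ((P, Q, R), 0)" "P \<in> sl2" "Q \<in> sl2" "R \<in> sl2" using z(1) \<theta>_part(1) by blast
    have act: "d21_act (P, Q, R) T = 0" for T
    proof -
      have "(0, T) \<in> \<theta> ` part G True" unfolding \<theta>_part(2) by simp
      then obtain y where y: "y \<in> part G True" "\<theta> y = (0, T)" by (metis imageE)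
      have sp: "y \<in> space_of G" "z \<in> space_of G" using y z part_space by blast+
      have "d21_brk \<alpha> (\<theta> z) (\<theta> y) = 0" using \<theta>_brk[OF sp(2,1)] z(2)[OF sp(1)] \<theta>0 by simp
      then have "d21_act (P, Q, R) T - d21_act 0 0 = 0"
        unfolding PQR(1) y(2) d21_brk_def by (simp add: zero_prod_def prod_eq_iff)
      moreover have "d21_act 0 0 = (0 :: 'k^2^2^2)" unfolding d21_act_def by (simp add: zero_prod_def vec_eq_iff)
      ultimately show ?thesis by simp
    qed
    have entry: "(if j = b \<and> k = c then P $ i $ a else 0) + (if i = a \<and> k = c then Q $ j $ b else 0)
       + (if i = a \<and> j = b then R $ k $ c else 0) = 0" for i j k a b c
    proof -
      \<comment> \<open>Elementary tensors isolate the matrix entries of the action.\<close>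
      define T :: "'k^2^2^2" where "T = (\<chi> i j k. if i = a \<and> j = b \<and> k = c then 1 else 0)"
      have "d21_act (P, Q, R) T $ i $ j $ k = 0" unfolding act by simp
      moreover have "(\<Sum>a'\<in>UNIV. P $ i $ a' * T $ a' $ j $ k) = (if j = b \<and> k = c then P $ i $ a else 0)"
        "(\<Sum>b'\<in>UNIV. Q $ j $ b' * T $ i $ b' $ k) = (if i = a \<and> k = c then Q $ j $ b else 0)"
        "(\<Sum>c'\<in>UNIV. R $ k $ c' * T $ i $ j $ c') = (if i = a \<and> j = b then R $ k $ c else 0)"
      proof -
        have "(\<Sum>a'\<in>UNIV. P $ i $ a' * T $ a' $ j $ k) = (\<Sum>a'\<in>UNIV. if a' = a then if j = b \<and> k = c then P $ i $ a else 0 else 0)"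
          by (intro sum.cong) (auto simp: T_def)
        then show "(\<Sum>a'\<in>UNIV. P $ i $ a' * T $ a' $ j $ k) = (if j = b \<and> k = c then P $ i $ a else 0)" by simp
        have "(\<Sum>b'\<in>UNIV. Q $ j $ b' * T $ i $ b' $ k) = (\<Sum>b'\<in>UNIV. if b' = b then if i = a \<and> k = c then Q $ j $ b else 0 else 0)"
          by (intro sum.cong) (auto simp: T_def)
        then show "(\<Sum>b'\<in>UNIV. Q $ j $ b' * T $ i $ b' $ k) = (if i = a \<and> k = c then Q $ j $ b else 0)" by simp
        have "(\<Sum>c'\<in>UNIV. R $ k $ c' * T $ i $ j $ c') = (\<Sum>c'\<in>UNIV. if c' = c then if i = a \<and> j = b then R $ k $ c else 0 else 0)"
          by (intro sum.cong) (auto simp: T_def)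
        then show "(\<Sum>c'\<in>UNIV. R $ k $ c' * T $ i $ j $ c') = (if i = a \<and> j = b then R $ k $ c else 0)" by simp
      qed
      ultimately show ?thesis unfolding d21_act_def by simp
    qed
    have off: "P $ i $ a = 0" "Q $ i $ a = 0" "R $ i $ a = 0" if "i \<noteq> a" for i a
      using that entry[where j = 1 and b = 1 and k = 1 and c = 1 and i = i and a = a]
        entry[where i = 1 and a = 1 and k = 1 and c = 1 and j = i and b = a]
        entry[where i = 1 and a = 1 and j = 1 and b = 1 and k = i and c = a] by simp_all
    \<comment> \<open>The diagonal sums vanish for all choices of indices, so each of the three
      matrices has equal diagonal entries; being traceless, it is zero since 2 is
      invertible.\<close>
    have dia: "P $ a $ a + Q $ b $ b + R $ c $ c = 0" for a b c using entry[where i = a and a = a and j = b and b = b and k = c and c = c] by simp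
    have tr: "P $ 1 $ 1 + P $ 2 $ 2 = 0" "Q $ 1 $ 1 + Q $ 2 $ 2 = 0" "R $ 1 $ 1 + R $ 2 $ 2 = 0"
      using PQR unfolding sl2_def trace_def by (simp_all add: sum_2)
    have eq: "P $ 1 $ 1 = P $ 2 $ 2" "Q $ 1 $ 1 = Q $ 2 $ 2" "R $ 1 $ 1 = R $ 2 $ 2"
      using dia[of 1 1 1] dia[of 2 1 1] dia[of 1 2 1] dia[of 1 1 2] by (simp_all add: add_eq_0_iff)
    have "2 * P $ 1 $ 1 = 0" "2 * Q $ 1 $ 1 = 0" "2 * R $ 1 $ 1 = 0" using tr eq by simp_all
    then have "P $ 1 $ 1 = 0" "Q $ 1 $ 1 = 0" "R $ 1 $ 1 = 0" using two_ne_0 by simp_all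
    then have "P $ i $ a = 0" "Q $ i $ a = 0" "R $ i $ a = 0" for i a
      using off[of i a] eq exhaust_2[of i] exhaust_2[of a] by auto
    then have "\<theta> z = 0" unfolding PQR(1) by (simp add: prod_eq_iff vec_eq_iff)
    then show "z = 0" using inj_onD[OF \<theta>(3), of z 0] \<theta>0 z(1) part_space space_closed(1) by auto
  qed
qed

lemma associated_grading_character:
  assumes "associated_grading G B X gr"
  shows "graded_character G chi gr"
  using assms unfolding associated_grading_def f4_realization_def g3_realization_def
  by (elim disjE exE conjE) (rule gl_sl_character osp_character d21_character tmod_character, assumption+)+

end

theorem proposition4p2:
  fixes G :: "('k::alg_closed_field, 'g::ab_group_add) lsuper"
    and B :: "'g \<Rightarrow> 'g \<Rightarrow> 'k"
    and X :: 'g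
    and chi :: "'g \<Rightarrow> 'k"
    and gr :: "int \<Rightarrow> 'g set"
    and m :: "'g set"
    and M :: "(('g list \<Rightarrow>\<^sub>0 'k) set, 'm) module"
    and Mp :: "bool \<Rightarrow> 'm set"
  assumes "CHAR('k) > 2"
    and "basic_classical G"
    and "invariant_form G B"
    and "nilpotent_elt G X"
    and "\<forall>y\<in>space_of G. chi y = B X y"
    and "associated_grading G B X gr"
    and "associated_subalgebra G chi gr m"
    and "graded_module (red_env G chi (space_of G)) (red_env_part G chi (space_of G)) M Mp"
  shows "graded_free (red_env G chi m) (restrict_module G chi M) Mp"
proof -
  interpret formed_superalgebra G B X chi
    using assms(1-5) unfolding basic_classical_def nilpotent_elt_def by unfold_locales auto
  interpret graded_character G chi gr by (rule associated_grading_character[OF assms(6)])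
  show ?thesis by (rule graded_free_associated[OF assms(7,8)])
qed

end
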